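(* For any partitions $\lambda$ and $\mu$ of $n$, we have $$c_{\lambda,\mu}\le|\operatorname{SYT}_\lambda(\mu)|.$$ In particular, a refined $(\lambda,\mu)$-Thrall subset always exists, i.e. there is a subset of $\operatorname{SYT}_\lambda(\mu)$ of cardinality $c_{\lambda,\mu}$. Moreover, for a given $\lambda\vdash n$, the equality $c_{\lambda,\mu}=|\operatorname{SYT}_\lambda(\mu)|$ holds for all $\mu\vdash n$ if and only if $\lambda$ has distinct parts.
   Context: Let $V=\mathbb{C}^N$, let $\operatorname{Lie}(V)$ be the free Lie algebra on $V$ inside the tensor algebra $T(V)$ (generated by $V$ under the commutator bracket), and $\mathcal L_m(V)=\operatorname{Lie}(V)\cap V^{\otimes m}$. For a partition $\lambda$ with $m_i(\lambda)$ parts equal to $i$, the higher Lie module is the $\operatorname{GL}(V)$-module $L_\lambda=\bigotimes_{i\ge1}\operatorname{Sym}^{m_i(\lambda)}(\mathcal L_i(V))$, and $L_n:=L_{(n)}$. $\operatorname{ch}(L_\lambda)$ denotes its character as a symmetric function of the eigenvalues $x_1,\dots,x_N$ of $g\in \operatorname{GL}(V)$, in the limit $N\to\infty$ (a symmetric function in infinitely many variables). Equivalently $\operatorname{ch}(L_\lambda)=\prod_{i\ge1}h_{m_i(\lambda)}[\operatorname{ch}(L_i)]$ (plethysm). For $\lambda\vdash n$, the coefficients $c_{\lambda,\mu}$ are defined by the Schur expansion $\operatorname{ch}(L_\lambda)=\sum_{\mu\vdash n}c_{\lambda,\mu}s_\mu$. $\operatorname{SYT}(\mu)$ is the set of standard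 Young tableaux of shape $\mu$ (English notation). $\operatorname{Des}(T)=\{i: i+1$ lies in a lower row of $T$ than $i\}$. $[a,b]$ is the set of integers from $a$ to $b$. For $\lambda=(\lambda_1,\dots,\lambda_r)\vdash n$ let $B_{\lambda,i}=[\lambda_1+\cdots+\lambda_{i-1}+1,\lambda_1+\cdots+\lambda_i]$, let $\operatorname{Des}_{\lambda,i}(T)=\{d-(\lambda_1+\cdots+\lambda_{i-1}): d\in \operatorname{Des}(T),\ d,d+1\in B_{\lambda,i}\}$, and let $\operatorname{maj}_{\lambda,i}(T)$ be the sum of the elements of $\operatorname{Des}_{\lambda,i}(T)$. Set $\operatorname{SYT}_\lambda(\mu)=\{T\in\operatorname{SYT}(\mu):\operatorname{maj}_{\lambda,i}(T)\equiv1\pmod{\lambda_i}\text{ for all }i\}$. A refined $(\lambda,\mu)$-Thrall subset is a subset of $\operatorname{SYT}_\lambda(\mu)$ whose cardinality is $c_{\lambda,\mu}$. *)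

theory Defs
  imports
    "HOL-Library.Poly_Mapping"
    "HOL-Library.Multiset"
    "HOL-Library.FuncSet"
    "HOL-Number_Theory.Cong"
    "Jordan_Normal_Form.Matrix"
begin

section \<open>Complex vector spaces with a distinguished basis\<close>

text \<open>
  The type \<^typ>\<open>'b \<Rightarrow>\<^sub>0 complex\<close> is the complex vector space with basis \<^typ>\<open>'b\<close>, a basis vector being
  \<^term>\<open>Poly_Mapping.single b 1\<close>. All modules below are subspaces of spaces of this kind.
\<close>

definition pm_scale :: "complex \<Rightarrow> ('b \<Rightarrow>\<^sub>0 complex) \<Rightarrow> ('b \<Rightarrow>\<^sub>0 complex)" where
  "pm_scale a p = Poly_Mapping.map ((*) a) p"

lemma lookup_pm_scale [simp]: "Poly_Mapping.lookup (pm_scale a p) b = a * Poly_Mapping.lookup p b"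
  unfolding pm_scale_def by transfer (auto simp: when_def)

global_interpretation pm: vector_space pm_scale
  by unfold_locales (auto intro!: poly_mapping_eqI simp: lookup_add algebra_simps)

definition lin_ext :: "('b \<Rightarrow> ('c \<Rightarrow>\<^sub>0 complex)) \<Rightarrow> ('b \<Rightarrow>\<^sub>0 complex) \<Rightarrow> ('c \<Rightarrow>\<^sub>0 complex)" where
  "lin_ext f p = (\<Sum>b\<in>Poly_Mapping.keys p. pm_scale (Poly_Mapping.lookup p b) (f b))"

text \<open>
  The trace of a linear operator on a finite-dimensional subspace that it leaves invariant; it does
  not depend on the chosen basis.
\<close>

definition trace_on :: "('b \<Rightarrow>\<^sub>0 complex) set \<Rightarrow> (('b \<Rightarrow>\<^sub>0 complex) \<Rightarrow> ('b \<Rightarrow>\<^sub>0 complex)) \<Rightarrow> complex" where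
  "trace_on W A =
     (let B = (SOME B. B \<subseteq> W \<and> pm.independent B \<and> pm.span B = W)
      in \<Sum>b\<in>B. pm.representation B (A b) b)"

section \<open>Tensor and symmetric algebras\<close>

text \<open>
  With concatenation as addition on lists, the convolution product of \<^theory>\<open>HOL-Library.Poly_Mapping\<close>
  makes \<^typ>\<open>'b list \<Rightarrow>\<^sub>0 complex\<close> the free associative algebra on \<^typ>\<open>'b\<close>, that is, the tensor
  algebra of \<^typ>\<open>'b \<Rightarrow>\<^sub>0 complex\<close>. In the same way \<^typ>\<open>'b multiset \<Rightarrow>\<^sub>0 complex\<close> is the polynomial
  algebra on \<^typ>\<open>'b\<close>, that is, the symmetric algebra of \<^typ>\<open>'b \<Rightarrow>\<^sub>0 complex\<close>.
\<close>

instantiation list :: (type) monoid_add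
begin

definition zero_list :: "'a list" where "zero_list = []"

definition plus_list :: "'a list \<Rightarrow> 'a list \<Rightarrow> 'a list" where "plus_list = (@)"

instance by standard (simp_all add: zero_list_def plus_list_def)

end

definition tens_vec :: "('b \<Rightarrow>\<^sub>0 complex) \<Rightarrow> ('b list \<Rightarrow>\<^sub>0 complex)" where
  "tens_vec = lin_ext (\<lambda>b. Poly_Mapping.single [b] 1)"

definition sym_vec :: "('b \<Rightarrow>\<^sub>0 complex) \<Rightarrow> ('b multiset \<Rightarrow>\<^sub>0 complex)" where
  "sym_vec = lin_ext (\<lambda>b. Poly_Mapping.single {#b#} 1)"

text \<open>The algebra endomorphisms induced by a linear operator on the generating vector space.\<close>

definition tens_map ::
  "(('b \<Rightarrow>\<^sub>0 complex) \<Rightarrow> ('b \<Rightarrow>\<^sub>0 complex)) \<Rightarrow> ('b list \<Rightarrow>\<^sub>0 complex) \<Rightarrow> ('b list \<Rightarrow>\<^sub>0 complex)" where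
  "tens_map A = lin_ext (\<lambda>w. \<Prod>b\<leftarrow>w. tens_vec (A (Poly_Mapping.single b 1)))"

definition sym_map ::
  "(('b \<Rightarrow>\<^sub>0 complex) \<Rightarrow> ('b \<Rightarrow>\<^sub>0 complex)) \<Rightarrow> ('b multiset \<Rightarrow>\<^sub>0 complex) \<Rightarrow> ('b multiset \<Rightarrow>\<^sub>0 complex)" where
  "sym_map A = lin_ext (\<lambda>M. \<Prod>b\<in>#M. sym_vec (A (Poly_Mapping.single b 1)))"

text \<open>
  For a subspace \<open>W\<close> of \<open>U\<close>, the inclusion induces an embedding of \<open>Sym\<^sup>k(W)\<close> into \<open>Sym\<^sup>k(U)\<close>, and
  for subspaces \<open>W\<^sub>1, \<dots>, W\<^sub>r\<close> it induces an embedding of \<open>W\<^sub>1 \<otimes> \<dots> \<otimes> W\<^sub>r\<close> into the \<open>r\<close>-th tensor power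
  of \<open>U\<close>. The following are the images of these embeddings.
\<close>

definition sym_power :: "nat \<Rightarrow> ('b \<Rightarrow>\<^sub>0 complex) set \<Rightarrow> ('b multiset \<Rightarrow>\<^sub>0 complex) set" where
  "sym_power k W = pm.span {\<Prod>w\<leftarrow>ws. sym_vec w | ws. length ws = k \<and> set ws \<subseteq> W}"

definition tensor_prod :: "('b \<Rightarrow>\<^sub>0 complex) set list \<Rightarrow> ('b list \<Rightarrow>\<^sub>0 complex) set" where
  "tensor_prod Ws = pm.span {\<Prod>w\<leftarrow>ws. tens_vec w | ws. list_all2 (\<in>) ws Ws}"

section \<open>Higher Lie modules\<close>

text \<open>
  Here \<open>V = \<complex>\<^sup>N\<close> has the basis \<^term>\<open>Poly_Mapping.single i 1\<close> with \<open>i < N\<close>, so that its tensor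
  algebra is spanned by the words with letters below \<open>N\<close>.
\<close>

inductive_set free_lie :: "nat \<Rightarrow> (nat list \<Rightarrow>\<^sub>0 complex) set" for N :: nat where
  gen: "i < N \<Longrightarrow> Poly_Mapping.single [i] 1 \<in> free_lie N"
| zero: "0 \<in> free_lie N"
| add: "p \<in> free_lie N \<Longrightarrow> q \<in> free_lie N \<Longrightarrow> p + q \<in> free_lie N"
| scale: "p \<in> free_lie N \<Longrightarrow> pm_scale a p \<in> free_lie N"
| bracket: "p \<in> free_lie N \<Longrightarrow> q \<in> free_lie N \<Longrightarrow> p * q - q * p \<in> free_lie N"

definition lie_part :: "nat \<Rightarrow> nat \<Rightarrow> (nat list \<Rightarrow>\<^sub>0 complex) set" where
  "lie_part N m = {p \<in> free_lie N. \<forall>w\<in>Poly_Mapping.keys p. length w = m}"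

text \<open>
  The factors with index greater than the sum of the parts are all \<open>Sym\<^sup>0 = \<complex>\<close> and are omitted.
\<close>

definition higher_lie :: "nat \<Rightarrow> nat list \<Rightarrow> (nat list multiset list \<Rightarrow>\<^sub>0 complex) set" where
  "higher_lie N lam =
     tensor_prod (map (\<lambda>i. sym_power (count_list lam i) (lie_part N i)) [1..<Suc (sum_list lam)])"

definition gl_std :: "complex mat \<Rightarrow> (nat \<Rightarrow>\<^sub>0 complex) \<Rightarrow> (nat \<Rightarrow>\<^sub>0 complex)" where
  "gl_std g = lin_ext (\<lambda>j. \<Sum>i<dim_row g. Poly_Mapping.single i (g $$ (i, j)))"

definition gl_action ::
  "complex mat \<Rightarrow> (nat list multiset list \<Rightarrow>\<^sub>0 complex) \<Rightarrow> (nat list multiset list \<Rightarrow>\<^sub>0 complex)" where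
  "gl_action g = tens_map (sym_map (tens_map (gl_std g)))"

text \<open>
  The character in \<open>N\<close> variables: the trace of an element of the general linear group with
  eigenvalues \<open>x 0, \<dots>, x (N - 1)\<close>, taken to be the diagonal one.
\<close>

definition higher_lie_char :: "nat \<Rightarrow> nat list \<Rightarrow> (nat \<Rightarrow> complex) \<Rightarrow> complex" where
  "higher_lie_char N lam x = trace_on (higher_lie N lam) (gl_action (mat_diag N x))"

section \<open>Partitions, tableaux and Schur functions\<close>

definition partitions :: "nat \<Rightarrow> nat list set" where
  "partitions n = {lam. sorted_wrt (\<ge>) lam \<and> 0 \<notin> set lam \<and> sum_list lam = n}"

text \<open>Cells are pairs (row, column), both counted from 0, with rows running downwards.\<close>

definition cells :: "nat list \<Rightarrow> (nat \<times> nat) set" where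
  "cells mu = {(r, c). r < length mu \<and> c < mu ! r}"

definition SSYT :: "nat list \<Rightarrow> nat \<Rightarrow> (nat \<times> nat \<Rightarrow> nat) set" where
  "SSYT mu N = {T \<in> cells mu \<rightarrow>\<^sub>E {..<N}.
     (\<forall>r c c'. (r, c) \<in> cells mu \<longrightarrow> (r, c') \<in> cells mu \<longrightarrow> c < c' \<longrightarrow> T (r, c) \<le> T (r, c')) \<and>
     (\<forall>r r' c. (r, c) \<in> cells mu \<longrightarrow> (r', c) \<in> cells mu \<longrightarrow> r < r' \<longrightarrow> T (r, c) < T (r', c))}"

definition schur_poly :: "nat \<Rightarrow> nat list \<Rightarrow> (nat \<Rightarrow> complex) \<Rightarrow> complex" where
  "schur_poly N mu x = (\<Sum>T\<in>SSYT mu N. \<Prod>u\<in>cells mu. x (T u))"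

definition SYT :: "nat list \<Rightarrow> (nat \<times> nat \<Rightarrow> nat) set" where
  "SYT mu = {T \<in> cells mu \<rightarrow>\<^sub>E {1..sum_list mu}. bij_betw T (cells mu) {1..sum_list mu} \<and>
     (\<forall>r c c'. (r, c) \<in> cells mu \<longrightarrow> (r, c') \<in> cells mu \<longrightarrow> c < c' \<longrightarrow> T (r, c) < T (r, c')) \<and>
     (\<forall>r r' c. (r, c) \<in> cells mu \<longrightarrow> (r', c) \<in> cells mu \<longrightarrow> r < r' \<longrightarrow> T (r, c) < T (r', c))}"

text \<open>
  The Schur expansion of the character as a symmetric function in infinitely many variables: an
  identity of polynomials in every finite number of variables, with one family of coefficients.
  A nonzero \<open>x i\<close> is required because the diagonal matrix has to be invertible.
\<close>

definition is_schur_expansion :: "nat list \<Rightarrow> (nat list \<Rightarrow> int) \<Rightarrow> bool" where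
  "is_schur_expansion lam c \<longleftrightarrow>
     (\<forall>mu. mu \<notin> partitions (sum_list lam) \<longrightarrow> c mu = 0) \<and>
     (\<forall>N x. (\<forall>i<N. x i \<noteq> 0) \<longrightarrow>
        higher_lie_char N lam x = (\<Sum>mu\<in>partitions (sum_list lam). of_int (c mu) * schur_poly N mu x))"

definition schur_coeff :: "nat list \<Rightarrow> nat list \<Rightarrow> int" where
  "schur_coeff lam = (THE c. is_schur_expansion lam c)"

section \<open>Descents and block major indices\<close>

definition Des :: "nat list \<Rightarrow> (nat \<times> nat \<Rightarrow> nat) \<Rightarrow> nat set" where
  "Des mu T = {i. \<exists>r c r' c'. (r, c) \<in> cells mu \<and> (r', c') \<in> cells mu \<and>
                 T (r, c) = i \<and> T (r', c') = i + 1 \<and> r < r'}"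

text \<open>The index \<open>i\<close> of a block runs from 0 to \<^term>\<open>length lam - 1\<close>.\<close>

definition block_start :: "nat list \<Rightarrow> nat \<Rightarrow> nat" where
  "block_start lam i = sum_list (take i lam)"

definition block :: "nat list \<Rightarrow> nat \<Rightarrow> nat set" where
  "block lam i = {block_start lam i + 1..block_start lam i + lam ! i}"

definition block_Des :: "nat list \<Rightarrow> nat \<Rightarrow> nat list \<Rightarrow> (nat \<times> nat \<Rightarrow> nat) \<Rightarrow> nat set" where
  "block_Des lam i mu T =
     {d - block_start lam i | d. d \<in> Des mu T \<and> d \<in> block lam i \<and> d + 1 \<in> block lam i}"

definition block_maj :: "nat list \<Rightarrow> nat \<Rightarrow> nat list \<Rightarrow> (nat \<times> nat \<Rightarrow> nat) \<Rightarrow> nat" where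
  "block_maj lam i mu T = \<Sum>(block_Des lam i mu T)"

definition SYT_blocks :: "nat list \<Rightarrow> nat list \<Rightarrow> (nat \<times> nat \<Rightarrow> nat) set" where
  "SYT_blocks lam mu = {T \<in> SYT mu. \<forall>i<length lam. [block_maj lam i mu T = 1] (mod lam ! i)}"

definition refined_Thrall_subset :: "nat list \<Rightarrow> nat list \<Rightarrow> (nat \<times> nat \<Rightarrow> nat) set \<Rightarrow> bool" where
  "refined_Thrall_subset lam mu S \<longleftrightarrow> S \<subseteq> SYT_blocks lam mu \<and> int (card S) = schur_coeff lam mu"

end

theory Submission
  imports
    Defs
    "HOL-Combinatorics.Permutations"
    "HOL-Library.Product_Lexorder"
    "Jordan_Normal_Form.Schur_Decomposition"
begin

text \<open>
  Let \<open>D\<close> be the diagram of \<open>lam\<close>. The centralizer \<open>wreath lam\<close> of a permutation of cycle type \<open>lam\<close>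
  acts on the words on \<open>D\<close>, and so does its subgroup \<open>rotations lam\<close> generated by the rotations of single
  rows. Let \<open>rot_char lam\<close> be the linear character sending a full rotation step of a row of length \<open>m\<close> to
  a primitive \<open>m\<close>-th root of unity and trivial on permutations of equal rows.

  Averaging over \<open>wreath lam\<close> gives the generating function of the multisets of primitive necklaces with lengths
  \<open>lam\<close>. This is the character of the higher Lie module, because the primitive necklaces of
  length \<open>m\<close> index a basis of \<open>lie_part N m\<close> compatible with the grading by content: on Lie elements
  the \<open>\<zeta>\<close>-twisted sum of cyclic rotations coincides with an invertible operator. Averaging over
  \<open>rotations lam\<close> gives the generating function of the words whose blocks have major index
  congruent to 1, hence by standardization the numbers \<open>card (SYT_blocks lam mu)\<close>.

  By Frobenius' formula the two Schur coefficients are the multiplicities of \<open>rot_char lam\<close> in one irreducible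
  character of the symmetric group, restricted to the two groups. Restricting to a subgroup can only enlarge the
  isotypic part. Equality for all \<open>mu\<close>, paired with the regular character, means that the two groups have
  the same order, that is, that no two parts are equal.
\<close>

section \<open>Shapes, horizontal strips and the Cauchy identity\<close>

text \<open>The irreducible characters are not built from modules. \<open>irr\<close> is the inverse
  Kostka combination of the permutation characters \<open>fixn\<close>, and its orthonormality is
  the Cauchy identity read through Kostka numbers. What this leaves open is positivity: the
  inequality needs a genuine representation whose isotypic parts have dimensions. It is recovered
  from the norm: \<open>irr\<close> is a difference of two characters of permutation modules and has
  norm one, so cancelling common constituents leaves a single one, and the value at the identity
  fixes the sign. Dimensions enter only as traces of idempotent matrices, which are natural numbers.
  Both averages rest on one twisted sum over the rotations of a row. Its weight has exponent
  \<open>m - 1\<close>, that is -1 modulo \<open>m\<close>: over fixed words it filters major index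
  1, by cyclic sieving, and over pairs of words it singles out primitive necklaces. The Lie side has
  to match this with actual bases, since the character is defined as a trace on the module; there
  the twisted rotation sums supply the dual functionals.\<close>

definition shape :: "(nat \<Rightarrow> nat) \<Rightarrow> bool" where
  "shape f \<longleftrightarrow> antimono f \<and> (\<exists>L. f L = 0)"

definition scells :: "(nat \<Rightarrow> nat) \<Rightarrow> (nat \<times> nat) set" where
  "scells f = {(r, c). c < f r}"

definition sz :: "(nat \<Rightarrow> nat) \<Rightarrow> nat" where
  "sz f = card (scells f)"

text \<open>Taking the content as a multiset lets tableaux, words on arbitrary index sets and
  monomials be compared by plain equality.\<close>

definition ssyt :: "(nat \<Rightarrow> nat) \<Rightarrow> nat multiset \<Rightarrow> (nat \<times> nat \<Rightarrow> nat) set" where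
  "ssyt f A = {T \<in> extensional (scells f). image_mset T (mset_set (scells f)) = A \<and>
     (\<forall>r c c'. c < c' \<longrightarrow> c' < f r \<longrightarrow> T (r, c) \<le> T (r, c')) \<and>
     (\<forall>r r' c. r < r' \<longrightarrow> c < f r' \<longrightarrow> T (r, c) < T (r', c))}"

definition kostka :: "(nat \<Rightarrow> nat) \<Rightarrow> nat multiset \<Rightarrow> nat" where
  "kostka f A = card (ssyt f A)"

text \<open>The inequality \<open>g (Suc i) \<le> f i\<close> says that \<open>g\<close> has at most
  one cell outside \<open>f\<close> in each column. Rows are indexed by all naturals, so no lengths
  have to be compared.\<close>

definition hstrip :: "(nat \<Rightarrow> nat) \<Rightarrow> (nat \<Rightarrow> nat) \<Rightarrow> bool" where
  "hstrip g f \<longleftrightarrow> (\<forall>i. f i \<le> g i \<and> g (Suc i) \<le> f i)"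

lemma shape_antimono: "shape f \<Longrightarrow> i \<le> j \<Longrightarrow> f j \<le> f i"
  by (auto simp: shape_def antimono_def)

lemma shape_zero_above: "shape f \<Longrightarrow> f L = 0 \<Longrightarrow> L \<le> i \<Longrightarrow> f i = 0"
  using shape_antimono[of f L i] by simp

lemma scells_eq_Sigma:
  assumes "shape f" "f L = 0"
  shows "scells f = (SIGMA r:{..<L}. {..<f r})"
  using shape_zero_above[OF assms] by (auto simp: scells_def) (metis leI less_nat_zero_code)

lemma finite_scells: "shape f \<Longrightarrow> finite (scells f)"
  using scells_eq_Sigma[of f] by (auto simp: shape_def)

lemma sz_eq_sum:
  assumes "shape f" "f L = 0"
  shows "sz f = (\<Sum>r<L. f r)"
  by (simp add: sz_def scells_eq_Sigma[OF assms])

lemma sz_eq_0_iff: "shape f \<Longrightarrow> sz f = 0 \<longleftrightarrow> f = (\<lambda>_. 0)"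
  by (auto simp: sz_def finite_scells) (auto simp: scells_def fun_eq_iff)

lemma shape_zero: "shape (\<lambda>_. 0)"
  by (simp add: shape_def antimono_def)

lemma shape_le_sz: "shape f \<Longrightarrow> f i \<le> sz f"
proof -
  assume f: "shape f"
  have "card (Pair i ` {..<f i}) \<le> sz f" unfolding sz_def
    by (rule card_mono[OF finite_scells[OF f]]) (auto simp: scells_def)
  then show ?thesis by (simp add: card_image inj_on_def)
qed

lemma hstrip_shape_upper: assumes "hstrip g f" "shape f" shows "shape g"
proof -
  have h: "f i \<le> g i" "g (Suc i) \<le> f i" for i using assms(1) by (auto simp: hstrip_def)
  obtain L where "f L = 0" using assms(2) by (auto simp: shape_def)
  then have "g (Suc L) = 0" using h(2)[of L] by simp
  moreover have "antimono g" unfolding decseq_Suc_iff using h le_trans by blast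
  ultimately show ?thesis unfolding shape_def by blast
qed

lemma hstrip_shape_lower: assumes "hstrip g f" "shape g" shows "shape f"
proof -
  have h: "f i \<le> g i" "g (Suc i) \<le> f i" for i using assms(1) by (auto simp: hstrip_def)
  obtain L where "g L = 0" using assms(2) by (auto simp: shape_def)
  then have "f L = 0" using h(1)[of L] by simp
  moreover have "antimono f" unfolding decseq_Suc_iff using h le_trans by blast
  ultimately show ?thesis unfolding shape_def by blast
qed

lemma hstrip_sz_le:
  assumes "hstrip g f" "shape g" shows "sz f \<le> sz g"
proof -
  have "f i \<le> g i" for i using assms(1) by (simp add: hstrip_def)
  then have "scells f \<subseteq> scells g" by (auto simp: scells_def intro: less_le_trans)
  then show ?thesis unfolding sz_def by (rule card_mono[OF finite_scells[OF assms(2)]])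
qed

lemma finite_bounded_shapes:
  "finite {f :: nat \<Rightarrow> nat. \<forall>i. (i \<in> {..<L} \<longrightarrow> f i \<in> {..M}) \<and> (i \<notin> {..<L} \<longrightarrow> f i = 0)}"
  by (rule finite_set_of_finite_funs) auto

lemma finite_hstrip_lower: assumes "shape f" shows "finite {g. hstrip f g \<and> P g}"
proof -
  obtain L where "f L = 0" using assms by (auto simp: shape_def)
  then show ?thesis
    using shape_zero_above[OF assms, of L] shape_antimono[OF assms, of 0]
    by (intro finite_subset[OF _ finite_bounded_shapes[of L "f 0"]])
      (auto simp: hstrip_def, meson le_trans le0, metis le_zero_eq not_le)
qed

lemma finite_shapes: "finite {f. shape f \<and> sz f = n}"
proof -
  have "f i = 0" if "shape f" "sz f = n" "n \<le> i" for f i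
  proof (rule ccontr)
    assume "f i \<noteq> 0"
    then have "f k \<ge> 1" if "k \<le> i" for k using shape_antimono[OF \<open>shape f\<close> that] by linarith
    then have "(\<lambda>k. (k, 0)) ` {..i} \<subseteq> scells f" by (fastforce simp: scells_def)
    then have "card ((\<lambda>k. (k, 0::nat)) ` {..i}) \<le> sz f"
      unfolding sz_def by (rule card_mono[OF finite_scells[OF \<open>shape f\<close>]])
    then show False using that by (simp add: card_image inj_on_def)
  qed
  then have "{f. shape f \<and> sz f = n} \<subseteq>
      {f. \<forall>i. (i \<in> {..<n} \<longrightarrow> f i \<in> {..n}) \<and> (i \<notin> {..<n} \<longrightarrow> f i = 0)}"
    using shape_le_sz by auto
  then show ?thesis by (rule finite_subset[OF _ finite_bounded_shapes])
qed

lemma finite_hstrip_upper: "shape f \<Longrightarrow> finite {g. hstrip g f \<and> sz g = n}"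
  by (rule finite_subset[OF _ finite_shapes[of n]]) (auto intro: hstrip_shape_upper)

lemma finite_ssyt: assumes "shape f" shows "finite (ssyt f A)"
proof -
  have "ssyt f A \<subseteq> (scells f \<rightarrow>\<^sub>E set_mset A)"
  proof
    fix T assume "T \<in> ssyt f A"
    then have e: "T \<in> extensional (scells f)" and c: "image_mset T (mset_set (scells f)) = A"
      unfolding ssyt_def by blast+
    have "T u \<in># A" if "u \<in> scells f" for u
      unfolding c[symmetric] using that finite_scells[OF assms] by simp
    then show "T \<in> (scells f \<rightarrow>\<^sub>E set_mset A)" using e unfolding PiE_iff by blast
  qed
  then show ?thesis
    by (rule finite_subset) (auto intro: finite_PiE simp: finite_scells[OF assms])
qed

lemma ssyt_size: "T \<in> ssyt f A \<Longrightarrow> sz f = size A"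
  by (auto simp: ssyt_def sz_def)

lemma kostka_eq_0: "sz f \<noteq> size A \<Longrightarrow> kostka f A = 0"
  unfolding kostka_def using ssyt_size[of _ f A] by (metis card.empty ex_in_conv)

lemma down_closed_eq_lessThan:
  fixes S :: "nat set"
  assumes "finite S" "\<And>c c'. c \<in> S \<Longrightarrow> c' < c \<Longrightarrow> c' \<in> S"
  shows "S = {..<card S}"
proof -
  define m where "m = (LEAST m. m \<notin> S)"
  have "\<exists>m. m \<notin> S" using assms(1) ex_new_if_finite infinite_UNIV_nat by blast
  then have "m \<notin> S" unfolding m_def by (rule LeastI_ex)
  moreover have "c \<in> S" if "c < m" for c using that not_less_Least unfolding m_def by blast
  ultimately have "S = {..<m}" using assms(2) by (auto, metis linorder_neqE_nat)
  then show ?thesis by simp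
qed

text \<open>Removing the cells that contain the largest letter \<open>N\<close>.\<close>

lemma kostka_rec:
  assumes f: "shape f" and A: "\<And>x. x \<in># A \<Longrightarrow> x < N" and s: "sz f = size A + a"
  shows "kostka f (A + replicate_mset a N) = (\<Sum>g | hstrip f g \<and> sz g = size A. kostka g A)"
proof -
  define G where "G = {g. hstrip f g \<and> sz g = size A}"
  \<comment> \<open>\<open>lev T\<close> is the shape of the entries below \<open>N\<close>;
    \<open>fwd\<close> records it together with the restricted tableau, and \<open>bwd\<close>
    refills the removed strip with \<open>N\<close>.\<close>
  define lev where "lev T r = card {c. c < f r \<and> T (r, c) < N}" for T :: "nat \<times> nat \<Rightarrow> nat" and r
  define fwd where "fwd T = (lev T, restrict T (scells (lev T)))" for T
  define bwd where "bwd = (\<lambda>(g, T'). \<lambda>u\<in>scells f. if u \<in> scells g then T' u else N)"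
  have finG: "finite G" unfolding G_def by (rule finite_hstrip_lower[OF f])
  have shG: "shape g" if "g \<in> G" for g using that f hstrip_shape_lower by (auto simp: G_def)
  have lev: "c < lev T r \<longleftrightarrow> c < f r \<and> T (r, c) < N" if T: "T \<in> ssyt f (A + replicate_mset a N)" for T r c
  proof -
    have "{c. c < f r \<and> T (r, c) < N} = {..<lev T r}" unfolding lev_def
      using T by (intro down_closed_eq_lessThan) (auto simp: ssyt_def, meson le_less_trans less_trans)
    then show ?thesis by auto
  qed
  have levc: "scells (lev T) = {u \<in> scells f. T u < N}" if "T \<in> ssyt f (A + replicate_mset a N)" for T
    using lev[OF that] by (auto simp: scells_def)
  have leN: "T u \<le> N" if T: "T \<in> ssyt f (A + replicate_mset a N)" and u: "u \<in> scells f" for T u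
  proof -
    have "T u \<in># image_mset T (mset_set (scells f))" using u finite_scells[OF f] by auto
    moreover have "image_mset T (mset_set (scells f)) = A + replicate_mset a N"
      using T unfolding ssyt_def mem_Collect_eq by (elim conjE)
    ultimately have "T u \<in># A + replicate_mset a N" by (simp only:)
    then have "T u \<in># A \<or> T u = N" by (simp split: if_splits)
    then show ?thesis using A[of "T u"] by linarith
  qed
  have fwd_in: "fwd T \<in> Sigma G (\<lambda>g. ssyt g A)" if T: "T \<in> ssyt f (A + replicate_mset a N)" for T
  proof -
    let ?g = "lev T"
    have row: "\<And>r c c'. c < c' \<Longrightarrow> c' < f r \<Longrightarrow> T (r, c) \<le> T (r, c')"
      and col: "\<And>r r' c. r < r' \<Longrightarrow> c < f r' \<Longrightarrow> T (r, c) < T (r', c)"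
      and cont: "image_mset T (mset_set (scells f)) = A + replicate_mset a N"
      using T by (auto simp: ssyt_def)
    have "image_mset T (mset_set (scells ?g)) = filter_mset (\<lambda>x. x < N) (image_mset T (mset_set (scells f)))"
      unfolding levc[OF T] filter_mset_image_mset
      using finite_scells[OF f] by (simp add: filter_mset_mset_set)
    also have "\<dots> = A" unfolding cont using A
      by (intro multiset_eqI) (auto simp: not_in_iff[symmetric] count_eq_zero_iff)
    finally have cg: "image_mset T (mset_set (scells ?g)) = A" .
    have fing: "finite (scells ?g)" using levc[OF T] finite_scells[OF f] by auto
    \<comment> \<open>A cell of row \<open>Suc i\<close> has entry at most \<open>N\<close>, so by
      column strictness the entry above it is below \<open>N\<close>: no two copies of
      \<open>N\<close> share a column.\<close>
    have hs: "hstrip f ?g" unfolding hstrip_def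
    proof (intro allI conjI)
      fix i show "?g i \<le> f i" using lev[OF T] by (metis leI less_irrefl)
      have "c < ?g i" if "c < f (Suc i)" for c
      proof -
        have "T (i, c) < T (Suc i, c)" using col that by blast
        moreover have "T (Suc i, c) \<le> N" using leN[OF T] that by (auto simp: scells_def)
        moreover have "c < f i" using shape_antimono[OF f, of i "Suc i"] that by simp
        ultimately show ?thesis using lev[OF T] by auto
      qed
      then show "f (Suc i) \<le> ?g i" by (metis leI less_irrefl)
    qed
    have "sz ?g = size A" using cg unfolding sz_def by (metis size_image_mset size_mset_set)
    then have gG: "?g \<in> G" using hs by (simp add: G_def)
    have "restrict T (scells ?g) \<in> ssyt ?g A"
      unfolding ssyt_def mem_Collect_eq
    proof (intro conjI allI impI)
      have "image_mset (restrict T (scells ?g)) (mset_set (scells ?g)) = image_mset T (mset_set (scells ?g))"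
        using fing by (intro image_mset_cong) auto
      then show "image_mset (restrict T (scells ?g)) (mset_set (scells ?g)) = A" using cg by simp
      have sg: "shape ?g" using shG[OF gG] .
      show "restrict T (scells ?g) (r, c) \<le> restrict T (scells ?g) (r, c')"
        if "c < c'" "c' < ?g r" for r c c'
        using that row[OF that(1), of r] lev[OF T, of c r] lev[OF T, of c' r] by (auto simp: scells_def)
      show "restrict T (scells ?g) (r, c) < restrict T (scells ?g) (r', c)"
        if "r < r'" "c < ?g r'" for r r' c
        using that col[OF that(1), of c] lev[OF T, of c r] lev[OF T, of c r'] shape_antimono[OF sg, of r r']
        by (auto simp: scells_def)
    qed simp
    then show ?thesis using gG by (simp add: fwd_def)
  qed
  have bwd_in: "bwd p \<in> ssyt f (A + replicate_mset a N)" and bwd_fwd: "fwd (bwd p) = p"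
    if p: "p \<in> Sigma G (\<lambda>g. ssyt g A)" for p
  proof -
    obtain g T' where p': "p = (g, T')" "g \<in> G" "T' \<in> ssyt g A" using p by auto
    have g: "shape g" "hstrip f g" "sz g = size A" using p'(2) shG by (auto simp: G_def)
    have "g i \<le> f i" for i using g(2) by (simp add: hstrip_def)
    then have sub: "scells g \<subseteq> scells f" by (auto simp: scells_def intro: less_le_trans)
    have row: "\<And>r c c'. c < c' \<Longrightarrow> c' < g r \<Longrightarrow> T' (r, c) \<le> T' (r, c')"
      and col: "\<And>r r' c. r < r' \<Longrightarrow> c < g r' \<Longrightarrow> T' (r, c) < T' (r', c)"
      and cont: "image_mset T' (mset_set (scells g)) = A" and ext: "T' \<in> extensional (scells g)"
      using p'(3) by (auto simp: ssyt_def)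
    let ?T = "bwd p"
    have T: "?T u = (if u \<in> scells g then T' u else N)" if "u \<in> scells f" for u
      using that by (simp add: bwd_def p')
    have lt: "T' u < N" if "u \<in> scells g" for u
    proof -
      have "T' u \<in># image_mset T' (mset_set (scells g))" using that finite_scells[OF g(1)] by auto
      then show ?thesis using cont A by simp
    qed
    have hs: "g i \<le> f i" "f (Suc i) \<le> g i" for i using g(2) by (auto simp: hstrip_def)
    have hs': "f r' \<le> g r" if "r < r'" for r r'
      using hs(2)[of r] shape_antimono[OF f, of "Suc r" r'] that by simp
    show in_T: "?T \<in> ssyt f (A + replicate_mset a N)"
      unfolding ssyt_def mem_Collect_eq
    proof (intro conjI allI impI)
      show "?T \<in> extensional (scells f)" by (simp add: bwd_def p')
      have "mset_set (scells f) = mset_set (scells g) + mset_set (scells f - scells g)"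
        using sub finite_scells[OF f] by (metis Diff_disjoint Un_Diff_cancel Un_absorb1 finite_Diff2 finite_subset mset_set_Union finite_Diff)
      moreover have "image_mset ?T (mset_set (scells g)) = A"
        unfolding cont[symmetric] using T sub finite_scells[OF g(1)] by (intro image_mset_cong) auto
      moreover have "image_mset ?T (mset_set (scells f - scells g)) = replicate_mset a N"
      proof -
        have "image_mset ?T (mset_set (scells f - scells g)) = image_mset (\<lambda>_. N) (mset_set (scells f - scells g))"
          using T finite_scells[OF f] by (intro image_mset_cong) auto
        also have "\<dots> = replicate_mset (card (scells f - scells g)) N" by (simp add: image_mset_const_eq)
        also have "card (scells f - scells g) = a"
          using sub finite_scells[OF g(1)] s g(3) by (simp add: card_Diff_subset sz_def)
        finally show ?thesis .
      qed
      ultimately show "image_mset ?T (mset_set (scells f)) = A + replicate_mset a N" by simp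
      show "?T (r, c) \<le> ?T (r, c')" if "c < c'" "c' < f r" for r c c'
        using that T[of "(r,c)"] T[of "(r,c')"] row[of c c' r] lt[of "(r, c)"]
        by (auto simp: scells_def less_imp_le)
      show "?T (r, c) < ?T (r', c)" if "r < r'" "c < f r'" for r r' c
        using that T[of "(r,c)"] T[of "(r',c)"] col[of r r' c] lt[of "(r, c)"] hs'[of r r']
          shape_antimono[OF f, of r r'] by (auto simp: scells_def)
    qed
    have "scells (lev ?T) = scells g"
      unfolding levc[OF in_T] using T lt sub by (auto split: if_splits)
    then have c1: "c < lev ?T r \<longleftrightarrow> c < g r" for r c by (auto simp: scells_def)
    have "lev ?T = g"
    proof
      fix r show "lev ?T r = g r" using c1[of _ r] by (metis linorder_neqE_nat less_irrefl)
    qed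
    moreover have "restrict ?T (scells g) = T'"
      using T sub ext by (auto simp: fun_eq_iff extensional_def restrict_def)
    ultimately show "fwd ?T = p" by (simp add: fwd_def p')
  qed
  have fb: "bwd (fwd T) = T" if "T \<in> ssyt f (A + replicate_mset a N)" for T
  proof
    fix u
    have "T \<in> extensional (scells f)" using that by (simp add: ssyt_def)
    then show "bwd (fwd T) u = T u"
      using levc[OF that] leN[OF that, of u]
      by (cases u) (auto simp: bwd_def fwd_def extensional_def restrict_def)
  qed
  have "bij_betw fwd (ssyt f (A + replicate_mset a N)) (Sigma G (\<lambda>g. ssyt g A))"
    by (rule bij_betw_byWitness[where f' = bwd])
      (use fwd_in bwd_in bwd_fwd fb in \<open>blast+\<close>)
  then have "kostka f (A + replicate_mset a N) = card (Sigma G (\<lambda>g. ssyt g A))"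
    unfolding kostka_def by (rule bij_betw_same_card)
  also have "\<dots> = (\<Sum>g\<in>G. kostka g A)"
    unfolding kostka_def using finG finite_ssyt shG by (intro card_SigmaI) auto
  finally show ?thesis unfolding G_def .
qed


lemma kostka_empty: "shape f \<Longrightarrow> kostka f {#} = (if sz f = 0 then 1 else 0)"
proof (cases "sz f = 0")
  case True
  assume f: "shape f"
  have "f = (\<lambda>_. 0)" using True sz_eq_0_iff[OF f] by blast
  then have "ssyt f {#} = {\<lambda>_. undefined}" by (auto simp: ssyt_def scells_def)
  then show ?thesis using True by (simp add: kostka_def)
qed (simp add: kostka_eq_0)

text \<open>
  Two shapes \<open>m\<close>, \<open>v\<close> have as common upper horizontal strips the interlacing \<open>g\<close> with
  \<open>max (m (i+1)) (v (i+1)) \<le> g (i+1) \<le> min (m i) (v i)\<close>, and as common lower ones the \<open>d\<close> with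
  \<open>max (m (i+1)) (v (i+1)) \<le> d i \<le> min (m i) (v i)\<close>; reflecting each interval matches the two, and
  only the first row of \<open>g\<close> remains free.
\<close>

definition toggle :: "(nat \<Rightarrow> nat) \<Rightarrow> (nat \<Rightarrow> nat) \<Rightarrow> (nat \<Rightarrow> nat) \<Rightarrow> nat \<Rightarrow> nat" where
  "toggle m v g i = min (m i) (v i) + max (m (Suc i)) (v (Suc i)) - g (Suc i)"

text \<open>Rowwise, minimum plus maximum is the sum, so all rows of \<open>g\<close> but the first
  cancel in the size count. What remains is the overhang of the first row beyond \<open>m\<close>
  and \<open>v\<close>, which is thereby determined by the sizes.\<close>

lemma toggle_sz:
  assumes m: "shape m" and v: "shape v" and gm: "hstrip g m" and gv: "hstrip g v"
  shows "hstrip m (toggle m v g)" "hstrip v (toggle m v g)" "shape (toggle m v g)"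
    "max (m 0) (v 0) \<le> g 0"
    "sz g + sz (toggle m v g) = (g 0 - max (m 0) (v 0)) + sz m + sz v"
proof -
  have b: "g (Suc i) \<le> min (m i) (v i)" "max (m i) (v i) \<le> g i" for i
    using gm gv by (auto simp: hstrip_def)
  show h: "hstrip m (toggle m v g)" "hstrip v (toggle m v g)"
    unfolding hstrip_def
  proof (safe)
    fix i
    have "toggle m v g i = min (m i) (v i) + max (m (Suc i)) (v (Suc i)) - g (Suc i)"
      by (simp add: toggle_def)
    moreover note b(1)[of i] b(2)[of "Suc i"]
    ultimately have "toggle m v g i \<le> min (m i) (v i)" "max (m (Suc i)) (v (Suc i)) \<le> toggle m v g i"
      by linarith+
    then show "toggle m v g i \<le> m i" "m (Suc i) \<le> toggle m v g i"
      "toggle m v g i \<le> v i" "v (Suc i) \<le> toggle m v g i" by simp_all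
  qed
  show d: "shape (toggle m v g)" using hstrip_shape_lower[OF h(1) m] .
  have g: "shape g" using hstrip_shape_upper[OF gm m] .
  show "max (m 0) (v 0) \<le> g 0" using b by blast
  obtain L1 L2 where L12: "m L1 = 0" "v L2 = 0" using m v by (auto simp: shape_def)
  define L where "L = max L1 L2"
  have L: "m i = 0" "v i = 0" if "L \<le> i" for i
    using that shape_zero_above[OF m L12(1)] shape_zero_above[OF v L12(2)] by (auto simp: L_def)
  have gL: "g (Suc L) = 0" using b(1)[of L] L[of L] by simp
  have dL: "toggle m v g L = 0" using L[of L] L[of "Suc L"] by (simp add: toggle_def)
  have "sz g = g 0 + (\<Sum>i<L. g (Suc i))"
    using sz_eq_sum[OF g gL] by (simp only: sum.lessThan_Suc_shift)
  moreover have "(\<Sum>i<L. g (Suc i)) + sz (toggle m v g)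
      = (\<Sum>i<L. min (m i) (v i)) + (\<Sum>i<L. max (m (Suc i)) (v (Suc i)))"
    unfolding sz_eq_sum[OF d dL] sum.distrib[symmetric] toggle_def
  proof (rule sum.cong[OF refl])
    fix i
    show "g (Suc i) + (min (m i) (v i) + max (m (Suc i)) (v (Suc i)) - g (Suc i))
        = min (m i) (v i) + max (m (Suc i)) (v (Suc i))"
      using b(1)[of i] by linarith
  qed
  moreover have "(\<Sum>i<L. max (m (Suc i)) (v (Suc i))) + max (m 0) (v 0) = (\<Sum>i<L. max (m i) (v i))"
    using sum.lessThan_Suc_shift[of "\<lambda>i. max (m i) (v i)" L] L[of L] by simp
  moreover have "(\<Sum>i<L. max (m i) (v i)) + (\<Sum>i<L. min (m i) (v i)) = sz m + sz v"
    unfolding sz_eq_sum[OF m L(1)[OF order_refl]] sz_eq_sum[OF v L(2)[OF order_refl]] sum.distrib[symmetric]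
    by (intro sum.cong) auto
  ultimately show "sz g + sz (toggle m v g) = (g 0 - max (m 0) (v 0)) + sz m + sz v"
    using b(2)[of 0] by linarith
qed

text \<open>\<open>k\<close> is the overhang of the first row, the only datum that
  \<open>toggle\<close> forgets.\<close>

definition untoggle :: "(nat \<Rightarrow> nat) \<Rightarrow> (nat \<Rightarrow> nat) \<Rightarrow> nat \<Rightarrow> (nat \<Rightarrow> nat) \<Rightarrow> nat \<Rightarrow> nat" where
  "untoggle m v k d i = (case i of 0 \<Rightarrow> max (m 0) (v 0) + k
     | Suc j \<Rightarrow> min (m j) (v j) + max (m (Suc j)) (v (Suc j)) - d j)"

lemma untoggle:
  assumes m: "shape m" and v: "shape v" and md: "hstrip m d" and vd: "hstrip v d"
  shows "hstrip (untoggle m v k d) m" "hstrip (untoggle m v k d) v" "toggle m v (untoggle m v k d) = d"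
proof -
  have b: "d i \<le> min (m i) (v i)" "max (m (Suc i)) (v (Suc i)) \<le> d i" for i
    using md vd by (auto simp: hstrip_def)
  have u: "untoggle m v k d 0 = max (m 0) (v 0) + k"
    "untoggle m v k d (Suc j) = min (m j) (v j) + max (m (Suc j)) (v (Suc j)) - d j" for j
    by (simp_all add: untoggle_def)
  have lo: "max (m i) (v i) \<le> untoggle m v k d i" for i
  proof (cases i)
    case (Suc j)
    show ?thesis unfolding Suc u using b(1)[of j] by linarith
  qed (simp add: u)
  have hi: "untoggle m v k d (Suc i) \<le> min (m i) (v i)" for i
    unfolding u using b(2)[of i] by linarith
  show "hstrip (untoggle m v k d) m" "hstrip (untoggle m v k d) v"
    using lo hi by (auto simp: hstrip_def)
  show "toggle m v (untoggle m v k d) = d"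
  proof
    fix i show "toggle m v (untoggle m v k d) i = d i"
      unfolding toggle_def u using b(1)[of i] by linarith
  qed
qed

lemma untoggle_toggle:
  assumes "hstrip g m" "hstrip g v"
  shows "untoggle m v (g 0 - max (m 0) (v 0)) (toggle m v g) = g"
proof
  fix i
  have b: "g (Suc i) \<le> min (m i) (v i)" "max (m i) (v i) \<le> g i" for i
    using assms by (auto simp: hstrip_def)
  show "untoggle m v (g 0 - max (m 0) (v 0)) (toggle m v g) i = g i"
  proof (cases i)
    case 0
    then show ?thesis using b(2)[of 0] by (simp add: untoggle_def)
  next
    case (Suc j)
    have "untoggle m v k (toggle m v g) (Suc j) = g (Suc j)" for k
      unfolding untoggle_def toggle_def nat.case using b(1)[of j] by linarith
    then show ?thesis using Suc by simp
  qed
qed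

section \<open>Splitting off the largest letter; the Pieri rule in coefficient form\<close>

lemma letter_split:
  fixes A :: "nat multiset"
  assumes "\<forall>x\<in>#A. x < Suc N"
  obtains A' a where "A = A' + replicate_mset a N" "\<forall>x\<in>#A'. x < N"
proof
  show "A = filter_mset (\<lambda>x. x < N) A + replicate_mset (count A N) N"
  proof (rule multiset_eqI)
    fix x
    consider "x < N" | "x = N" | "\<not> x < Suc N" by linarith
    then show "count A x = count (filter_mset (\<lambda>x. x < N) A + replicate_mset (count A N) N) x"
    proof cases
      case 3
      then have "count A x = 0" using assms by (meson not_in_iff)
      with 3 show ?thesis by simp
    qed simp_all
  qed
  show "\<forall>x\<in>#filter_mset (\<lambda>x. x < N) A. x < N" by simp
qed

lemma filter_mset_sum_split:
  assumes "\<forall>x\<in>#C. x < (N :: nat)"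
  shows "filter_mset (\<lambda>x. x < N) (C + replicate_mset k N) = C"
proof -
  have "filter_mset (\<lambda>x. x < N) C = C" using assms by (simp add: filter_mset_eq_conv)
  moreover have "filter_mset (\<lambda>x. x < N) (replicate_mset k N) = {#}" by (auto simp: filter_mset_eq_conv)
  ultimately show ?thesis by simp
qed

text \<open>The multiplicity of \<open>N\<close> in a part of prescribed size is forced by the other
  letters; the two inequalities say that the forced number lies between 0 and
  \<open>a\<close>.\<close>

lemma sub_letter_split:
  fixes A :: "nat multiset"
  assumes A: "\<forall>x\<in>#A. x < N"
  shows "bij_betw (\<lambda>C. C + replicate_mset (s - size C) N)
    {C. C \<subseteq># A \<and> size C \<le> s \<and> s \<le> size C + a}
    {C. C \<subseteq># A + replicate_mset a N \<and> size C = s}"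
proof (rule bij_betw_byWitness[where f' = "filter_mset (\<lambda>x. x < N)"], goal_cases)
  case 1
  show ?case
  proof safe
    fix C assume "C \<subseteq># A"
    then have "\<forall>x\<in>#C. x < N" using A by (auto dest: mset_subset_eqD)
    then show "filter_mset (\<lambda>x. x < N) (C + replicate_mset (s - size C) N) = C"
      using filter_mset_sum_split[of C N] by simp
  qed
next
  case 2
  have NA: "count A N = 0" using A by (meson less_irrefl not_in_iff)
  show ?case
  proof safe
    fix C assume C: "C \<subseteq># A + replicate_mset a N" and s: "s = size C"
    have "\<forall>x\<in>#C. x < Suc N" using A mset_subset_eqD[OF C] by (fastforce split: if_splits)
    then obtain C' c where C': "C = C' + replicate_mset c N" "\<forall>x\<in>#C'. x < N" by (rule letter_split)
    have "filter_mset (\<lambda>x. x < N) C = C'" using C' filter_mset_sum_split by simp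
    then show "filter_mset (\<lambda>x. x < N) C + replicate_mset (size C - size (filter_mset (\<lambda>x. x < N) C)) N = C"
      using C'(1) by simp
  qed
next
  case 3
  have "replicate_mset k N \<subseteq># replicate_mset a N" if "k \<le> a" for k
    using that by (intro mset_subset_eqI) simp
  then show ?case by (auto intro!: subset_mset.add_mono)
next
  case 4
  show ?case
  proof safe
    fix C assume C: "C \<subseteq># A + replicate_mset a N"
    have "\<forall>x\<in>#C. x < Suc N" using A mset_subset_eqD[OF C] by (fastforce split: if_splits)
    then obtain C' c where C': "C = C' + replicate_mset c N" "\<forall>x\<in>#C'. x < N" by (rule letter_split)
    have f: "filter_mset (\<lambda>x. x < N) C = C'" using C' filter_mset_sum_split by simp
    have NA: "count A N = 0" "count C' N = 0" using A C'(2) by (meson less_irrefl not_in_iff)+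
    have "count C N \<le> a" using mset_subset_eq_count[OF C, of N] NA by simp
    then have "c \<le> a" using C'(1) NA by simp
    moreover have "C' \<subseteq># A"
    proof (rule mset_subset_eqI)
      fix x show "count C' x \<le> count A x"
        using mset_subset_eq_count[OF C, of x] NA C'(1) by (cases "x = N") auto
    qed
    ultimately show "filter_mset (\<lambda>x. x < N) C \<subseteq># A" "size (filter_mset (\<lambda>x. x < N) C) \<le> size C"
      "size C \<le> size (filter_mset (\<lambda>x. x < N) C) + a" using f C'(1) by auto
  qed
qed

lemma finite_msets_size: "finite S \<Longrightarrow> finite {M. set_mset M \<subseteq> S \<and> size M = n}"
proof -
  assume "finite S"
  then have "finite (mset ` {xs. set xs \<subseteq> S \<and> length xs = n})" by (intro finite_imageI finite_lists_length_eq)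
  moreover have "{M. set_mset M \<subseteq> S \<and> size M = n} \<subseteq> mset ` {xs. set xs \<subseteq> S \<and> length xs = n}"
    by (auto, metis (mono_tags, lifting) ex_mset imageI mem_Collect_eq set_mset_mset size_mset)
  ultimately show ?thesis by (rule finite_subset[rotated])
qed

lemma finite_submsets: "finite {C. C \<subseteq># (A :: 'a multiset) \<and> P C}"
proof (rule finite_subset)
  show "{C. C \<subseteq># A \<and> P C} \<subseteq> (\<Union>n\<le>size A. {M. set_mset M \<subseteq> set_mset A \<and> size M = n})"
    by (auto dest: mset_subset_eqD size_mset_mono)
qed (simp add: finite_msets_size)

text \<open>Both sides are the coefficient at content \<open>A\<close> in the product of the Schur
  function of \<open>m\<close> with a complete symmetric function: on the right, \<open>C\<close> is
  the content of the tableau and the remaining letters form the complete factor. By induction on the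
  alphabet the largest letter is removed from \<open>g\<close>, and \<open>toggle\<close> exchanges
  that removal with the added strip.\<close>

lemma pieri:
  assumes "shape m" "\<forall>x\<in>#A. x < N"
  shows "(\<Sum>g | hstrip g m \<and> sz g = size A. kostka g A) = (\<Sum>C | C \<subseteq># A \<and> size C = sz m. kostka m C)"
  using assms
proof (induction N arbitrary: A m)
  case 0
  then have A: "A = {#}" by (metis less_nat_zero_code multiset_nonemptyE)
  have z: "hstrip g m \<and> sz g = 0 \<longleftrightarrow> g = (\<lambda>_. 0) \<and> sz m = 0" for g
    using hstrip_sz_le[of g m] hstrip_shape_upper[of g m] 0(1) sz_eq_0_iff[of g] sz_eq_0_iff[of m] shape_zero
    by (auto simp: hstrip_def)
  show ?case
  proof (cases "sz m = 0")
    case True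
    then have "m = (\<lambda>_. 0)" using sz_eq_0_iff[OF 0(1)] by simp
    then show ?thesis using True z by (simp add: A cong: conj_cong)
  next
    case False
    then have "{g. hstrip g m \<and> sz g = size A} = {}" "{C. C \<subseteq># A \<and> size C = sz m} = {}"
      using z by (auto simp: A)
    then show ?thesis by (simp only: sum.empty)
  qed
next
  case (Suc N)
  obtain A' a where A: "A = A' + replicate_mset a N" and A': "\<forall>x\<in>#A'. x < N"
    using letter_split[OF Suc.prems(2)] by blast
  note m = Suc.prems(1)
  define V where "V = {v. shape v \<and> sz v = size A'}"
  have finV: "finite V" unfolding V_def by (rule finite_shapes)
  \<comment> \<open>\<open>X\<close> walks from \<open>m\<close> up to \<open>g\<close> and then
    down to \<open>v\<close>; \<open>Y\<close> walks down to \<open>d\<close> first and then up. The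
    bound in \<open>Dl\<close> says that \<open>m\<close> has at most \<open>a\<close> cells outside
    \<open>d\<close>.\<close>
  define X where "X = (SIGMA g:{g. hstrip g m \<and> sz g = size A}. {v. hstrip g v \<and> sz v = size A'})"
  define Dl where "Dl = {d. hstrip m d \<and> sz m \<le> sz d + a}"
  define Y where "Y = (SIGMA d:Dl. {v. hstrip v d \<and> sz v = size A'})"
  have finD: "finite Dl" unfolding Dl_def by (rule finite_hstrip_lower[OF m])
  have shD: "shape d" if "d \<in> Dl" for d using that hstrip_shape_lower[OF _ m] by (auto simp: Dl_def)
  have shg: "shape g" if "hstrip g m" for g using hstrip_shape_upper[OF that m] .
  have "(\<Sum>g | hstrip g m \<and> sz g = size A. kostka g A)
      = (\<Sum>g | hstrip g m \<and> sz g = size A. \<Sum>v | hstrip g v \<and> sz v = size A'. kostka v A')"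
    using shg A' by (intro sum.cong) (auto simp: A intro!: kostka_rec)
  also have "\<dots> = (\<Sum>(g, v)\<in>X. kostka v A')"
    unfolding X_def using finite_hstrip_upper[OF m] finite_hstrip_lower shg by (intro sum.Sigma) auto
  also have "\<dots> = (\<Sum>(d, v)\<in>Y. kostka v A')"
  \<comment> \<open>The size identity of \<open>toggle_sz\<close> forces the overhang to be
    \<open>size A + sz d - sz m - sz v\<close>; the bound in \<open>Dl\<close> keeps this truncated
    difference exact.\<close>
  proof (rule sum.reindex_bij_witness[where
        i = "\<lambda>(d, v). (untoggle m v (size A + sz d - sz m - sz v) d, v)" and j = "\<lambda>(g, v). (toggle m v g, v)"], goal_cases)
    case (1 p)
    then obtain g v where p: "p = (g, v)" "hstrip g m" "sz g = size A" "hstrip g v" "sz v = size A'"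
      by (auto simp: X_def)
    have v: "shape v" using hstrip_shape_lower[OF p(4) shg[OF p(2)]] .
    have "size A + sz (toggle m v g) - sz m - sz v = g 0 - max (m 0) (v 0)"
      using toggle_sz(5)[OF m v p(2,4)] p(3) by linarith
    then show ?case using untoggle_toggle[OF p(2,4)] by (simp add: p(1))
  next
    case (2 p)
    then obtain g v where p: "p = (g, v)" "hstrip g m" "sz g = size A" "hstrip g v" "sz v = size A'"
      by (auto simp: X_def)
    have v: "shape v" using hstrip_shape_lower[OF p(4) shg[OF p(2)]] .
    show ?case using toggle_sz[OF m v p(2,4)] p(3,5) by (auto simp: p(1) Y_def Dl_def A)
  next
    case (3 p)
    then obtain d v where p: "p = (d, v)" "d \<in> Dl" "hstrip v d" "sz v = size A'" by (auto simp: Y_def)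
    have v: "shape v" using hstrip_shape_upper[OF p(3) shD[OF p(2)]] .
    have md: "hstrip m d" using p(2) by (simp add: Dl_def)
    show ?case using untoggle(3)[OF m v md p(3)] by (simp add: p(1))
  next
    case (4 p)
    then obtain d v where p: "p = (d, v)" "d \<in> Dl" "hstrip v d" "sz v = size A'" by (auto simp: Y_def)
    have v: "shape v" using hstrip_shape_upper[OF p(3) shD[OF p(2)]] .
    have md: "hstrip m d" and le: "sz m \<le> sz d + a" using p(2) by (auto simp: Dl_def)
    define k where "k = size A + sz d - sz m - sz v"
    note u = untoggle[OF m v md p(3), of k]
    have "untoggle m v k d 0 - max (m 0) (v 0) = k" by (simp add: untoggle_def)
    then have "sz (untoggle m v k d) + sz d = k + sz m + sz v" using toggle_sz(5)[OF m v u(1,2)] u(3) by simp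
    moreover have "k + sz m + sz v = size A + sz d" using le p(4) by (simp add: k_def A)
    ultimately have "(untoggle m v k d, v) \<in> X" using u(1,2) p(4) by (simp add: X_def)
    then show ?case unfolding k_def p(1) prod.case .
  qed auto
  also have "\<dots> = (\<Sum>d\<in>Dl. \<Sum>v | hstrip v d \<and> sz v = size A'. kostka v A')"
    unfolding Y_def using finD finite_hstrip_upper shD by (intro sum.Sigma[symmetric]) auto
  also have "\<dots> = (\<Sum>d\<in>Dl. \<Sum>C | C \<subseteq># A' \<and> size C = sz d. kostka d C)"
    using Suc.IH shD A' by (intro sum.cong) auto
  also have "\<dots> = (\<Sum>d\<in>Dl. \<Sum>C\<in>{C. C \<subseteq># A' \<and> size C \<le> sz m \<and> sz m \<le> size C + a}. if sz d = size C then kostka d C else 0)"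
    unfolding sum.inter_filter[OF finite_submsets, symmetric]
    using hstrip_sz_le[OF _ m] by (intro sum.cong) (auto simp: Dl_def)
  also have "\<dots> = (\<Sum>C\<in>{C. C \<subseteq># A' \<and> size C \<le> sz m \<and> sz m \<le> size C + a}. \<Sum>d\<in>Dl. if sz d = size C then kostka d C else 0)"
    by (rule sum.swap)
  also have "\<dots> = (\<Sum>C\<in>{C. C \<subseteq># A' \<and> size C \<le> sz m \<and> sz m \<le> size C + a}. kostka m (C + replicate_mset (sz m - size C) N))"
  proof (rule sum.cong[OF refl])
    fix C assume C: "C \<in> {C. C \<subseteq># A' \<and> size C \<le> sz m \<and> sz m \<le> size C + a}"
    then have "\<And>x. x \<in># C \<Longrightarrow> x < N" using A' by (auto dest: mset_subset_eqD)
    then have "kostka m (C + replicate_mset (sz m - size C) N) = (\<Sum>g | hstrip m g \<and> sz g = size C. kostka g C)"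
      using C by (intro kostka_rec[OF m]) auto
    also have "\<dots> = (\<Sum>d\<in>Dl. if sz d = size C then kostka d C else 0)"
      unfolding sum.inter_filter[OF finD, symmetric] using C by (intro sum.cong) (auto simp: Dl_def)
    finally show "(\<Sum>d\<in>Dl. if sz d = size C then kostka d C else 0) = kostka m (C + replicate_mset (sz m - size C) N)" ..
  qed
  also have "\<dots> = (\<Sum>C | C \<subseteq># A \<and> size C = sz m. kostka m C)"
    unfolding A by (rule sum.reindex_bij_betw[OF sub_letter_split[OF A']])
  finally show ?case .
qed

section \<open>Two-line arrays and the Cauchy identity\<close>

definition pair_msets :: "'a multiset \<Rightarrow> 'b multiset \<Rightarrow> ('a \<times> 'b) multiset set" where
  "pair_msets A B = {M. image_mset fst M = A \<and> image_mset snd M = B}"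

lemma pair_msets_snd: "M \<in> pair_msets A B \<Longrightarrow> p \<in># M \<Longrightarrow> snd p \<in># B"
  by (auto simp: pair_msets_def)

lemma finite_pair_msets: "finite (pair_msets A B)"
proof (rule finite_subset)
  show "pair_msets A B \<subseteq> {M. set_mset M \<subseteq> set_mset A \<times> set_mset B \<and> size M = size A}"
    by (force simp: pair_msets_def)
qed (rule finite_msets_size, simp)

text \<open>Multisets of pairs with given projections are matrices over the naturals with given
  margins. The letters of \<open>A\<close> that are not matched with \<open>B\<close> are exactly
  those paired with \<open>N\<close>.\<close>

lemma card_pair_msets_rec:
  assumes B: "\<forall>x\<in>#B. x < (N::nat)" and s: "size A = size B + b"
  shows "card (pair_msets A (B + replicate_mset b N)) = (\<Sum>C | C \<subseteq># A \<and> size C = size B. card (pair_msets C B))"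
proof -
  have "bij_betw (\<lambda>(C, M). M + image_mset (\<lambda>x. (x, N)) (A - C))
     (SIGMA C:{C. C \<subseteq># A \<and> size C = size B}. pair_msets C B) (pair_msets A (B + replicate_mset b N))"
  proof (rule bij_betw_byWitness[where f' = "\<lambda>M. (image_mset fst (filter_mset (\<lambda>p. snd p < N) M), filter_mset (\<lambda>p. snd p < N) M)"], goal_cases)
    case 1
    show ?case
    proof (rule ballI, clarsimp simp del: filter_union_mset)
      fix C M assume C: "C \<subseteq># A" and M: "M \<in> pair_msets C B"
      have "snd p < N" if "p \<in># M" for p
      proof -
        show ?thesis using pair_msets_snd[OF M that] B by blast
      qed
      then have "filter_mset (\<lambda>p. snd p < N) M = M" by (auto simp: filter_mset_eq_conv)
      moreover have "filter_mset (\<lambda>p. snd p < N) (image_mset (\<lambda>x. (x, N)) (A - C)) = {#}"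
        by (simp add: filter_mset_image_mset)
      ultimately have "filter_mset (\<lambda>p. snd p < N) (M + image_mset (\<lambda>x. (x, N)) (A - C)) = M" by simp
      then show "image_mset fst (filter_mset (\<lambda>p. snd p < N) (M + image_mset (\<lambda>x. (x, N)) (A - C))) = C \<and>
        filter_mset (\<lambda>p. snd p < N) (M + image_mset (\<lambda>x. (x, N)) (A - C)) = M"
        using M by (simp add: pair_msets_def)
    qed
  next
    case 2
    show ?case
    proof
      fix M assume M: "M \<in> pair_msets A (B + replicate_mset b N)"
      let ?F = "filter_mset (\<lambda>p. snd p < N) M" and ?G = "filter_mset (\<lambda>p. \<not> snd p < N) M"
      have MFG: "M = ?F + ?G" by (rule multiset_partition)
      have "snd p = N" if "p \<in># ?G" for p
      proof -
        have "snd p \<in># B + replicate_mset b N" using pair_msets_snd[OF M] that by simp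
        then show ?thesis using B that by (auto split: if_splits)
      qed
      then have G: "image_mset (\<lambda>p. (fst p, N)) ?G = ?G"
        by (metis (mono_tags, lifting) multiset.map_cong0 multiset.map_ident prod.collapse)
      have "A = image_mset fst (?F + ?G)" using M by (simp only: MFG[symmetric] pair_msets_def mem_Collect_eq)
      then have "A - image_mset fst ?F = image_mset fst ?G" by (simp only: image_mset_union add_diff_cancel_left')
      then have "?F + image_mset (\<lambda>x. (x, N)) (A - image_mset fst ?F) = ?F + ?G"
        using G by (simp only: multiset.map_comp o_def)
      then show "(\<lambda>(C, M). M + image_mset (\<lambda>x. (x, N)) (A - C)) (image_mset fst ?F, ?F) = M"
        by (simp only: MFG[symmetric] prod.case)
    qed
  next
    case 3
    show ?case
      using s by (auto simp: pair_msets_def multiset.map_comp o_def image_mset_const_eq size_Diff_submset)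
  next
    case 4
    show ?case
    proof (rule image_subsetI)
      fix M assume M: "M \<in> pair_msets A (B + replicate_mset b N)"
      have "image_mset snd (filter_mset (\<lambda>p. snd p < N) M) = filter_mset (\<lambda>x. x < N) (image_mset snd M)"
        by (simp add: filter_mset_image_mset)
      also have "image_mset snd M = B + replicate_mset b N" using M by (simp add: pair_msets_def)
      also have "filter_mset (\<lambda>x. x < N) (B + replicate_mset b N) = B" by (rule filter_mset_sum_split[OF B])
      finally have *: "image_mset snd (filter_mset (\<lambda>p. snd p < N) M) = B" .
      then have "size (filter_mset (\<lambda>p. snd p < N) M) = size B" by (metis size_image_mset)
      moreover have "image_mset fst (filter_mset (\<lambda>p. snd p < N) M) \<subseteq># A"
        using M by (auto simp: pair_msets_def intro!: image_mset_subseteq_mono)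
      ultimately show "(image_mset fst (filter_mset (\<lambda>p. snd p < N) M), filter_mset (\<lambda>p. snd p < N) M)
          \<in> (SIGMA C:{C. C \<subseteq># A \<and> size C = size B}. pair_msets C B)"
        using * by (simp add: pair_msets_def)
    qed
  qed
  from bij_betw_same_card[OF this] show ?thesis
    by (subst (asm) card_SigmaI) (auto intro: finite_submsets finite_pair_msets)
qed

text \<open>A single coefficient of the Cauchy identity. In place of a bijection, the largest letter
  of \<open>B\<close> is stripped from the second tableau, and \<open>pieri\<close> turns the strip
  into a choice of letters of \<open>A\<close>.\<close>

theorem kostka_cauchy:
  assumes "size A = size B" "\<forall>x\<in>#A. x < N" "\<forall>x\<in>#B. x < N'"
  shows "(\<Sum>f | shape f \<and> sz f = size A. kostka f A * kostka f B) = card (pair_msets A B)"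
  using assms
proof (induction N' arbitrary: A B)
  case 0
  then have B: "B = {#}" by (metis less_nat_zero_code multiset_nonemptyE)
  with 0 have A: "A = {#}" by simp
  have "{f. shape f \<and> sz f = 0} = {\<lambda>_. 0}" using sz_eq_0_iff shape_zero by auto
  moreover have "(pair_msets {#} {#} :: (nat \<times> nat) multiset set) = {{#}}" by (auto simp: pair_msets_def)
  ultimately have "(\<Sum>f\<in>{f. shape f \<and> sz f = 0}. kostka f {#} * kostka f {#}) = card (pair_msets {#} {#} :: (nat \<times> nat) multiset set)"
    using kostka_empty[OF shape_zero] sz_eq_0_iff[OF shape_zero] by simp
  then show ?case by (simp only: A B size_empty)
next
  case (Suc N')
  obtain B' b where B: "B = B' + replicate_mset b N'" and B': "\<forall>x\<in>#B'. x < N'"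
    using letter_split[OF Suc.prems(3)] by blast
  let ?S = "\<lambda>n. {f. shape f \<and> sz f = n}"
  have "(\<Sum>f\<in>?S (size A). kostka f A * kostka f B)
    = (\<Sum>f\<in>?S (size A). \<Sum>v | hstrip f v \<and> sz v = size B'. kostka f A * kostka v B')"
    using B' Suc.prems(1) by (intro sum.cong) (auto simp: B kostka_rec sum_distrib_left)
  also have "\<dots> = (\<Sum>f\<in>?S (size A). \<Sum>v\<in>?S (size B'). if hstrip f v then kostka f A * kostka v B' else 0)"
    unfolding sum.inter_filter[OF finite_shapes, symmetric]
    by (intro sum.cong) (auto intro: hstrip_shape_lower)
  also have "\<dots> = (\<Sum>v\<in>?S (size B'). \<Sum>f\<in>?S (size A). if hstrip f v then kostka f A * kostka v B' else 0)"
    by (rule sum.swap)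
  also have "\<dots> = (\<Sum>v\<in>?S (size B'). (\<Sum>f | hstrip f v \<and> sz f = size A. kostka f A) * kostka v B')"
    unfolding sum.inter_filter[OF finite_shapes, symmetric] sum_distrib_right
    by (intro sum.cong) (auto intro: hstrip_shape_upper)
  also have "\<dots> = (\<Sum>v\<in>?S (size B'). (\<Sum>C | C \<subseteq># A \<and> size C = size B'. kostka v C) * kostka v B')"
    using pieri[OF _ Suc.prems(2)] by (intro sum.cong) auto
  also have "\<dots> = (\<Sum>C | C \<subseteq># A \<and> size C = size B'. \<Sum>v\<in>?S (size B'). kostka v C * kostka v B')"
    unfolding sum_distrib_right by (rule sum.swap)
  also have "\<dots> = (\<Sum>C | C \<subseteq># A \<and> size C = size B'. card (pair_msets C B'))"
  proof (rule sum.cong[OF refl])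
    fix C assume C: "C \<in> {C. C \<subseteq># A \<and> size C = size B'}"
    then have "\<forall>x\<in>#C. x < N" using Suc.prems(2) by (auto dest: mset_subset_eqD)
    then show "(\<Sum>v\<in>?S (size B'). kostka v C * kostka v B') = card (pair_msets C B')"
      using Suc.IH[of C B'] C B' by simp
  qed
  also have "\<dots> = card (pair_msets A B)"
    unfolding B using card_pair_msets_rec[OF B', of A b] Suc.prems(1) by (simp add: B)
  finally show ?case .
qed

section \<open>Standard tableaux, words and descents\<close>

definition row_of :: "nat list \<Rightarrow> nat \<Rightarrow> nat" where
  "row_of mu i = (if i < length mu then mu ! i else 0)"

lemma cells_eq_scells: "cells mu = scells (row_of mu)"
  by (auto simp: cells_def scells_def row_of_def split: if_splits)

lemma shape_row_of: assumes "mu \<in> partitions n" shows "shape (row_of mu)"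
proof -
  have "sorted_wrt (\<ge>) mu" using assms by (simp add: partitions_def)
  then have "mu ! j \<le> mu ! i" if "i \<le> j" "j < length mu" for i j
    using that by (cases "i = j") (auto simp: sorted_wrt_iff_nth_less)
  then have "antimono (row_of mu)" by (auto simp: antimono_def row_of_def)
  moreover have "row_of mu (length mu) = 0" by (simp add: row_of_def)
  ultimately show ?thesis unfolding shape_def by blast
qed

lemma sz_row_of: assumes "mu \<in> partitions n" shows "sz (row_of mu) = n"
proof -
  have "sz (row_of mu) = (\<Sum>r<length mu. row_of mu r)"
    by (rule sz_eq_sum[OF shape_row_of[OF assms]]) (simp add: row_of_def)
  also have "\<dots> = sum_list mu" by (simp add: sum_list_sum_nth row_of_def atLeast0LessThan)
  finally show ?thesis using assms by (simp add: partitions_def)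
qed

lemma bij_row_of: "bij_betw row_of (partitions n) {f. shape f \<and> sz f = n}"
  unfolding bij_betw_def
proof
  show "inj_on row_of (partitions n)"
  proof (rule inj_onI)
    fix mu nu assume mn: "mu \<in> partitions n" "nu \<in> partitions n" "row_of mu = row_of nu"
    have nz: "i < length l \<longleftrightarrow> row_of l i \<noteq> 0" if "l \<in> partitions n" for l i
    proof (cases "i < length l")
      case True
      then have "l ! i \<in> set l" by (rule nth_mem)
      moreover have "0 \<notin> set l" using that by (simp add: partitions_def)
      ultimately have "l ! i \<noteq> 0" by metis
      then show ?thesis using True by (simp add: row_of_def)
    qed (simp add: row_of_def)
    have "i < length mu \<longleftrightarrow> i < length nu" for i using nz[OF mn(1)] nz[OF mn(2)] mn(3) by simp
    then have l: "length mu = length nu" by (metis less_irrefl linorder_neqE_nat)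
    show "mu = nu"
    proof (rule nth_equalityI[OF l])
      fix i assume "i < length mu"
      then show "mu ! i = nu ! i" using fun_cong[OF mn(3), of i] l by (simp add: row_of_def)
    qed
  qed
  show "row_of ` partitions n = {f. shape f \<and> sz f = n}"
  proof (intro equalityI subsetI)
    fix f assume "f \<in> {f. shape f \<and> sz f = n}"
    then have f: "shape f" "sz f = n" by auto
    define L where "L = (LEAST i. f i = 0)"
    have L0: "f L = 0" unfolding L_def using f(1) by (auto simp: shape_def intro: LeastI)
    have Lp: "f i \<noteq> 0" if "i < L" for i using not_less_Least that unfolding L_def by blast
    define mu where "mu = map f [0..<L]"
    have rf: "row_of mu = f" using shape_zero_above[OF f(1) L0] by (auto simp: row_of_def mu_def fun_eq_iff)
    have "sum_list mu = n"
      using f(2) sz_eq_sum[OF f(1) L0] by (simp add: mu_def sum_list_sum_nth atLeast0LessThan)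
    moreover have "sorted_wrt (\<ge>) mu" using shape_antimono[OF f(1)] by (auto simp: mu_def sorted_wrt_iff_nth_less)
    moreover have "0 \<notin> set mu" using Lp by (force simp: mu_def)
    ultimately have "mu \<in> partitions n" by (simp add: partitions_def)
    then show "f \<in> row_of ` partitions n" using rf by (intro image_eqI[of _ _ mu]) auto
  qed (auto intro: shape_row_of sz_row_of)
qed

lemma finite_partitions: "finite (partitions n)"
  using bij_betw_finite[OF bij_row_of] finite_shapes by blast

subsection \<open>Unitriangularity of the Kostka numbers\<close>

definition row_content :: "(nat \<Rightarrow> nat) \<Rightarrow> nat multiset" where
  "row_content f = image_mset fst (mset_set (scells f))"

text \<open>The statistic usually written n(lambda). It serves as a height function for
  triangularity in place of the dominance order.\<close>

definition row_weight :: "(nat \<Rightarrow> nat) \<Rightarrow> nat" where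
  "row_weight f = sum_mset (row_content f)"

lemma count_row_content: assumes "shape f" shows "count (row_content f) i = f i"
proof -
  have "count (row_content f) i = card {u \<in> scells f. fst u = i}"
    unfolding row_content_def using finite_scells[OF assms] by (simp add: count_image_mset_eq_card_vimage)
  also have "{u \<in> scells f. fst u = i} = Pair i ` {..<f i}" by (auto simp: scells_def)
  also have "card \<dots> = f i" by (simp add: card_image inj_on_def)
  finally show ?thesis .
qed

lemma row_content_inj: "shape f \<Longrightarrow> shape g \<Longrightarrow> row_content f = row_content g \<Longrightarrow> f = g"
  by (metis count_row_content ext)

lemma size_row_content: "size (row_content f) = sz f"
  by (simp add: row_content_def sz_def)

lemma ssyt_ge_row:
  assumes f: "shape f" and T: "T \<in> ssyt f A" and c: "c < f r"
  shows "r \<le> T (r, c)"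
  using c
proof (induction r)
  case (Suc r)
  have "c < f r" using Suc.prems shape_antimono[OF f, of r "Suc r"] by simp
  moreover have "T (r, c) < T (Suc r, c)" using T Suc.prems by (simp add: ssyt_def)
  ultimately show ?case using Suc.IH by simp
qed simp

text \<open>Column strictness forces every entry of row \<open>r\<close> to be at least
  \<open>r\<close>. Comparing the sums of entries, equality leaves only the tableau whose row
  \<open>r\<close> is filled with \<open>r\<close>.\<close>

lemma ssyt_row_content:
  assumes f: "shape f" and T: "T \<in> ssyt f A"
  shows "row_weight f \<le> sum_mset A" "row_weight f = sum_mset A \<Longrightarrow> T = restrict fst (scells f)"
proof -
  have A: "sum_mset A = (\<Sum>u\<in>scells f. T u)"
    using T by (auto simp: ssyt_def sum_unfold_sum_mset)
  have w: "row_weight f = (\<Sum>u\<in>scells f. fst u)"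
    by (auto simp: row_weight_def row_content_def sum_unfold_sum_mset)
  have le: "fst u \<le> T u" if "u \<in> scells f" for u
    using ssyt_ge_row[OF f T] that by (auto simp: scells_def)
  show "row_weight f \<le> sum_mset A" unfolding A w using le by (rule sum_mono)
  assume "row_weight f = sum_mset A"
  then have "(\<Sum>u\<in>scells f. fst u) = (\<Sum>u\<in>scells f. T u)" by (simp add: A w)
  then have "fst u = T u" if "u \<in> scells f" for u
    using sum_mono_inv[of fst "scells f" T u] le that finite_scells[OF f] by simp
  then show "T = restrict fst (scells f)" using T by (auto simp: ssyt_def extensional_def restrict_def)
qed

lemma kostka_row_content:
  assumes f: "shape f" shows "kostka f (row_content f) = 1"
proof -
  have "restrict fst (scells f) \<in> ssyt f (row_content f)"
    unfolding ssyt_def row_content_def mem_Collect_eq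
  proof (intro conjI allI impI)
    show "image_mset (restrict fst (scells f)) (mset_set (scells f)) = image_mset fst (mset_set (scells f))"
      using finite_scells[OF f] by (intro image_mset_cong) auto
    show "restrict fst (scells f) (r, c) < restrict fst (scells f) (r', c)" if "r < r'" "c < f r'" for r r' c
      using that shape_antimono[OF f, of r r'] by (auto simp: scells_def)
  qed (auto simp: scells_def)
  moreover have "T = restrict fst (scells f)" if "T \<in> ssyt f (row_content f)" for T
    using ssyt_row_content(2)[OF f that] by (simp add: row_weight_def)
  ultimately have "ssyt f (row_content f) = {restrict fst (scells f)}" by blast
  then show ?thesis by (simp add: kostka_def)
qed

lemma kostka_triangular:
  assumes f: "shape f" and g: "shape g" and n0: "kostka f (row_content g) \<noteq> 0" and ne: "f \<noteq> g"
  shows "row_weight f < row_weight g"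
proof (rule ccontr)
  assume nlt: "\<not> row_weight f < row_weight g"
  obtain T where T: "T \<in> ssyt f (row_content g)" using n0 unfolding kostka_def by (metis card.empty ex_in_conv)
  have "T = restrict fst (scells f)"
    using ssyt_row_content[OF f T] nlt by (simp add: row_weight_def)
  then have "row_content g = image_mset (restrict fst (scells f)) (mset_set (scells f))"
    using T by (simp add: ssyt_def)
  also have "\<dots> = row_content f" unfolding row_content_def
    using finite_scells[OF f] by (intro image_mset_cong) auto
  finally show False using row_content_inj[OF g f] ne by auto
qed

text \<open>Unitriangularity is inverted recursively along \<open>row_weight\<close>: the column of
  Kostka numbers at \<open>row_content f\<close> is the unit vector at \<open>f\<close> plus entries
  at shapes of smaller weight, and the combinations already found for those are subtracted.\<close>

lemma inverse_kostka:
  assumes "shape f" "sz f = n"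
  shows "\<exists>a :: (nat \<Rightarrow> nat) \<Rightarrow> int. \<forall>g. shape g \<and> sz g = n \<longrightarrow>
    (\<Sum>h | shape h \<and> sz h = n. a h * int (kostka g (row_content h))) = (if g = f then 1 else 0)"
  using assms
proof (induction "row_weight f" arbitrary: f rule: less_induct)
  case less
  let ?S = "{h. shape h \<and> sz h = n}"
  let ?L = "{k \<in> ?S. row_weight k < row_weight f}"
  have "\<forall>k\<in>?L. \<exists>a :: (nat \<Rightarrow> nat) \<Rightarrow> int. \<forall>g. shape g \<and> sz g = n \<longrightarrow>
      (\<Sum>h\<in>?S. a h * int (kostka g (row_content h))) = (if g = k then 1 else 0)"
    using less.hyps by simp
  from bchoice[OF this] obtain a :: "(nat \<Rightarrow> nat) \<Rightarrow> (nat \<Rightarrow> nat) \<Rightarrow> int" where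
    "\<forall>k\<in>?L. \<forall>g. shape g \<and> sz g = n \<longrightarrow>
      (\<Sum>h\<in>?S. a k h * int (kostka g (row_content h))) = (if g = k then 1 else 0)" ..
  then have a: "(\<Sum>h\<in>?S. a k h * int (kostka g (row_content h))) = (if g = k then 1 else 0)"
    if "k \<in> ?L" "g \<in> ?S" for k g using that by simp
  define b where "b h = (if h = f then 1 else 0) - (\<Sum>k\<in>?L. int (kostka k (row_content f)) * a k h)" for h
  have "(\<Sum>h\<in>?S. b h * int (kostka g (row_content h))) = (if g = f then 1 else 0)" if g: "g \<in> ?S" for g
  proof -
    have fin: "finite ?S" by (rule finite_shapes)
    then have fin': "finite ?L" by (rule rev_finite_subset) auto
    have "(\<Sum>h\<in>?S. b h * int (kostka g (row_content h)))
      = (\<Sum>h\<in>?S. (if h = f then int (kostka g (row_content h)) else 0))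
        - (\<Sum>h\<in>?S. \<Sum>k\<in>?L. int (kostka k (row_content f)) * (a k h * int (kostka g (row_content h))))"
      unfolding sum_subtractf[symmetric] b_def
      by (intro sum.cong) (auto simp: left_diff_distrib sum_distrib_right mult.assoc)
    also have "(\<Sum>h\<in>?S. (if h = f then int (kostka g (row_content h)) else 0)) = int (kostka g (row_content f))"
      using fin less.prems by (simp add: sum.delta)
    also have "(\<Sum>h\<in>?S. \<Sum>k\<in>?L. int (kostka k (row_content f)) * (a k h * int (kostka g (row_content h))))
      = (\<Sum>k\<in>?L. int (kostka k (row_content f)) * (\<Sum>h\<in>?S. a k h * int (kostka g (row_content h))))"
      unfolding sum_distrib_left by (rule sum.swap)
    also have "\<dots> = (\<Sum>k\<in>?L. if k = g then int (kostka k (row_content f)) else 0)"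
      using a g by (intro sum.cong) auto
    also have "\<dots> = (if g \<in> ?L then int (kostka g (row_content f)) else 0)"
      using fin' by (simp add: sum.delta)
    finally show ?thesis
      using g less.prems kostka_triangular[of g f] kostka_row_content[of f] by auto
  qed
  then show ?case by blast
qed

subsection \<open>Descents\<close>

definition syt :: "(nat \<Rightarrow> nat) \<Rightarrow> (nat \<times> nat \<Rightarrow> nat) set" where
  "syt f = {T \<in> scells f \<rightarrow>\<^sub>E {1..sz f}. bij_betw T (scells f) {1..sz f} \<and>
     (\<forall>r c c'. c < c' \<longrightarrow> c' < f r \<longrightarrow> T (r, c) < T (r, c')) \<and>
     (\<forall>r r' c. r < r' \<longrightarrow> c < f r' \<longrightarrow> T (r, c) < T (r', c))}"

definition des :: "(nat \<Rightarrow> nat) \<Rightarrow> (nat \<times> nat \<Rightarrow> nat) \<Rightarrow> nat set" where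
  "des f T = {i. \<exists>u\<in>scells f. \<exists>v\<in>scells f. T u = i \<and> T v = Suc i \<and> fst u < fst v}"

lemma SYT_eq_syt: assumes "mu \<in> partitions n" shows "SYT mu = syt (row_of mu)"
proof -
  have "sum_list mu = sz (row_of mu)" using sz_row_of[OF assms] assms by (simp add: partitions_def)
  moreover have "(\<forall>r c c'. (r, c) \<in> cells mu \<longrightarrow> (r, c') \<in> cells mu \<longrightarrow> c < c' \<longrightarrow> T (r, c) < T (r, c'))
      \<longleftrightarrow> (\<forall>r c c'. c < c' \<longrightarrow> c' < row_of mu r \<longrightarrow> T (r, c) < T (r, c'))" for T :: "nat \<times> nat \<Rightarrow> nat"
    unfolding cells_eq_scells by (auto simp: scells_def)
  moreover have "(\<forall>r r' c. (r, c) \<in> cells mu \<longrightarrow> (r', c) \<in> cells mu \<longrightarrow> r < r' \<longrightarrow> T (r, c) < T (r', c))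
      \<longleftrightarrow> (\<forall>r r' c. r < r' \<longrightarrow> c < row_of mu r' \<longrightarrow> T (r, c) < T (r', c))" for T :: "nat \<times> nat \<Rightarrow> nat"
    unfolding cells_eq_scells using shape_antimono[OF shape_row_of[OF assms]]
    by (auto simp: scells_def) (meson less_imp_le order.strict_trans2)
  ultimately show ?thesis unfolding SYT_def syt_def cells_eq_scells by simp
qed

lemma Des_eq_des: "Des mu T = des (row_of mu) T"
  unfolding Des_def des_def cells_eq_scells by force

definition below :: "nat set \<Rightarrow> nat \<Rightarrow> nat" where
  "below S i = card {s \<in> S. s < i}"

text \<open>For \<open>S\<close> inside \<open>{1..<n}\<close> this is the content of the
  composition of \<open>n\<close> with partial sums \<open>S\<close>: letter 0 up to the first
  element of \<open>S\<close>, letter 1 up to the next, and so on.\<close>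

definition below_content :: "nat set \<Rightarrow> nat \<Rightarrow> nat multiset" where
  "below_content S n = image_mset (below S) (mset_set {1..n})"

lemma below_mono: "i \<le> j \<Longrightarrow> below S i \<le> below S j"
  unfolding below_def by (rule card_mono) auto

lemma below_eq_iff: assumes "i \<le> j" shows "below S i = below S j \<longleftrightarrow> (\<forall>s\<in>S. s < i \<or> j \<le> s)"
proof
  assume "below S i = below S j"
  moreover have "{s \<in> S. s < i} \<subseteq> {s \<in> S. s < j}" using assms by auto
  ultimately have "{s \<in> S. s < i} = {s \<in> S. s < j}" unfolding below_def by (intro card_subset_eq) auto
  then show "\<forall>s\<in>S. s < i \<or> j \<le> s" unfolding set_eq_iff mem_Collect_eq by (meson not_le)
next
  assume "\<forall>s\<in>S. s < i \<or> j \<le> s"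
  then have "{s \<in> S. s < i} = {s \<in> S. s < j}" using assms by fastforce
  then show "below S i = below S j" by (simp add: below_def)
qed

lemma below_Suc_eq_iff: "below S i = below S (Suc i) \<longleftrightarrow> i \<notin> S"
  by (subst below_eq_iff) (auto simp: Suc_le_eq, metis linorder_neqE_nat)

lemma size_below_content: "size (below_content S n) = n"
  by (simp add: below_content_def)

lemma below_content_list: "mset (map (below S) [1..<Suc n]) = below_content S n"
proof -
  have "mset [1..<Suc n] = mset_set {1..n}"
    by (metis atLeastLessThanSuc_atLeastAtMost mset_upt)
  then show ?thesis by (simp only: mset_map below_content_def)
qed

lemma sorted_below: "sorted (map (below S) [1..<Suc n])"
  by (rule sorted_map_mono[OF sorted_upt]) (auto simp: mono_on_def below_mono)

lemma sorted_eq_below: assumes "sorted xs" "mset xs = below_content S n"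
  shows "xs = map (below S) [1..<Suc n]"
  using assms sorted_below[of S n] below_content_list[of S n]
  by (metis properties_for_sort)

text \<open>A non-descent \<open>k\<close> has \<open>k + 1\<close> in a weakly higher row; the
  claim follows step by step along the entries between the two cells.\<close>

lemma syt_row_antitone:
  assumes Q: "Q \<in> syt f" and u: "u \<in> scells f" and v: "v \<in> scells f"
    and ij: "Q u \<le> Q v" and nd: "\<And>k. Q u \<le> k \<Longrightarrow> k < Q v \<Longrightarrow> k \<notin> des f Q"
  shows "fst v \<le> fst u"
proof -
  have inj: "inj_on Q (scells f)" and im: "Q ` scells f = {1..sz f}"
    using Q by (auto simp: syt_def bij_betw_def)
  have "fst w \<le> fst u" if "w \<in> scells f" "Q w = Q u + d" "Q w \<le> Q v" for w d
    using that
  proof (induction d arbitrary: w)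
    case 0
    then have "w = u" using inj u by (auto dest: inj_onD)
    then show ?case by simp
  next
    case (Suc d)
    have "Q u + d \<in> {1..sz f}" using Suc.prems im u by (metis (no_types, lifting) add_Suc_right atLeastAtMost_iff imageI le_add1 le_trans Suc_leD)
    then obtain x where x: "x \<in> scells f" "Q x = Q u + d" using im by (metis imageE)
    have "Q x \<le> Q v" using x Suc.prems by simp
    then have "fst x \<le> fst u" by (rule Suc.IH[OF x])
    moreover have "Q x \<notin> des f Q" using nd[of "Q x"] x Suc.prems by simp
    then have "fst w \<le> fst x" using x Suc.prems by (force simp: des_def)
    ultimately show ?case by simp
  qed
  from this[OF v, of "Q v - Q u"] ij show ?thesis by simp
qed

lemma syt_less_NW:
  assumes f: "shape f" and Q: "Q \<in> syt f" and v: "(r', c') \<in> scells f" and "r \<le> r'" "c \<le> c'" "(r, c) \<noteq> (r', c')"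
  shows "Q (r, c) < Q (r', c')"
proof -
  have row: "\<And>r c c'. c < c' \<Longrightarrow> c' < f r \<Longrightarrow> Q (r, c) < Q (r, c')"
    and col: "\<And>r r' c. r < r' \<Longrightarrow> c < f r' \<Longrightarrow> Q (r, c) < Q (r', c)"
    using Q by (auto simp: syt_def)
  have v': "c' < f r'" using v by (simp add: scells_def)
  then have "c < f r'" using assms(5) by simp
  then have "Q (r, c) \<le> Q (r', c)" using col[of r r' c] assms(4) by (cases "r = r'") auto
  moreover have "Q (r', c) \<le> Q (r', c')" using row[of c c' r'] assms(5) v' by (cases "c = c'") auto
  moreover have "Q (r, c) < Q (r', c) \<or> Q (r', c) < Q (r', c')"
    using assms(4-6) col[of r r' c] row[of c c' r'] v' \<open>c < f r'\<close> by auto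
  ultimately show ?thesis by linarith
qed

lemma rank_bij:
  fixes key :: "'a \<Rightarrow> 'b :: linorder"
  assumes fin: "finite U" and inj: "inj_on key U"
  defines "rk \<equiv> \<lambda>u. card {v \<in> U. key v \<le> key u}"
  shows "bij_betw rk U {1..card U}" "\<And>u v. u \<in> U \<Longrightarrow> v \<in> U \<Longrightarrow> rk u < rk v \<longleftrightarrow> key u < key v"
proof -
  show less: "rk u < rk v \<longleftrightarrow> key u < key v" if "u \<in> U" "v \<in> U" for u v
  proof
    assume "key u < key v"
    then have "{w \<in> U. key w \<le> key u} \<subset> {w \<in> U. key w \<le> key v}" using that by force
    then show "rk u < rk v" unfolding rk_def by (rule psubset_card_mono[rotated]) (use fin in auto)
  next
    assume "rk u < rk v"
    moreover have "rk v \<le> rk u" if "key v \<le> key u"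
      unfolding rk_def using that fin by (intro card_mono) auto
    ultimately show "key u < key v" by (meson leD not_le)
  qed
  have ij: "inj_on rk U"
  proof (rule inj_onI)
    fix u v assume "u \<in> U" "v \<in> U" "rk u = rk v"
    then have "key u = key v" using less[of u v] less[of v u] by auto
    then show "u = v" using inj \<open>u \<in> U\<close> \<open>v \<in> U\<close> by (auto dest: inj_onD)
  qed
  have "rk u \<in> {1..card U}" if "u \<in> U" for u
  proof -
    have "{u} \<subseteq> {v \<in> U. key v \<le> key u}" using that by auto
    then have "card {u} \<le> rk u" unfolding rk_def by (rule card_mono[rotated]) (use fin in auto)
    moreover have "rk u \<le> card U" unfolding rk_def using fin by (intro card_mono) auto
    ultimately show ?thesis by simp
  qed
  then have "rk ` U = {1..card U}"
    using ij by (intro card_subset_eq) (auto simp: card_image)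
  then show "bij_betw rk U {1..card U}" using ij by (simp add: bij_betw_def)
qed

text \<open>
  Replacing each entry by the number of elements of \<open>S\<close> below it inverts standardization; equal entries
  of the semistandard tableau are ordered by their columns.
\<close>

lemma card_syt_des_subset:
  assumes f: "shape f"
  shows "card {Q \<in> syt f. des f Q \<subseteq> S} = kostka f (below_content S (sz f))"
proof -
  let ?n = "sz f"
  define std where "std Q = restrict (\<lambda>u. below S (Q u)) (scells f)" for Q :: "nat \<times> nat \<Rightarrow> nat"
  note fin = finite_scells[OF f]
  \<comment> \<open>Between cells with equal \<open>std\<close> value there is no descent of
    \<open>Q\<close>, so the rows move weakly up and the columns must increase. Hence the value,
    with the column as tie-break, recovers the order of the entries of \<open>Q\<close>.\<close>
  have key: "Q u < Q v \<longleftrightarrow> (std Q u, snd u) < (std Q v, snd v)"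
    if Q: "Q \<in> syt f" and d: "des f Q \<subseteq> S" and u: "u \<in> scells f" and v: "v \<in> scells f" for Q u v
  proof -
    have imp: "(std Q x, snd x) < (std Q y, snd y)" if x: "x \<in> scells f" and y: "y \<in> scells f" and "Q x < Q y" for x y
    proof -
      have le: "std Q x \<le> std Q y" using that by (simp add: std_def below_mono)
      have "snd x < snd y" if eq: "std Q x = std Q y"
      proof (rule ccontr)
        assume "\<not> snd x < snd y"
        have "\<forall>s\<in>S. s < Q x \<or> Q y \<le> s"
          using eq x y \<open>Q x < Q y\<close> below_eq_iff[of "Q x" "Q y" S] by (simp add: std_def)
        then have "fst y \<le> fst x" using \<open>Q x < Q y\<close> d by (intro syt_row_antitone[OF Q x y]) force+
        then have "Q y < Q x"
          using syt_less_NW[OF f Q, of "fst x" "snd x" "fst y" "snd y"] \<open>\<not> snd x < snd y\<close> x \<open>Q x < Q y\<close>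
          by (metis less_irrefl not_less prod.collapse)
        then show False using \<open>Q x < Q y\<close> by simp
      qed
      then show ?thesis using le by (auto simp: less_prod_def')
    qed
    show ?thesis
    proof
      assume "(std Q u, snd u) < (std Q v, snd v)"
      then have "\<not> Q v < Q u" "u \<noteq> v" using imp[OF v u] by (auto simp: less_prod_def')
      moreover have "inj_on Q (scells f)" using Q by (simp add: syt_def bij_betw_def)
      ultimately show "Q u < Q v" using u v by (metis inj_onD linorder_neqE_nat)
    qed (rule imp[OF u v])
  qed
  have std_in: "std Q \<in> ssyt f (below_content S ?n)" if Q: "Q \<in> syt f" and d: "des f Q \<subseteq> S" for Q
    unfolding ssyt_def mem_Collect_eq
  proof (intro conjI allI impI)
    have bij: "bij_betw Q (scells f) {1..?n}" using Q by (simp add: syt_def)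
    have "image_mset (std Q) (mset_set (scells f)) = image_mset (below S) (image_mset Q (mset_set (scells f)))"
      unfolding multiset.map_comp using fin by (intro image_mset_cong) (auto simp: std_def)
    also have "image_mset Q (mset_set (scells f)) = mset_set {1..?n}"
      using bij by (metis bij_betw_def image_mset_mset_set)
    finally show "image_mset (std Q) (mset_set (scells f)) = below_content S ?n" by (simp add: below_content_def)
    show "std Q \<in> extensional (scells f)" by (simp add: std_def)
    show "std Q (r, c) \<le> std Q (r, c')" if "c < c'" "c' < f r" for r c c'
    proof -
      have "Q (r, c) \<le> Q (r, c')" using that Q unfolding syt_def mem_Collect_eq by (blast intro: less_imp_le)
      then show ?thesis using that below_mono by (simp add: std_def scells_def)
    qed
    show "std Q (r, c) < std Q (r', c)" if "r < r'" "c < f r'" for r r' c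
    proof -
      have uv: "(r, c) \<in> scells f" "(r', c) \<in> scells f"
        using that shape_antimono[OF f, of r r'] by (auto simp: scells_def)
      have "Q (r, c) < Q (r', c)" using that Q by (simp add: syt_def)
      then show ?thesis using key[OF Q d uv] by (auto simp: less_prod_def')
    qed
  qed
  have "inj_on std {Q \<in> syt f. des f Q \<subseteq> S}"
  proof (rule inj_onI)
    fix Q Q' assume Q: "Q \<in> {Q \<in> syt f. des f Q \<subseteq> S}" and Q': "Q' \<in> {Q \<in> syt f. des f Q \<subseteq> S}" and eq: "std Q = std Q'"
    have rk: "R u = Suc (card {v \<in> scells f. (std R v, snd v) < (std R u, snd u)})"
      if R: "R \<in> {Q \<in> syt f. des f Q \<subseteq> S}" and u: "u \<in> scells f" for R u
    proof -
      have bij: "bij_betw R (scells f) {1..?n}" using R by (simp add: syt_def)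
      have "R ` {v \<in> scells f. R v < R u} = {1..<R u}"
      proof (intro equalityI subsetI)
        fix i assume "i \<in> {1..<R u}"
        moreover have "R u \<in> {1..?n}" using bij u by (auto simp: bij_betw_def)
        ultimately have "i \<in> {1..?n}" "i < R u" by auto
        then obtain v where "v \<in> scells f" "R v = i" using bij unfolding bij_betw_def by (metis imageE)
        then show "i \<in> R ` {v \<in> scells f. R v < R u}" using \<open>i < R u\<close> by blast
      qed (use bij in \<open>auto simp: bij_betw_def\<close>)
      moreover have "card (R ` {v \<in> scells f. R v < R u}) = card {v \<in> scells f. R v < R u}"
        using bij by (intro card_image) (auto simp: bij_betw_def inj_on_def)
      moreover have "{v \<in> scells f. R v < R u} = {v \<in> scells f. (std R v, snd v) < (std R u, snd u)}"
        using key[of R] R u by blast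
      moreover have "R u \<ge> 1" using bij u by (auto simp: bij_betw_def)
      ultimately show ?thesis by simp
    qed
    have "Q u = Q' u" for u
    proof (cases "u \<in> scells f")
      case True then show ?thesis using rk[OF Q True] rk[OF Q' True] eq by simp
    next
      case False
      have "Q \<in> scells f \<rightarrow>\<^sub>E {1..?n}" "Q' \<in> scells f \<rightarrow>\<^sub>E {1..?n}" using Q Q' by (auto simp: syt_def)
      then show ?thesis using False by (metis PiE_arb)
    qed
    then show "Q = Q'" by (rule ext)
  qed
  moreover have "std ` {Q \<in> syt f. des f Q \<subseteq> S} = ssyt f (below_content S ?n)"
  proof (intro equalityI subsetI)
    fix T assume T: "T \<in> ssyt f (below_content S ?n)"
    have row: "\<And>r c c'. c < c' \<Longrightarrow> c' < f r \<Longrightarrow> T (r, c) \<le> T (r, c')"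
      and col: "\<And>r r' c. r < r' \<Longrightarrow> c < f r' \<Longrightarrow> T (r, c) < T (r', c)"
      and cont: "image_mset T (mset_set (scells f)) = below_content S ?n"
      and ext: "T \<in> extensional (scells f)" using T by (auto simp: ssyt_def)
    \<comment> \<open>Ties in value are broken by the column; two cells of one column never tie, so
      the keys are distinct and their ranks form a filling by \<open>{1..?n}\<close>.\<close>
    define k where "k u = (T u, snd u)" for u :: "nat \<times> nat"
    have inj: "inj_on k (scells f)"
    proof (rule inj_onI)
      fix u v assume uv: "u \<in> scells f" "v \<in> scells f" "k u = k v"
      then have "\<not> fst u < fst v" "\<not> fst v < fst u"
        using col[of "fst u" "fst v" "snd u"] col[of "fst v" "fst u" "snd u"]
        by (auto simp: k_def scells_def)
      then show "u = v" using uv(3) by (simp add: k_def prod_eq_iff)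
    qed
    define Q where "Q = restrict (\<lambda>u. card {v \<in> scells f. k v \<le> k u}) (scells f)"
    have bij: "bij_betw Q (scells f) {1..?n}"
      using rank_bij(1)[OF fin inj] unfolding sz_def Q_def by (subst bij_betw_cong) auto
    have less: "Q u < Q v \<longleftrightarrow> k u < k v" if "u \<in> scells f" "v \<in> scells f" for u v
      using rank_bij(2)[OF fin inj that] that by (simp add: Q_def)
    have sub: "(r, c) \<in> scells f" if "r \<le> r'" "c < f r'" for r r' c
      using that shape_antimono[OF f, of r r'] by (auto simp: scells_def)
    have Q: "Q \<in> syt f" unfolding syt_def mem_Collect_eq
    proof (intro conjI allI impI)
      show "Q \<in> scells f \<rightarrow>\<^sub>E {1..?n}" using bij by (auto simp: PiE_iff Q_def bij_betw_def)
      show "Q (r, c) < Q (r, c')" if "c < c'" "c' < f r" for r c c'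
        using less[OF sub[of r r c] sub[of r r c']] row[OF that] that by (auto simp: k_def less_prod_def')
      show "Q (r, c) < Q (r', c)" if "r < r'" "c < f r'" for r r' c
        using less[OF sub[of r r' c] sub[of r' r' c]] col[OF that] that by (auto simp: k_def less_prod_def')
    qed (rule bij)
    define q where "q = the_inv_into (scells f) Q"
    have q: "q i \<in> scells f" "Q (q i) = i" if "i \<in> {1..?n}" for i
      using bij that unfolding q_def
      by (auto simp: bij_betw_def intro: the_inv_into_into f_the_inv_into_f)
    have qQ: "q (Q u) = u" if "u \<in> scells f" for u
      using bij that unfolding q_def by (auto simp: bij_betw_def the_inv_into_f_f)
    have "sorted (map (T \<circ> q) [1..<Suc ?n])"
    proof (rule sorted_map_mono[OF sorted_upt])
      show "mono_on (set [1..<Suc ?n]) (T \<circ> q)"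
      proof (rule mono_onI)
        fix i j assume "i \<in> set [1..<Suc ?n]" "j \<in> set [1..<Suc ?n]" and "i \<le> j"
        then have ij: "i \<in> {1..?n}" "j \<in> {1..?n}" "i \<le> j" by auto
        show "(T \<circ> q) i \<le> (T \<circ> q) j"
        proof (cases "i = j")
          case False
          then have "Q (q i) < Q (q j)" using ij q by simp
          then have "k (q i) < k (q j)" using less q ij by blast
          then show ?thesis by (auto simp: k_def less_prod_def')
        qed simp
      qed
    qed
    moreover have "mset (map (T \<circ> q) [1..<Suc ?n]) = below_content S ?n"
    proof -
      have "mset (map (T \<circ> q) [1..<Suc ?n]) = image_mset (T \<circ> q) (mset_set {1..?n})"
        by (metis atLeastLessThanSuc_atLeastAtMost mset_upt mset_map)
      also have "mset_set {1..?n} = image_mset Q (mset_set (scells f))"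
        using bij by (metis bij_betw_def image_mset_mset_set)
      also have "image_mset (T \<circ> q) \<dots> = image_mset T (mset_set (scells f))"
        unfolding multiset.map_comp using fin qQ by (intro image_mset_cong) auto
      also note cont
      finally show ?thesis .
    qed
    ultimately have "map (T \<circ> q) [1..<Suc ?n] = map (below S) [1..<Suc ?n]" by (rule sorted_eq_below)
    then have Tq: "T (q i) = below S i" if "i \<in> {1..?n}" for i using that by (simp add: map_eq_conv del: upt_Suc)
    have TQ: "T u = below S (Q u)" if "u \<in> scells f" for u
    proof -
      have "Q u \<in> {1..?n}" using bij_betwE[OF bij] that by blast
      then show ?thesis using Tq[of "Q u"] qQ[OF that] by simp
    qed
    have "std Q = T" using TQ ext by (auto simp: std_def extensional_def restrict_def)
    moreover have "des f Q \<subseteq> S"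
    proof
      fix i assume "i \<in> des f Q"
      then obtain r c r' c' where u: "(r, c) \<in> scells f" and v: "(r', c') \<in> scells f"
        and Qi: "Q (r, c) = i" "Q (r', c') = Suc i" "r < r'" by (auto simp: des_def)
      show "i \<in> S"
      proof (rule ccontr)
        assume "i \<notin> S"
        then have eq: "T (r, c) = T (r', c')" using TQ u v Qi below_Suc_eq_iff by simp
        have "k (r, c) < k (r', c')" using less[OF u v] Qi by simp
        then have "c < c'" using eq by (auto simp: k_def less_prod_def')
        moreover have "c' < f r'" using v by (simp add: scells_def)
        \<comment> \<open>The cell \<open>(r, c')\<close> lies to the right of one cell and above
          the other, and so separates two values that were assumed equal.\<close>
        moreover have "c' < f r" using \<open>c' < f r'\<close> shape_antimono[OF f, of r r'] Qi(3) by simp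
        ultimately have "T (r, c) < T (r', c')" using row[of c c' r] col[of r r' c'] Qi(3) by simp
        then show False using eq by simp
      qed
    qed
    ultimately show "T \<in> std ` {Q \<in> syt f. des f Q \<subseteq> S}" using Q by auto
  qed (use std_in in auto)
  ultimately show ?thesis unfolding kostka_def by (metis card_image)
qed

text \<open>Descents are numbered from 1 as for tableaux: \<open>i\<close> compares the letters in
  places \<open>i\<close> and \<open>i + 1\<close>, which are \<open>w ! (i - 1)\<close> and
  \<open>w ! i\<close>.\<close>

definition wdes :: "nat list \<Rightarrow> nat set" where
  "wdes w = {i. 0 < i \<and> i < length w \<and> w ! i < w ! (i - 1)}"

text \<open>Under the weakly increasing top row \<open>below S\<close>, a two-line array is sorted
  exactly when its bottom row descends only where the top row increases, that is at elements of
  \<open>S\<close>. Each multiset of pairs has one sorted arrangement.\<close>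

lemma card_wdes_subset:
  assumes B: "size B = n"
  shows "card {w. mset w = B \<and> wdes w \<subseteq> S} = card (pair_msets (below_content S n) B)"
proof -
  let ?a = "map (below S) [1..<Suc n]"
  have la: "length ?a = n" by simp
  have sor: "sorted (zip ?a w) \<longleftrightarrow> wdes w \<subseteq> S" if "length w = n" for w
  proof -
    have nth: "zip ?a w ! i = (below S (Suc i), w ! i)" if "i < n" for i
      using that \<open>length w = n\<close> by (simp del: upt_Suc)
    have "sorted (zip ?a w) \<longleftrightarrow> (\<forall>i. Suc i < n \<longrightarrow> zip ?a w ! i \<le> zip ?a w ! Suc i)"
      using that by (simp add: sorted_iff_nth_Suc)
    also have "\<dots> \<longleftrightarrow> (\<forall>i. Suc i < n \<longrightarrow> Suc i \<in> S \<or> w ! i \<le> w ! Suc i)"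
    proof (intro all_cong1 imp_cong refl)
      fix i assume i: "Suc i < n"
      have "below S (Suc i) = below S (Suc (Suc i)) \<longleftrightarrow> Suc i \<notin> S" by (rule below_Suc_eq_iff)
      moreover have "below S (Suc i) \<le> below S (Suc (Suc i))" by (rule below_mono) simp
      ultimately show "zip ?a w ! i \<le> zip ?a w ! Suc i \<longleftrightarrow> Suc i \<in> S \<or> w ! i \<le> w ! Suc i"
        unfolding nth[OF Suc_lessD[OF i]] nth[OF i] by (auto simp: less_eq_prod_def)
    qed
    also have "\<dots> \<longleftrightarrow> wdes w \<subseteq> S"
    proof
      assume *: "\<forall>i. Suc i < n \<longrightarrow> Suc i \<in> S \<or> w ! i \<le> w ! Suc i"
      show "wdes w \<subseteq> S"
      proof
        fix i assume i: "i \<in> wdes w"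
        then obtain j where "i = Suc j" by (cases i) (auto simp: wdes_def)
        then show "i \<in> S" using i * that by (auto simp: wdes_def)
      qed
    next
      assume *: "wdes w \<subseteq> S"
      show "\<forall>i. Suc i < n \<longrightarrow> Suc i \<in> S \<or> w ! i \<le> w ! Suc i"
      proof (intro allI impI disjCI)
        fix i assume "Suc i < n" "\<not> w ! i \<le> w ! Suc i"
        then have "Suc i \<in> wdes w" using that by (simp add: wdes_def)
        then show "Suc i \<in> S" using * by blast
      qed
    qed
    finally show ?thesis .
  qed
  have len: "length w = n" if "mset w = B" for w using that B by (metis size_mset)
  have "bij_betw (\<lambda>w. mset (zip ?a w)) {w. mset w = B \<and> wdes w \<subseteq> S} (pair_msets (below_content S n) B)"
    unfolding bij_betw_def
  proof
    show "inj_on (\<lambda>w. mset (zip ?a w)) {w. mset w = B \<and> wdes w \<subseteq> S}"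
    proof (rule inj_onI)
      fix w w' assume w: "w \<in> {w. mset w = B \<and> wdes w \<subseteq> S}" "w' \<in> {w. mset w = B \<and> wdes w \<subseteq> S}"
        and eq: "mset (zip ?a w) = mset (zip ?a w')"
      have l: "length w = n" "length w' = n" using w len by auto
      have "zip ?a w = zip ?a w'"
        using eq sor[OF l(1)] sor[OF l(2)] w by (metis (mono_tags, lifting) mem_Collect_eq properties_for_sort)
      then have "map snd (zip ?a w) = map snd (zip ?a w')" by (rule arg_cong)
      then show "w = w'" using l la by (metis map_snd_zip)
    qed
    show "(\<lambda>w. mset (zip ?a w)) ` {w. mset w = B \<and> wdes w \<subseteq> S} = pair_msets (below_content S n) B"
    proof (intro equalityI subsetI)
      fix M assume "M \<in> (\<lambda>w. mset (zip ?a w)) ` {w. mset w = B \<and> wdes w \<subseteq> S}"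
      then obtain w where w: "M = mset (zip ?a w)" "mset w = B" by auto
      have "image_mset fst M = mset (map fst (zip ?a w))" "image_mset snd M = mset (map snd (zip ?a w))"
        by (simp_all only: w mset_map)
      then show "M \<in> pair_msets (below_content S n) B"
        using len[OF w(2)] la w(2) by (simp only: pair_msets_def mem_Collect_eq map_fst_zip map_snd_zip below_content_list)
    next
      fix M assume M: "M \<in> pair_msets (below_content S n) B"
      define l where "l = sorted_list_of_multiset M"
      have l: "sorted l" "mset l = M" by (simp_all add: l_def)
      have "sorted (map fst l)" using l(1) unfolding sorted_map
        by (rule sorted_wrt_mono_rel[rotated]) (auto simp: less_eq_prod_def)
      moreover have "mset (map fst l) = below_content S n" using M l(2) by (simp add: pair_msets_def)
      ultimately have a: "map fst l = ?a" by (rule sorted_eq_below)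
      have w: "mset (map snd l) = B" using M l(2) by (simp add: pair_msets_def)
      have z: "zip ?a (map snd l) = l" unfolding a[symmetric] by (rule zip_map_fst_snd)
      have "wdes (map snd l) \<subseteq> S" using sor[OF len[OF w]] z l(1) by simp
      then show "M \<in> (\<lambda>w. mset (zip ?a w)) ` {w. mset w = B \<and> wdes w \<subseteq> S}"
        using w z l(2) by (intro image_eqI[of _ _ "map snd l"]) auto
    qed
  qed
  then show ?thesis by (rule bij_betw_same_card)
qed

text \<open>Inclusion-exclusion in the form of a uniqueness statement, by induction on the
  set.\<close>

lemma subset_sums_determine:
  fixes F G :: "'a set \<Rightarrow> nat"
  assumes U: "finite U" and eq: "\<And>S. S \<subseteq> U \<Longrightarrow> sum F (Pow S) = sum G (Pow S)" and S: "S \<subseteq> U"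
  shows "F S = G S"
proof -
  have "finite S" using U S by (rule rev_finite_subset)
  then show ?thesis using S
  proof (induction S rule: finite_psubset_induct)
    case (psubset S)
    have P: "Pow S = insert S (Pow S - {S})" by auto
    have fin: "finite (Pow S - {S})" using psubset.hyps by simp
    have "sum F (Pow S) = F S + sum F (Pow S - {S})" by (subst P, subst sum.insert) (use fin in auto)
    moreover have "sum G (Pow S) = G S + sum G (Pow S - {S})" by (subst P, subst sum.insert) (use fin in auto)
    moreover have "sum F (Pow S - {S}) = sum G (Pow S - {S})"
      using psubset.IH psubset.prems by (intro sum.cong) auto
    ultimately show ?case using eq[OF psubset.prems] by linarith
  qed
qed

lemma finite_mset_eq: "finite {w. mset w = B}"
proof -
  have "{w. mset w = B} \<subseteq> {w. set w \<subseteq> set_mset B \<and> length w = size B}" by auto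
  then show ?thesis by (rule finite_subset) (simp add: finite_lists_length_eq)
qed

lemma finite_syt: "shape f \<Longrightarrow> finite (syt f)"
  by (rule finite_subset[of _ "scells f \<rightarrow>\<^sub>E {1..sz f}"]) (auto simp: syt_def finite_scells intro: finite_PiE)

lemma card_eq_sum_fibers:
  assumes "finite A" "finite I" "g ` A \<subseteq> I"
  shows "card A = (\<Sum>X\<in>I. card {x \<in> A. g x = X})"
  using sum.group[OF assms, of "\<lambda>_. 1 :: nat"] by simp

text \<open>The numerical content of the Robinson-Schensted-Knuth correspondence with descents. No
  bijection is constructed: for descent sets contained in \<open>S\<close> both sides count two-line
  arrays, by \<open>card_wdes_subset\<close> and the Cauchy identity, and exact descent sets follow
  by inclusion-exclusion.\<close>

theorem card_words_wdes:
  assumes B: "size B = n"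
  shows "card {w. mset w = B \<and> P (wdes w)} = (\<Sum>f | shape f \<and> sz f = n. kostka f B * card {Q \<in> syt f. P (des f Q)})"
proof -
  let ?U = "{1..<n}" and ?S = "{f. shape f \<and> sz f = n}"
  define F where "F X = card {w. mset w = B \<and> wdes w = X}" for X
  define G where "G X = (\<Sum>f\<in>?S. kostka f B * card {Q \<in> syt f. des f Q = X})" for X
  have wU: "wdes w \<subseteq> ?U" if "mset w = B" for w using that B by (auto simp: wdes_def)
  have dU: "des f Q \<subseteq> ?U" if f: "f \<in> ?S" and Q: "Q \<in> syt f" for f Q
  proof
    fix i assume "i \<in> des f Q"
    then obtain u v where "u \<in> scells f" "v \<in> scells f" "Q u = i" "Q v = Suc i" by (auto simp: des_def)
    moreover have "Q ` scells f = {1..n}" using Q f by (auto simp: syt_def bij_betw_def)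
    ultimately have "i \<in> {1..n}" "Suc i \<in> {1..n}" by (metis imageI)+
    then show "i \<in> ?U" by simp
  qed
  have FG: "F X = G X" if "X \<subseteq> ?U" for X
  proof (rule subset_sums_determine[of ?U F G])
    fix S assume S: "S \<subseteq> ?U"
    then have fS: "finite S" by (rule finite_subset) simp
    have "sum F (Pow S) = card {w. mset w = B \<and> wdes w \<subseteq> S}"
      unfolding F_def using fS finite_mset_eq[of B]
      by (subst card_eq_sum_fibers[where g = wdes and I = "Pow S"])
         (auto intro!: sum.cong arg_cong[where f = card] intro: rev_finite_subset)
    also have "\<dots> = card (pair_msets (below_content S n) B)" by (rule card_wdes_subset[OF B])
    also have "\<dots> = (\<Sum>f\<in>?S. kostka f (below_content S n) * kostka f B)"
    proof -
      have "\<forall>x\<in>#A. x < Suc (Max_mset A)" for A :: "nat multiset"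
        by (simp add: less_Suc_eq_le)
      then have "(\<Sum>f | shape f \<and> sz f = size (below_content S n). kostka f (below_content S n) * kostka f B)
          = card (pair_msets (below_content S n) B)"
        using B size_below_content[of S n] by (intro kostka_cauchy) auto
      then show ?thesis by (simp add: size_below_content)
    qed
    also have "\<dots> = (\<Sum>f\<in>?S. kostka f B * card {Q \<in> syt f. des f Q \<subseteq> S})"
      using card_syt_des_subset by (intro sum.cong) auto
    also have "\<dots> = (\<Sum>f\<in>?S. kostka f B * (\<Sum>X\<in>Pow S. card {Q \<in> syt f. des f Q = X}))"
    proof (rule sum.cong[OF refl])
      fix f assume f: "f \<in> ?S"
      have "card {Q \<in> syt f. des f Q \<subseteq> S} = (\<Sum>X\<in>Pow S. card {Q \<in> syt f. des f Q = X})"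
        using fS finite_syt f
        by (subst card_eq_sum_fibers[where g = "des f" and I = "Pow S"])
           (auto intro!: sum.cong arg_cong[where f = card])
      then show "kostka f B * card {Q \<in> syt f. des f Q \<subseteq> S} = kostka f B * (\<Sum>X\<in>Pow S. card {Q \<in> syt f. des f Q = X})"
        by simp
    qed
    also have "\<dots> = sum G (Pow S)"
      unfolding G_def sum_distrib_left by (rule sum.swap)
    finally show "sum F (Pow S) = sum G (Pow S)" .
  qed (use that in auto)
  have "card {w. mset w = B \<and> P (wdes w)} = (\<Sum>X\<in>{X \<in> Pow ?U. P X}. F X)"
    unfolding F_def using finite_mset_eq[of B] wU
    by (subst card_eq_sum_fibers[where g = wdes and I = "{X \<in> Pow ?U. P X}"])
       (auto intro!: sum.cong arg_cong[where f = card] intro: rev_finite_subset)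
  also have "\<dots> = (\<Sum>X\<in>{X \<in> Pow ?U. P X}. G X)" using FG by (intro sum.cong) auto
  also have "\<dots> = (\<Sum>f\<in>?S. kostka f B * (\<Sum>X\<in>{X \<in> Pow ?U. P X}. card {Q \<in> syt f. des f Q = X}))"
    unfolding G_def sum_distrib_left by (rule sum.swap)
  also have "\<dots> = (\<Sum>f\<in>?S. kostka f B * card {Q \<in> syt f. P (des f Q)})"
  proof (rule sum.cong[OF refl])
    fix f assume f: "f \<in> ?S"
    have "card {Q \<in> syt f. P (des f Q)} = (\<Sum>X\<in>{X \<in> Pow ?U. P X}. card {Q \<in> syt f. des f Q = X})"
      using finite_syt f dU[OF f]
      by (subst card_eq_sum_fibers[where g = "des f" and I = "{X \<in> Pow ?U. P X}"])
         (auto intro!: sum.cong arg_cong[where f = card])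
    then show "kostka f B * (\<Sum>X\<in>{X \<in> Pow ?U. P X}. card {Q \<in> syt f. des f Q = X}) = kostka f B * card {Q \<in> syt f. P (des f Q)}"
      by simp
  qed
  finally show ?thesis .
qed

section \<open>Matrices over a finite index set\<close>

definition mmul :: "'a set \<Rightarrow> ('a \<Rightarrow> 'a \<Rightarrow> complex) \<Rightarrow> ('a \<Rightarrow> 'a \<Rightarrow> complex) \<Rightarrow> 'a \<Rightarrow> 'a \<Rightarrow> complex" where
  "mmul S A B = (\<lambda>u v. \<Sum>k\<in>S. A u k * B k v)"

definition mtrace :: "'a set \<Rightarrow> ('a \<Rightarrow> 'a \<Rightarrow> complex) \<Rightarrow> complex" where
  "mtrace S A = (\<Sum>u\<in>S. A u u)"

text \<open>Vanishing outside \<open>S\<close> turns agreement on \<open>S\<close> into plain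
  equality of functions, so that matrix identities can be used for rewriting.\<close>

definition msupp :: "'a set \<Rightarrow> ('a \<Rightarrow> 'a \<Rightarrow> complex) \<Rightarrow> bool" where
  "msupp S A \<longleftrightarrow> (\<forall>u v. u \<notin> S \<or> v \<notin> S \<longrightarrow> A u v = 0)"

lemma mmul_assoc: "mmul S (mmul S A B) C = mmul S A (mmul S B C)"
proof (intro ext)
  fix u v
  have "mmul S (mmul S A B) C u v = (\<Sum>l\<in>S. \<Sum>k\<in>S. A u k * B k l * C l v)"
    by (simp add: mmul_def sum_distrib_right)
  also have "\<dots> = (\<Sum>k\<in>S. \<Sum>l\<in>S. A u k * B k l * C l v)" by (rule sum.swap)
  also have "\<dots> = mmul S A (mmul S B C) u v" by (simp add: mmul_def sum_distrib_left mult.assoc)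
  finally show "mmul S (mmul S A B) C u v = mmul S A (mmul S B C) u v" .
qed

lemma mtrace_mmul: "mtrace S (mmul S A B) = mtrace S (mmul S B A)"
proof -
  have "mtrace S (mmul S A B) = (\<Sum>u\<in>S. \<Sum>k\<in>S. A u k * B k u)" by (simp add: mtrace_def mmul_def)
  also have "\<dots> = (\<Sum>k\<in>S. \<Sum>u\<in>S. A u k * B k u)" by (rule sum.swap)
  finally show ?thesis by (simp add: mtrace_def mmul_def mult.commute)
qed

lemma mmul_diff_left: "mmul S (\<lambda>u v. A u v - B u v) C = (\<lambda>u v. mmul S A C u v - mmul S B C u v)"
  by (simp add: mmul_def left_diff_distrib sum_subtractf)

lemma mmul_diff_right: "mmul S C (\<lambda>u v. A u v - B u v) = (\<lambda>u v. mmul S C A u v - mmul S C B u v)"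
  by (simp add: mmul_def right_diff_distrib sum_subtractf)

lemma mtrace_diff: "mtrace S (\<lambda>u v. A u v - B u v) = mtrace S A - mtrace S B"
  by (simp add: mtrace_def sum_subtractf)

lemma mmul_lincomb_left: "mmul S (\<lambda>u v. \<Sum>g\<in>G. c g * A g u v) C = (\<lambda>u v. \<Sum>g\<in>G. c g * mmul S (A g) C u v)"
proof (intro ext)
  fix u v
  have "mmul S (\<lambda>u v. \<Sum>g\<in>G. c g * A g u v) C u v = (\<Sum>k\<in>S. \<Sum>g\<in>G. c g * (A g u k * C k v))"
    by (simp add: mmul_def sum_distrib_right mult.assoc)
  also have "\<dots> = (\<Sum>g\<in>G. \<Sum>k\<in>S. c g * (A g u k * C k v))" by (rule sum.swap)
  finally show "mmul S (\<lambda>u v. \<Sum>g\<in>G. c g * A g u v) C u v = (\<Sum>g\<in>G. c g * mmul S (A g) C u v)"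
    by (simp add: mmul_def sum_distrib_left)
qed

lemma mmul_lincomb_right: "mmul S C (\<lambda>u v. \<Sum>g\<in>G. c g * A g u v) = (\<lambda>u v. \<Sum>g\<in>G. c g * mmul S C (A g) u v)"
proof (intro ext)
  fix u v
  have "mmul S C (\<lambda>u v. \<Sum>g\<in>G. c g * A g u v) u v = (\<Sum>k\<in>S. \<Sum>g\<in>G. c g * (C u k * A g k v))"
    by (simp add: mmul_def sum_distrib_left mult.left_commute)
  also have "\<dots> = (\<Sum>g\<in>G. \<Sum>k\<in>S. c g * (C u k * A g k v))" by (rule sum.swap)
  finally show "mmul S C (\<lambda>u v. \<Sum>g\<in>G. c g * A g u v) u v = (\<Sum>g\<in>G. c g * mmul S C (A g) u v)"
    by (simp add: mmul_def sum_distrib_left)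
qed

lemma mtrace_lincomb: "mtrace S (\<lambda>u v. \<Sum>g\<in>G. c g * A g u v) = (\<Sum>g\<in>G. c g * mtrace S (A g))"
proof -
  have "mtrace S (\<lambda>u v. \<Sum>g\<in>G. c g * A g u v) = (\<Sum>g\<in>G. \<Sum>u\<in>S. c g * A g u u)"
    unfolding mtrace_def by (rule sum.swap)
  then show ?thesis by (simp add: mtrace_def sum_distrib_left)
qed

lemma msupp_mmul: "msupp S A \<Longrightarrow> msupp S B \<Longrightarrow> msupp S (mmul S A B)"
  by (auto simp: msupp_def mmul_def)

lemma msupp_eqI: "msupp S A \<Longrightarrow> msupp S B \<Longrightarrow> (\<And>u v. u \<in> S \<Longrightarrow> v \<in> S \<Longrightarrow> A u v = B u v) \<Longrightarrow> A = B"
  by (auto simp: msupp_def fun_eq_iff) metis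

text \<open>After triangularization the diagonal entries satisfy \<open>b = b * b\<close>, so they
  are 0 or 1 and the trace counts the ones. If there are none, the matrix is strictly triangular and
  idempotent, hence zero.\<close>

lemma idempotent_trace_nat:
  fixes m :: "nat \<Rightarrow> nat \<Rightarrow> complex"
  assumes idem: "\<And>i j. i < n \<Longrightarrow> j < n \<Longrightarrow> mmul {..<n} m m i j = m i j"
  shows "\<exists>k::nat. mtrace {..<n} m = of_nat k \<and> (k = 0 \<longrightarrow> (\<forall>i<n. \<forall>j<n. m i j = 0))"
proof -
  define M where "M = mat n n (\<lambda>(i, j). m i j)"
  have M: "M \<in> carrier_mat n n" by (simp add: M_def)
  obtain es where es: "char_poly M = (\<Prod>a\<leftarrow>es. [:- a, 1:])" using char_poly_factorized[OF M] by blast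
  obtain B P Q where BPQ: "schur_decomposition M es = (B, P, Q)" by (cases "schur_decomposition M es") auto
  have sim: "similar_mat_wit M B P Q" and ut: "upper_triangular B"
    using schur_decomposition[OF M es BPQ] by auto
  have car: "B \<in> carrier_mat n n" "P \<in> carrier_mat n n" "Q \<in> carrier_mat n n"
    and PQ: "P * Q = 1\<^sub>m n" "Q * P = 1\<^sub>m n" and MB: "M = P * B * Q"
    using sim M unfolding similar_mat_wit_def Let_def by auto
  have mult: "(X * Y) $$ (i, j) = (\<Sum>k<n. X $$ (i, k) * Y $$ (k, j))"
    if "X \<in> carrier_mat n n" "Y \<in> carrier_mat n n" "i < n" "j < n" for X Y :: "complex mat" and i j
    using that by (simp add: scalar_prod_def atLeast0LessThan)
  have MM: "M * M = M"
  proof (rule eq_matI)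
    fix i j assume "i < dim_row M" "j < dim_col M"
    then have ij: "i < n" "j < n" using M by auto
    have "(M * M) $$ (i, j) = (\<Sum>k<n. m i k * m k j)"
      unfolding mult[OF M M ij] using ij by (intro sum.cong) (auto simp: M_def)
    also have "\<dots> = M $$ (i, j)" using idem[OF ij] ij by (simp add: mmul_def M_def)
    finally show "(M * M) $$ (i, j) = M $$ (i, j)" .
  qed (use M in auto)
  have BQP: "B = Q * M * P"
  proof -
    have "Q * M * P = Q * (P * (B * (Q * P)))" unfolding MB
      using car by (simp add: assoc_mult_mat[of _ n n _ n _ n])
    also have "\<dots> = B" unfolding PQ(2) right_mult_one_mat[OF car(1)]
      using car PQ(2) by (simp add: assoc_mult_mat[of _ n n _ n _ n, symmetric])
    finally show ?thesis ..
  qed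
  have BB: "B * B = B"
  proof -
    have "B * B = Q * (M * ((P * Q) * (M * P)))"
      using car M by (simp add: BQP assoc_mult_mat[of _ n n _ n _ n])
    also have "\<dots> = Q * ((M * M) * P)" unfolding PQ(1) using car M by (simp add: assoc_mult_mat[of _ n n _ n _ n])
    finally show ?thesis unfolding MM using car M by (simp add: BQP assoc_mult_mat[of _ n n _ n _ n])
  qed
  have ut': "B $$ (i, j) = 0" if "j < i" "i < n" for i j
    using ut that car(1) unfolding upper_triangular_def by auto
  have bb: "B $$ (i, j) = (\<Sum>k<n. B $$ (i, k) * B $$ (k, j))" if "i < n" "j < n" for i j
    using mult[OF car(1) car(1) that] BB by simp
  have diag: "B $$ (i, i) = 0 \<or> B $$ (i, i) = 1" if "i < n" for i
  proof -
    have "B $$ (i, i) = (\<Sum>k<n. if k = i then B $$ (i, i) * B $$ (i, i) else 0)"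
      unfolding bb[OF that that, symmetric]
      by (subst (1) bb[OF that that], rule sum.cong)
         (use ut' that in \<open>auto, metis linorder_neqE_nat\<close>)
    then have "B $$ (i, i) = B $$ (i, i) * B $$ (i, i)" using that by simp
    then show ?thesis by (metis mult_cancel_left2)
  qed
  have "mtrace {..<n} m = (\<Sum>i<n. M $$ (i, i))" by (simp add: mtrace_def M_def)
  also have "\<dots> = (\<Sum>i<n. \<Sum>k<n. P $$ (i, k) * (\<Sum>l<n. B $$ (k, l) * Q $$ (l, i)))"
  proof (rule sum.cong[OF refl])
    fix i assume "i \<in> {..<n}"
    then have i: "i < n" by simp
    have "M = P * (B * Q)" unfolding MB using car by (simp add: assoc_mult_mat[of _ n n _ n _ n])
    then show "M $$ (i, i) = (\<Sum>k<n. P $$ (i, k) * (\<Sum>l<n. B $$ (k, l) * Q $$ (l, i)))"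
      using car i by (simp add: mult del: index_mult_mat)
  qed
  also have "\<dots> = mtrace {..<n} (mmul {..<n} (\<lambda>i j. P $$ (i, j)) (mmul {..<n} (\<lambda>i j. B $$ (i, j)) (\<lambda>i j. Q $$ (i, j))))"
    by (simp add: mtrace_def mmul_def)
  also have "\<dots> = mtrace {..<n} (mmul {..<n} (\<lambda>i j. B $$ (i, j)) (mmul {..<n} (\<lambda>i j. Q $$ (i, j)) (\<lambda>i j. P $$ (i, j))))"
    by (subst mtrace_mmul) (simp only: mmul_assoc)
  also have "\<dots> = (\<Sum>i<n. \<Sum>k<n. B $$ (i, k) * (1\<^sub>m n) $$ (k, i))"
    unfolding mtrace_def mmul_def PQ(2)[symmetric]
    using car by (intro sum.cong refl) (simp add: mult del: index_mult_mat)
  also have "\<dots> = (\<Sum>i<n. \<Sum>k<n. if k = i then B $$ (i, i) else 0)"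
    by (intro sum.cong refl) auto
  also have "\<dots> = (\<Sum>i<n. B $$ (i, i))" by (intro sum.cong refl) simp
  also have "\<dots> = (\<Sum>i<n. if B $$ (i, i) = 1 then 1 else 0)" using diag by (intro sum.cong) auto
  also have "\<dots> = of_nat (card {i \<in> {..<n}. B $$ (i, i) = 1})" by (simp add: sum.inter_filter[symmetric])
  finally have tr: "mtrace {..<n} m = of_nat (card {i \<in> {..<n}. B $$ (i, i) = 1})" .
  have "m i j = 0" if z: "card {i \<in> {..<n}. B $$ (i, i) = 1} = 0" and ij: "i < n" "j < n" for i j
  proof -
    have d0: "B $$ (i, i) = 0" if "i < n" for i using z diag[OF that] that by auto
    \<comment> \<open>Induction on the distance from the diagonal: in the expansion of
      \<open>B * B\<close> every product has a vanishing factor on or below the diagonal, or two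
      factors closer to it.\<close>
    have "B $$ (i, j) = 0" if "i < n" "j < n" for i j
      using that
    proof (induction "j - i" arbitrary: i j rule: less_induct)
      case less
      have "B $$ (i, k) * B $$ (k, j) = 0" if k: "k < n" for k
      proof -
        consider "k \<le> i" | "j \<le> k" | "i < k" "k < j" by linarith
        then show ?thesis
        proof cases
          case 1 then show ?thesis using d0 ut' less.prems k by (cases "k = i") auto
        next
          case 2 then show ?thesis using d0 ut' less.prems k by (cases "k = j") auto
        next
          case 3 then show ?thesis using less.hyps[of k i] less.prems k by simp
        qed
      qed
      then show ?case unfolding bb[OF less.prems] by (intro sum.neutral) simp
    qed
    then have "B = 0\<^sub>m n n" using car by (intro eq_matI) auto
    then have "M = 0\<^sub>m n n" using MB car by simp
    then show ?thesis using ij by (metis M_def case_prod_conv index_mat(1) index_zero_mat(1))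
  qed
  then show ?thesis using tr by blast
qed

lemma idempotent_trace:
  assumes fin: "finite S" and supp: "msupp S A" and idem: "mmul S A A = A"
  shows "\<exists>k::nat. mtrace S A = of_nat k \<and> (k = 0 \<longrightarrow> A = (\<lambda>_ _. 0))"
proof -
  obtain f where f: "bij_betw f {..<card S} S" using ex_bij_betw_nat_finite[OF fin] by (auto simp: atLeast0LessThan)
  define m where "m i j = A (f i) (f j)" for i j
  have fS: "f i \<in> S" if "i < card S" for i using f that by (auto simp: bij_betw_def)
  have "mmul {..<card S} m m i j = m i j" for i j
  proof -
    have "mmul {..<card S} m m i j = mmul S A A (f i) (f j)"
      unfolding mmul_def m_def by (rule sum.reindex_bij_betw[OF f])
    then show ?thesis by (simp add: idem m_def)
  qed
  then obtain k where k: "mtrace {..<card S} m = of_nat k" "k = 0 \<longrightarrow> (\<forall>i<card S. \<forall>j<card S. m i j = 0)"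
    using idempotent_trace_nat by blast
  have "mtrace {..<card S} m = mtrace S A"
    unfolding mtrace_def m_def by (rule sum.reindex_bij_betw[OF f])
  moreover have "A = (\<lambda>_ _. 0)" if "k = 0"
  proof (rule msupp_eqI[OF supp])
    fix u v assume "u \<in> S" "v \<in> S"
    then obtain i j where "i < card S" "j < card S" "f i = u" "f j = v"
      using f by (metis bij_betw_def imageE lessThan_iff)
    then show "A u v = 0" using k(2) that by (auto simp: m_def)
  qed (simp add: msupp_def)
  ultimately show ?thesis using k(1) by metis
qed

interpretation pm_pair: vector_space_pair "pm_scale :: complex \<Rightarrow> ('b \<Rightarrow>\<^sub>0 complex) \<Rightarrow> _"
    "pm_scale :: complex \<Rightarrow> ('c \<Rightarrow>\<^sub>0 complex) \<Rightarrow> _"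
  by unfold_locales

text \<open>\<open>X\<close> is a right inverse of \<open>T\<close> on its image, cut down to
  \<open>S\<close>; nothing is lost because \<open>T\<close> is supported there.\<close>

lemma generalized_inverse:
  assumes fin: "finite S" and supp: "msupp S T"
  shows "\<exists>X. msupp S X \<and> mmul S T (mmul S X T) = T"
proof -
  define f :: "('a \<Rightarrow>\<^sub>0 complex) \<Rightarrow> ('a \<Rightarrow>\<^sub>0 complex)" where
    "f p = (\<Sum>u\<in>S. Poly_Mapping.single u (\<Sum>k\<in>S. T u k * Poly_Mapping.lookup p k))" for p
  have lf: "Poly_Mapping.lookup (f p) u = (\<Sum>k\<in>S. T u k * Poly_Mapping.lookup p k)" for p u
  proof -
    have "Poly_Mapping.lookup (f p) u = (\<Sum>w\<in>S. Poly_Mapping.lookup (Poly_Mapping.single w (\<Sum>k\<in>S. T w k * Poly_Mapping.lookup p k)) u)"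
      by (simp add: f_def lookup_sum)
    also have "\<dots> = (\<Sum>w\<in>S. if w = u then (\<Sum>k\<in>S. T u k * Poly_Mapping.lookup p k) else 0)"
      by (intro sum.cong) (auto simp: when_def lookup_single)
    also have "\<dots> = (\<Sum>k\<in>S. T u k * Poly_Mapping.lookup p k)"
      using fin supp by (cases "u \<in> S") (auto simp: msupp_def)
    finally show ?thesis .
  qed
  have "Vector_Spaces.linear pm_scale pm_scale f"
    by (unfold_locales)
       (auto intro!: poly_mapping_eqI simp: lf lookup_add algebra_simps sum.distrib sum_distrib_left)
  from pm_pair.linear_exists_right_inverse_on[OF this pm.subspace_UNIV]
  obtain g where g: "Vector_Spaces.linear pm_scale pm_scale g" "\<And>v. f (g (f v)) = f v" by auto
  interpret g: Vector_Spaces.linear pm_scale pm_scale g by (rule g(1))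
  define X where "X u v = (if u \<in> S \<and> v \<in> S then Poly_Mapping.lookup (g (Poly_Mapping.single v 1)) u else 0)" for u v
  have sX: "msupp S X" by (simp add: msupp_def X_def)
  have "mmul S T (mmul S X T) = T"
  proof (rule msupp_eqI)
    fix u v assume uv: "u \<in> S" "v \<in> S"
    define y where "y = f (Poly_Mapping.single v 1)"
    have ly: "Poly_Mapping.lookup y w = T w v" for w
    proof -
      have "Poly_Mapping.lookup y w = (\<Sum>k\<in>S. if k = v then T w v else 0)"
        unfolding y_def lf lookup_single by (intro sum.cong) (auto simp: when_def)
      then show ?thesis using fin uv by simp
    qed
    have y: "y = (\<Sum>w\<in>S. pm_scale (T w v) (Poly_Mapping.single w 1))"
    proof (rule poly_mapping_eqI)
      fix x
      have "Poly_Mapping.lookup (\<Sum>w\<in>S. pm_scale (T w v) (Poly_Mapping.single w 1)) x = (\<Sum>w\<in>S. if w = x then T x v else 0)"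
        unfolding lookup_sum by (intro sum.cong) (auto simp: lookup_single when_def)
      also have "\<dots> = T x v" using fin supp by (cases "x \<in> S") (auto simp: msupp_def)
      finally show "Poly_Mapping.lookup y x = Poly_Mapping.lookup (\<Sum>w\<in>S. pm_scale (T w v) (Poly_Mapping.single w 1)) x" by (simp add: ly)
    qed
    have "g y = (\<Sum>w\<in>S. pm_scale (T w v) (g (Poly_Mapping.single w 1)))"
      unfolding y g.sum g.scale ..
    then have lg: "Poly_Mapping.lookup (g y) k = (\<Sum>w\<in>S. X k w * T w v)" if "k \<in> S" for k
      using that by (simp add: lookup_sum X_def mult.commute)
    have "T u v = Poly_Mapping.lookup (f (g y)) u" using g(2)[of "Poly_Mapping.single v 1"] ly by (simp add: y_def)
    also have "\<dots> = mmul S T (mmul S X T) u v" unfolding lf mmul_def using lg by (intro sum.cong) auto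
    finally show "mmul S T (mmul S X T) u v = T u v" ..
  qed (use sX supp in \<open>auto intro: msupp_mmul\<close>)
  then show ?thesis using sX by blast
qed

section \<open>Virtual characters of norm one\<close>

abbreviation finv :: "('a \<Rightarrow> 'b) \<Rightarrow> 'b \<Rightarrow> 'a" where "finv \<equiv> inv_into UNIV"

text \<open>\<open>act_comp\<close> reverses the order because permutations act on words by
  precomposition. With rows as sources, the matrices \<open>R\<close> nevertheless multiply in the
  order of composition.\<close>

locale perm_rep =
  fixes D :: "'i set" and Om :: "'a set" and act :: "('i \<Rightarrow> 'i) \<Rightarrow> 'a \<Rightarrow> 'a"
  assumes finD: "finite D" and finOm: "finite Om"
    and act_in: "g permutes D \<Longrightarrow> u \<in> Om \<Longrightarrow> act g u \<in> Om"
    and act_id: "act id u = u"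
    and act_comp: "act (f \<circ> g) u = act g (act f u)"
begin

definition G :: "('i \<Rightarrow> 'i) set" where "G = {g. g permutes D}"

definition R :: "('i \<Rightarrow> 'i) \<Rightarrow> 'a \<Rightarrow> 'a \<Rightarrow> complex" where
  "R g u v = (if u \<in> Om \<and> v \<in> Om \<and> act g u = v then 1 else 0)"

abbreviation mul (infixl "**" 70) where "A ** B \<equiv> mmul Om A B"
abbreviation tr where "tr \<equiv> mtrace Om"

definition eqv :: "('a \<Rightarrow> 'a \<Rightarrow> complex) \<Rightarrow> bool" where
  "eqv A \<longleftrightarrow> msupp Om A \<and> (\<forall>g\<in>G. R g ** A = A ** R g)"

text \<open>A subrepresentation is handled through an equivariant projection onto it, with character
  \<open>chi\<close>; splitting and cancelling summands then become matrix identities.\<close>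

definition eqvi :: "('a \<Rightarrow> 'a \<Rightarrow> complex) \<Rightarrow> bool" where
  "eqvi P \<longleftrightarrow> eqv P \<and> P ** P = P"

definition chi :: "('a \<Rightarrow> 'a \<Rightarrow> complex) \<Rightarrow> ('i \<Rightarrow> 'i) \<Rightarrow> complex" where
  "chi A g = tr (R g ** A)"

lemma finG: "finite G" unfolding G_def using finD by (rule finite_permutations)
lemma id_G: "id \<in> G" by (simp add: G_def permutes_id)
lemma comp_G: "f \<in> G \<Longrightarrow> g \<in> G \<Longrightarrow> f \<circ> g \<in> G" by (simp add: G_def permutes_compose)
lemma inv_G: "g \<in> G \<Longrightarrow> finv g \<in> G" by (simp add: G_def permutes_inv)
lemma inv_comp_G: "f \<in> G \<Longrightarrow> g \<in> G \<Longrightarrow> finv (f \<circ> g) = finv g \<circ> finv f"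
  by (simp add: G_def permutes_bij o_inv_distrib)
lemma comp_inv_G: "g \<in> G \<Longrightarrow> g \<circ> finv g = id" "g \<in> G \<Longrightarrow> finv g \<circ> g = id"
  by (simp_all add: G_def permutes_inv_o)
lemma inv_inv_G: "g \<in> G \<Longrightarrow> finv (finv g) = g" by (simp add: G_def permutes_inv_inv)
lemma card_G: "card G \<noteq> 0" using finG id_G by auto

lemma sum_G_left: "h \<in> G \<Longrightarrow> (\<Sum>g\<in>G. F (h \<circ> g)) = (\<Sum>g\<in>G. F g)"
  for F :: "_ \<Rightarrow> 'c :: comm_monoid_add"
  by (rule sum.reindex_bij_witness[of _ "\<lambda>g. finv h \<circ> g" "\<lambda>g. h \<circ> g"])
     (auto simp: comp_G inv_G o_assoc comp_inv_G)

lemma sum_G_inv: "(\<Sum>g\<in>G. F (finv g)) = (\<Sum>g\<in>G. F g)" for F :: "_ \<Rightarrow> 'c :: comm_monoid_add"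
  by (rule sum.reindex_bij_witness[of _ finv finv]) (auto simp: inv_G inv_inv_G)

lemma msupp_R: "msupp Om (R g)" by (simp add: msupp_def R_def)

lemma R_mult: assumes "f \<in> G" "g \<in> G" shows "R f ** R g = R (f \<circ> g)"
proof (rule msupp_eqI[OF msupp_mmul[OF msupp_R msupp_R] msupp_R])
  fix u v assume uv: "u \<in> Om" "v \<in> Om"
  have "act f u \<in> Om" using assms(1) uv act_in by (simp add: G_def)
  have "(R f ** R g) u v = (\<Sum>k\<in>Om. if k = act f u then (if act g k = v then 1 else 0) else 0)"
    unfolding mmul_def using uv by (intro sum.cong) (auto simp: R_def)
  then show "(R f ** R g) u v = R (f \<circ> g) u v"
    using finOm uv \<open>act f u \<in> Om\<close> by (simp add: R_def act_comp)
qed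

lemma R_id: assumes "msupp Om A" shows "R id ** A = A" "A ** R id = A"
proof -
  show "R id ** A = A"
  proof (rule msupp_eqI[OF msupp_mmul[OF msupp_R assms] assms])
    fix u v assume uv: "u \<in> Om" "v \<in> Om"
    have "(R id ** A) u v = (\<Sum>k\<in>Om. if k = u then A u v else 0)"
      unfolding mmul_def using uv by (intro sum.cong) (auto simp: R_def act_id)
    then show "(R id ** A) u v = A u v" using finOm uv by simp
  qed
  show "A ** R id = A"
  proof (rule msupp_eqI[OF msupp_mmul[OF assms msupp_R] assms])
    fix u v assume uv: "u \<in> Om" "v \<in> Om"
    have "(A ** R id) u v = (\<Sum>k\<in>Om. if k = v then A u v else 0)"
      unfolding mmul_def using uv by (intro sum.cong) (auto simp: R_def act_id)
    then show "(A ** R id) u v = A u v" using finOm uv by simp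
  qed
qed

lemma eqvD: "eqv A \<Longrightarrow> g \<in> G \<Longrightarrow> R g ** A = A ** R g" "eqv A \<Longrightarrow> msupp Om A"
  by (auto simp: eqv_def)

lemma eqv_mmul: "eqv A \<Longrightarrow> eqv B \<Longrightarrow> eqv (A ** B)"
  unfolding eqv_def by (auto intro: msupp_mmul) (metis mmul_assoc)

lemma eqv_diff: "eqv A \<Longrightarrow> eqv B \<Longrightarrow> eqv (\<lambda>u v. A u v - B u v)"
  unfolding eqv_def by (auto simp: mmul_diff_left mmul_diff_right msupp_def)

lemma chi_diff: "chi (\<lambda>u v. A u v - B u v) g = chi A g - chi B g"
  by (simp add: chi_def mmul_diff_right mtrace_diff)

definition rep :: "('a \<Rightarrow> 'a \<Rightarrow> complex) \<Rightarrow> ('i \<Rightarrow> 'i) \<Rightarrow> 'a \<Rightarrow> 'a \<Rightarrow> complex" where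
  "rep P g = R g ** P"

lemma rep_mult: assumes P: "eqvi P" and fg: "f \<in> G" "g \<in> G"
  shows "rep P f ** rep P g = rep P (f \<circ> g)"
proof -
  have block_perms: "P ** P = P" and Pg: "R g ** P = P ** R g" using P fg by (auto simp: eqvi_def eqv_def)
  have "rep P f ** rep P g = R f ** ((P ** R g) ** P)" by (simp add: rep_def mmul_assoc)
  also have "\<dots> = R f ** R g ** (P ** P)" by (simp only: Pg[symmetric] mmul_assoc)
  finally show ?thesis using block_perms R_mult[OF fg] by (simp add: rep_def)
qed

lemma rep_id: "eqvi P \<Longrightarrow> rep P id = P"
  by (simp add: rep_def R_id eqvi_def eqv_def)

lemma msupp_rep: "eqvi P \<Longrightarrow> msupp Om (rep P g)"
  unfolding rep_def eqvi_def eqv_def by (auto intro: msupp_mmul msupp_R)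

definition avg :: "(('i \<Rightarrow> 'i) \<Rightarrow> 'a \<Rightarrow> 'a \<Rightarrow> complex) \<Rightarrow> ('a \<Rightarrow> 'a \<Rightarrow> complex)" where
  "avg F = (\<lambda>u v. \<Sum>g\<in>G. (1 / of_nat (card G)) * F g u v)"

lemma avg_const: "(\<And>g. g \<in> G \<Longrightarrow> F g = A) \<Longrightarrow> avg F = A"
  using card_G by (simp add: avg_def)

lemma mmul_avg: "A ** avg F = avg (\<lambda>g. A ** F g)" "avg F ** A = avg (\<lambda>g. F g ** A)"
  unfolding avg_def by (simp_all only: mmul_lincomb_left mmul_lincomb_right)

lemma eqv_avg_conj:
  assumes A: "msupp Om A"
  shows "eqv (avg (\<lambda>g. R g ** (A ** R (finv g))))"
  unfolding eqv_def
proof (intro conjI ballI)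
  have "msupp Om (R g ** (A ** R (finv g)))" for g by (intro msupp_mmul msupp_R A)
  then show "msupp Om (avg (\<lambda>g. R g ** (A ** R (finv g))))" by (simp add: msupp_def avg_def)
  fix h assume h: "h \<in> G"
  let ?F = "\<lambda>g. R g ** (A ** R (finv g))"
  have e: "R h ** ?F g = ?F (h \<circ> g) ** R h" if g: "g \<in> G" for g
  proof -
    have "R (finv (h \<circ> g)) = R (finv g) ** R (finv h)"
        by (simp only: inv_comp_G[OF h g] R_mult[OF inv_G[OF g] inv_G[OF h]])
    then have "?F (h \<circ> g) ** R h = R (h \<circ> g) ** (A ** (R (finv g) ** (R (finv h) ** R h)))"
      by (simp only: mmul_assoc)
    also have "R (finv h) ** R h = R id" using h by (simp add: R_mult inv_G comp_inv_G)
    also have "R (finv g) ** R id = R (finv g)" by (rule R_id(2)[OF msupp_R])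
    finally show ?thesis by (simp only: R_mult[OF h g, symmetric] mmul_assoc)
  qed
  have "R h ** avg ?F = avg (\<lambda>g. R h ** ?F g)" by (rule mmul_avg)
  also have "\<dots> = avg (\<lambda>g. ?F (h \<circ> g) ** R h)" unfolding avg_def using e by (intro ext sum.cong) simp_all
  also have "\<dots> = avg (\<lambda>g. ?F g ** R h)"
    unfolding avg_def
    by (intro ext sum_G_left[OF h, of "\<lambda>g. (1 / of_nat (card G)) * (?F g ** R h) _ _"])
  finally show "R h ** avg ?F = avg ?F ** R h" by (simp add: mmul_avg)
qed

text \<open>The second argument is taken at the inverse instead of being conjugated, which keeps the
  form bilinear.\<close>

definition inner :: "('a \<Rightarrow> 'a \<Rightarrow> complex) \<Rightarrow> ('a \<Rightarrow> 'a \<Rightarrow> complex) \<Rightarrow> complex" where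
  "inner P Q = (\<Sum>g\<in>G. (1 / of_nat (card G)) * (chi P g * chi Q (finv g)))"

lemma inner_commute: "inner P Q = inner Q P"
proof -
  have "inner P Q = (\<Sum>g\<in>G. (1 / of_nat (card G)) * (chi P (finv g) * chi Q (finv (finv g))))"
    unfolding inner_def by (rule sum_G_inv[symmetric])
  also have "\<dots> = inner Q P" unfolding inner_def by (intro sum.cong) (auto simp: inv_inv_G)
  finally show ?thesis .
qed

text \<open>Averaging a matrix unit, compressed by \<open>Q\<close> and \<open>P\<close>, gives an
  intertwiner. The entries of these averages at their own positions add up to the inner product, so
  one of them is nonzero.\<close>

lemma inner_nonzero:
  assumes P: "eqvi P" and Q: "eqvi Q" and nz: "inner Q P \<noteq> 0"
  shows "\<exists>T. eqv T \<and> Q ** T = T \<and> T ** P = T \<and> T \<noteq> (\<lambda>_ _. 0)"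
proof -
  define E :: "'a \<Rightarrow> 'a \<Rightarrow> 'a \<Rightarrow> 'a \<Rightarrow> complex" where "E a b u v = (if u = a \<and> v = b then 1 else 0)" for a b u v
  define T where "T a b = avg (\<lambda>g. R g ** ((Q ** (E a b ** P)) ** R (finv g)))" for a b
  have supE: "msupp Om (E a b)" if "a \<in> Om" "b \<in> Om" for a b using that by (auto simp: E_def msupp_def)
  have sP: "msupp Om P" "msupp Om Q" using P Q by (auto simp: eqvi_def eqv_def)
  have block_perms: "P ** P = P" "Q ** Q = Q" using P Q by (auto simp: eqvi_def)
  have comm: "R g ** Q = Q ** R g" "R g ** P = P ** R g" if "g \<in> G" for g
    using P Q that by (auto simp: eqvi_def eqv_def)
  have ev: "eqv (T a b)" if "a \<in> Om" "b \<in> Om" for a b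
    unfolding T_def by (intro eqv_avg_conj msupp_mmul sP supE that)
  have QT: "Q ** T a b = T a b" for a b
  proof -
    have "Q ** (R g ** ((Q ** (E a b ** P)) ** R (finv g))) = R g ** ((Q ** (E a b ** P)) ** R (finv g))" if "g \<in> G" for g
      using comm(1)[OF that] block_perms(2) by (metis mmul_assoc)
    then show ?thesis unfolding T_def mmul_avg by (simp add: avg_def)
  qed
  have TP: "T a b ** P = T a b" for a b
  proof -
    have "(R g ** ((Q ** (E a b ** P)) ** R (finv g))) ** P = R g ** ((Q ** (E a b ** P)) ** R (finv g))" if "g \<in> G" for g
      using comm(2)[OF inv_G[OF that]] block_perms(1) by (metis mmul_assoc)
    then show ?thesis unfolding T_def mmul_avg by (simp add: avg_def)
  qed
  have entry: "(A ** (E a b ** B)) u v = A u a * B b v" if "a \<in> Om" "b \<in> Om" for A B a b u v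
  proof -
    have "(E a b ** B) k v = (if k = a then B b v else 0)" for k
    proof -
      have "(E a b ** B) k v = (\<Sum>l\<in>Om. if l = b then (if k = a then B b v else 0) else 0)"
        unfolding mmul_def E_def by (intro sum.cong) auto
      then show ?thesis using finOm that by simp
    qed
    then have "(A ** (E a b ** B)) u v = (\<Sum>k\<in>Om. if k = a then A u a * B b v else 0)"
      unfolding mmul_def[of _ A] by (intro sum.cong) auto
    then show ?thesis using finOm that by simp
  qed
  have "inner Q P = (\<Sum>a\<in>Om. \<Sum>b\<in>Om. T a b a b)"
  proof -
    have t: "T a b a b = (\<Sum>g\<in>G. (1 / of_nat (card G)) * ((R g ** Q) a a * (R (finv g) ** P) b b))"
      if "a \<in> Om" "b \<in> Om" for a b
    proof -
      have "R g ** ((Q ** (E a b ** P)) ** R (finv g)) = (R g ** Q) ** (E a b ** (R (finv g) ** P))" if "g \<in> G" for g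
        using comm(2)[OF inv_G[OF that]] by (simp add: mmul_assoc)
      then show ?thesis unfolding T_def avg_def
        using entry[OF that, of _ _ a b] by (intro sum.cong) auto
    qed
    have "(\<Sum>a\<in>Om. \<Sum>b\<in>Om. T a b a b) = (\<Sum>a\<in>Om. \<Sum>b\<in>Om. \<Sum>g\<in>G. (1 / of_nat (card G)) * ((R g ** Q) a a * (R (finv g) ** P) b b))"
      using t by (intro sum.cong) auto
    also have "\<dots> = (\<Sum>a\<in>Om. \<Sum>g\<in>G. \<Sum>b\<in>Om. (1 / of_nat (card G)) * ((R g ** Q) a a * (R (finv g) ** P) b b))"
      by (intro sum.cong refl sum.swap)
    also have "\<dots> = (\<Sum>g\<in>G. \<Sum>a\<in>Om. \<Sum>b\<in>Om. (1 / of_nat (card G)) * ((R g ** Q) a a * (R (finv g) ** P) b b))"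
      by (rule sum.swap)
    also have "\<dots> = inner Q P"
      unfolding inner_def chi_def mtrace_def sum_product by (simp add: sum_distrib_left)
    finally show ?thesis ..
  qed
  then obtain a b where ab: "a \<in> Om" "b \<in> Om" "T a b a b \<noteq> 0" using nz by (metis (mono_tags, lifting) sum.neutral)
  then have "T a b \<noteq> (\<lambda>_ _. 0)" by (auto simp: fun_eq_iff)
  then show ?thesis using ev[OF ab(1,2)] QT TP by blast
qed

text \<open>\<open>K\<close> is the averaging projection of matrices onto the endomorphisms of the
  constituent that commute with the group, so its trace is a dimension. It fixes \<open>P\<close>,
  the identity of the constituent; hence \<open>K = 0\<close> forces \<open>P = 0\<close>.\<close>

lemma inner_self:
  assumes P: "eqvi P"
  shows "\<exists>k::nat. inner P P = of_nat k \<and> (k = 0 \<longrightarrow> P = (\<lambda>_ _. 0))"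
proof -
  let ?c = "1 / of_nat (card G) :: complex"
  let ?r = "rep P"
  define K where "K p q = (\<Sum>g\<in>G. ?c * (?r g (fst p) (fst q) * ?r (finv g) (snd q) (snd p)))" for p q :: "'a \<times> 'a"
  note sr = msupp_rep[OF P]
  have sK: "msupp (Om \<times> Om) K"
    unfolding msupp_def
  proof (intro allI impI)
    fix p q :: "'a \<times> 'a" assume pq: "p \<notin> Om \<times> Om \<or> q \<notin> Om \<times> Om"
    have "?r g (fst p) (fst q) * ?r (finv g) (snd q) (snd p) = 0" for g
      using pq sr[of g] sr[of "finv g"] unfolding msupp_def mult_eq_0_iff mem_Times_iff by blast
    then show "K p q = 0" unfolding K_def by simp
  qed
  have "mmul (Om \<times> Om) K K = K"
  proof (intro ext)
    fix p q :: "'a \<times> 'a"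
    let ?t = "\<lambda>g h a b. (?r g (fst p) a * ?r h a (fst q)) * (?r (finv h) (snd q) b * ?r (finv g) b (snd p))"
    have "mmul (Om \<times> Om) K K p q = (\<Sum>(a, b)\<in>Om \<times> Om. \<Sum>g\<in>G. \<Sum>h\<in>G. ?c * ?c * ?t g h a b)"
      unfolding mmul_def K_def sum_product
      by (intro sum.cong refl) (auto intro!: sum.cong)
    also have "\<dots> = (\<Sum>g\<in>G. \<Sum>(a, b)\<in>Om \<times> Om. \<Sum>h\<in>G. ?c * ?c * ?t g h a b)"
      unfolding split_def by (rule sum.swap)
    also have "\<dots> = (\<Sum>g\<in>G. \<Sum>h\<in>G. \<Sum>(a, b)\<in>Om \<times> Om. ?c * ?c * ?t g h a b)"
      unfolding split_def by (intro sum.cong refl sum.swap)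
    also have "\<dots> = (\<Sum>g\<in>G. \<Sum>h\<in>G. ?c * ?c * (?r (g \<circ> h) (fst p) (fst q) * ?r (finv (g \<circ> h)) (snd q) (snd p)))"
    proof (intro sum.cong refl)
      fix g h assume gh: "g \<in> G" "h \<in> G"
      have "(\<Sum>(a, b)\<in>Om \<times> Om. ?c * ?c * ?t g h a b)
          = ?c * ?c * ((\<Sum>a\<in>Om. ?r g (fst p) a * ?r h a (fst q)) * (\<Sum>b\<in>Om. ?r (finv h) (snd q) b * ?r (finv g) b (snd p)))"
        unfolding sum_product sum.cartesian_product by (simp only: sum_distrib_left split_def)
      also have "\<dots> = ?c * ?c * ((?r g ** ?r h) (fst p) (fst q) * (?r (finv h) ** ?r (finv g)) (snd q) (snd p))"
        by (simp add: mmul_def)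
      finally show "(\<Sum>(a, b)\<in>Om \<times> Om. ?c * ?c * ?t g h a b)
          = ?c * ?c * (?r (g \<circ> h) (fst p) (fst q) * ?r (finv (g \<circ> h)) (snd q) (snd p))"
        using gh by (simp only: rep_mult[OF P] inv_G inv_comp_G)
    qed
    also have "\<dots> = (\<Sum>g\<in>G. \<Sum>h\<in>G. ?c * ?c * (?r h (fst p) (fst q) * ?r (finv h) (snd q) (snd p)))"
      by (intro sum.cong refl sum_G_left[where F = "\<lambda>h. ?c * ?c * (?r h (fst p) (fst q) * ?r (finv h) (snd q) (snd p))"])
    also have "\<dots> = K p q"
      unfolding K_def using card_G by (simp add: sum_distrib_left)
    finally show "mmul (Om \<times> Om) K K p q = K p q" .
  qed
  then obtain k where k: "mtrace (Om \<times> Om) K = of_nat k" "k = 0 \<longrightarrow> K = (\<lambda>_ _. 0)"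
    using idempotent_trace[OF _ sK] finOm by auto
  have "mtrace (Om \<times> Om) K = (\<Sum>g\<in>G. \<Sum>p\<in>Om \<times> Om. ?c * (?r g (fst p) (fst p) * ?r (finv g) (snd p) (snd p)))"
    unfolding mtrace_def K_def by (rule sum.swap)
  also have "\<dots> = inner P P"
    unfolding inner_def chi_def mtrace_def rep_def[symmetric]
  proof (intro sum.cong refl)
    fix g
    have "(\<Sum>u\<in>Om. ?r g u u) * (\<Sum>u\<in>Om. ?r (finv g) u u) = (\<Sum>p\<in>Om \<times> Om. ?r g (fst p) (fst p) * ?r (finv g) (snd p) (snd p))"
      unfolding sum_product sum.cartesian_product by (simp only: split_def)
    then show "(\<Sum>p\<in>Om \<times> Om. ?c * (?r g (fst p) (fst p) * ?r (finv g) (snd p) (snd p)))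
        = ?c * ((\<Sum>u\<in>Om. ?r g u u) * (\<Sum>u\<in>Om. ?r (finv g) u u))"
      by (simp only: sum_distrib_left)
  qed
  finally have tr: "inner P P = of_nat k" using k(1) by simp
  have "P = (\<lambda>_ _. 0)" if "K = (\<lambda>_ _. 0)"
  proof (intro ext)
    fix u v
    have "0 = (\<Sum>(a, b)\<in>Om \<times> Om. K (u, v) (a, b) * P a b)" using that by simp
    also have "\<dots> = (\<Sum>(a, b)\<in>Om \<times> Om. \<Sum>g\<in>G. ?c * (?r g u a * (P a b * ?r (finv g) b v)))"
      unfolding K_def sum_distrib_right by (intro sum.cong refl) (auto intro!: sum.cong)
    also have "\<dots> = (\<Sum>g\<in>G. \<Sum>(a, b)\<in>Om \<times> Om. ?c * (?r g u a * (P a b * ?r (finv g) b v)))"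
      unfolding split_def by (rule sum.swap)
    also have "\<dots> = (\<Sum>g\<in>G. ?c * P u v)"
    proof (intro sum.cong refl)
      fix g assume g: "g \<in> G"
      have "(\<Sum>(a, b)\<in>Om \<times> Om. ?c * (?r g u a * (P a b * ?r (finv g) b v)))
        = ?c * (\<Sum>a\<in>Om. ?r g u a * (\<Sum>b\<in>Om. P a b * ?r (finv g) b v))"
        by (simp only: sum_distrib_left sum.cartesian_product split_def)
      also have "(\<Sum>a\<in>Om. ?r g u a * (\<Sum>b\<in>Om. P a b * ?r (finv g) b v)) = (?r g ** (?r id ** ?r (finv g))) u v"
        by (simp add: mmul_def rep_id[OF P])
      also have "\<dots> = P u v"
        unfolding rep_mult[OF P id_G inv_G[OF g]] id_comp rep_mult[OF P g inv_G[OF g]] comp_inv_G(1)[OF g]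
        by (simp only: rep_id[OF P])
      finally show "(\<Sum>(a, b)\<in>Om \<times> Om. ?c * (?r g u a * (P a b * ?r (finv g) b v))) = ?c * P u v" .
    qed
    also have "\<dots> = P u v" using card_G by simp
    finally show "P u v = 0" ..
  qed
  then show ?thesis using tr k(2) by blast
qed

text \<open>
  A nonzero intertwiner \<open>T\<close> between the two constituents splits off isomorphic summands
  \<open>S T\<close> and \<open>T S\<close>, where \<open>S\<close> is an equivariant generalized inverse; once no intertwiner is
  left, \<open>\<langle>P, P\<rangle> + \<langle>Q, Q\<rangle> = 1\<close> forces one constituent to vanish.
\<close>

lemma virtual_norm_one:
  assumes "eqvi P" "eqvi Q"
    and "(\<Sum>g\<in>G. (chi P g - chi Q g) * (chi P (finv g) - chi Q (finv g))) = of_nat (card G)"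
  shows "\<exists>Z. eqvi Z \<and> ((\<forall>g\<in>G. chi P g - chi Q g = chi Z g) \<or> (\<forall>g\<in>G. chi P g - chi Q g = - chi Z g))"
proof -
  have tr_nat: "\<exists>k::nat. tr X = of_nat k \<and> (k = 0 \<longrightarrow> X = (\<lambda>_ _. 0))" if "eqvi X" for X
    using that by (intro idempotent_trace finOm) (auto simp: eqvi_def eqv_def)
  obtain k :: nat where "tr P = of_nat k" using tr_nat[OF assms(1)] by auto
  then show ?thesis using assms
  proof (induction k arbitrary: P Q rule: less_induct)
    case (less k)
    note P = less.prems(2) and Q = less.prems(3) and nrm = less.prems(4)
    show ?case
    proof (cases "inner Q P = 0")
      case True
      let ?c = "1 / of_nat (card G) :: complex"
      have "inner P P + inner Q Q - inner P Q - inner Q P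
          = ?c * (\<Sum>g\<in>G. (chi P g - chi Q g) * (chi P (finv g) - chi Q (finv g)))"
        unfolding inner_def sum_distrib_left sum.distrib[symmetric] sum_subtractf[symmetric]
        by (intro sum.cong) (auto simp: algebra_simps)
      also have "\<dots> = 1" using nrm card_G by simp
      finally have one: "inner P P + inner Q Q = 1" using True inner_commute[of P Q] by simp
      obtain k l :: nat where k: "inner P P = of_nat k" "k = 0 \<longrightarrow> P = (\<lambda>_ _. 0)"
        and l: "inner Q Q = of_nat l" "l = 0 \<longrightarrow> Q = (\<lambda>_ _. 0)" using inner_self P Q by meson
      have "of_nat (k + l) = (of_nat 1 :: complex)" using one k l by simp
      then have "k + l = 1" by (simp only: of_nat_eq_iff)
      then have "k = 0 \<or> l = 0" by linarith
      moreover have "chi (\<lambda>_ _. 0) g = 0" for g by (simp add: chi_def mmul_def mtrace_def)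
      ultimately show ?thesis using k(2) l(2) P Q by auto
    next
      case False
      obtain T where T: "eqv T" "Q ** T = T" "T ** P = T" "T \<noteq> (\<lambda>_ _. 0)"
        using inner_nonzero[OF P Q False] by blast
      have sT: "msupp Om T" using T(1) by (simp add: eqv_def)
      obtain X where X: "msupp Om X" "T ** (X ** T) = T" using generalized_inverse[OF finOm sT] by blast
      \<comment> \<open>Averaging preserves the generalized inverse: \<open>T\<close> commutes with
        the group, so every conjugate of \<open>X\<close> satisfies the same equation.\<close>
      define S where "S = avg (\<lambda>g. R g ** (X ** R (finv g)))"
      have eS: "eqv S" unfolding S_def by (rule eqv_avg_conj[OF X(1)])
      have TST: "T ** (S ** T) = T"
      proof -
        have "T ** ((R g ** (X ** R (finv g))) ** T) = T" if g: "g \<in> G" for g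
        proof -
          have "T ** ((R g ** (X ** R (finv g))) ** T) = R g ** (T ** (X ** T)) ** R (finv g)"
            using eqvD(1)[OF T(1) g] eqvD(1)[OF T(1) inv_G[OF g]] by (metis mmul_assoc)
          also have "\<dots> = T ** (R g ** R (finv g))"
            unfolding X(2) using eqvD(1)[OF T(1) g] by (simp add: mmul_assoc)
          also have "\<dots> = T" using g by (simp add: R_mult inv_G comp_inv_G R_id sT)
          finally show ?thesis .
        qed
        then show ?thesis unfolding S_def mmul_avg by (intro avg_const)
      qed
      have eP: "eqv P" "P ** P = P" and eQ: "eqv Q" "Q ** Q = Q" using P Q by (auto simp: eqvi_def)
      \<comment> \<open>Compressing by \<open>P\<close> and \<open>Q\<close> places
        \<open>P1\<close> below \<open>P\<close> and \<open>Q1\<close> below \<open>Q\<close>;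
        cyclicity of the trace gives both the same character.\<close>
      define S' where "S' = P ** (S ** Q)"
      have eS': "eqv S'" unfolding S'_def by (intro eqv_mmul eP eQ eS)
      have PS: "P ** S' = S'" unfolding S'_def using eP(2) by (metis mmul_assoc)
      have SQ: "S' ** Q = S'" unfolding S'_def using eQ(2) by (metis mmul_assoc)
      have TS'T: "T ** (S' ** T) = T"
        unfolding S'_def using T(2,3) TST by (metis mmul_assoc)
      define P1 where "P1 = S' ** T"
      define Q1 where "Q1 = T ** S'"
      have e1: "eqv P1" "eqv Q1" unfolding P1_def Q1_def by (intro eqv_mmul T(1) eS')+
      have P1: "P1 ** P1 = P1" "P ** P1 = P1" "P1 ** P = P1"
        unfolding P1_def using TS'T PS T(3) by (metis mmul_assoc)+
      have Q1: "Q1 ** Q1 = Q1" "Q ** Q1 = Q1" "Q1 ** Q = Q1"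
        unfolding Q1_def using TS'T SQ T(2) by (metis mmul_assoc)+
      have chi1: "chi P1 g = chi Q1 g" if "g \<in> G" for g
      proof -
        have "chi P1 g = tr ((R g ** S') ** T)" by (simp add: chi_def P1_def mmul_assoc)
        also have "\<dots> = tr (T ** (R g ** S'))" by (rule mtrace_mmul)
        also have "T ** (R g ** S') = R g ** (T ** S')" using eqvD(1)[OF T(1) that] by (metis mmul_assoc)
        finally show ?thesis by (simp add: chi_def Q1_def)
      qed
      have nz1: "P1 \<noteq> (\<lambda>_ _. 0)"
      proof
        assume "P1 = (\<lambda>_ _. 0)"
        then have "T ** P1 = (\<lambda>_ _. 0)" by (simp add: mmul_def)
        then show False using TS'T T(4) by (simp add: P1_def)
      qed
      let ?P' = "\<lambda>u v. P u v - P1 u v" and ?Q' = "\<lambda>u v. Q u v - Q1 u v"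
      have P': "eqvi ?P'" unfolding eqvi_def
        using eP e1 P1 by (simp add: eqv_diff mmul_diff_left mmul_diff_right)
      have Q': "eqvi ?Q'" unfolding eqvi_def
        using eQ e1 Q1 by (simp add: eqv_diff mmul_diff_left mmul_diff_right)
      have cd: "chi ?P' g - chi ?Q' g = chi P g - chi Q g" if "g \<in> G" for g
        using chi1[OF that] by (simp add: chi_diff)
      \<comment> \<open>\<open>P1\<close> is nonzero, so its trace is a positive number and the
        induction measure, the trace of \<open>P\<close>, drops.\<close>
      obtain k1 :: nat where k1: "tr P1 = of_nat k1" "k1 \<noteq> 0"
        using tr_nat[of P1] e1(1) P1(1) nz1 by (auto simp: eqvi_def)
      obtain k' :: nat where k': "tr ?P' = of_nat k'" using tr_nat[OF P'] by auto
      have "of_nat (k' + k1) = (of_nat k :: complex)" using k' k1(1) less.prems(1) by (simp add: mtrace_diff algebra_simps)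
      then have "k' + k1 = k" by (simp only: of_nat_eq_iff)
      then have "k' < k" using k1(2) by simp
      moreover have "(\<Sum>g\<in>G. (chi ?P' g - chi ?Q' g) * (chi ?P' (finv g) - chi ?Q' (finv g))) = of_nat (card G)"
        unfolding nrm[symmetric] by (intro sum.cong refl) (simp only: cd inv_G)
      ultimately obtain Z where "eqvi Z"
        "(\<forall>g\<in>G. chi ?P' g - chi ?Q' g = chi Z g) \<or> (\<forall>g\<in>G. chi ?P' g - chi ?Q' g = - chi Z g)"
        using less.IH[of k' ?P' ?Q'] k' P' Q' by blast
      then show ?thesis using cd by auto
    qed
  qed
qed

text \<open>For a nowhere vanishing multiplicative \<open>om\<close> on a group \<open>H\<close>
  this is the projection onto the vectors on which \<open>H\<close> acts through the inverse of
  \<open>om\<close>.\<close>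

definition isot :: "('i \<Rightarrow> 'i) set \<Rightarrow> (('i \<Rightarrow> 'i) \<Rightarrow> complex) \<Rightarrow> 'a \<Rightarrow> 'a \<Rightarrow> complex" where
  "isot H om = (\<lambda>u v. \<Sum>h\<in>H. om h / of_nat (card H) * R h u v)"

lemma bij_comp:
  assumes H: "H \<subseteq> G" "\<And>f g. f \<in> H \<Longrightarrow> g \<in> H \<Longrightarrow> f \<circ> g \<in> H" and k: "k \<in> H"
  shows "bij_betw (\<lambda>h. k \<circ> h) H H" "bij_betw (\<lambda>h. h \<circ> k) H H"
proof -
  have fin: "finite H" using H(1) finG by (rule finite_subset)
  have kG: "k \<in> G" using H k by blast
  have l: "inj_on (\<lambda>h. k \<circ> h) H"
  proof (rule inj_onI)
    fix h h' assume "k \<circ> h = k \<circ> h'"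
    then have "finv k \<circ> k \<circ> h = finv k \<circ> k \<circ> h'" by (simp only: comp_assoc)
    then show "h = h'" unfolding comp_inv_G(2)[OF kG] id_comp .
  qed
  have r: "inj_on (\<lambda>h. h \<circ> k) H"
  proof (rule inj_onI)
    fix h h' assume "h \<circ> k = h' \<circ> k"
    then have "h \<circ> (k \<circ> finv k) = h' \<circ> (k \<circ> finv k)" by (simp only: comp_assoc[symmetric])
    then show "h = h'" unfolding comp_inv_G(1)[OF kG] comp_id .
  qed
  have "(\<lambda>h. k \<circ> h) ` H = H" using H(2) k fin l by (intro card_subset_eq) (auto simp: card_image)
  then show "bij_betw (\<lambda>h. k \<circ> h) H H" using l by (simp add: bij_betw_def)
  have "(\<lambda>h. h \<circ> k) ` H = H" using H(2) k fin r by (intro card_subset_eq) (auto simp: card_image)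
  then show "bij_betw (\<lambda>h. h \<circ> k) H H" using r by (simp add: bij_betw_def)
qed

text \<open>Substituting \<open>k \<circ> h\<close> for \<open>h\<close> shows that
  \<open>om k\<close> times \<open>R k\<close> fixes the average over \<open>H\<close>; averaging
  over \<open>K\<close> preserves this. The other side is symmetric.\<close>

lemma isot_mult:
  assumes H: "H \<subseteq> G" "\<And>f g. f \<in> H \<Longrightarrow> g \<in> H \<Longrightarrow> f \<circ> g \<in> H"
    and om: "\<And>f g. f \<in> H \<Longrightarrow> g \<in> H \<Longrightarrow> om (f \<circ> g) = om f * om g"
    and K: "K \<subseteq> H" "id \<in> K"
  shows "isot K om ** isot H om = isot H om" "isot H om ** isot K om = isot H om"
proof -
  have "finite K" using K(1) H(1) finG by (meson finite_subset)
  then have cK: "card K \<noteq> 0" using K by auto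
  have KH: "k \<in> H" "k \<in> G" if "k \<in> K" for k using that K H by auto
  have HG: "h \<in> G" if "h \<in> H" for h using that H by auto
  show "isot K om ** isot H om = isot H om"
  proof (intro ext)
    fix u v
    have "(isot K om ** isot H om) u v = (\<Sum>k\<in>K. om k / of_nat (card K) * (\<Sum>h\<in>H. om h / of_nat (card H) * (R k ** R h) u v))"
      unfolding isot_def mmul_lincomb_left mmul_lincomb_right ..
    also have "\<dots> = (\<Sum>k\<in>K. 1 / of_nat (card K) * (\<Sum>h\<in>H. om (k \<circ> h) / of_nat (card H) * R (k \<circ> h) u v))"
    proof (rule sum.cong[OF refl])
      fix k assume k: "k \<in> K"
      have "(\<Sum>h\<in>H. om (k \<circ> h) / of_nat (card H) * R (k \<circ> h) u v) = om k * (\<Sum>h\<in>H. om h / of_nat (card H) * (R k ** R h) u v)"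
        unfolding sum_distrib_left using KH[OF k] HG om by (intro sum.cong) (auto simp: R_mult)
      then show "om k / of_nat (card K) * (\<Sum>h\<in>H. om h / of_nat (card H) * (R k ** R h) u v)
        = 1 / of_nat (card K) * (\<Sum>h\<in>H. om (k \<circ> h) / of_nat (card H) * R (k \<circ> h) u v)" by simp
    qed
    also have "\<dots> = (\<Sum>k\<in>K. 1 / of_nat (card K) * isot H om u v)"
      unfolding isot_def using sum.reindex_bij_betw[OF bij_comp(1)[OF H KH(1)], of _ "\<lambda>h. om h / of_nat (card H) * R h u v"]
      by (intro sum.cong refl) simp
    finally show "(isot K om ** isot H om) u v = isot H om u v" using cK by simp
  qed
  show "isot H om ** isot K om = isot H om"
  proof (intro ext)
    fix u v
    have "(isot H om ** isot K om) u v = (\<Sum>k\<in>K. om k / of_nat (card K) * (\<Sum>h\<in>H. om h / of_nat (card H) * (R h ** R k) u v))"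
      unfolding isot_def mmul_lincomb_right mmul_lincomb_left ..
    also have "\<dots> = (\<Sum>k\<in>K. 1 / of_nat (card K) * (\<Sum>h\<in>H. om (h \<circ> k) / of_nat (card H) * R (h \<circ> k) u v))"
    proof (rule sum.cong[OF refl])
      fix k assume k: "k \<in> K"
      have "(\<Sum>h\<in>H. om (h \<circ> k) / of_nat (card H) * R (h \<circ> k) u v) = om k * (\<Sum>h\<in>H. om h / of_nat (card H) * (R h ** R k) u v)"
        unfolding sum_distrib_left using KH[OF k] HG om by (intro sum.cong) (auto simp: R_mult)
      then show "om k / of_nat (card K) * (\<Sum>h\<in>H. om h / of_nat (card H) * (R h ** R k) u v)
        = 1 / of_nat (card K) * (\<Sum>h\<in>H. om (h \<circ> k) / of_nat (card H) * R (h \<circ> k) u v)" by simp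
    qed
    also have "\<dots> = (\<Sum>k\<in>K. 1 / of_nat (card K) * isot H om u v)"
      unfolding isot_def using sum.reindex_bij_betw[OF bij_comp(2)[OF H KH(1)], of _ "\<lambda>h. om h / of_nat (card H) * R h u v"]
      by (intro sum.cong refl) simp
    finally show "(isot H om ** isot K om) u v = isot H om u v" using cK by simp
  qed
qed

lemma commuting_idempotents:
  assumes "Z ** E = E ** Z" "E ** E = E" "Z ** Z = Z"
  shows "(E ** Z) ** (E ** Z) = E ** Z"
  using assms by (metis mmul_assoc)

text \<open>By \<open>isot_mult\<close> the difference of the projections for \<open>H'\<close> and
  \<open>H\<close> is again idempotent. All of them commute with \<open>Z\<close>, so their products
  with \<open>Z\<close> are idempotents with natural traces, and the trace of the difference is the
  gain from passing to the smaller group.\<close>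

lemma isotypic_dimension:
  assumes Z: "eqvi Z" and H: "H \<subseteq> G" "id \<in> H" "\<And>f g. f \<in> H \<Longrightarrow> g \<in> H \<Longrightarrow> f \<circ> g \<in> H"
    and om: "\<And>f g. f \<in> H \<Longrightarrow> g \<in> H \<Longrightarrow> om (f \<circ> g) = om f * om g"
    and H': "H' \<subseteq> H" "id \<in> H'" "\<And>f g. f \<in> H' \<Longrightarrow> g \<in> H' \<Longrightarrow> f \<circ> g \<in> H'"
  shows "\<exists>k::nat. (\<Sum>h\<in>H. om h / of_nat (card H) * chi Z h) = of_nat k"
    "\<exists>k::nat. (\<Sum>h\<in>H'. om h / of_nat (card H') * chi Z h) = (\<Sum>h\<in>H. om h / of_nat (card H) * chi Z h) + of_nat k"
proof -
  have H'G: "H' \<subseteq> G" using H H' by blast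
  have om': "om (f \<circ> g) = om f * om g" if "f \<in> H'" "g \<in> H'" for f g using om that H'(1) by blast
  have HH: "isot H om ** isot H om = isot H om" by (rule isot_mult(1)[OF H(1,3) om order_refl H(2)])
  have H'H': "isot H' om ** isot H' om = isot H' om" by (rule isot_mult(1)[OF H'G H'(3) om' order_refl H'(2)])
  have E'E: "isot H' om ** isot H om = isot H om" "isot H om ** isot H' om = isot H om"
    by (rule isot_mult[OF H(1,3) om H'(1,2)]; assumption)+
  have eZ: "eqv Z" "Z ** Z = Z" using Z by (auto simp: eqvi_def)
  have sup: "msupp Om (isot K om)" for K by (auto simp: msupp_def isot_def R_def)
  have com: "Z ** isot K om = isot K om ** Z" if "K \<subseteq> G" for K
    unfolding isot_def mmul_lincomb_left mmul_lincomb_right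
    using eqvD(1)[OF eZ(1)] that by (intro ext sum.cong) (auto simp: subset_iff)
  have tr: "tr (isot K om ** Z) = (\<Sum>h\<in>K. om h / of_nat (card K) * chi Z h)" for K
    unfolding isot_def mmul_lincomb_left mtrace_lincomb chi_def ..
  let ?E = "isot H om" and ?E' = "isot H' om"
  have "(?E ** Z) ** (?E ** Z) = ?E ** Z" by (rule commuting_idempotents[OF com[OF H(1)] HH eZ(2)])
  then show "\<exists>k::nat. (\<Sum>h\<in>H. om h / of_nat (card H) * chi Z h) = of_nat k"
    using idempotent_trace[OF finOm, of "?E ** Z"] sup eqvD(2)[OF eZ(1)] msupp_mmul tr by metis
  let ?Dm = "\<lambda>u v. ?E' u v - ?E u v"
  have DD: "?Dm ** ?Dm = ?Dm" by (simp add: mmul_diff_left mmul_diff_right E'E HH H'H')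
  have DZ: "Z ** ?Dm = ?Dm ** Z" by (simp add: mmul_diff_left mmul_diff_right com[OF H(1)] com[OF H'G])
  have "(?Dm ** Z) ** (?Dm ** Z) = ?Dm ** Z" by (rule commuting_idempotents[OF DZ DD eZ(2)])
  moreover have "msupp Om (?Dm ** Z)"
    by (intro msupp_mmul eqvD(2)[OF eZ(1)]) (use sup in \<open>auto simp: msupp_def\<close>)
  ultimately obtain k :: nat where "tr (?Dm ** Z) = of_nat k" using idempotent_trace[OF finOm, of "?Dm ** Z"] by blast
  then have "(\<Sum>h\<in>H'. om h / of_nat (card H') * chi Z h) - (\<Sum>h\<in>H. om h / of_nat (card H) * chi Z h) = of_nat k"
    by (simp add: mmul_diff_left mtrace_diff tr)
  then have "(\<Sum>h\<in>H'. om h / of_nat (card H') * chi Z h) = (\<Sum>h\<in>H. om h / of_nat (card H) * chi Z h) + of_nat k"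
    by (simp add: algebra_simps)
  then show "\<exists>k::nat. (\<Sum>h\<in>H'. om h / of_nat (card H') * chi Z h) = (\<Sum>h\<in>H. om h / of_nat (card H) * chi Z h) + of_nat k"
    by blast
qed

end

section \<open>Words on a finite index set and the irreducible characters\<close>

definition content_words :: "'i set \<Rightarrow> 'b multiset \<Rightarrow> ('i \<Rightarrow> 'b) set" where
  "content_words D M = {w \<in> extensional D. image_mset w (mset_set D) = M}"

text \<open>The character of the permutation module on words of content \<open>M\<close>. Words live
  on an arbitrary finite set so that \<open>D\<close> can be the diagram of
  \<open>lam\<close>.\<close>

definition fixn :: "'i set \<Rightarrow> 'b multiset \<Rightarrow> ('i \<Rightarrow> 'i) \<Rightarrow> nat" where
  "fixn D M \<sigma> = card {w \<in> content_words D M. w \<circ> \<sigma> = w}"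

lemma finite_content_words: assumes "finite D" shows "finite (content_words D M)"
proof (rule finite_subset)
  show "content_words D M \<subseteq> (D \<rightarrow>\<^sub>E set_mset M)"
  proof
    fix w assume "w \<in> content_words D M"
    then have e: "w \<in> extensional D" and c: "image_mset w (mset_set D) = M" by (auto simp: content_words_def)
    have "w i \<in># M" if "i \<in> D" for i unfolding c[symmetric] using that assms by simp
    then show "w \<in> (D \<rightarrow>\<^sub>E set_mset M)" using e unfolding PiE_iff by blast
  qed
qed (use assms in \<open>auto intro: finite_PiE\<close>)

lemma content_words_comp:
  assumes "\<sigma> permutes D" "w \<in> content_words D M" shows "w \<circ> \<sigma> \<in> content_words D M"
proof -
  have "image_mset (w \<circ> \<sigma>) (mset_set D) = image_mset w (image_mset \<sigma> (mset_set D))"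
    by (simp add: multiset.map_comp)
  also have "image_mset \<sigma> (mset_set D) = mset_set D"
    using assms(1) by (simp add: image_mset_mset_set permutes_inj_on permutes_image)
  also have "image_mset w (mset_set D) = M" using assms(2) by (simp add: content_words_def)
  finally have "image_mset (w \<circ> \<sigma>) (mset_set D) = M" .
  moreover have "w \<circ> \<sigma> \<in> extensional D"
    using assms(2) permutes_not_in[OF assms(1)] by (simp add: content_words_def extensional_def)
  ultimately show ?thesis by (simp add: content_words_def)
qed

lemma content_words_nonempty:
  assumes "finite D" "size M = card D" shows "content_words D M \<noteq> {}"
proof -
  obtain xs where xs: "mset xs = M" using ex_mset by blast
  obtain f where f: "bij_betw f D {..<card D}"
    using ex_bij_betw_finite_nat[OF assms(1)] by (auto simp: atLeast0LessThan)
  define w where "w = restrict (\<lambda>i. xs ! f i) D"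
  have "image_mset w (mset_set D) = image_mset ((!) xs) (image_mset f (mset_set D))"
    unfolding multiset.map_comp using assms(1) by (intro image_mset_cong) (auto simp: w_def)
  also have "image_mset f (mset_set D) = mset_set {..<length xs}"
    using f xs assms(2) by (metis bij_betw_def image_mset_mset_set size_mset)
  also have "image_mset ((!) xs) \<dots> = mset (map ((!) xs) [0..<length xs])"
    by (metis atLeast0LessThan mset_map mset_upt)
  also have "\<dots> = M" by (simp only: map_nth xs)
  finally have "image_mset w (mset_set D) = M" .
  moreover have "w \<in> extensional D" by (simp add: w_def)
  ultimately have "w \<in> content_words D M" by (simp only: content_words_def mem_Collect_eq)
  then show ?thesis by blast
qed

lemma sum_card_swap:
  assumes "finite A" "finite B"
  shows "(\<Sum>a\<in>A. card {b \<in> B. P a b}) = (\<Sum>b\<in>B. card {a \<in> A. P a b})"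
proof -
  have "(\<Sum>a\<in>A. card {b \<in> B. P a b}) = (\<Sum>a\<in>A. \<Sum>b\<in>B. if P a b then 1 else 0)"
    using assms by (simp add: sum.inter_filter[symmetric])
  also have "\<dots> = (\<Sum>b\<in>B. \<Sum>a\<in>A. if P a b then 1 else 0)" by (rule sum.swap)
  finally show ?thesis using assms by (simp add: sum.inter_filter[symmetric])
qed

lemma content_words_transitive:
  assumes D: "finite D" and w0: "w0 \<in> content_words D M" and w: "w \<in> content_words D M"
  obtains \<tau> where "\<tau> permutes D" "w = w0 \<circ> \<tau>"
proof -
  have "image_mset w (mset_set D) = image_mset w0 (mset_set D)" using w0 w by (simp add: content_words_def)
  from image_mset_eq_implies_permutes[OF D this] obtain \<tau>
    where \<tau>: "\<tau> permutes D" "\<forall>x\<in>D. w x = w0 (\<tau> x)" by blast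
  have "w x = w0 (\<tau> x)" for x
  proof (cases "x \<in> D")
    case False
    then show ?thesis using w0 w permutes_not_in[OF \<tau>(1)] by (simp add: content_words_def extensional_def)
  qed (use \<tau> in simp)
  then have "w = w0 \<circ> \<tau>" by (simp add: fun_eq_iff)
  then show ?thesis by (rule that[OF \<tau>(1)])
qed

text \<open>Burnside's lemma for a part \<open>Q\<close> of a single orbit that may fail to be
  invariant: the stabilizer of a word is in bijection with the permutations that carry
  \<open>w0\<close> to it.\<close>

lemma sum_fixn_weighted:
  assumes D: "finite D" and w0: "w0 \<in> content_words D M" and Q: "Q \<subseteq> content_words D M"
  shows "(\<Sum>\<sigma> | \<sigma> permutes D. card {w \<in> Q. w \<circ> \<sigma> = w}) = card {\<rho>. \<rho> permutes D \<and> w0 \<circ> \<rho> \<in> Q}"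
proof -
  have fG: "finite {\<sigma>. \<sigma> permutes D}" using D by (rule finite_permutations)
  have fQ: "finite Q" using Q finite_content_words[OF D] by (rule finite_subset)
  have "(\<Sum>\<sigma> | \<sigma> permutes D. card {w \<in> Q. w \<circ> \<sigma> = w})
      = (\<Sum>w\<in>Q. card {\<sigma> \<in> {\<sigma>. \<sigma> permutes D}. w \<circ> \<sigma> = w})"
    by (rule sum_card_swap[OF fG fQ])
  also have "\<dots> = (\<Sum>w\<in>Q. card {\<rho> \<in> {\<rho>. \<rho> permutes D \<and> w0 \<circ> \<rho> \<in> Q}. w0 \<circ> \<rho> = w})"
  proof (rule sum.cong[OF refl])
    fix w assume w: "w \<in> Q"
    obtain \<tau> where \<tau>: "\<tau> permutes D" "w = w0 \<circ> \<tau>" using content_words_transitive[OF D w0] w Q by blast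
    have "bij_betw (\<lambda>\<sigma>. \<tau> \<circ> \<sigma>) {\<sigma> \<in> {\<sigma>. \<sigma> permutes D}. w \<circ> \<sigma> = w} {\<rho> \<in> {\<rho>. \<rho> permutes D \<and> w0 \<circ> \<rho> \<in> Q}. w0 \<circ> \<rho> = w}"
    proof (rule bij_betw_byWitness[where f' = "\<lambda>\<rho>. finv \<tau> \<circ> \<rho>"])
      show "\<forall>a\<in>{\<sigma> \<in> {\<sigma>. \<sigma> permutes D}. w \<circ> \<sigma> = w}. finv \<tau> \<circ> (\<tau> \<circ> a) = a"
        by (simp add: comp_assoc[symmetric] permutes_inv_o(2)[OF \<tau>(1)])
      show "\<forall>a'\<in>{\<rho> \<in> {\<rho>. \<rho> permutes D \<and> w0 \<circ> \<rho> \<in> Q}. w0 \<circ> \<rho> = w}. \<tau> \<circ> (finv \<tau> \<circ> a') = a'"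
        by (simp add: comp_assoc[symmetric] permutes_inv_o(1)[OF \<tau>(1)])
      show "(\<lambda>\<sigma>. \<tau> \<circ> \<sigma>) ` {\<sigma> \<in> {\<sigma>. \<sigma> permutes D}. w \<circ> \<sigma> = w} \<subseteq> {\<rho> \<in> {\<rho>. \<rho> permutes D \<and> w0 \<circ> \<rho> \<in> Q}. w0 \<circ> \<rho> = w}"
        using w \<tau> by (auto simp: comp_assoc[symmetric] intro: permutes_compose)
      show "(\<lambda>\<rho>. finv \<tau> \<circ> \<rho>) ` {\<rho> \<in> {\<rho>. \<rho> permutes D \<and> w0 \<circ> \<rho> \<in> Q}. w0 \<circ> \<rho> = w} \<subseteq> {\<sigma> \<in> {\<sigma>. \<sigma> permutes D}. w \<circ> \<sigma> = w}"
      proof clarsimp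
        fix \<rho> assume \<rho>: "\<rho> permutes D"  "w = w0 \<circ> \<rho>"
        have "w \<circ> (finv \<tau> \<circ> \<rho>) = w0 \<circ> (\<tau> \<circ> finv \<tau>) \<circ> \<rho>" by (simp only: \<tau>(2) comp_assoc)
        then show "finv \<tau> \<circ> \<rho> permutes D \<and> w0 \<circ> \<rho> \<circ> (finv \<tau> \<circ> \<rho>) = w0 \<circ> \<rho>"
          using \<rho> permutes_inv[OF \<tau>(1)] by (simp add: permutes_inv_o(1)[OF \<tau>(1)] permutes_compose)
      qed
    qed
    then show "card {\<sigma> \<in> {\<sigma>. \<sigma> permutes D}. w \<circ> \<sigma> = w} = card {\<rho> \<in> {\<rho>. \<rho> permutes D \<and> w0 \<circ> \<rho> \<in> Q}. w0 \<circ> \<rho> = w}"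
      by (rule bij_betw_same_card)
  qed
  also have "\<dots> = card {\<rho>. \<rho> permutes D \<and> w0 \<circ> \<rho> \<in> Q}"
  proof (rule card_eq_sum_fibers[symmetric, OF _ fQ])
    show "finite {\<rho>. \<rho> permutes D \<and> w0 \<circ> \<rho> \<in> Q}" using fG by (rule rev_finite_subset) auto
  qed auto
  finally show ?thesis .
qed

lemma sum_fixn:
  assumes D: "finite D" and M: "size M = card D"
  shows "(\<Sum>\<sigma> | \<sigma> permutes D. fixn D M \<sigma>) = fact (card D)"
proof -
  obtain w0 where w0: "w0 \<in> content_words D M" using content_words_nonempty[OF D M] by blast
  have "(\<Sum>\<sigma> | \<sigma> permutes D. fixn D M \<sigma>) = card {\<rho>. \<rho> permutes D \<and> w0 \<circ> \<rho> \<in> content_words D M}"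
    unfolding fixn_def by (rule sum_fixn_weighted[OF D w0 order_refl])
  also have "{\<rho>. \<rho> permutes D \<and> w0 \<circ> \<rho> \<in> content_words D M} = {\<rho>. \<rho> permutes D}"
    using content_words_comp[OF _ w0] by auto
  also have "card \<dots> = fact (card D)" using D by (intro card_permutations) auto
  finally show ?thesis .
qed

text \<open>A fixed word of content \<open>A\<close> and one of content \<open>B\<close> together
  form a fixed word of pairs. So the product of the two characters is a sum of permutation
  characters, each of which averages to one.\<close>

lemma sum_fixn_mult:
  fixes A :: "'a multiset" and B :: "'b multiset" and D :: "'i set"
  assumes D: "finite D" and A: "size A = card D"
  shows "(\<Sum>\<sigma> | \<sigma> permutes D. fixn D A \<sigma> * fixn D B \<sigma>) = fact (card D) * card (pair_msets A B)"
proof -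
  have "fixn D A \<sigma> * fixn D B \<sigma> = (\<Sum>M\<in>pair_msets A B. fixn D M \<sigma>)" if \<sigma>: "\<sigma> permutes D" for \<sigma>
  proof -
    define Fx where "Fx M = {w \<in> content_words D M. w \<circ> \<sigma> = w}" for M :: "('a \<times> 'b) multiset"
    have fixI: "w \<circ> \<sigma> = w" if "\<And>i. i \<in> D \<Longrightarrow> w (\<sigma> i) = w i" for w :: "'i \<Rightarrow> 'c"
    proof
      fix i show "(w \<circ> \<sigma>) i = w i" using that permutes_not_in[OF \<sigma>, of i] by (cases "i \<in> D") auto
    qed
    have s: "\<sigma> i \<in> D" if "i \<in> D" for i using that permutes_in_image[OF \<sigma>] by blast
    have "bij_betw (\<lambda>(u, v). \<lambda>i\<in>D. (u i, v i))
      ({u \<in> content_words D A. u \<circ> \<sigma> = u} \<times> {v \<in> content_words D B. v \<circ> \<sigma> = v}) (\<Union>M\<in>pair_msets A B. Fx M)"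
    proof (rule bij_betw_byWitness[where f' = "\<lambda>w. (\<lambda>i\<in>D. fst (w i), \<lambda>i\<in>D. snd (w i))"])
      show "\<forall>a\<in>{u \<in> content_words D A. u \<circ> \<sigma> = u} \<times> {v \<in> content_words D B. v \<circ> \<sigma> = v}.
        (\<lambda>w. (\<lambda>i\<in>D. fst (w i), \<lambda>i\<in>D. snd (w i))) ((\<lambda>(u, v). \<lambda>i\<in>D. (u i, v i)) a) = a"
        by (auto simp: content_words_def extensional_def restrict_def fun_eq_iff)
      show "\<forall>a'\<in>\<Union>M\<in>pair_msets A B. Fx M. (\<lambda>(u, v). \<lambda>i\<in>D. (u i, v i)) (\<lambda>i\<in>D. fst (a' i), \<lambda>i\<in>D. snd (a' i)) = a'"
        by (auto simp: Fx_def content_words_def extensional_def restrict_def fun_eq_iff)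
      show "(\<lambda>(u, v). \<lambda>i\<in>D. (u i, v i)) ` ({u \<in> content_words D A. u \<circ> \<sigma> = u} \<times> {v \<in> content_words D B. v \<circ> \<sigma> = v})
        \<subseteq> (\<Union>M\<in>pair_msets A B. Fx M)"
      proof clarify
        fix u v assume u: "u \<in> content_words D A" "u \<circ> \<sigma> = u" and v: "v \<in> content_words D B" "v \<circ> \<sigma> = v"
        let ?w = "\<lambda>i\<in>D. (u i, v i)"
        have "image_mset fst (image_mset ?w (mset_set D)) = image_mset u (mset_set D)"
          "image_mset snd (image_mset ?w (mset_set D)) = image_mset v (mset_set D)"
          unfolding multiset.map_comp using D by (auto intro!: image_mset_cong)
        then have "image_mset ?w (mset_set D) \<in> pair_msets A B"
          using u v by (simp add: pair_msets_def content_words_def)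
        moreover have "?w \<circ> \<sigma> = ?w"
          using u(2) v(2) s by (intro fixI) (auto simp: fun_eq_iff)
        ultimately show "?w \<in> (\<Union>M\<in>pair_msets A B. Fx M)" by (auto simp: Fx_def content_words_def)
      qed
      show "(\<lambda>w. (\<lambda>i\<in>D. fst (w i), \<lambda>i\<in>D. snd (w i))) ` (\<Union>M\<in>pair_msets A B. Fx M)
        \<subseteq> {u \<in> content_words D A. u \<circ> \<sigma> = u} \<times> {v \<in> content_words D B. v \<circ> \<sigma> = v}"
      proof (rule image_subsetI)
        fix w assume "w \<in> (\<Union>M\<in>pair_msets A B. Fx M)"
        then obtain M where M: "M \<in> pair_msets A B" "w \<in> content_words D M" "w \<circ> \<sigma> = w" by (auto simp: Fx_def)
        have "image_mset (\<lambda>i\<in>D. fst (w i)) (mset_set D) = image_mset fst (image_mset w (mset_set D))"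
          "image_mset (\<lambda>i\<in>D. snd (w i)) (mset_set D) = image_mset snd (image_mset w (mset_set D))"
          unfolding multiset.map_comp using D by (auto intro!: image_mset_cong)
        then have "(\<lambda>i\<in>D. fst (w i)) \<in> content_words D A" "(\<lambda>i\<in>D. snd (w i)) \<in> content_words D B"
          using M by (auto simp: pair_msets_def content_words_def)
        moreover have "w (\<sigma> i) = w i" for i using fun_cong[OF M(3), of i] by simp
        then have "(\<lambda>i\<in>D. fst (w i)) \<circ> \<sigma> = (\<lambda>i\<in>D. fst (w i))" "(\<lambda>i\<in>D. snd (w i)) \<circ> \<sigma> = (\<lambda>i\<in>D. snd (w i))"
          using s by (auto intro!: fixI)
        ultimately show "(\<lambda>i\<in>D. fst (w i), \<lambda>i\<in>D. snd (w i)) \<in> {u \<in> content_words D A. u \<circ> \<sigma> = u} \<times> {v \<in> content_words D B. v \<circ> \<sigma> = v}"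
          by simp
      qed
    qed
    then have "fixn D A \<sigma> * fixn D B \<sigma> = card (\<Union>M\<in>pair_msets A B. Fx M)"
      unfolding fixn_def by (simp add: bij_betw_same_card flip: card_cartesian_product)
    also have "\<dots> = (\<Sum>M\<in>pair_msets A B. card (Fx M))"
    proof (intro card_UN_disjoint finite_pair_msets ballI impI)
      show "finite (Fx M)" for M unfolding Fx_def using finite_content_words[OF D, of M] by simp
    qed (auto simp: Fx_def content_words_def)
    finally show ?thesis by (simp add: Fx_def fixn_def)
  qed
  then have "(\<Sum>\<sigma> | \<sigma> permutes D. fixn D A \<sigma> * fixn D B \<sigma>) = (\<Sum>\<sigma> | \<sigma> permutes D. \<Sum>M\<in>pair_msets A B. fixn D M \<sigma>)"
    by (intro sum.cong) auto
  also have "\<dots> = (\<Sum>M\<in>pair_msets A B. \<Sum>\<sigma> | \<sigma> permutes D. fixn D M \<sigma>)" by (rule sum.swap)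
  also have "\<dots> = (\<Sum>M\<in>pair_msets A B. fact (card D))"
  proof (rule sum.cong[OF refl])
    fix M assume "M \<in> pair_msets A B"
    then have "size M = card D" using A by (auto simp: pair_msets_def)
    then show "(\<Sum>\<sigma> | \<sigma> permutes D. fixn D M \<sigma>) = fact (card D)" by (rule sum_fixn[OF D])
  qed
  finally show ?thesis by simp
qed

section \<open>Irreducible characters as inverse Kostka combinations\<close>

lemma kostka_cauchy_sizes:
  fixes A B :: "nat multiset"
  assumes "size A = n" "size B = n"
  shows "(\<Sum>f | shape f \<and> sz f = n. kostka f A * kostka f B) = card (pair_msets A B)"
proof -
  have "\<forall>x\<in>#A. x < Suc (Max_mset A)" for A :: "nat multiset" by (simp add: less_Suc_eq_le)
  then have "(\<Sum>f | shape f \<and> sz f = size A. kostka f A * kostka f B) = card (pair_msets A B)"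
    using assms by (intro kostka_cauchy) auto
  then show ?thesis by (simp only: assms)
qed

definition inv_kostka :: "(nat \<Rightarrow> nat) \<Rightarrow> (nat \<Rightarrow> nat) \<Rightarrow> int" where
  "inv_kostka f = (SOME a. \<forall>g. shape g \<and> sz g = sz f \<longrightarrow>
    (\<Sum>h | shape h \<and> sz h = sz f. a h * int (kostka g (row_content h))) = (if g = f then 1 else 0))"

lemma inv_kostka:
  assumes "shape f" "shape g" "sz g = sz f"
  shows "(\<Sum>h | shape h \<and> sz h = sz f. inv_kostka f h * int (kostka g (row_content h))) = (if g = f then 1 else 0)"
  using someI_ex[OF inverse_kostka[OF assms(1) refl], folded inv_kostka_def] assms(2,3) by blast

text \<open>The determinantal formula for the irreducible character of shape \<open>f\<close>, with
  the inverse Kostka matrix in place of the determinant. So far it is an integral combination of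
  permutation characters; that it is a genuine character emerges in
  \<open>irr_isotypic\<close>.\<close>

definition irr :: "'i set \<Rightarrow> (nat \<Rightarrow> nat) \<Rightarrow> ('i \<Rightarrow> 'i) \<Rightarrow> int" where
  "irr D f \<sigma> = (\<Sum>h | shape h \<and> sz h = sz f. inv_kostka f h * int (fixn D (row_content h) \<sigma>))"

text \<open>Young's rule: the Cauchy identity expands the inner product of two permutation
  characters in Kostka numbers, and the inverse matrix selects the shape \<open>f\<close>.\<close>

lemma sum_fixn_irr:
  assumes D: "finite D" and f: "shape f" "sz f = card D" and B: "size B = card D"
  shows "(\<Sum>\<sigma> | \<sigma> permutes D. int (fixn D B \<sigma>) * irr D f \<sigma>) = fact (card D) * int (kostka f B)"
proof -
  let ?S = "{h. shape h \<and> sz h = card D}"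
  have "(\<Sum>\<sigma> | \<sigma> permutes D. int (fixn D B \<sigma>) * irr D f \<sigma>)
    = (\<Sum>\<sigma> | \<sigma> permutes D. \<Sum>h\<in>?S. inv_kostka f h * int (fixn D B \<sigma> * fixn D (row_content h) \<sigma>))"
    unfolding irr_def f(2) sum_distrib_left by (intro sum.cong refl) simp
  also have "\<dots> = (\<Sum>h\<in>?S. inv_kostka f h * int (\<Sum>\<sigma> | \<sigma> permutes D. fixn D B \<sigma> * fixn D (row_content h) \<sigma>))"
    unfolding of_nat_sum sum_distrib_left by (rule sum.swap)
  also have "\<dots> = (\<Sum>h\<in>?S. inv_kostka f h * (fact (card D) * (\<Sum>g\<in>?S. int (kostka g B) * int (kostka g (row_content h)))))"
  proof (rule sum.cong[OF refl])
    fix h assume h: "h \<in> ?S"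
    then have "card (pair_msets B (row_content h)) = (\<Sum>g\<in>?S. kostka g B * kostka g (row_content h))"
      using B by (intro kostka_cauchy_sizes[symmetric]) (auto simp: size_row_content)
    then show "inv_kostka f h * int (\<Sum>\<sigma> | \<sigma> permutes D. fixn D B \<sigma> * fixn D (row_content h) \<sigma>)
      = inv_kostka f h * (fact (card D) * (\<Sum>g\<in>?S. int (kostka g B) * int (kostka g (row_content h))))"
      by (simp only: sum_fixn_mult[OF D B] of_nat_mult of_nat_sum of_nat_fact)
  qed
  also have "\<dots> = (\<Sum>h\<in>?S. \<Sum>g\<in>?S. fact (card D) * (int (kostka g B) * (inv_kostka f h * int (kostka g (row_content h)))))"
    unfolding sum_distrib_left by (intro sum.cong refl) (simp add: algebra_simps)
  also have "\<dots> = (\<Sum>g\<in>?S. fact (card D) * (int (kostka g B) * (\<Sum>h\<in>?S. inv_kostka f h * int (kostka g (row_content h)))))"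
    unfolding sum_distrib_left by (rule sum.swap)
  also have "\<dots> = (\<Sum>g\<in>?S. if g = f then fact (card D) * int (kostka f B) else 0)"
    using inv_kostka[OF f(1)] f(2) by (intro sum.cong refl) auto
  also have "\<dots> = fact (card D) * int (kostka f B)" using f finite_shapes by (simp add: sum.delta)
  finally show ?thesis .
qed

lemma sum_irr_irr:
  assumes D: "finite D" and f: "shape f" "sz f = card D" and g: "shape g" "sz g = card D"
  shows "(\<Sum>\<sigma> | \<sigma> permutes D. irr D f \<sigma> * irr D g \<sigma>) = (if f = g then fact (card D) else 0)"
proof -
  let ?S = "{h. shape h \<and> sz h = card D}"
  have "(\<Sum>\<sigma> | \<sigma> permutes D. irr D f \<sigma> * irr D g \<sigma>)
    = (\<Sum>\<sigma> | \<sigma> permutes D. \<Sum>h\<in>?S. inv_kostka g h * (int (fixn D (row_content h) \<sigma>) * irr D f \<sigma>))"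
    unfolding irr_def[of D g] g(2) sum_distrib_left by (intro sum.cong refl) (simp add: algebra_simps)
  also have "\<dots> = (\<Sum>h\<in>?S. inv_kostka g h * (\<Sum>\<sigma> | \<sigma> permutes D. int (fixn D (row_content h) \<sigma>) * irr D f \<sigma>))"
    unfolding sum_distrib_left by (rule sum.swap)
  also have "\<dots> = (\<Sum>h\<in>?S. fact (card D) * (inv_kostka g h * int (kostka f (row_content h))))"
    using sum_fixn_irr[OF D f] by (intro sum.cong refl) (auto simp: size_row_content)
  also have "\<dots> = fact (card D) * (if f = g then 1 else 0)"
    unfolding sum_distrib_left[symmetric] using inv_kostka[OF g(1) f(1)] f g by simp
  finally show ?thesis by simp
qed

text \<open>The difference of the two sides has norm zero.\<close>

lemma fixn_eq_sum_irr:
  assumes D: "finite D" and B: "size B = card D" and \<sigma>: "\<sigma> permutes D"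
  shows "int (fixn D B \<sigma>) = (\<Sum>f | shape f \<and> sz f = card D. int (kostka f B) * irr D f \<sigma>)"
proof -
  let ?S = "{f. shape f \<and> sz f = card D}" and ?G = "{\<sigma>. \<sigma> permutes D}"
  let ?n = "fact (card D) :: int" and ?K = "\<lambda>f. int (kostka f B)"
  define s where "s \<sigma> = (\<Sum>f\<in>?S. ?K f * irr D f \<sigma>)" for \<sigma>
  have fs: "(\<Sum>\<sigma>\<in>?G. int (fixn D B \<sigma>) * s \<sigma>) = ?n * (\<Sum>f\<in>?S. ?K f * ?K f)"
  proof -
    have "(\<Sum>\<sigma>\<in>?G. int (fixn D B \<sigma>) * s \<sigma>) = (\<Sum>\<sigma>\<in>?G. \<Sum>f\<in>?S. ?K f * (int (fixn D B \<sigma>) * irr D f \<sigma>))"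
      unfolding s_def sum_distrib_left by (intro sum.cong refl) (simp add: algebra_simps)
    also have "\<dots> = (\<Sum>f\<in>?S. ?K f * (\<Sum>\<sigma>\<in>?G. int (fixn D B \<sigma>) * irr D f \<sigma>))"
      unfolding sum_distrib_left by (rule sum.swap)
    also have "\<dots> = (\<Sum>f\<in>?S. ?n * (?K f * ?K f))"
      using sum_fixn_irr[OF D _ _ B] by (intro sum.cong refl) auto
    finally show ?thesis by (simp add: sum_distrib_left)
  qed
  have ss: "(\<Sum>\<sigma>\<in>?G. s \<sigma> * s \<sigma>) = ?n * (\<Sum>f\<in>?S. ?K f * ?K f)"
  proof -
    have "(\<Sum>\<sigma>\<in>?G. s \<sigma> * s \<sigma>) = (\<Sum>\<sigma>\<in>?G. \<Sum>f\<in>?S. \<Sum>g\<in>?S. ?K f * ?K g * (irr D f \<sigma> * irr D g \<sigma>))"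
      unfolding s_def sum_product by (intro sum.cong refl) (simp add: algebra_simps)
    also have "\<dots> = (\<Sum>f\<in>?S. \<Sum>\<sigma>\<in>?G. \<Sum>g\<in>?S. ?K f * ?K g * (irr D f \<sigma> * irr D g \<sigma>))" by (rule sum.swap)
    also have "\<dots> = (\<Sum>f\<in>?S. \<Sum>g\<in>?S. ?K f * ?K g * (\<Sum>\<sigma>\<in>?G. irr D f \<sigma> * irr D g \<sigma>))"
      unfolding sum_distrib_left by (intro sum.cong refl sum.swap)
    also have "\<dots> = (\<Sum>f\<in>?S. \<Sum>g\<in>?S. if g = f then ?n * (?K f * ?K f) else 0)"
      using sum_irr_irr[OF D] by (intro sum.cong refl) auto
    also have "\<dots> = (\<Sum>f\<in>?S. ?n * (?K f * ?K f))" using finite_shapes by (intro sum.cong refl) (simp add: sum.delta)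
    finally show ?thesis by (simp add: sum_distrib_left)
  qed
  have ff: "(\<Sum>\<sigma>\<in>?G. int (fixn D B \<sigma>) * int (fixn D B \<sigma>)) = ?n * (\<Sum>f\<in>?S. ?K f * ?K f)"
  proof -
    have "(\<Sum>\<sigma>\<in>?G. int (fixn D B \<sigma>) * int (fixn D B \<sigma>)) = int (\<Sum>\<sigma>\<in>?G. fixn D B \<sigma> * fixn D B \<sigma>)" by simp
    also have "\<dots> = int (fact (card D) * (\<Sum>f\<in>?S. kostka f B * kostka f B))"
      unfolding sum_fixn_mult[OF D B] kostka_cauchy_sizes[OF B B] ..
    finally show ?thesis by simp
  qed
  have "(\<Sum>\<sigma>\<in>?G. (int (fixn D B \<sigma>) - s \<sigma>)\<^sup>2)
    = (\<Sum>\<sigma>\<in>?G. int (fixn D B \<sigma>) * int (fixn D B \<sigma>)) - 2 * (\<Sum>\<sigma>\<in>?G. int (fixn D B \<sigma>) * s \<sigma>) + (\<Sum>\<sigma>\<in>?G. s \<sigma> * s \<sigma>)"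
    unfolding sum_distrib_left sum_subtractf[symmetric] sum.distrib[symmetric]
    by (intro sum.cong refl) (simp add: power2_eq_square algebra_simps)
  also have "\<dots> = 0" unfolding fs ss ff by simp
  finally have "\<forall>\<sigma>\<in>?G. (int (fixn D B \<sigma>) - s \<sigma>)\<^sup>2 = 0"
    using finite_permutations[OF D] by (subst (asm) sum_nonneg_eq_0_iff) auto
  then show ?thesis using \<sigma> by (simp add: s_def)
qed

text \<open>A word with distinct letters has trivial stabilizer: this is the regular
  character.\<close>

lemma fixn_distinct:
  assumes D: "finite D" and \<sigma>0: "\<sigma> permutes D"
  shows "fixn D (mset_set {..<card D}) \<sigma> = (if \<sigma> = id then fact (card D) else 0)"
proof -
  let ?M = "mset_set {..<card D}"
  have z: "fixn D ?M \<sigma> = 0" if \<sigma>: "\<sigma> permutes D" "\<sigma> \<noteq> id" for \<sigma>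
  proof -
    have "w \<circ> \<sigma> \<noteq> w" if w: "w \<in> content_words D ?M" for w
    proof
      assume fx: "w \<circ> \<sigma> = w"
      have c: "image_mset w (mset_set D) = ?M" using w by (simp add: content_words_def)
      have "w ` D = {..<card D}" using arg_cong[OF c, of set_mset] D by simp
      then have "inj_on w D" using D by (intro eq_card_imp_inj_on) auto
      have "\<sigma> i = i" for i
      proof (cases "i \<in> D")
        case True
        then have "\<sigma> i \<in> D" using permutes_in_image[OF \<sigma>(1)] by blast
        moreover have "w (\<sigma> i) = w i" using fun_cong[OF fx, of i] by simp
        ultimately show ?thesis using \<open>inj_on w D\<close> True by (auto dest: inj_onD)
      qed (use permutes_not_in[OF \<sigma>(1)] in auto)
      then show False using \<sigma>(2) by auto
    qed
    then have "{w \<in> content_words D ?M. w \<circ> \<sigma> = w} = {}" by blast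
    then show ?thesis unfolding fixn_def by (simp only: card.empty)
  qed
  have "(\<Sum>\<sigma> | \<sigma> permutes D. fixn D ?M \<sigma>) = (\<Sum>\<sigma> | \<sigma> permutes D. if \<sigma> = id then fixn D ?M id else 0)"
    using z by (intro sum.cong) auto
  also have "\<dots> = fixn D ?M id" using finite_permutations[OF D] permutes_id by (simp add: sum.delta)
  finally have "fixn D ?M id = fact (card D)" using sum_fixn[OF D, of ?M] by simp
  then show ?thesis using z \<sigma>0 by auto
qed

text \<open>Pairing with the regular character exhibits the degree as a Kostka number. The sign
  later rules out the negative of a character.\<close>

lemma irr_id_nonneg:
  assumes D: "finite D" and f: "shape f" "sz f = card D"
  shows "irr D f id \<ge> 0"
proof -
  have "(\<Sum>\<sigma> | \<sigma> permutes D. int (fixn D (mset_set {..<card D}) \<sigma>) * irr D f \<sigma>)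
    = (\<Sum>\<sigma> | \<sigma> permutes D. if \<sigma> = id then fact (card D) * irr D f id else 0)"
    using fixn_distinct[OF D] by (intro sum.cong) auto
  also have "\<dots> = fact (card D) * irr D f id"
    using finite_permutations[OF D] permutes_id by (simp add: sum.delta)
  finally have "fact (card D) * irr D f id = fact (card D) * int (kostka f (mset_set {..<card D}))"
    using sum_fixn_irr[OF D f] by simp
  then show ?thesis by simp
qed

text \<open>A permutation and its inverse fix the same words. This turns the norm with inverses in
  \<open>virtual_norm_one\<close> into the sum of squares computed by
  \<open>sum_irr_irr\<close>.\<close>

lemma fixn_inv: assumes "\<sigma> permutes D" shows "fixn D B (finv \<sigma>) = fixn D B \<sigma>"
proof -
  have "w \<circ> finv \<sigma> = w \<longleftrightarrow> w \<circ> \<sigma> = w" for w :: "'a \<Rightarrow> 'b"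
    by (metis comp_assoc comp_id permutes_inv_o(1)[OF assms] permutes_inv_o(2)[OF assms])
  then show ?thesis by (simp add: fixn_def)
qed

lemma irr_inv: "\<sigma> permutes D \<Longrightarrow> irr D f (finv \<sigma>) = irr D f \<sigma>"
  by (simp add: irr_def fixn_inv)

text \<open>\<open>irr D f\<close> is realised as a difference of two permutation characters, one
  for each sign in its inverse Kostka expansion. Its norm is one, so \<open>virtual_norm_one\<close>
  makes it plus or minus a genuine character, and \<open>isotypic_dimension\<close> applies.\<close>

theorem irr_isotypic:
  fixes D :: "'i set" and om :: "('i \<Rightarrow> 'i) \<Rightarrow> complex"
  assumes D: "finite D" and f: "shape f" "sz f = card D"
    and H: "H \<subseteq> {\<sigma>. \<sigma> permutes D}" "id \<in> H" "\<And>f g. f \<in> H \<Longrightarrow> g \<in> H \<Longrightarrow> f \<circ> g \<in> H"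
    and om: "\<And>f g. f \<in> H \<Longrightarrow> g \<in> H \<Longrightarrow> om (f \<circ> g) = om f * om g"
    and H': "H' \<subseteq> H" "id \<in> H'" "\<And>f g. f \<in> H' \<Longrightarrow> g \<in> H' \<Longrightarrow> f \<circ> g \<in> H'"
  shows "\<exists>k::nat. (\<Sum>h\<in>H. om h / of_nat (card H) * of_int (irr D f h)) = of_nat k"
    "\<exists>k::nat. (\<Sum>h\<in>H'. om h / of_nat (card H') * of_int (irr D f h)) = (\<Sum>h\<in>H. om h / of_nat (card H) * of_int (irr D f h)) + of_nat k"
proof -
  let ?S = "{h. shape h \<and> sz h = sz f}"
  let ?a = "inv_kostka f"
  \<comment> \<open>One index for each unit in the absolute value of \<open>?a h\<close>;
    \<open>Om\<close> is a disjoint union of that many copies of each module of words, and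
    \<open>act\<close> moves only the word.\<close>
  define I where "I = (SIGMA h:?S. {..<nat \<bar>?a h\<bar>})"
  define Om where "Om = (SIGMA t:I. content_words D (row_content (fst t)))"
  define act where "act \<sigma> u = (fst u, snd u \<circ> \<sigma>)" for \<sigma> :: "'i \<Rightarrow> 'i" and u :: "((nat \<Rightarrow> nat) \<times> nat) \<times> ('i \<Rightarrow> nat)"
  have finI: "finite I" unfolding I_def using finite_shapes by auto
  interpret perm_rep D Om act
  proof
    show "finite D" by (rule D)
    show "finite Om" unfolding Om_def using finI finite_content_words[OF D] by auto
    show "act g u \<in> Om" if "g permutes D" "u \<in> Om" for g u
      using that content_words_comp by (auto simp: act_def Om_def)
    show "act id u = u" for u by (simp add: act_def)
    show "act (f \<circ> g) u = act g (act f u)" for f g u by (simp add: act_def comp_assoc)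
  qed
  \<comment> \<open>The diagonal projection onto the copies selected by \<open>c\<close>; it is
    equivariant because the action preserves the copy.\<close>
  define dg where "dg c u v = (if u \<in> Om \<and> u = v \<and> c (fst u) then 1 else 0 :: complex)" for c u v
  have dgR: "mmul Om (R g) (dg c) = (\<lambda>u v. if c (fst v) then R g u v else 0)" for g c
  proof (intro ext)
    fix u v
    have "mmul Om (R g) (dg c) u v = (\<Sum>k\<in>Om. if k = v then (if c (fst v) then R g u v else 0) else 0)"
      unfolding mmul_def dg_def by (intro sum.cong) auto
    then show "mmul Om (R g) (dg c) u v = (if c (fst v) then R g u v else 0)"
      using finOm by (simp add: sum.delta) (auto simp: R_def)
  qed
  have Rdg: "mmul Om (dg c) (R g) = (\<lambda>u v. if c (fst u) then R g u v else 0)" for g c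
  proof (intro ext)
    fix u v
    have "mmul Om (dg c) (R g) u v = (\<Sum>k\<in>Om. if k = u then (if c (fst u) then R g u v else 0) else 0)"
      unfolding mmul_def dg_def by (intro sum.cong) auto
    then show "mmul Om (dg c) (R g) u v = (if c (fst u) then R g u v else 0)"
      using finOm by (simp add: sum.delta) (auto simp: R_def)
  qed
  have sdg: "msupp Om (dg c)" for c by (auto simp: msupp_def dg_def)
  have edg: "eqvi (dg c)" for c unfolding eqvi_def eqv_def
  proof (intro conjI ballI)
    show "msupp Om (dg c)" by (rule sdg)
    show "mmul Om (R g) (dg c) = mmul Om (dg c) (R g)" if "g \<in> G" for g
    proof -
      have "fst u = fst v" if "R g u v \<noteq> 0" for u v
        using that by (auto simp: R_def act_def split: if_splits)
      then show ?thesis unfolding dgR Rdg by (metis (no_types, opaque_lifting))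
    qed
    show "mmul Om (dg c) (dg c) = dg c"
    proof (intro ext)
      fix u v
      have "mmul Om (dg c) (dg c) u v = (\<Sum>k\<in>Om. if k = u then dg c u v else 0)"
        unfolding mmul_def dg_def by (intro sum.cong) auto
      then show "mmul Om (dg c) (dg c) u v = dg c u v" using finOm by (auto simp: sum.delta dg_def)
    qed
  qed
  \<comment> \<open>The copies with positive and those with negative coefficient; the difference of
    their characters is \<open>irr D f\<close>.\<close>
  let ?P = "dg (\<lambda>t. ?a (fst t) > 0)" and ?Q = "dg (\<lambda>t. ?a (fst t) < 0)"
  have chi: "chi ?P g - chi ?Q g = of_int (irr D f g)" if "g \<in> G" for g
  proof -
    let ?e = "\<lambda>t :: (nat \<Rightarrow> nat) \<times> nat. of_int (sgn (?a (fst t))) :: complex"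
    have "chi ?P g - chi ?Q g = (\<Sum>u\<in>Om. ?e (fst u) * (if snd u \<circ> g = snd u then 1 else 0))"
      unfolding chi_def mtrace_def dgR sum_subtractf[symmetric]
      by (intro sum.cong refl) (auto simp: R_def act_def prod_eq_iff)
    also have "\<dots> = (\<Sum>t\<in>I. \<Sum>w\<in>content_words D (row_content (fst t)). ?e t * (if w \<circ> g = w then 1 else 0))"
      unfolding Om_def using finI finite_content_words[OF D] by (subst sum.Sigma) (auto simp: split_def)
    also have "\<dots> = (\<Sum>t\<in>I. ?e t * of_nat (fixn D (row_content (fst t)) g))"
    proof (intro sum.cong refl)
      fix t :: "(nat \<Rightarrow> nat) \<times> nat"
      let ?W = "content_words D (row_content (fst t)) :: ('i \<Rightarrow> nat) set"
      have "finite ?W" by (rule finite_content_words[OF D])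
      then have "(\<Sum>w\<in>?W. if w \<circ> g = w then 1 else 0) = (of_nat (fixn D (row_content (fst t)) g) :: complex)"
        unfolding fixn_def by (simp only: sum.inter_filter[symmetric] sum_constant of_nat_mult[symmetric] mult_1_right)
      then show "(\<Sum>w\<in>?W. ?e t * (if w \<circ> g = w then 1 else 0)) = ?e t * of_nat (fixn D (row_content (fst t)) g)"
        by (simp only: sum_distrib_left[symmetric])
    qed
    also have "\<dots> = (\<Sum>h\<in>?S. \<Sum>k<nat \<bar>?a h\<bar>. of_int (sgn (?a h)) * of_nat (fixn D (row_content h) g))"
      unfolding I_def using finite_shapes by (subst sum.Sigma) (auto simp: split_def)
    also have "\<dots> = (\<Sum>h\<in>?S. of_int (?a h * int (fixn D (row_content h) g)))"
    proof (intro sum.cong refl)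
      fix h
      have "of_nat (nat \<bar>?a h\<bar>) * of_int (sgn (?a h)) = (of_int (?a h) :: complex)"
        by (cases "?a h" "0 :: int" rule: linorder_cases) auto
      then show "(\<Sum>k<nat \<bar>?a h\<bar>. of_int (sgn (?a h)) * of_nat (fixn D (row_content h) g))
        = (of_int (?a h * int (fixn D (row_content h) g)) :: complex)"
        by (simp add: mult.assoc[symmetric])
    qed
    finally show ?thesis by (simp add: irr_def)
  qed
  have GG: "G = {\<sigma>. \<sigma> permutes D}" by (simp add: G_def)
  have cG: "card G = fact (card D)" unfolding GG using D by (intro card_permutations) auto
  have "(\<Sum>g\<in>G. (chi ?P g - chi ?Q g) * (chi ?P (finv g) - chi ?Q (finv g)))
    = (\<Sum>g\<in>G. of_int (irr D f g * irr D f g))"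
    using chi inv_G by (intro sum.cong refl) (simp add: irr_inv GG)
  also have "\<dots> = of_int (\<Sum>g\<in>G. irr D f g * irr D f g)" by simp
  also have "\<dots> = of_nat (card G)" unfolding GG using sum_irr_irr[OF D f f] cG[unfolded GG] by simp
  finally have nrm: "(\<Sum>g\<in>G. (chi ?P g - chi ?Q g) * (chi ?P (finv g) - chi ?Q (finv g))) = of_nat (card G)" .
  obtain Z where Z: "eqvi Z" and
    pm: "(\<forall>g\<in>G. chi ?P g - chi ?Q g = chi Z g) \<or> (\<forall>g\<in>G. chi ?P g - chi ?Q g = - chi Z g)"
    using virtual_norm_one[OF edg edg nrm] by blast
  have cZ: "chi Z g = of_int (irr D f g)" if "g \<in> G" for g
  proof (cases "\<forall>g\<in>G. chi ?P g - chi ?Q g = chi Z g")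
    case True
    then show ?thesis using chi that by simp
  next
    case False
    \<comment> \<open>If \<open>irr\<close> is minus a character, its value at the identity is
      nonnegative and also minus a dimension. Then \<open>Z\<close> is zero, and the required
      equation holds all the same.\<close>
    then have neg: "\<forall>g\<in>G. of_int (irr D f g) = - chi Z g" using pm chi by auto
    have sZ: "msupp Om Z" using Z by (simp add: eqvi_def eqv_def)
    obtain k :: nat where k: "mtrace Om Z = of_nat k" "k = 0 \<longrightarrow> Z = (\<lambda>_ _. 0)"
      using idempotent_trace[OF finOm sZ] Z by (auto simp: eqvi_def)
    have "chi Z id = of_nat k" using k(1) R_id(1)[OF sZ] by (simp add: chi_def)
    then have "of_int (irr D f id) = (of_int (- int k) :: complex)" using neg id_G by simp
    then have "irr D f id = - int k" by (simp only: of_int_eq_iff)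
    then have "k = 0" using irr_id_nonneg[OF D f] by simp
    then have "chi Z g = 0" for g using k(2) by (simp add: chi_def mmul_def mtrace_def)
    then show ?thesis using neg that by simp
  qed
  have HG: "H \<subseteq> G" using H(1) GG by simp
  have e: "(\<Sum>h\<in>K. om h / of_nat (card K) * chi Z h) = (\<Sum>h\<in>K. om h / of_nat (card K) * of_int (irr D f h))"
    if "K \<subseteq> G" for K using cZ that by (intro sum.cong refl) auto
  have H'G: "H' \<subseteq> G" using H'(1) HG by blast
  note dims = isotypic_dimension[of Z H om H', OF Z HG H(2) H(3) om H'(1) H'(2) H'(3)]
  show "\<exists>k::nat. (\<Sum>h\<in>H. om h / of_nat (card H) * of_int (irr D f h)) = of_nat k"
    using dims(1) unfolding e[OF HG] .
  show "\<exists>k::nat. (\<Sum>h\<in>H'. om h / of_nat (card H') * of_int (irr D f h)) = (\<Sum>h\<in>H. om h / of_nat (card H) * of_int (irr D f h)) + of_nat k"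
    using dims(2) unfolding e[OF HG] e[OF H'G] .
qed

section \<open>Power sums of permutations and Schur polynomials\<close>

text \<open>A word is fixed by \<open>\<sigma>\<close> when it is constant on cycles, so this is the
  power sum polynomial of the cycle type. Keeping the words explicit avoids cycle types
  altogether.\<close>

definition psum :: "'i set \<Rightarrow> nat \<Rightarrow> (nat \<Rightarrow> complex) \<Rightarrow> ('i \<Rightarrow> 'i) \<Rightarrow> complex" where
  "psum D N x \<sigma> = (\<Sum>w | w \<in> D \<rightarrow>\<^sub>E {..<N} \<and> w \<circ> \<sigma> = w. \<Prod>i\<in>D. x (w i))"

definition letter_msets :: "nat \<Rightarrow> nat \<Rightarrow> nat multiset set" where
  "letter_msets N n = {B. set_mset B \<subseteq> {..<N} \<and> size B = n}"

lemma finite_letter_msets: "finite (letter_msets N n)"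
  unfolding letter_msets_def by (rule finite_msets_size) simp

lemma prod_eq_prod_mset: "finite D \<Longrightarrow> (\<Prod>i\<in>D. x (w i)) = prod_mset (image_mset x (image_mset w (mset_set D)))"
  by (simp add: prod_unfold_prod_mset multiset.map_comp o_def)

lemma sum_by_content:
  fixes g :: "nat multiset \<Rightarrow> complex"
  assumes "finite W" "\<And>w. w \<in> W \<Longrightarrow> c w \<in> letter_msets N n"
  shows "(\<Sum>w\<in>W. g (c w)) = (\<Sum>B\<in>letter_msets N n. of_nat (card {w \<in> W. c w = B}) * g B)"
proof -
  have "(\<Sum>w\<in>W. g (c w)) = (\<Sum>B\<in>letter_msets N n. \<Sum>w | w \<in> W \<and> c w = B. g (c w))"
    using assms finite_letter_msets by (intro sum.group[symmetric]) auto
  also have "\<dots> = (\<Sum>B\<in>letter_msets N n. of_nat (card {w \<in> W. c w = B}) * g B)"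
    by (intro sum.cong refl) simp
  finally show ?thesis .
qed

lemma psum_content:
  assumes D: "finite D"
  shows "psum D N x \<sigma> = (\<Sum>B\<in>letter_msets N (card D). of_nat (fixn D B \<sigma>) * prod_mset (image_mset x B))"
proof -
  have "psum D N x \<sigma> = (\<Sum>w | w \<in> D \<rightarrow>\<^sub>E {..<N} \<and> w \<circ> \<sigma> = w. prod_mset (image_mset x (image_mset w (mset_set D))))"
    unfolding psum_def by (simp add: prod_eq_prod_mset[OF D])
  also have "\<dots> = (\<Sum>B\<in>letter_msets N (card D). of_nat (card {w \<in> {w. w \<in> D \<rightarrow>\<^sub>E {..<N} \<and> w \<circ> \<sigma> = w}. image_mset w (mset_set D) = B}) * prod_mset (image_mset x B))"
  proof (rule sum_by_content)
    show "finite {w. w \<in> D \<rightarrow>\<^sub>E {..<N} \<and> w \<circ> \<sigma> = w}"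
      by (rule finite_subset[of _ "D \<rightarrow>\<^sub>E {..<N}"]) (auto intro: finite_PiE D)
  qed (use D in \<open>auto simp: letter_msets_def\<close>)
  also have "\<dots> = (\<Sum>B\<in>letter_msets N (card D). of_nat (fixn D B \<sigma>) * prod_mset (image_mset x B))"
  proof (intro sum.cong refl arg_cong2[where f = "(*)"] arg_cong[where f = of_nat])
    fix B assume B: "B \<in> letter_msets N (card D)"
    have "{w \<in> {w. w \<in> D \<rightarrow>\<^sub>E {..<N} \<and> w \<circ> \<sigma> = w}. image_mset w (mset_set D) = B} = {w \<in> content_words D B. w \<circ> \<sigma> = w}"
    proof (intro Collect_eqI iffI; clarsimp simp: content_words_def PiE_iff)
      fix w i assume "i \<in> D" and c: "B = image_mset w (mset_set D)"
      then have "w i \<in># B" using D by simp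
      then show "w i < N" using B by (auto simp: letter_msets_def)
    qed
    then show "card {w \<in> {w. w \<in> D \<rightarrow>\<^sub>E {..<N} \<and> w \<circ> \<sigma> = w}. image_mset w (mset_set D) = B} = fixn D B \<sigma>"
      by (simp add: fixn_def)
  qed
  finally show ?thesis .
qed

lemma schur_poly_content:
  assumes mu: "mu \<in> partitions n"
  shows "schur_poly N mu x = (\<Sum>B\<in>letter_msets N n. of_nat (kostka (row_of mu) B) * prod_mset (image_mset x B))"
proof -
  let ?f = "row_of mu"
  note f = shape_row_of[OF mu]
  have D: "finite (scells ?f)" by (rule finite_scells[OF f])
  have SS: "SSYT mu N = {T \<in> scells ?f \<rightarrow>\<^sub>E {..<N}. (\<forall>r c c'. c < c' \<longrightarrow> c' < ?f r \<longrightarrow> T (r, c) \<le> T (r, c')) \<and>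
     (\<forall>r r' c. r < r' \<longrightarrow> c < ?f r' \<longrightarrow> T (r, c) < T (r', c))}"
  proof -
    have "(\<forall>r c c'. (r, c) \<in> scells ?f \<longrightarrow> (r, c') \<in> scells ?f \<longrightarrow> c < c' \<longrightarrow> T (r, c) \<le> T (r, c'))
        \<longleftrightarrow> (\<forall>r c c'. c < c' \<longrightarrow> c' < ?f r \<longrightarrow> T (r, c) \<le> T (r, c'))" for T :: "nat \<times> nat \<Rightarrow> nat"
      by (auto simp: scells_def)
    moreover have "(\<forall>r r' c. (r, c) \<in> scells ?f \<longrightarrow> (r', c) \<in> scells ?f \<longrightarrow> r < r' \<longrightarrow> T (r, c) < T (r', c))
        \<longleftrightarrow> (\<forall>r r' c. r < r' \<longrightarrow> c < ?f r' \<longrightarrow> T (r, c) < T (r', c))" for T :: "nat \<times> nat \<Rightarrow> nat"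
      using shape_antimono[OF f] by (auto simp: scells_def) (meson less_imp_le order.strict_trans2)
    ultimately show ?thesis unfolding SSYT_def cells_eq_scells by simp
  qed
  have fin: "finite (SSYT mu N)"
    unfolding SS by (rule finite_subset[of _ "scells ?f \<rightarrow>\<^sub>E {..<N}"]) (auto intro: finite_PiE D)
  have "schur_poly N mu x = (\<Sum>T\<in>SSYT mu N. prod_mset (image_mset x (image_mset T (mset_set (scells ?f)))))"
    unfolding schur_poly_def cells_eq_scells by (simp add: prod_eq_prod_mset[OF D])
  also have "\<dots> = (\<Sum>B\<in>letter_msets N n. of_nat (card {T \<in> SSYT mu N. image_mset T (mset_set (scells ?f)) = B}) * prod_mset (image_mset x B))"
  proof (rule sum_by_content[OF fin])
    fix T assume "T \<in> SSYT mu N"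
    then show "image_mset T (mset_set (scells ?f)) \<in> letter_msets N n"
      using D sz_row_of[OF mu] by (auto simp: letter_msets_def SS sz_def)
  qed
  also have "\<dots> = (\<Sum>B\<in>letter_msets N n. of_nat (kostka ?f B) * prod_mset (image_mset x B))"
  proof (intro sum.cong refl arg_cong2[where f = "(*)"] arg_cong[where f = of_nat])
    fix B assume B: "B \<in> letter_msets N n"
    have "T \<in> scells ?f \<rightarrow>\<^sub>E {..<N}" if "T \<in> extensional (scells ?f)" "image_mset T (mset_set (scells ?f)) = B" for T
    proof (rule PiE_I)
      fix u assume "u \<in> scells ?f"
      then have "T u \<in># B" using that D by auto
      then show "T u \<in> {..<N}" using B by (auto simp: letter_msets_def)
    qed (use that in \<open>auto simp: extensional_def\<close>)
    then have "{T \<in> SSYT mu N. image_mset T (mset_set (scells ?f)) = B} = ssyt ?f B"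
      unfolding SS ssyt_def by (auto simp: PiE_iff)
    then show "card {T \<in> SSYT mu N. image_mset T (mset_set (scells ?f)) = B} = kostka ?f B"
      by (simp add: kostka_def)
  qed
  finally show ?thesis .
qed

text \<open>Frobenius' formula, read off monomial by monomial from
  \<open>fixn_eq_sum_irr\<close>.\<close>

theorem psum_eq_schur:
  assumes D: "finite D" and \<sigma>: "\<sigma> permutes D"
  shows "psum D N x \<sigma> = (\<Sum>mu\<in>partitions (card D). of_int (irr D (row_of mu) \<sigma>) * schur_poly N mu x)"
proof -
  let ?n = "card D"
  let ?x = "\<lambda>B. prod_mset (image_mset x B)"
  have "psum D N x \<sigma> = (\<Sum>B\<in>letter_msets N ?n. (\<Sum>f | shape f \<and> sz f = ?n. of_nat (kostka f B) * of_int (irr D f \<sigma>)) * ?x B)"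
  proof -
    have "(of_nat (fixn D B \<sigma>) :: complex) = (\<Sum>f | shape f \<and> sz f = ?n. of_nat (kostka f B) * of_int (irr D f \<sigma>))"
      if "B \<in> letter_msets N ?n" for B
    proof -
      have "size B = ?n" using that by (simp add: letter_msets_def)
      from fixn_eq_sum_irr[OF D this \<sigma>] have "(of_int (int (fixn D B \<sigma>)) :: complex) = of_int (\<Sum>f | shape f \<and> sz f = ?n. int (kostka f B) * irr D f \<sigma>)"
        by (rule arg_cong)
      then show ?thesis by simp
    qed
    then show ?thesis unfolding psum_content[OF D] by (intro sum.cong refl) simp
  qed
  also have "\<dots> = (\<Sum>B\<in>letter_msets N ?n. \<Sum>f | shape f \<and> sz f = ?n. of_int (irr D f \<sigma>) * (of_nat (kostka f B) * ?x B))"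
    unfolding sum_distrib_right by (intro sum.cong refl) (simp add: algebra_simps)
  also have "\<dots> = (\<Sum>f | shape f \<and> sz f = ?n. of_int (irr D f \<sigma>) * (\<Sum>B\<in>letter_msets N ?n. of_nat (kostka f B) * ?x B))"
    unfolding sum_distrib_left by (rule sum.swap)
  also have "\<dots> = (\<Sum>mu\<in>partitions ?n. of_int (irr D (row_of mu) \<sigma>) * (\<Sum>B\<in>letter_msets N ?n. of_nat (kostka (row_of mu) B) * ?x B))"
    by (rule sum.reindex_bij_betw[OF bij_row_of, symmetric])
  also have "\<dots> = (\<Sum>mu\<in>partitions ?n. of_int (irr D (row_of mu) \<sigma>) * schur_poly N mu x)"
    using schur_poly_content by (intro sum.cong refl) simp
  finally show ?thesis .
qed

section \<open>The major index modulo the length\<close>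

definition words :: "nat \<Rightarrow> nat \<Rightarrow> nat list set" where
  "words N m = {u. length u = m \<and> set u \<subseteq> {..<N}}"

definition letter_prod :: "(nat \<Rightarrow> complex) \<Rightarrow> nat list \<Rightarrow> complex" where
  "letter_prod x u = prod_list (map x u)"

definition maj_word :: "nat list \<Rightarrow> nat" where "maj_word u = \<Sum>(wdes u)"

lemma finite_words: "finite (words N m)"
  using finite_lists_length_eq[of "{..<N}" m] by (auto simp: words_def conj_commute)

lemma letter_prod_append: "letter_prod x (u @ v) = letter_prod x u * letter_prod x v" by (simp add: letter_prod_def)

lemma letter_prod_eq_prod: "letter_prod x u = (\<Prod>i<length u. x (u ! i))"
  by (simp add: letter_prod_def prod.list_conv_set_nth atLeast0LessThan)

lemma letter_prod_mset: "letter_prod x u = prod_mset (image_mset x (mset u))"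
  by (metis letter_prod_def mset_map prod_mset_prod_list)

lemma sum_words_append:
  fixes F :: "nat list \<Rightarrow> 'c :: comm_monoid_add"
  shows "(\<Sum>w\<in>words N (a + b). F w) = (\<Sum>u\<in>words N a. \<Sum>v\<in>words N b. F (u @ v))"
proof -
  have "(\<Sum>u\<in>words N a. \<Sum>v\<in>words N b. F (u @ v)) = (\<Sum>p\<in>words N a \<times> words N b. F (fst p @ snd p))"
    by (simp add: sum.cartesian_product split_def)
  also have "\<dots> = (\<Sum>w\<in>words N (a + b). F w)"
    by (rule sum.reindex_bij_witness[of _ "\<lambda>w. (take a w, drop a w)" "\<lambda>p. fst p @ snd p"])
       (auto simp: words_def dest: in_set_takeD in_set_dropD)
  finally show ?thesis ..
qed

lemma sum_words_power: "(\<Sum>u\<in>words N m. letter_prod y u) = (\<Sum>a<N. y a) ^ m"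
proof (induction m)
  case 0
  have "words N 0 = {[]}" by (auto simp: words_def)
  then show ?case by (simp add: letter_prod_def)
next
  case (Suc m)
  have "words N 1 = (\<lambda>a. [a]) ` {..<N}" by (auto simp: words_def length_Suc_conv)
  then have 1: "(\<Sum>u\<in>words N 1. letter_prod y u) = (\<Sum>a<N. y a)"
    by (simp add: sum.reindex inj_on_def letter_prod_def)
  have "(\<Sum>w\<in>words N (1 + m). letter_prod y w) = (\<Sum>u\<in>words N 1. letter_prod y u) * (\<Sum>v\<in>words N m. letter_prod y v)"
    unfolding sum_words_append letter_prod_append sum_product ..
  then show ?case using 1 Suc by simp
qed

lemma power_mod_root: "\<eta> ^ d = 1 \<Longrightarrow> \<eta> ^ (n mod d) = (\<eta> :: complex) ^ n"
  by (metis div_mult_mod_eq mult.left_neutral power_add power_mult power_one mult.commute)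

lemma finite_wdes: "finite (wdes u)" by (rule finite_subset[of _ "{..<length u}"]) (auto simp: wdes_def)

lemma power_maj_word: "\<eta> ^ maj_word u = (\<Prod>i\<in>wdes u. (\<eta> :: complex) ^ i)"
  by (simp add: maj_word_def power_sum)

text \<open>
  Rotation shifts the set of cyclic descents, so a class of words with \<open>c\<close> cyclic descents
  is multiplied by \<open>\<eta> ^ c\<close>; only the words without cyclic descents survive.
\<close>

lemma sum_maj_word_primitive_root:
  assumes d: "d > 0" and root: "\<eta> ^ d = 1" and prim: "\<And>i. 0 < i \<Longrightarrow> i < d \<Longrightarrow> \<eta> ^ i \<noteq> (1 :: complex)"
  shows "(\<Sum>u\<in>words N d. \<eta> ^ maj_word u * letter_prod x u) = (\<Sum>a<N. x a ^ d)"
proof -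
  \<comment> \<open>The cyclic descents, shifted by one: \<open>i\<close> stands for the descent
    \<open>Suc i\<close>. The wrap-around descent has exponent \<open>d\<close> and contributes
    nothing, since \<open>\<eta> ^ d = 1\<close>.\<close>
  define C where "C u = {i. i < d \<and> u ! (Suc i mod d) < u ! i}" for u :: "nat list"
  define F where "F u = (\<Prod>i\<in>C u. \<eta> ^ Suc i) * letter_prod x u" for u
  have finC: "finite (C u)" for u unfolding C_def by (rule finite_subset[of _ "{..<d}"]) auto
  have maj: "\<eta> ^ maj_word u = (\<Prod>i\<in>C u. \<eta> ^ Suc i)" if u: "u \<in> words N d" for u
  proof -
    have len: "length u = d" using u by (simp add: words_def)
    have "(\<Prod>i\<in>C u. \<eta> ^ Suc i) = (\<Prod>i\<in>{i \<in> C u. Suc i < d}. \<eta> ^ Suc i)"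
    proof (rule prod.mono_neutral_right[OF finC])
      show "\<forall>i\<in>C u - {i \<in> C u. Suc i < d}. \<eta> ^ Suc i = 1"
      proof
        fix i assume "i \<in> C u - {i \<in> C u. Suc i < d}"
        then have "Suc i = d" by (auto simp: C_def)
        then show "\<eta> ^ Suc i = 1" using root by metis
      qed
    qed auto
    also have "\<dots> = (\<Prod>i\<in>wdes u. \<eta> ^ i)"
    proof (rule prod.reindex_bij_witness[of _ "\<lambda>i. i - 1" Suc])
      fix i assume "i \<in> {i \<in> C u. Suc i < d}"
      then have "Suc i < d" "u ! (Suc i mod d) < u ! i" by (auto simp: C_def)
      then show "Suc i \<in> wdes u" by (simp add: wdes_def len)
    qed (auto simp: C_def wdes_def len)
    finally show ?thesis by (simp add: power_maj_word)
  qed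
  define s where "s i = Suc i mod d" for i
  have bij: "bij_betw s (C (rotate1 u)) (C u)" if u: "u \<in> words N d" for u
  proof -
    have len: "length u = d" using u by (simp add: words_def)
    have rot: "rotate1 u ! i = u ! (Suc i mod d)" if "i < d" for i
      using nth_rotate1[of i u] that len by simp
    have s0: "bij_betw s {..<d} {..<d}"
    proof -
      have "inj_on s {..<d}"
        unfolding s_def by (rule inj_onI) (auto simp: mod_Suc split: if_splits)
      moreover have "s ` {..<d} \<subseteq> {..<d}" using d by (auto simp: s_def)
      ultimately show ?thesis by (simp add: bij_betw_def endo_inj_surj)
    qed
    have "i \<in> C (rotate1 u) \<longleftrightarrow> s i \<in> C u" if "i < d" for i
      using that d rot[of i] rot[of "Suc i mod d"] by (simp add: C_def s_def)
    then have "C (rotate1 u) = {i \<in> {..<d}. s i \<in> C u}" by (auto simp: C_def)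
    moreover have "C u \<subseteq> {..<d}" by (auto simp: C_def)
    moreover have "s ` {..<d} = {..<d}" using s0 by (simp add: bij_betw_def)
    ultimately have "s ` C (rotate1 u) = C u"
    proof (intro equalityI subsetI)
      fix j assume "C u \<subseteq> {..<d}" "s ` {..<d} = {..<d}" "j \<in> C u" and C: "C (rotate1 u) = {i \<in> {..<d}. s i \<in> C u}"
      then obtain i where "i \<in> {..<d}" "j = s i" by blast
      then show "j \<in> s ` C (rotate1 u)" unfolding C using \<open>j \<in> C u\<close> by blast
    qed blast
    moreover have "inj_on s (C (rotate1 u))"
      using s0 by (rule bij_betw_imp_inj_on[THEN inj_on_subset]) (auto simp: C_def)
    ultimately show ?thesis by (simp add: bij_betw_def)
  qed
  have rotF: "F u = \<eta> ^ card (C u) * F (rotate1 u)" and cardC: "card (C (rotate1 u)) = card (C u)"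
    if u: "u \<in> words N d" for u
  proof -
    show c: "card (C (rotate1 u)) = card (C u)" using bij[OF u] by (rule bij_betw_same_card)
    have "(\<Prod>i\<in>C u. \<eta> ^ Suc i) = (\<Prod>i\<in>C (rotate1 u). \<eta> ^ Suc (s i))"
      by (rule prod.reindex_bij_betw[OF bij[OF u], symmetric])
    also have "\<dots> = (\<Prod>i\<in>C (rotate1 u). \<eta> * \<eta> ^ Suc i)"
      by (intro prod.cong refl) (simp add: s_def power_mod_root[OF root])
    also have "\<dots> = \<eta> ^ card (C u) * (\<Prod>i\<in>C (rotate1 u). \<eta> ^ Suc i)"
      unfolding prod.distrib prod_constant c ..
    finally have 1: "(\<Prod>i\<in>C u. \<eta> ^ Suc i) = \<eta> ^ card (C u) * (\<Prod>i\<in>C (rotate1 u). \<eta> ^ Suc i)" .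
    have "letter_prod x (rotate1 u) = letter_prod x u" by (cases u) (simp_all add: letter_prod_def)
    then show "F u = \<eta> ^ card (C u) * F (rotate1 u)" by (simp only: F_def 1 mult.assoc)
  qed
  have rotw: "rotate1 u \<in> words N d \<longleftrightarrow> u \<in> words N d" for u by (simp add: words_def)
  let ?W = "\<lambda>c. {u \<in> words N d. card (C u) = c}"
  have zero: "(\<Sum>u\<in>?W c. F u) = 0" if c: "0 < c" "c < d" for c
  proof -
    have "bij_betw rotate1 (?W c) (?W c)"
    proof (rule bij_betw_imageI)
      have ij: "inj (rotate1 :: nat list \<Rightarrow> _)" by (rule inj_rotate1)
      then show "inj_on rotate1 (?W c)" by (rule inj_on_subset) simp
      have "rotate1 ` ?W c \<subseteq> ?W c" using cardC rotw by auto
      moreover have "finite (?W c)" using finite_words by simp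
      ultimately show "rotate1 ` ?W c = ?W c"
        using ij by (metis (no_types, lifting) endo_inj_surj inj_on_subset subset_UNIV)
    qed
    then have rot: "(\<Sum>u\<in>?W c. F (rotate1 u)) = (\<Sum>u\<in>?W c. F u)" by (rule sum.reindex_bij_betw)
    have "(\<Sum>u\<in>?W c. F u) = (\<Sum>u\<in>?W c. \<eta> ^ c * F (rotate1 u))"
      using rotF by (intro sum.cong refl) auto
    also have "\<dots> = \<eta> ^ c * (\<Sum>u\<in>?W c. F (rotate1 u))" by (rule sum_distrib_left[symmetric])
    also note rot
    finally have "(\<Sum>u\<in>?W c. F u) = \<eta> ^ c * (\<Sum>u\<in>?W c. F u)" .
    then have "(1 - \<eta> ^ c) * (\<Sum>u\<in>?W c. F u) = 0" by (simp add: algebra_simps)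
    then show ?thesis using prim[OF c] by auto
  qed
  \<comment> \<open>Descending at all \<open>d\<close> cyclic places would make the first letter
    smaller than itself. So \<open>c\<close> is 0 or lies strictly between 0 and \<open>d\<close>,
    where \<open>\<eta> ^ c\<close> differs from one.\<close>
  have cless: "card (C u) < d" if u: "u \<in> words N d" for u
  proof (rule ccontr)
    assume "\<not> card (C u) < d"
    moreover have "C u \<subseteq> {..<d}" by (auto simp: C_def)
    ultimately have "C u = {..<d}" by (intro card_subset_eq) (auto intro: le_antisym dest: card_mono[rotated])
    then have dec: "u ! (Suc i mod d) < u ! i" if "i < d" for i using that by (auto simp: C_def)
    have "u ! i \<le> u ! 0" if "i < d" for i
      using that
    proof (induction i)
      case (Suc i)
      then show ?case using dec[of i] by simp
    qed simp
    then have "u ! (d - 1) \<le> u ! 0" using d by simp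
    moreover have "Suc (d - 1) mod d = 0" using d by simp
    ultimately show False using dec[of "d - 1"] d by simp
  qed
  have const: "u = replicate d (u ! 0)" if u: "u \<in> words N d" and c: "C u = {}" for u
  proof (rule nth_equalityI)
    show "length u = length (replicate d (u ! 0))" using u by (simp add: words_def)
    have inc: "u ! i \<le> u ! (Suc i mod d)" if "i < d" for i
    proof -
      have "i \<notin> C u" using c by simp
      then show ?thesis using that by (simp add: C_def not_less)
    qed
    have ge: "u ! 0 \<le> u ! i" if "i < d" for i
      using that
    proof (induction i)
      case (Suc i)
      then show ?case using inc[of i] by simp
    qed simp
    have le: "u ! (d - Suc k) \<le> u ! 0" if "k < d" for k
      using that
    proof (induction k)
      case 0
      then show ?case using inc[of "d - 1"] d by simp
    next
      case (Suc k)
      then have "Suc (d - Suc (Suc k)) = d - Suc k" by simp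
      then show ?case using Suc inc[of "d - Suc (Suc k)"] by simp
    qed
    fix i assume "i < length u"
    then have i: "i < d" using u by (simp add: words_def)
    have "d - Suc (d - Suc i) = i" using i by simp
    then have "u ! i \<le> u ! 0" using le[of "d - Suc i"] i by simp
    then show "u ! i = replicate d (u ! 0) ! i" using ge[OF i] i by simp
  qed
  have "(\<Sum>u\<in>words N d. \<eta> ^ maj_word u * letter_prod x u) = (\<Sum>u\<in>words N d. F u)"
    using maj by (intro sum.cong) (auto simp: F_def)
  also have "\<dots> = (\<Sum>c<d. \<Sum>u\<in>?W c. F u)"
    using cless by (intro sum.group[symmetric] finite_words) auto
  also have "\<dots> = (\<Sum>c<d. if c = 0 then \<Sum>u\<in>?W 0. F u else 0)"
    using zero by (intro sum.cong) auto
  also have "\<dots> = (\<Sum>u\<in>?W 0. F u)" using d by simp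
  also have "?W 0 = {u \<in> words N d. C u = {}}" using finC by simp
  also have "\<dots> = replicate d ` {..<N}"
  proof (intro equalityI subsetI)
    fix u assume "u \<in> {u \<in> words N d. C u = {}}"
    then have "u = replicate d (u ! 0)" "u ! 0 < N"
      using const d by (auto simp: words_def subset_iff)
    then show "u \<in> replicate d ` {..<N}" by blast
  qed (use d in \<open>auto simp: words_def C_def\<close>)
  also have "(\<Sum>u\<in>replicate d ` {..<N}. F u) = (\<Sum>a<N. F (replicate d a))"
    using d by (subst sum.reindex) (auto simp: inj_on_def)
  also have "\<dots> = (\<Sum>a<N. x a ^ d)"
  proof (rule sum.cong[OF refl])
    fix a
    have "C (replicate d a) = {}" using d by (auto simp: C_def)
    then show "F (replicate d a) = x a ^ d" by (simp add: F_def letter_prod_def)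
  qed
  finally show ?thesis .
qed

lemma wdes_append:
  assumes "v \<noteq> []"
  obtains B where "B \<subseteq> {length v}" "wdes (v @ u) = wdes v \<union> B \<union> (\<lambda>i. length v + i) ` wdes u"
proof
  let ?B = "wdes (v @ u) \<inter> {length v}"
  show "?B \<subseteq> {length v}" by simp
  have "i \<in> wdes (v @ u) \<longleftrightarrow> i \<in> wdes v \<union> ?B \<union> (\<lambda>i. length v + i) ` wdes u" for i
  proof -
    consider "i < length v" | "i = length v" | k where "i = length v + k" "k > 0"
      by (metis less_imp_add_positive linorder_neqE_nat)
    then show ?thesis
    proof cases
      case 1 then show ?thesis by (auto simp: wdes_def nth_append)
    next
      case 2 then show ?thesis by (auto simp: wdes_def)
    next
      case 3
      then have "i - 1 = length v + (k - 1)" by simp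
      then show ?thesis using 3 by (auto simp: wdes_def nth_append)
    qed
  qed
  then show "wdes (v @ u) = wdes v \<union> ?B \<union> (\<lambda>i. length v + i) ` wdes u" by blast
qed

text \<open>A descent at the junction sits at position \<open>length v\<close>, and the descents of
  \<open>u\<close> are shifted by the same amount; powers of \<open>\<eta>\<close> see
  neither.\<close>

lemma power_maj_word_append:
  assumes "\<eta> ^ length v = (1 :: complex)" "v \<noteq> []"
  shows "\<eta> ^ maj_word (v @ u) = \<eta> ^ maj_word v * \<eta> ^ maj_word u"
proof -
  obtain B where B: "B \<subseteq> {length v}" "wdes (v @ u) = wdes v \<union> B \<union> (\<lambda>i. length v + i) ` wdes u"
    using wdes_append[OF assms(2)] by blast
  have lt: "i < length v" if "i \<in> wdes v" for i using that by (simp add: wdes_def)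
  have pos: "0 < i" if "i \<in> wdes u" for i using that by (simp add: wdes_def)
  have fB: "finite B" using B(1) by (rule finite_subset) simp
  have "\<eta> ^ maj_word (v @ u) = (\<Prod>i\<in>wdes v. \<eta> ^ i) * (\<Prod>i\<in>B. \<eta> ^ i) * (\<Prod>i\<in>(\<lambda>i. length v + i) ` wdes u. \<eta> ^ i)"
    unfolding power_maj_word B(2) using finite_wdes fB B(1) lt pos
    by (subst prod.union_disjoint; (subst prod.union_disjoint)?) (fastforce+)
  also have "(\<Prod>i\<in>B. \<eta> ^ i) = 1" using B(1) assms(1) by (intro prod.neutral) auto
  also have "(\<Prod>i\<in>(\<lambda>i. length v + i) ` wdes u. \<eta> ^ i) = (\<Prod>i\<in>wdes u. \<eta> ^ i)"
    by (subst prod.reindex) (auto simp: power_add assms(1))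
  finally show ?thesis by (simp add: power_maj_word)
qed

lemma sum_maj_word_root:
  assumes d: "d > 0" and root: "\<eta> ^ d = 1" and prim: "\<And>i. 0 < i \<Longrightarrow> i < d \<Longrightarrow> \<eta> ^ i \<noteq> (1 :: complex)"
  shows "(\<Sum>u\<in>words N (d * q). \<eta> ^ maj_word u * letter_prod x u) = (\<Sum>a<N. x a ^ d) ^ q"
proof (induction q)
  case 0
  have "words N 0 = {[]}" by (auto simp: words_def)
  then show ?case by (simp add: letter_prod_def maj_word_def wdes_def)
next
  case (Suc q)
  have "(\<Sum>u\<in>words N (d + d * q). \<eta> ^ maj_word u * letter_prod x u)
    = (\<Sum>v\<in>words N d. \<Sum>u\<in>words N (d * q). (\<eta> ^ maj_word v * letter_prod x v) * (\<eta> ^ maj_word u * letter_prod x u))"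
    unfolding sum_words_append
  proof (intro sum.cong refl)
    fix v u assume "v \<in> words N d"
    then have v: "length v = d" "v \<noteq> []" using d by (auto simp: words_def)
    then have "\<eta> ^ maj_word (v @ u) = \<eta> ^ maj_word v * \<eta> ^ maj_word u" using root by (intro power_maj_word_append) auto
    then show "\<eta> ^ maj_word (v @ u) * letter_prod x (v @ u) = (\<eta> ^ maj_word v * letter_prod x v) * (\<eta> ^ maj_word u * letter_prod x u)"
      by (simp add: letter_prod_append)
  qed
  also have "\<dots> = (\<Sum>a<N. x a ^ d) ^ Suc q"
  proof -
    have "(\<Sum>v\<in>words N d. \<eta> ^ maj_word v * letter_prod x v) = (\<Sum>a<N. x a ^ d)"
      by (rule sum_maj_word_primitive_root[OF d root]) (rule prim)
    then show ?thesis unfolding sum_product[symmetric] Suc.IH by simp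
  qed
  finally show ?case by simp
qed

text \<open>Some multiple of \<open>k\<close> is congruent to \<open>gcd k m\<close> modulo
  \<open>m\<close>, so invariance under rotation by \<open>k\<close> is invariance under rotation by
  the greatest common divisor.\<close>

lemma rotate_fixed_iff:
  assumes len: "length u = m" and m: "m > 0"
  shows "rotate k u = u \<longleftrightarrow> (\<forall>i<m. u ! i = u ! (i mod gcd k m))"
proof
  let ?g = "gcd k m"
  assume r: "rotate k u = u"
  have step: "u ! (i mod m) = u ! ((i + k) mod m)" for i
  proof -
    have "rotate k u ! (i mod m) = u ! ((k + i mod m) mod m)" using m len by (simp add: nth_rotate)
    then show ?thesis using r by (simp add: mod_add_right_eq add.commute)
  qed
  have steps: "u ! (i mod m) = u ! ((i + c * k) mod m)" for i c
  proof (induction c)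
    case (Suc c)
    then show ?case using step[of "i + c * k"] by (simp add: algebra_simps)
  qed simp
  obtain c where c: "[k * c = ?g] (mod m)" using cong_solve_nat[of k m] by (cases "k = 0") (auto intro: cong_sym simp: cong_def)
  have stepg: "u ! (i mod m) = u ! ((i + ?g) mod m)" for i
  proof -
    have "(i + c * k) mod m = (i + ?g) mod m" using c by (metis cong_add_lcancel_nat cong_def mult.commute)
    then show ?thesis using steps[of i c] by simp
  qed
  have "u ! (i mod m) = u ! ((i + b * ?g) mod m)" for i b
  proof (induction b)
    case (Suc b)
    then show ?case using stepg[of "i + b * ?g"] by (simp add: algebra_simps)
  qed simp
  then have "u ! ((i mod ?g) mod m) = u ! ((i mod ?g + (i div ?g) * ?g) mod m)" for i by blast
  then have e: "u ! ((i mod ?g) mod m) = u ! (i mod m)" for i unfolding mod_div_mult_eq by blast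
  show "\<forall>i<m. u ! i = u ! (i mod ?g)"
  proof (intro allI impI)
    fix i assume i: "i < m"
    then have "i mod ?g < m" by (meson le_less_trans mod_less_eq_dividend)
    then show "u ! i = u ! (i mod ?g)" using e[of i] i by simp
  qed
next
  let ?g = "gcd k m"
  assume p: "\<forall>i<m. u ! i = u ! (i mod ?g)"
  show "rotate k u = u"
  proof (rule nth_equalityI)
    fix i assume "i < length (rotate k u)"
    then have i: "i < m" using len by simp
    have "rotate k u ! i = u ! ((k + i) mod m)" using i len by (simp add: nth_rotate)
    also have "\<dots> = u ! (((k + i) mod m) mod ?g)" using p m by simp
    also have "((k + i) mod m) mod ?g = i mod ?g"
      by (metis (no_types, lifting) dvd_imp_mod_0 gcd_dvd1 gcd_dvd2 mod_add_left_eq mod_mod_cancel add_0)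
    also have "u ! (i mod ?g) = u ! i" using p i by simp
    finally show "rotate k u ! i = u ! i" .
  qed simp
qed

text \<open>A fixed word is a repetition of its first \<open>gcd k m\<close> letters, which may be
  chosen freely.\<close>

lemma sum_rotate_fixed:
  assumes m: "m > 0"
  shows "(\<Sum>u | u \<in> words N m \<and> rotate k u = u. letter_prod x u) = (\<Sum>a<N. x a ^ (m div gcd k m)) ^ gcd k m"
proof -
  let ?g = "gcd k m" and ?d = "m div gcd k m"
  have g: "?g > 0" "?g \<le> m" and md: "m = ?d * ?g" using m by (auto intro: gcd_le2_nat)
  have "(\<Sum>u | u \<in> words N m \<and> rotate k u = u. letter_prod x u) = (\<Sum>v\<in>words N ?g. letter_prod (\<lambda>a. x a ^ ?d) v)"
  proof (rule sum.reindex_bij_witness[of _ "\<lambda>v. map (\<lambda>i. v ! (i mod ?g)) [0..<m]" "take ?g"])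
    fix u assume "u \<in> {u. u \<in> words N m \<and> rotate k u = u}"
    then have u: "length u = m" "set u \<subseteq> {..<N}" "rotate k u = u" by (auto simp: words_def)
    then have p: "\<forall>i<m. u ! i = u ! (i mod ?g)" using rotate_fixed_iff[OF u(1) m] by blast
    have t: "take ?g u ! (i mod ?g) = u ! (i mod ?g)" for i using g(1) by simp
    show "map (\<lambda>i. take ?g u ! (i mod ?g)) [0..<m] = u"
      unfolding t using p u(1) by (intro nth_equalityI) auto
    show "take ?g u \<in> words N ?g" using u g(2) by (auto simp: words_def dest: in_set_takeD)
    have "letter_prod x u = (\<Prod>i<?d * ?g. x (u ! (i mod ?g)))"
      using p u(1) md unfolding letter_prod_eq_prod by (intro prod.cong) auto
    also have "\<dots> = (\<Prod>i<?g. x (u ! i)) ^ ?d"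
    proof -
      have "(\<Prod>i<b * ?g. x (u ! (i mod ?g))) = (\<Prod>i<?g. x (u ! i)) ^ b" for b
      proof (induction b)
        case (Suc b)
        have "{..<Suc b * ?g} = {..<b * ?g} \<union> (\<lambda>i. b * ?g + i) ` {..<?g}"
        proof (intro equalityI subsetI)
          fix i assume i: "i \<in> {..<Suc b * ?g}"
          show "i \<in> {..<b * ?g} \<union> (\<lambda>i. b * ?g + i) ` {..<?g}"
          proof (cases "i < b * ?g")
            case False
            then show ?thesis using i by (intro UnI2 image_eqI[of _ _ "i - b * ?g"]) auto
          qed simp
        qed auto
        then have "(\<Prod>i<Suc b * ?g. x (u ! (i mod ?g)))
            = (\<Prod>i<b * ?g. x (u ! (i mod ?g))) * (\<Prod>i\<in>(\<lambda>i. b * ?g + i) ` {..<?g}. x (u ! (i mod ?g)))"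
          by (simp only:) (rule prod.union_disjoint, auto)
        also have "(\<Prod>i\<in>(\<lambda>i. b * ?g + i) ` {..<?g}. x (u ! (i mod ?g))) = (\<Prod>i<?g. x (u ! i))"
          by (subst prod.reindex) (auto simp: inj_on_def)
        finally show ?case using Suc.IH by simp
      qed simp
      then show ?thesis .
    qed
    also have "\<dots> = (\<Prod>i<?g. x (u ! i) ^ ?d)" by (rule prod_power_distrib)
    also have "\<dots> = letter_prod (\<lambda>a. x a ^ ?d) (take ?g u)"
      using u(1) g(2) by (simp add: letter_prod_eq_prod)
    finally show "letter_prod (\<lambda>a. x a ^ ?d) (take ?g u) = letter_prod x u" ..
  next
    fix v assume "v \<in> words N ?g"
    then have v: "length v = ?g" "set v \<subseteq> {..<N}" by (auto simp: words_def)
    let ?u = "map (\<lambda>i. v ! (i mod ?g)) [0..<m]"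
    show "take ?g ?u = v" using v(1) g by (intro nth_equalityI) auto
    have "v ! (i mod ?g) < N" for i
    proof -
      have "v ! (i mod ?g) \<in> set v" using v(1) g(1) by simp
      then show ?thesis using v(2) by auto
    qed
    then have "?u \<in> words N m" by (auto simp: words_def)
    moreover have "rotate k ?u = ?u"
    proof (subst rotate_fixed_iff[OF _ m]; (intro allI impI)?)
      fix i assume i: "i < m"
      then have "i mod ?g < m" by (meson le_less_trans mod_less_eq_dividend)
      then show "?u ! i = ?u ! (i mod ?g)" using i by simp
    qed simp
    ultimately show "?u \<in> {u. u \<in> words N m \<and> rotate k u = u}" by simp
  qed
  then show ?thesis by (simp only: sum_words_power)
qed

definition unit_root :: "nat \<Rightarrow> complex" where "unit_root m = cis (2 * pi / of_nat m)"

lemma unit_root_power_eq_1_iff: assumes "m > 0" shows "unit_root m ^ k = 1 \<longleftrightarrow> m dvd k"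
proof -
  have e: "unit_root m ^ k = cis (2 * pi * of_nat k / of_nat m)" by (simp add: unit_root_def DeMoivre mult.commute)
  show ?thesis
  proof
    assume "unit_root m ^ k = 1"
    then have "cos (2 * pi * of_nat k / of_nat m) = 1" unfolding e by (simp add: complex_eq_iff)
    then obtain j :: int where "2 * pi * of_nat k / of_nat m = of_int j * 2 * pi"
      using cos_one_2pi_int by blast
    then have "of_nat k = of_int j * (of_nat m :: real)" using assms by (simp add: field_simps)
    then have "int k = j * int m" by (metis of_int_eq_iff of_int_mult of_int_of_nat_eq)
    then show "m dvd k" by (metis dvd_triv_right int_dvd_int_iff)
  next
    assume "m dvd k"
    then obtain j where "k = m * j" by auto
    then have "2 * pi * real k / real m = 2 * pi * real j" using assms by simp
    then show "unit_root m ^ k = 1" unfolding e by (metis cis_multiple_2pi Ints_of_nat)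
  qed
qed

lemma unit_root_nz: "unit_root m \<noteq> 0" by (simp add: unit_root_def)

text \<open>An instance of cyclic sieving. The number \<open>unit_root m ^ k\<close> has exact order
  \<open>d = m div gcd k m\<close>, so both sides are the \<open>gcd k m\<close>-th power of the
  power sum of degree \<open>d\<close>.\<close>

theorem sum_maj_word_eq_sum_rotate:
  assumes m: "m > 0"
  shows "(\<Sum>u\<in>words N m. unit_root m ^ (k * maj_word u) * letter_prod x u) = (\<Sum>u | u \<in> words N m \<and> rotate k u = u. letter_prod x u)"
proof -
  let ?g = "gcd k m" and ?d = "m div gcd k m"
  have g: "?g > 0" and md: "m = ?d * ?g" using m by auto
  have d: "?d > 0" using md m by (metis gr0I mult_0)
  have iff: "(unit_root m ^ k) ^ i = 1 \<longleftrightarrow> ?d dvd i" for i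
  proof -
    have "(unit_root m ^ k) ^ i = 1 \<longleftrightarrow> m dvd k * i" unfolding power_mult[symmetric] by (rule unit_root_power_eq_1_iff[OF m])
    also have "\<dots> \<longleftrightarrow> ?d * ?g dvd (k div ?g) * i * ?g"
      using md by (metis dvd_div_mult_self gcd_dvd1 mult.assoc mult.commute)
    also have "\<dots> \<longleftrightarrow> ?d dvd (k div ?g) * i" using g by (metis nat_mult_dvd_cancel1 mult.commute)
    also have "\<dots> \<longleftrightarrow> ?d dvd i"
      using m by (intro coprime_dvd_mult_right_iff) (simp add: div_gcd_coprime coprime_commute)
    finally show ?thesis .
  qed
  have "(\<Sum>u\<in>words N (?d * ?g). (unit_root m ^ k) ^ maj_word u * letter_prod x u) = (\<Sum>a<N. x a ^ ?d) ^ ?g"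
    using iff by (intro sum_maj_word_root d) (auto dest: dvd_imp_le)
  then show ?thesis unfolding sum_rotate_fixed[OF m] md[symmetric] power_mult .
qed

lemma sum_root_powers: "z ^ m = 1 \<Longrightarrow> (\<Sum>k<m. z ^ k) = (if z = 1 then of_nat m else (0 :: complex))"
  by (simp add: geometric_sum)

text \<open>The exponent \<open>m - 1\<close> stands for -1 modulo \<open>m\<close>, which makes the
  sum over \<open>k\<close> a root-of-unity filter for major index 1.\<close>

lemma sum_maj_word_residue:
  assumes m: "m > 0"
  shows "(\<Sum>k<m. unit_root m ^ (k * (m - 1)) * (\<Sum>u | u \<in> words N m \<and> rotate k u = u. letter_prod x u))
    = of_nat m * (\<Sum>u | u \<in> words N m \<and> [maj_word u = 1] (mod m). letter_prod x u)"
proof -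
  have geo: "(\<Sum>k<m. unit_root m ^ (k * (m - 1 + a))) = (if [a = 1] (mod m) then of_nat m else 0)" for a
  proof -
    let ?z = "unit_root m ^ (m - 1 + a)"
    have s: "(\<Sum>k<m. unit_root m ^ (k * (m - 1 + a))) = (\<Sum>k<m. ?z ^ k)"
      by (intro sum.cong refl) (simp add: power_mult[symmetric] mult.commute)
    have "[a = 1] (mod m) \<longleftrightarrow> m dvd (m - 1 + a)"
    proof -
      have "[a = 1] (mod m) \<longleftrightarrow> [m - 1 + a = m - 1 + 1] (mod m)" by (rule cong_add_lcancel_nat[symmetric])
      also have "m - 1 + 1 = m" using m by simp
      finally show ?thesis by (simp add: cong_def dvd_eq_mod_eq_0)
    qed
    then have iff: "?z = 1 \<longleftrightarrow> [a = 1] (mod m)" using unit_root_power_eq_1_iff[OF m] by simp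
    have "?z ^ m = 1" unfolding power_mult[symmetric] using unit_root_power_eq_1_iff[OF m] by simp
    then have "(\<Sum>k<m. ?z ^ k) = (if ?z = 1 then of_nat m else 0)" by (rule sum_root_powers)
    then show ?thesis unfolding s iff .
  qed
  have "(\<Sum>k<m. unit_root m ^ (k * (m - 1)) * (\<Sum>u | u \<in> words N m \<and> rotate k u = u. letter_prod x u))
    = (\<Sum>k<m. \<Sum>u\<in>words N m. unit_root m ^ (k * (m - 1 + maj_word u)) * letter_prod x u)"
    unfolding sum_maj_word_eq_sum_rotate[OF m, symmetric] sum_distrib_left
    by (intro sum.cong refl) (simp only: power_add distrib_left mult.assoc)
  also have "\<dots> = (\<Sum>u\<in>words N m. (\<Sum>k<m. unit_root m ^ (k * (m - 1 + maj_word u))) * letter_prod x u)"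
    unfolding sum_distrib_right by (rule sum.swap)
  also have "\<dots> = (\<Sum>u\<in>words N m. if [maj_word u = 1] (mod m) then of_nat m * letter_prod x u else 0)"
    unfolding geo by (intro sum.cong refl) simp
  also have "\<dots> = of_nat m * (\<Sum>u | u \<in> words N m \<and> [maj_word u = 1] (mod m). letter_prod x u)"
    using finite_words by (simp add: sum.inter_filter[symmetric] sum_distrib_left)
  finally show ?thesis .
qed

section \<open>The centralizer of a permutation of cycle type \<open>lam\<close>\<close>

definition rowl :: "nat list \<Rightarrow> (nat \<times> nat \<Rightarrow> nat) \<Rightarrow> nat \<Rightarrow> nat list" where
  "rowl lam w j = map (\<lambda>t. w (j, t)) [0..<lam ! j]"

definition rows :: "nat list \<Rightarrow> nat \<Rightarrow> (nat \<Rightarrow> nat list) set" where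
  "rows lam N = (\<Pi>\<^sub>E j\<in>{..<length lam}. words N (lam ! j))"

text \<open>Row \<open>j\<close> is sent to row \<open>\<pi> j\<close> and turned by
  \<open>c j\<close>. For \<open>\<pi>\<close> in \<open>block_perms lam\<close> both rows have the
  same length, so the modulus of the source row fits the target.\<close>

definition hperm :: "nat list \<Rightarrow> (nat \<Rightarrow> nat) \<Rightarrow> (nat \<Rightarrow> nat) \<Rightarrow> nat \<times> nat \<Rightarrow> nat \<times> nat" where
  "hperm lam \<pi> c = (\<lambda>(j, t). if (j, t) \<in> cells lam then (\<pi> j, (t + c j) mod lam ! j) else (j, t))"

definition block_shifts :: "nat list \<Rightarrow> (nat \<Rightarrow> nat) set" where
  "block_shifts lam = (\<Pi>\<^sub>E j\<in>{..<length lam}. {..<lam ! j})"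

definition block_perms :: "nat list \<Rightarrow> (nat \<Rightarrow> nat) set" where
  "block_perms lam = {\<pi>. \<pi> permutes {..<length lam} \<and> (\<forall>j<length lam. lam ! \<pi> j = lam ! j)}"

text \<open>The shift of row \<open>j\<close> is visible in the image of its first cell. The
  exponent \<open>lam ! j - 1\<close> inverts the root of unity.\<close>

definition rot_char :: "nat list \<Rightarrow> (nat \<times> nat \<Rightarrow> nat \<times> nat) \<Rightarrow> complex" where
  "rot_char lam h = (\<Prod>j<length lam. unit_root (lam ! j) ^ (snd (h (j, 0)) * (lam ! j - 1)))"

definition wreath :: "nat list \<Rightarrow> (nat \<times> nat \<Rightarrow> nat \<times> nat) set" where
  "wreath lam = (\<lambda>(\<pi>, c). hperm lam \<pi> c) ` (block_perms lam \<times> block_shifts lam)"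

definition rotations :: "nat list \<Rightarrow> (nat \<times> nat \<Rightarrow> nat \<times> nat) set" where
  "rotations lam = hperm lam id ` block_shifts lam"

lemma cells_Sigma: "cells lam = (SIGMA j:{..<length lam}. {..<lam ! j})"
  by (auto simp: cells_def)

lemma finite_cells: "finite (cells lam)" by (simp add: cells_Sigma)

lemma card_cells: "card (cells lam) = sum_list lam"
  by (simp add: cells_Sigma sum_list_sum_nth atLeast0LessThan)

lemma finite_rows: "finite (rows lam N)"
  unfolding rows_def by (intro finite_PiE) (auto simp: finite_words)

lemma card_block_shifts: "card (block_shifts lam) = (\<Prod>j<length lam. lam ! j)"
  unfolding block_shifts_def by (subst card_PiE) auto

lemma finite_block_perms: "finite (block_perms lam)"
  by (rule finite_subset[OF _ finite_permutations[of "{..<length lam}"]]) (auto simp: block_perms_def)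

lemma id_block_perms: "id \<in> block_perms lam" by (simp add: block_perms_def permutes_id)

lemma prod_rowl: "(\<Prod>i\<in>cells lam. x (w i)) = (\<Prod>j<length lam. letter_prod x (rowl lam w j))"
proof -
  have "(\<Prod>j<length lam. letter_prod x (rowl lam w j)) = (\<Prod>j<length lam. \<Prod>t<lam ! j. x (w (j, t)))"
    by (intro prod.cong refl) (simp add: letter_prod_eq_prod rowl_def)
  also have "\<dots> = (\<Prod>i\<in>cells lam. x (w i))"
    unfolding cells_Sigma by (subst prod.Sigma) (auto simp: split_def)
  finally show ?thesis ..
qed

lemma bij_rows:
  "bij_betw (\<lambda>w. \<lambda>j\<in>{..<length lam}. rowl lam w j) (cells lam \<rightarrow>\<^sub>E {..<N}) (rows lam N)"
proof (rule bij_betw_byWitness[where f' = "\<lambda>p. \<lambda>i\<in>cells lam. p (fst i) ! snd i"])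
  show "\<forall>w\<in>cells lam \<rightarrow>\<^sub>E {..<N}. (\<lambda>i\<in>cells lam. (\<lambda>j\<in>{..<length lam}. rowl lam w j) (fst i) ! snd i) = w"
  proof
    fix w assume w: "w \<in> cells lam \<rightarrow>\<^sub>E {..<N}"
    show "(\<lambda>i\<in>cells lam. (\<lambda>j\<in>{..<length lam}. rowl lam w j) (fst i) ! snd i) = w"
    proof
      fix i show "(\<lambda>i\<in>cells lam. (\<lambda>j\<in>{..<length lam}. rowl lam w j) (fst i) ! snd i) i = w i"
        using PiE_arb[OF w, of i] by (cases i) (auto simp: cells_def rowl_def)
    qed
  qed
  show "\<forall>p\<in>rows lam N. (\<lambda>j\<in>{..<length lam}. rowl lam (\<lambda>i\<in>cells lam. p (fst i) ! snd i) j) = p"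
  proof
    fix p assume p: "p \<in> rows lam N"
    show "(\<lambda>j\<in>{..<length lam}. rowl lam (\<lambda>i\<in>cells lam. p (fst i) ! snd i) j) = p"
    proof
      fix j show "(\<lambda>j\<in>{..<length lam}. rowl lam (\<lambda>i\<in>cells lam. p (fst i) ! snd i) j) j = p j"
      proof (cases "j < length lam")
        case True
        then have "length (p j) = lam ! j" using p by (auto simp: rows_def words_def PiE_iff)
        then show ?thesis using True by (auto intro!: nth_equalityI simp: rowl_def cells_def)
      next
        case False
        then show ?thesis using p by (auto simp: rows_def PiE_iff extensional_def)
      qed
    qed
  qed
  show "(\<lambda>w. \<lambda>j\<in>{..<length lam}. rowl lam w j) ` (cells lam \<rightarrow>\<^sub>E {..<N}) \<subseteq> rows lam N"
    by (auto simp: rows_def words_def rowl_def cells_def PiE_iff)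
  show "(\<lambda>p. \<lambda>i\<in>cells lam. p (fst i) ! snd i) ` rows lam N \<subseteq> cells lam \<rightarrow>\<^sub>E {..<N}"
  proof (rule image_subsetI)
    fix p assume p: "p \<in> rows lam N"
    have "p (fst i) ! snd i < N" if "i \<in> cells lam" for i
    proof -
      have "p (fst i) \<in> words N (lam ! fst i)" using p that by (auto simp: rows_def PiE_iff cells_def)
      moreover have "snd i < lam ! fst i" using that by (auto simp: cells_def)
      ultimately have "p (fst i) ! snd i \<in> set (p (fst i))" "set (p (fst i)) \<subseteq> {..<N}" by (auto simp: words_def)
      then show ?thesis by blast
    qed
    then show "(\<lambda>i\<in>cells lam. p (fst i) ! snd i) \<in> cells lam \<rightarrow>\<^sub>E {..<N}" by auto
  qed
qed

lemma hperm_in: assumes "\<pi> \<in> block_perms lam" "(j, t) \<in> cells lam"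
  shows "hperm lam \<pi> c (j, t) = (\<pi> j, (t + c j) mod lam ! j)" "(\<pi> j, (t + c j) mod lam ! j) \<in> cells lam"
proof -
  have j: "j < length lam" "t < lam ! j" using assms(2) by (auto simp: cells_def)
  have "\<pi> j < length lam" using assms(1) j(1) permutes_in_image[of \<pi> "{..<length lam}" j] by (auto simp: block_perms_def)
  moreover have "lam ! \<pi> j = lam ! j" using assms(1) j(1) by (simp add: block_perms_def)
  moreover have "(t + c j) mod lam ! j < lam ! j" using j(2) by (intro mod_less_divisor) linarith
  ultimately show "(\<pi> j, (t + c j) mod lam ! j) \<in> cells lam" by (simp add: cells_def)
  show "hperm lam \<pi> c (j, t) = (\<pi> j, (t + c j) mod lam ! j)" using assms(2) by (simp add: hperm_def)
qed

lemma hperm_permutes: assumes \<pi>: "\<pi> \<in> block_perms lam" shows "hperm lam \<pi> c permutes cells lam"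
proof (rule bij_imp_permutes)
  have "inj_on (hperm lam \<pi> c) (cells lam)"
  proof (rule inj_onI)
    fix i i' assume i: "i \<in> cells lam" "i' \<in> cells lam" and e: "hperm lam \<pi> c i = hperm lam \<pi> c i'"
    obtain j t j' t' where ii: "i = (j, t)" "i' = (j', t')" by fastforce
    have e': "\<pi> j = \<pi> j'" "(t + c j) mod lam ! j = (t' + c j') mod lam ! j'"
      using e hperm_in(1)[OF \<pi> i(1)[unfolded ii]] hperm_in(1)[OF \<pi> i(2)[unfolded ii]] by (auto simp: ii)
    have "inj \<pi>" using \<pi> by (auto simp: block_perms_def permutes_inj)
    then have j: "j = j'" using e'(1) by (simp add: inj_eq)
    have "[t + c j = t' + c j] (mod lam ! j)" using e'(2) j by (simp add: cong_def)
    then have "[t = t'] (mod lam ! j)" by (simp add: cong_add_rcancel_nat)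
    then have "t = t'" using i j unfolding ii by (intro cong_less_modulus_unique_nat) (auto simp: cells_def)
    then show "i = i'" using j ii by simp
  qed
  moreover have "hperm lam \<pi> c ` cells lam \<subseteq> cells lam"
  proof (rule image_subsetI)
    fix i assume "i \<in> cells lam"
    then show "hperm lam \<pi> c i \<in> cells lam" using hperm_in[OF \<pi>, of "fst i" "snd i" c] by simp
  qed
  ultimately show "bij_betw (hperm lam \<pi> c) (cells lam) (cells lam)"
    by (simp add: bij_betw_def endo_inj_surj finite_cells)
qed (auto simp: hperm_def)

lemma hperm_0: assumes "\<forall>j<length lam. 0 < lam ! j" "j < length lam" "c \<in> block_shifts lam"
  shows "hperm lam \<pi> c (j, 0) = (\<pi> j, c j)"
  using assms by (auto simp: hperm_def cells_def block_shifts_def PiE_iff)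

lemma hperm_inj: assumes pos: "\<forall>j<length lam. 0 < lam ! j"
  shows "inj_on (\<lambda>(\<pi>, c). hperm lam \<pi> c) (block_perms lam \<times> block_shifts lam)"
proof (rule inj_onI, clarify)
  fix \<pi> c \<pi>' c' assume a: "\<pi> \<in> block_perms lam" "c \<in> block_shifts lam" "\<pi>' \<in> block_perms lam" "c' \<in> block_shifts lam"
    and e: "hperm lam \<pi> c = hperm lam \<pi>' c'"
  have 1: "\<pi> j = \<pi>' j" "c j = c' j" if "j < length lam" for j
    using hperm_0[OF pos that a(2), of \<pi>] hperm_0[OF pos that a(4), of \<pi>'] e by auto
  have "\<pi> j = \<pi>' j" for j
  proof (cases "j < length lam")
    case False
    then show ?thesis using a permutes_not_in[of \<pi> "{..<length lam}" j] permutes_not_in[of \<pi>' "{..<length lam}" j]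
      by (simp add: block_perms_def)
  qed (rule 1)
  moreover have "c j = c' j" for j
  proof (cases "j < length lam")
    case False
    then show ?thesis using a by (auto simp: block_shifts_def PiE_iff extensional_def)
  qed (rule 1)
  ultimately show "\<pi> = \<pi>' \<and> c = c'" by (simp add: fun_eq_iff)
qed

text \<open>The row is first turned by \<open>c' j\<close> and then, in its new place
  \<open>\<pi>' j\<close>, by \<open>c (\<pi>' j)\<close>.\<close>

lemma hperm_comp:
  assumes "\<pi> \<in> block_perms lam" "\<pi>' \<in> block_perms lam"
  shows "hperm lam \<pi> c \<circ> hperm lam \<pi>' c' = hperm lam (\<pi> \<circ> \<pi>') (\<lambda>j\<in>{..<length lam}. (c' j + c (\<pi>' j)) mod lam ! j)"
proof
  fix i :: "nat \<times> nat"
  obtain j t where i: "i = (j, t)" by fastforce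
  show "(hperm lam \<pi> c \<circ> hperm lam \<pi>' c') i = hperm lam (\<pi> \<circ> \<pi>') (\<lambda>j\<in>{..<length lam}. (c' j + c (\<pi>' j)) mod lam ! j) i"
  proof (cases "i \<in> cells lam")
    case True
    then have j: "j < length lam" by (auto simp: i cells_def)
    have "lam ! \<pi>' j = lam ! j" using assms(2) j by (simp add: block_perms_def)
    then show ?thesis
      using hperm_in[OF assms(2) True[unfolded i], of c'] hperm_in(1)[OF assms(1) hperm_in(2)[OF assms(2) True[unfolded i], of c'], of c] True j
      by (simp add: i hperm_def[of lam "\<pi> \<circ> \<pi>'"] mod_simps add.assoc)
  qed (auto simp: hperm_def i)
qed

lemma block_perms_comp: assumes "\<pi> \<in> block_perms lam" "\<pi>' \<in> block_perms lam" shows "\<pi> \<circ> \<pi>' \<in> block_perms lam"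
proof -
  have "\<pi>' j < length lam" if "j < length lam" for j
    using assms(2) that permutes_in_image[of \<pi>' "{..<length lam}" j] by (auto simp: block_perms_def)
  then show ?thesis using assms by (auto simp: block_perms_def intro: permutes_compose)
qed

lemma block_shifts_comp: assumes "\<forall>j<length lam. 0 < lam ! j" shows "(\<lambda>j\<in>{..<length lam}. F j mod lam ! j) \<in> block_shifts lam"
  using assms by (auto simp: block_shifts_def)

lemma rot_char_hperm: assumes "\<forall>j<length lam. 0 < lam ! j" "c \<in> block_shifts lam"
  shows "rot_char lam (hperm lam \<pi> c) = (\<Prod>j<length lam. unit_root (lam ! j) ^ (c j * (lam ! j - 1)))"
  unfolding rot_char_def using hperm_0[OF assms(1) _ assms(2)] by (intro prod.cong) auto

lemma unit_root_power_mod: assumes "m > 0" shows "unit_root m ^ ((a mod m) * b) = unit_root m ^ (a * b)"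
proof -
  have "(unit_root m ^ b) ^ m = 1" unfolding power_mult[symmetric] using unit_root_power_eq_1_iff[OF assms] by simp
  then have "(unit_root m ^ b) ^ (a mod m) = (unit_root m ^ b) ^ a" by (rule power_mod_root)
  then show ?thesis by (simp only: power_mult[symmetric] mult.commute)
qed

lemma wreath_group:
  assumes pos: "\<forall>j<length lam. 0 < lam ! j"
  shows "wreath lam \<subseteq> {\<sigma>. \<sigma> permutes cells lam}" "id \<in> rotations lam" "rotations lam \<subseteq> wreath lam"
    "\<And>f g. f \<in> wreath lam \<Longrightarrow> g \<in> wreath lam \<Longrightarrow> f \<circ> g \<in> wreath lam"
    "\<And>f g. f \<in> rotations lam \<Longrightarrow> g \<in> rotations lam \<Longrightarrow> f \<circ> g \<in> rotations lam"
    "\<And>f g. f \<in> wreath lam \<Longrightarrow> g \<in> wreath lam \<Longrightarrow> rot_char lam (f \<circ> g) = rot_char lam f * rot_char lam g"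
proof -
  show "wreath lam \<subseteq> {\<sigma>. \<sigma> permutes cells lam}" using hperm_permutes by (auto simp: wreath_def)
  have "hperm lam id (\<lambda>j\<in>{..<length lam}. 0) = id" by (auto simp: hperm_def fun_eq_iff cells_def)
  moreover have "(\<lambda>j\<in>{..<length lam}. 0) \<in> block_shifts lam" using pos by (auto simp: block_shifts_def)
  ultimately show "id \<in> rotations lam" unfolding rotations_def by (metis imageI)
  show "rotations lam \<subseteq> wreath lam" using id_block_perms by (force simp: rotations_def wreath_def)
  show "f \<circ> g \<in> rotations lam" if fg: "f \<in> rotations lam" "g \<in> rotations lam" for f g
  proof -
    obtain c c' where "f = hperm lam id c" "g = hperm lam id c'" using fg by (auto simp: rotations_def)
    then have "f \<circ> g = hperm lam id (\<lambda>j\<in>{..<length lam}. (c' j + c j) mod lam ! j)"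
      using hperm_comp[OF id_block_perms id_block_perms] by simp
    then show ?thesis using block_shifts_comp[OF pos, of "\<lambda>j. c' j + c j"] unfolding rotations_def by blast
  qed
  fix f g assume "f \<in> wreath lam" "g \<in> wreath lam"
  then obtain \<pi> c \<pi>' c' where f: "f = hperm lam \<pi> c" "\<pi> \<in> block_perms lam" "c \<in> block_shifts lam"
    and g: "g = hperm lam \<pi>' c'" "\<pi>' \<in> block_perms lam" "c' \<in> block_shifts lam" by (auto simp: wreath_def)
  define d where "d = (\<lambda>j\<in>{..<length lam}. (c' j + c (\<pi>' j)) mod lam ! j)"
  have d: "d \<in> block_shifts lam" unfolding d_def by (rule block_shifts_comp[OF pos])
  have fg: "f \<circ> g = hperm lam (\<pi> \<circ> \<pi>') d" unfolding f(1) g(1) d_def by (rule hperm_comp[OF f(2) g(2)])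
  show "f \<circ> g \<in> wreath lam" unfolding fg wreath_def using block_perms_comp[OF f(2) g(2)] d by blast
  have perm: "\<pi>' permutes {..<length lam}" using g(2) by (simp add: block_perms_def)
  have "rot_char lam (f \<circ> g) = (\<Prod>j<length lam. unit_root (lam ! j) ^ (c' j * (lam ! j - 1)) * unit_root (lam ! \<pi>' j) ^ (c (\<pi>' j) * (lam ! \<pi>' j - 1)))"
    unfolding fg rot_char_hperm[OF pos d]
  proof (intro prod.cong refl)
    fix j assume j: "j \<in> {..<length lam}"
    then have "lam ! \<pi>' j = lam ! j" using g(2) by (simp add: block_perms_def)
    then show "unit_root (lam ! j) ^ (d j * (lam ! j - 1)) = unit_root (lam ! j) ^ (c' j * (lam ! j - 1)) * unit_root (lam ! \<pi>' j) ^ (c (\<pi>' j) * (lam ! \<pi>' j - 1))"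
      using j pos by (simp add: d_def unit_root_power_mod distrib_right power_add)
  qed
  also have "\<dots> = rot_char lam g * (\<Prod>j<length lam. unit_root (lam ! \<pi>' j) ^ (c (\<pi>' j) * (lam ! \<pi>' j - 1)))"
    unfolding prod.distrib g(1) rot_char_hperm[OF pos g(3)] ..
  also have "(\<Prod>j<length lam. unit_root (lam ! \<pi>' j) ^ (c (\<pi>' j) * (lam ! \<pi>' j - 1))) = rot_char lam f"
    unfolding f(1) rot_char_hperm[OF pos f(3)]
    by (rule prod.permute[OF perm, unfolded o_def, symmetric])
  finally show "rot_char lam (f \<circ> g) = rot_char lam f * rot_char lam g" unfolding mult.commute[of "rot_char lam f"] .
qed

lemma card_wreath: assumes "\<forall>j<length lam. 0 < lam ! j"
  shows "card (wreath lam) = card (block_perms lam) * card (block_shifts lam)" "card (rotations lam) = card (block_shifts lam)"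
proof -
  show "card (wreath lam) = card (block_perms lam) * card (block_shifts lam)"
    unfolding wreath_def using hperm_inj[OF assms] by (simp add: card_image card_cartesian_product)
  have "inj_on (hperm lam id) (block_shifts lam)"
    using hperm_inj[OF assms] id_block_perms by (auto simp: inj_on_def)
  then show "card (rotations lam) = card (block_shifts lam)" unfolding rotations_def by (rule card_image)
qed

lemma fixed_rows:
  assumes w: "w \<in> cells lam \<rightarrow>\<^sub>E {..<N}" and \<pi>: "\<pi> \<in> block_perms lam"
  shows "w \<circ> hperm lam \<pi> c = w \<longleftrightarrow> (\<forall>j<length lam. rotate (c j) (rowl lam w (\<pi> j)) = rowl lam w j)"
proof -
  have lp: "lam ! \<pi> j = lam ! j" if "j < length lam" for j using \<pi> that by (simp add: block_perms_def)
  have nth: "rotate (c j) (rowl lam w (\<pi> j)) ! t = w (hperm lam \<pi> c (j, t))" if "j < length lam" "t < lam ! j" for j t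
  proof -
    have "(j, t) \<in> cells lam" using that by (simp add: cells_def)
    moreover have "(c j + t) mod lam ! j < lam ! j" using that(2) by (intro mod_less_divisor) linarith
    ultimately show ?thesis using that lp[OF that(1)] hperm_in(1)[OF \<pi>, of j t c]
      by (simp add: nth_rotate rowl_def add.commute)
  qed
  have "w \<circ> hperm lam \<pi> c = w \<longleftrightarrow> (\<forall>i\<in>cells lam. w (hperm lam \<pi> c i) = w i)"
  proof
    assume *: "\<forall>i\<in>cells lam. w (hperm lam \<pi> c i) = w i"
    show "w \<circ> hperm lam \<pi> c = w"
    proof
      fix i show "(w \<circ> hperm lam \<pi> c) i = w i"
        using * by (cases "i \<in> cells lam") (auto simp: hperm_def split: prod.splits)
    qed
  qed (auto simp: fun_eq_iff)
  also have "\<dots> \<longleftrightarrow> (\<forall>j<length lam. \<forall>t<lam ! j. w (hperm lam \<pi> c (j, t)) = w (j, t))"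
    by (auto simp: cells_def)
  also have "\<dots> \<longleftrightarrow> (\<forall>j<length lam. rotate (c j) (rowl lam w (\<pi> j)) = rowl lam w j)"
  proof -
    have "rotate (c j) (rowl lam w (\<pi> j)) = rowl lam w j \<longleftrightarrow> (\<forall>t<lam ! j. w (hperm lam \<pi> c (j, t)) = w (j, t))"
      if j: "j < length lam" for j
    proof -
      have l: "length (rotate (c j) (rowl lam w (\<pi> j))) = lam ! j" "length (rowl lam w j) = lam ! j"
        using lp[OF j] by (simp_all add: rowl_def)
      have "rowl lam w j ! t = w (j, t)" if "t < lam ! j" for t using that by (simp add: rowl_def)
      then show ?thesis unfolding list_eq_iff_nth_eq l using nth[OF j] by metis
    qed
    then show ?thesis by blast
  qed
  finally show ?thesis .
qed

lemma psum_hperm: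
  assumes \<pi>: "\<pi> \<in> block_perms lam"
  shows "psum (cells lam) N x (hperm lam \<pi> c)
    = (\<Sum>p\<in>rows lam N. if \<forall>j<length lam. rotate (c j) (p (\<pi> j)) = p j then \<Prod>j<length lam. letter_prod x (p j) else 0)"
proof -
  let ?r = "\<lambda>w. \<lambda>j\<in>{..<length lam}. rowl lam w j"
  have pj: "\<pi> j < length lam" if "j < length lam" for j
    using \<pi> that permutes_in_image[of \<pi> "{..<length lam}" j] by (auto simp: block_perms_def)
  have "psum (cells lam) N x (hperm lam \<pi> c)
    = (\<Sum>w\<in>cells lam \<rightarrow>\<^sub>E {..<N}. if w \<circ> hperm lam \<pi> c = w then \<Prod>i\<in>cells lam. x (w i) else 0)"
    unfolding psum_def by (subst sum.inter_filter[symmetric]) (auto intro!: finite_PiE finite_cells)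
  also have "\<dots> = (\<Sum>w\<in>cells lam \<rightarrow>\<^sub>E {..<N}. (\<lambda>p. if \<forall>j<length lam. rotate (c j) (p (\<pi> j)) = p j then \<Prod>j<length lam. letter_prod x (p j) else 0) (?r w))"
  proof (intro sum.cong refl)
    fix w assume w: "w \<in> cells lam \<rightarrow>\<^sub>E {..<N}"
    have "(\<forall>j<length lam. rotate (c j) (?r w (\<pi> j)) = ?r w j) \<longleftrightarrow> w \<circ> hperm lam \<pi> c = w"
      unfolding fixed_rows[OF w \<pi>] using pj by simp
    moreover have "(\<Prod>j<length lam. letter_prod x (?r w j)) = (\<Prod>i\<in>cells lam. x (w i))"
      unfolding prod_rowl by (intro prod.cong) auto
    ultimately show "(if w \<circ> hperm lam \<pi> c = w then \<Prod>i\<in>cells lam. x (w i) else 0)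
      = (\<lambda>p. if \<forall>j<length lam. rotate (c j) (p (\<pi> j)) = p j then \<Prod>j<length lam. letter_prod x (p j) else 0) (?r w)"
      by (simp only:)
  qed
  also have "\<dots> = (\<Sum>p\<in>rows lam N. if \<forall>j<length lam. rotate (c j) (p (\<pi> j)) = p j then \<Prod>j<length lam. letter_prod x (p j) else 0)"
    by (rule sum.reindex_bij_betw[OF bij_rows])
  finally show ?thesis .
qed

section \<open>Averaging over the rotations of single rows\<close>

definition maj_rows_sum :: "nat list \<Rightarrow> nat \<Rightarrow> (nat \<Rightarrow> complex) \<Rightarrow> complex" where
  "maj_rows_sum lam N x = (\<Sum>p | p \<in> rows lam N \<and> (\<forall>j<length lam. [maj_word (p j) = 1] (mod lam ! j)). \<Prod>j<length lam. letter_prod x (p j))"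

lemma rows_filter:
  "{p. p \<in> rows lam N \<and> (\<forall>j<length lam. P j (p j))} = (\<Pi>\<^sub>E j\<in>{..<length lam}. {u. u \<in> words N (lam ! j) \<and> P j u})"
  unfolding rows_def PiE_iff set_eq_iff mem_Collect_eq lessThan_iff Ball_def by blast

text \<open>When no rows are permuted, fixed words, weights and shifts all factor over the rows, and
  each factor is the filter of \<open>sum_maj_word_residue\<close>.\<close>

theorem rotations_average:
  assumes pos: "\<forall>j<length lam. 0 < lam ! j"
  shows "(\<Sum>h\<in>rotations lam. rot_char lam h / of_nat (card (rotations lam)) * psum (cells lam) N x h) = maj_rows_sum lam N x"
proof -
  let ?J = "{..<length lam}"
  define A where "A j k = {u. u \<in> words N (lam ! j) \<and> rotate k u = u}" for j k
  have ps: "psum (cells lam) N x (hperm lam id c) = (\<Prod>j\<in>?J. \<Sum>u\<in>A j (c j). letter_prod x u)" for c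
  proof -
    have "psum (cells lam) N x (hperm lam id c) = (\<Sum>p | p \<in> rows lam N \<and> (\<forall>j<length lam. rotate (c j) (p j) = p j). \<Prod>j\<in>?J. letter_prod x (p j))"
      unfolding psum_hperm[OF id_block_perms] using finite_rows by (simp add: sum.inter_filter[symmetric])
    also have "{p. p \<in> rows lam N \<and> (\<forall>j<length lam. rotate (c j) (p j) = p j)} = (\<Pi>\<^sub>E j\<in>?J. A j (c j))"
      unfolding A_def by (rule rows_filter)
    also have "(\<Sum>p\<in>(\<Pi>\<^sub>E j\<in>?J. A j (c j)). \<Prod>j\<in>?J. letter_prod x (p j)) = (\<Prod>j\<in>?J. \<Sum>u\<in>A j (c j). letter_prod x u)"
      unfolding A_def using finite_words by (intro prod_sum_PiE[symmetric]) auto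
    finally show ?thesis .
  qed
  have inj: "inj_on (hperm lam id) (block_shifts lam)"
    using hperm_inj[OF pos] id_block_perms by (auto simp: inj_on_def)
  have "(\<Sum>h\<in>rotations lam. rot_char lam h * psum (cells lam) N x h)
    = (\<Sum>c\<in>block_shifts lam. \<Prod>j\<in>?J. unit_root (lam ! j) ^ (c j * (lam ! j - 1)) * (\<Sum>u\<in>A j (c j). letter_prod x u))"
    unfolding rotations_def sum.reindex[OF inj] o_def
    by (intro sum.cong refl) (simp add: rot_char_hperm[OF pos] ps prod.distrib)
  also have "\<dots> = (\<Prod>j\<in>?J. \<Sum>k<lam ! j. unit_root (lam ! j) ^ (k * (lam ! j - 1)) * (\<Sum>u\<in>A j k. letter_prod x u))"
    unfolding block_shifts_def by (rule prod_sum_PiE[symmetric]) auto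
  also have "\<dots> = (\<Prod>j\<in>?J. of_nat (lam ! j) * (\<Sum>u | u \<in> words N (lam ! j) \<and> [maj_word u = 1] (mod lam ! j). letter_prod x u))"
    unfolding A_def using pos by (intro prod.cong refl sum_maj_word_residue) auto
  also have "\<dots> = of_nat (card (block_shifts lam)) * (\<Sum>p\<in>(\<Pi>\<^sub>E j\<in>?J. {u. u \<in> words N (lam ! j) \<and> [maj_word u = 1] (mod lam ! j)}). \<Prod>j\<in>?J. letter_prod x (p j))"
    unfolding prod.distrib card_block_shifts of_nat_prod using finite_words by (subst prod_sum_PiE) auto
  also have "(\<Pi>\<^sub>E j\<in>?J. {u. u \<in> words N (lam ! j) \<and> [maj_word u = 1] (mod lam ! j)}) = {p. p \<in> rows lam N \<and> (\<forall>j<length lam. [maj_word (p j) = 1] (mod lam ! j))}"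
    by (rule rows_filter[symmetric])
  finally have e: "(\<Sum>h\<in>rotations lam. rot_char lam h * psum (cells lam) N x h) = of_nat (card (block_shifts lam)) * maj_rows_sum lam N x"
    unfolding maj_rows_sum_def .
  have "card (block_shifts lam) \<noteq> 0" unfolding card_block_shifts using pos by simp
  moreover have "(\<Sum>h\<in>rotations lam. rot_char lam h / of_nat (card (rotations lam)) * psum (cells lam) N x h)
    = (\<Sum>h\<in>rotations lam. rot_char lam h * psum (cells lam) N x h) / of_nat (card (block_shifts lam))"
    by (simp add: card_wreath(2)[OF pos] sum_divide_distrib)
  ultimately show ?thesis using e by simp
qed

subsection \<open>Tableaux with prescribed block major indices\<close>

text \<open>The block condition as a property of a descent set alone, so that
  \<open>card_words_wdes\<close> can transfer it from words to tableaux.\<close>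

definition blockP :: "nat list \<Rightarrow> nat set \<Rightarrow> bool" where
  "blockP lam X \<longleftrightarrow> (\<forall>j<length lam. [\<Sum>{d - block_start lam j | d. d \<in> X \<and> d \<in> block lam j \<and> d + 1 \<in> block lam j} = 1] (mod lam ! j))"

lemma SYT_blocks_eq: "mu \<in> partitions n \<Longrightarrow> SYT_blocks lam mu = {Q \<in> syt (row_of mu). blockP lam (des (row_of mu) Q)}"
  by (simp add: SYT_blocks_def SYT_eq_syt blockP_def block_maj_def block_Des_def Des_eq_des)

lemma concat_rows: "length w = sum_list lam \<Longrightarrow> concat (map (\<lambda>j. take (lam ! j) (drop (block_start lam j) w)) [0..<length lam]) = w"
proof (induction lam arbitrary: w)
  case (Cons a lam)
  have e: "[0..<length (a # lam)] = 0 # map Suc [0..<length lam]" by (simp add: upt_conv_Cons map_Suc_upt del: upt_Suc)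
  have "concat (map (\<lambda>j. take ((a # lam) ! j) (drop (block_start (a # lam) j) w)) [0..<length (a # lam)])
    = take a w @ concat (map (\<lambda>j. take (lam ! j) (drop (block_start lam j) (drop a w))) [0..<length lam])"
    unfolding e by (simp add: block_start_def o_def add.commute)
  also have "concat (map (\<lambda>j. take (lam ! j) (drop (block_start lam j) (drop a w))) [0..<length lam]) = drop a w"
    using Cons.prems by (intro Cons.IH) simp
  also have "take a w @ drop a w = w" by simp
  finally show ?case .
qed simp

lemma rows_concat: "(\<And>j. j < length lam \<Longrightarrow> length (p j) = lam ! j) \<Longrightarrow> j < length lam \<Longrightarrow>
  take (lam ! j) (drop (block_start lam j) (concat (map p [0..<length lam]))) = p j"
proof (induction lam arbitrary: p j)
  case (Cons a lam)
  have e: "[0..<length (a # lam)] = 0 # map Suc [0..<length lam]" by (simp add: upt_conv_Cons map_Suc_upt del: upt_Suc)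
  have l0: "length (p 0) = a" using Cons.prems(1)[of 0] by simp
  have c: "concat (map p [0..<length (a # lam)]) = p 0 @ concat (map (\<lambda>i. p (Suc i)) [0..<length lam])"
    unfolding e by (simp add: o_def)
  show ?case
  proof (cases j)
    case 0
    then show ?thesis unfolding c using l0 by (simp add: block_start_def)
  next
    case (Suc i)
    have "take (lam ! i) (drop (block_start lam i) (concat (map (\<lambda>i. p (Suc i)) [0..<length lam]))) = p (Suc i)"
      using Cons.prems Suc by (intro Cons.IH) force+
    then show ?thesis unfolding c Suc using l0 by (simp add: block_start_def)
  qed
qed simp

lemma block_start_le: "j < length lam \<Longrightarrow> block_start lam j + lam ! j \<le> sum_list lam"
proof -
  assume j: "j < length lam"
  have "sum_list (take (Suc j) lam) = block_start lam j + lam ! j"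
    using j by (simp add: block_start_def take_Suc_conv_app_nth)
  moreover have "sum_list lam = sum_list (take (Suc j) lam) + sum_list (drop (Suc j) lam)"
    by (metis append_take_drop_id sum_list_append)
  ultimately show ?thesis by simp
qed

text \<open>Asking for both \<open>d\<close> and \<open>d + 1\<close> in the block discards the
  descents at junctions, which leaves those of the corresponding factor of \<open>w\<close>.\<close>

lemma blockP_wdes:
  assumes w: "length w = sum_list lam"
  shows "blockP lam (wdes w) \<longleftrightarrow> (\<forall>j<length lam. [maj_word (take (lam ! j) (drop (block_start lam j) w)) = 1] (mod lam ! j))"
proof -
  have "{d - block_start lam j | d. d \<in> wdes w \<and> d \<in> block lam j \<and> d + 1 \<in> block lam j}
      = wdes (take (lam ! j) (drop (block_start lam j) w))" if j: "j < length lam" for j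
  proof -
    let ?s = "block_start lam j" and ?m = "lam ! j"
    let ?v = "take ?m (drop ?s w)"
    have len: "length ?v = ?m" using block_start_le[OF j] w by simp
    have nth: "?v ! i = w ! (?s + i)" if "i < ?m" for i using that block_start_le[OF j] w by simp
    have "i \<in> wdes ?v \<longleftrightarrow> ?s + i \<in> wdes w \<and> ?s + i \<in> block lam j \<and> ?s + i + 1 \<in> block lam j" for i
    proof (cases "0 < i \<and> i < ?m")
      case True
      then have "?v ! i = w ! (?s + i)" "?v ! (i - 1) = w ! (?s + i - 1)" using nth[of i] nth[of "i - 1"] by auto
      then show ?thesis using True len block_start_le[OF j] w by (auto simp: wdes_def block_def)
    next
      case False
      then show ?thesis using len by (auto simp: wdes_def block_def)
    qed
    note iff = this
    show ?thesis
    proof (intro equalityI subsetI)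
      fix i assume "i \<in> {d - ?s | d. d \<in> wdes w \<and> d \<in> block lam j \<and> d + 1 \<in> block lam j}"
      then obtain d where d: "i = d - ?s" "d \<in> wdes w" "d \<in> block lam j" "d + 1 \<in> block lam j" by auto
      then have "d = ?s + i" by (auto simp: block_def)
      then show "i \<in> wdes ?v" using iff d by simp
    next
      fix i assume "i \<in> wdes ?v"
      then have "?s + i \<in> wdes w \<and> ?s + i \<in> block lam j \<and> ?s + i + 1 \<in> block lam j" using iff by blast
      then show "i \<in> {d - ?s | d. d \<in> wdes w \<and> d \<in> block lam j \<and> d + 1 \<in> block lam j}"
        by (intro CollectI exI[of _ "?s + i"]) auto
    qed
  qed
  then show ?thesis by (simp add: blockP_def maj_word_def)
qed

lemma sum_words_rows:
  fixes F :: "(nat \<Rightarrow> nat list) \<Rightarrow> 'c :: comm_monoid_add"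
  shows "(\<Sum>w\<in>words N (sum_list lam). F (\<lambda>j\<in>{..<length lam}. take (lam ! j) (drop (block_start lam j) w))) = (\<Sum>p\<in>rows lam N. F p)"
proof (rule sum.reindex_bij_witness[of _ "\<lambda>p. concat (map p [0..<length lam])" "\<lambda>w. \<lambda>j\<in>{..<length lam}. take (lam ! j) (drop (block_start lam j) w)"])
  fix w assume w: "w \<in> words N (sum_list lam)"
  have "map (\<lambda>j\<in>{..<length lam}. take (lam ! j) (drop (block_start lam j) w)) [0..<length lam]
      = map (\<lambda>j. take (lam ! j) (drop (block_start lam j) w)) [0..<length lam]" by simp
  then show "concat (map (\<lambda>j\<in>{..<length lam}. take (lam ! j) (drop (block_start lam j) w)) [0..<length lam]) = w"
    using concat_rows[of w lam] w unfolding words_def mem_Collect_eq by (simp only:)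
  show "(\<lambda>j\<in>{..<length lam}. take (lam ! j) (drop (block_start lam j) w)) \<in> rows lam N"
    using w block_start_le[of _ lam] by (fastforce simp: rows_def words_def dest: in_set_takeD in_set_dropD)
next
  fix p assume p: "p \<in> rows lam N"
  then have l: "length (p j) = lam ! j" and s: "set (p j) \<subseteq> {..<N}" if "j < length lam" for j
    using that by (auto simp: rows_def words_def PiE_iff)
  show "(\<lambda>j\<in>{..<length lam}. take (lam ! j) (drop (block_start lam j) (concat (map p [0..<length lam])))) = p"
  proof
    fix j show "(\<lambda>j\<in>{..<length lam}. take (lam ! j) (drop (block_start lam j) (concat (map p [0..<length lam])))) j = p j"
    proof (cases "j < length lam")
      case True
      then show ?thesis using rows_concat[of lam p j] l by simp
    next
      case False
      then show ?thesis using p by (auto simp: rows_def PiE_iff extensional_def)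
    qed
  qed
  have "length (concat (map p [0..<length lam])) = sum_list lam"
  proof -
    have "length (concat (map p [0..<length lam])) = sum_list (map (\<lambda>j. lam ! j) [0..<length lam])"
      unfolding length_concat map_map using l by (intro arg_cong[where f = sum_list]) auto
    then show ?thesis by (simp add: map_nth)
  qed
  then show "concat (map p [0..<length lam]) \<in> words N (sum_list lam)"
    using s by (fastforce simp: words_def)
qed auto

lemma prod_letter_prod_blocks:
  assumes "length w = sum_list lam"
  shows "(\<Prod>j<length lam. letter_prod x (take (lam ! j) (drop (block_start lam j) w))) = letter_prod x w"
proof -
  have "letter_prod x w = letter_prod x (concat (map (\<lambda>j. take (lam ! j) (drop (block_start lam j) w)) [0..<length lam]))"
    using concat_rows[OF assms] by simp
  also have "\<dots> = prod_list (map (\<lambda>j. letter_prod x (take (lam ! j) (drop (block_start lam j) w))) [0..<length lam])"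
  proof -
    have "letter_prod x (concat (map F js)) = prod_list (map (\<lambda>j. letter_prod x (F j)) js)" for F js
      by (induction js) (simp_all add: letter_prod_def)
    then show ?thesis .
  qed
  also have "\<dots> = (\<Prod>j<length lam. letter_prod x (take (lam ! j) (drop (block_start lam j) w)))"
    by (simp add: prod.distinct_set_conv_list[symmetric] atLeast0LessThan)
  finally show ?thesis ..
qed

text \<open>Concatenating rows gives words, grouped here by content; \<open>card_words_wdes\<close>
  then applies with \<open>P = blockP lam\<close>.\<close>

theorem maj_rows_schur:
  assumes n: "sum_list lam = n"
  shows "maj_rows_sum lam N x = (\<Sum>mu\<in>partitions n. of_nat (card (SYT_blocks lam mu)) * schur_poly N mu x)"
proof -
  let ?x = "\<lambda>B. prod_mset (image_mset x B)"
  let ?rw = "\<lambda>w. \<lambda>j\<in>{..<length lam}. take (lam ! j) (drop (block_start lam j) w)"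
  have "maj_rows_sum lam N x = (\<Sum>p\<in>rows lam N. if \<forall>j<length lam. [maj_word (p j) = 1] (mod lam ! j) then \<Prod>j<length lam. letter_prod x (p j) else 0)"
    unfolding maj_rows_sum_def using finite_rows by (simp add: sum.inter_filter[symmetric])
  also have "\<dots> = (\<Sum>w\<in>words N n. if blockP lam (wdes w) then letter_prod x w else 0)"
    unfolding n[symmetric] sum_words_rows[symmetric]
    by (intro sum.cong refl) (auto simp: words_def blockP_wdes prod_letter_prod_blocks)
  also have "\<dots> = (\<Sum>w | w \<in> words N n \<and> blockP lam (wdes w). ?x (mset w))"
    using finite_words by (simp add: sum.inter_filter[symmetric] letter_prod_mset)
  also have "\<dots> = (\<Sum>B\<in>letter_msets N n. of_nat (card {w \<in> {w. w \<in> words N n \<and> blockP lam (wdes w)}. mset w = B}) * ?x B)"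
  proof (rule sum_by_content)
    show "finite {w. w \<in> words N n \<and> blockP lam (wdes w)}" using finite_words by simp
  qed (auto simp: words_def letter_msets_def)
  also have "\<dots> = (\<Sum>B\<in>letter_msets N n. (\<Sum>f | shape f \<and> sz f = n. of_nat (kostka f B) * of_nat (card {Q \<in> syt f. blockP lam (des f Q)})) * ?x B)"
  proof (intro sum.cong refl arg_cong2[where f = "(*)"])
    fix B assume B: "B \<in> letter_msets N n"
    then have "{w \<in> {w. w \<in> words N n \<and> blockP lam (wdes w)}. mset w = B} = {w. mset w = B \<and> blockP lam (wdes w)}"
      by (auto simp: words_def letter_msets_def)
    moreover have "size B = n" using B by (simp add: letter_msets_def)
    ultimately show "of_nat (card {w \<in> {w. w \<in> words N n \<and> blockP lam (wdes w)}. mset w = B})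
      = (\<Sum>f | shape f \<and> sz f = n. of_nat (kostka f B) * (of_nat (card {Q \<in> syt f. blockP lam (des f Q)}) :: complex))"
      by (simp add: card_words_wdes)
  qed
  also have "\<dots> = (\<Sum>f | shape f \<and> sz f = n. \<Sum>B\<in>letter_msets N n. of_nat (card {Q \<in> syt f. blockP lam (des f Q)}) * (of_nat (kostka f B) * ?x B))"
    unfolding sum_distrib_right by (subst sum.swap) (simp add: algebra_simps)
  also have "\<dots> = (\<Sum>f | shape f \<and> sz f = n. of_nat (card {Q \<in> syt f. blockP lam (des f Q)}) * (\<Sum>B\<in>letter_msets N n. of_nat (kostka f B) * ?x B))"
    by (simp only: sum_distrib_left)
  also have "\<dots> = (\<Sum>mu\<in>partitions n. of_nat (card {Q \<in> syt (row_of mu). blockP lam (des (row_of mu) Q)}) * (\<Sum>B\<in>letter_msets N n. of_nat (kostka (row_of mu) B) * ?x B))"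
    by (rule sum.reindex_bij_betw[OF bij_row_of, symmetric])
  also have "\<dots> = (\<Sum>mu\<in>partitions n. of_nat (card (SYT_blocks lam mu)) * schur_poly N mu x)"
    by (intro sum.cong refl) (simp add: SYT_blocks_eq schur_poly_content)
  finally show ?thesis .
qed

subsection \<open>Multisets of necklaces\<close>

definition prim :: "nat list \<Rightarrow> bool" where
  "prim u \<longleftrightarrow> u \<noteq> [] \<and> (\<forall>k. 0 < k \<longrightarrow> k < length u \<longrightarrow> rotate k u \<noteq> u)"

text \<open>The choice is made from the set of rotations, which is the same set for every rotation
  of \<open>u\<close>, so the representative depends on the necklace only.\<close>

definition necklace_rep :: "nat list \<Rightarrow> nat list" where
  "necklace_rep u = (SOME v. v \<in> range (\<lambda>k. rotate k u))"

definition neck :: "nat \<Rightarrow> nat list set" where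
  "neck N = {u. prim u \<and> set u \<subseteq> {..<N} \<and> necklace_rep u = u}"

definition rot_offset :: "nat list \<Rightarrow> nat" where
  "rot_offset v = (SOME k. rotate k (necklace_rep v) = v)"

lemma rotate_mod_len: "rotate (k mod length u) u = rotate k u"
  by (rule rotate_conv_mod[symmetric])

text \<open>\<open>length u * k - k\<close> is minus \<open>k\<close> modulo the length, kept
  nonnegative.\<close>

lemma rotate_back: "rotate (length u * k - k) (rotate k u) = u" 
proof (cases "u = []")
  case False
  then have "length u * k - k + k = length u * k" by (cases "length u") auto
  then have "rotate (length u * k - k) (rotate k u) = rotate (length u * k) u" by (simp only: rotate_rotate)
  also have "\<dots> = rotate ((length u * k) mod length u) u" by (rule rotate_conv_mod)
  finally show ?thesis by simp
qed simp

lemma range_rotate: "range (\<lambda>k. rotate k (rotate l u)) = range (\<lambda>k. rotate k u)"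
proof (intro equalityI subsetI)
  fix v assume "v \<in> range (\<lambda>k. rotate k u)"
  then obtain k where "v = rotate k u" by auto
  then have "v = rotate (k + (length u * l - l)) (rotate l u)"
    using rotate_back[of u l] by (metis rotate_rotate)
  then show "v \<in> range (\<lambda>k. rotate k (rotate l u))" by blast
qed (auto simp: rotate_rotate)

lemma necklace_rep_rotate: "necklace_rep (rotate k u) = necklace_rep u"
  by (simp add: necklace_rep_def range_rotate)

lemma necklace_rep_ex: "\<exists>k. necklace_rep u = rotate k u"
proof -
  have "necklace_rep u \<in> range (\<lambda>k. rotate k u)" unfolding necklace_rep_def by (rule someI[of _ u]) (metis rangeI rotate0 id_apply)
  then show ?thesis by auto
qed

lemma necklace_rep_necklace_rep: "necklace_rep (necklace_rep u) = necklace_rep u" using necklace_rep_ex[of u] necklace_rep_rotate by metis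

lemma necklace_rep_facts: "length (necklace_rep u) = length u" "set (necklace_rep u) = set u" "letter_prod x (necklace_rep u) = letter_prod x u"
proof -
  obtain k where k: "necklace_rep u = rotate k u" using necklace_rep_ex by blast
  have "letter_prod x (rotate1 v) = letter_prod x v" for v by (cases v) (simp_all add: letter_prod_def)
  then have "letter_prod x (rotate k u) = letter_prod x u" by (induction k) simp_all
  then show "length (necklace_rep u) = length u" "set (necklace_rep u) = set u" "letter_prod x (necklace_rep u) = letter_prod x u" by (simp_all add: k)
qed

lemma rotate_rot_offset: "rotate (rot_offset v) (necklace_rep v) = v"
proof -
  obtain k where k: "necklace_rep v = rotate k v" using necklace_rep_ex by blast
  have "rotate (length v * k - k) (necklace_rep v) = v" unfolding k by (rule rotate_back)
  then show ?thesis unfolding rot_offset_def by (rule someI)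
qed

lemma rotate_inj: "rotate k u = rotate k v \<Longrightarrow> u = v"
  by (metis length_rotate rotate_back)

lemma prim_rotate: "prim (rotate k u) \<longleftrightarrow> prim u"
proof -
  have "rotate j (rotate k u) = rotate k u \<longleftrightarrow> rotate j u = u" for j
    using rotate_inj[of k "rotate j u" u] by (metis rotate_rotate add.commute)
  then show ?thesis by (simp add: prim_def)
qed

lemma prim_necklace_rep: "prim (necklace_rep u) \<longleftrightarrow> prim u" using necklace_rep_ex[of u] prim_rotate by metis

lemma prim_rotate_eq_iff:
  assumes "prim u" shows "rotate a u = rotate b u \<longleftrightarrow> [a = b] (mod length u)"
proof
  have m: "length u > 0" using assms by (simp add: prim_def)
  {
    fix a b assume e: "rotate a u = rotate b u" and le: "a mod length u \<le> b mod length u"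
    let ?a = "a mod length u" and ?b = "b mod length u"
    have "rotate ?a (rotate (?b - ?a) u) = rotate ?a u"
      using e le by (simp add: rotate_rotate rotate_mod_len)
    then have "rotate (?b - ?a) u = u" by (rule rotate_inj)
    moreover have "?b - ?a < length u" using m by (meson le_less_trans diff_le_self mod_less_divisor)
    ultimately have "?b - ?a = 0" using assms by (metis gr0I prim_def)
    then have "?a = ?b" using le by simp
  }
  note w = this
  assume "rotate a u = rotate b u"
  then show "[a = b] (mod length u)" using w[of a b] w[of b a] unfolding cong_def by (metis nle_le)
next
  assume "[a = b] (mod length u)"
  then show "rotate a u = rotate b u" by (metis cong_def rotate_mod_len)
qed

text \<open>A gauge for the twisted sums: the weight of the rotation between two words of one
  primitive necklace is a quotient of two such values, so it cancels in products over a permutation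
  of the rows.\<close>

definition rot_weight :: "nat list \<Rightarrow> complex" where
  "rot_weight v = unit_root (length v) ^ (rot_offset v * (length v - 1))"

lemma rot_weight_nz: "rot_weight v \<noteq> 0" by (simp add: rot_weight_def unit_root_nz)

text \<open>A primitive word reaches each of its rotations for exactly one \<open>k\<close>. For a
  periodic word, shifting \<open>k\<close> by the period multiplies the sum by a number different
  from one, so the sum vanishes.\<close>

lemma sum_rotate_indicator:
  assumes m: "m > 0" and u: "length u = m" and v: "length v = m"
  shows "(\<Sum>k<m. unit_root m ^ (k * (m - 1)) * (if rotate k u = v then 1 else 0))
    = (if prim u \<and> necklace_rep u = necklace_rep v then rot_weight v / rot_weight u else 0)"
proof (cases "prim u")
  case True
  show ?thesis
  proof (cases "necklace_rep u = necklace_rep v")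
    case True
    note rep = True
    define y where "y = necklace_rep u"
    have y: "prim y" "length y = m" using \<open>prim u\<close> prim_necklace_rep necklace_rep_facts(1) u by (auto simp: y_def)
    have iff: "rotate k u = v \<longleftrightarrow> [k + rot_offset u = rot_offset v] (mod m)" for k
    proof -
      have "rotate k u = rotate (k + rot_offset u) y" using rotate_rot_offset[of u] by (metis rotate_rotate y_def)
      moreover have "v = rotate (rot_offset v) y" using rotate_rot_offset[of v] rep by (simp add: y_def)
      ultimately show ?thesis using prim_rotate_eq_iff[OF y(1), of "k + rot_offset u" "rot_offset v"] y(2) by simp
    qed
    \<comment> \<open>The difference of the offsets modulo \<open>m\<close>; the term
      \<open>m * rot_offset u - rot_offset u\<close> plays the role of minus
      \<open>rot_offset u\<close>.\<close>
    define k0 where "k0 = (rot_offset v + (m * rot_offset u - rot_offset u)) mod m"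
    have k0: "k0 < m" using m by (simp add: k0_def)
    have le: "rot_offset u \<le> m * rot_offset u" using m by simp
    have c0: "[k0 + rot_offset u = rot_offset v] (mod m)"
    proof -
      have "(k0 + rot_offset u) mod m = (rot_offset v + (m * rot_offset u - rot_offset u) + rot_offset u) mod m" unfolding k0_def by (simp add: mod_simps)
      also have "rot_offset v + (m * rot_offset u - rot_offset u) + rot_offset u = rot_offset v + m * rot_offset u" using le by linarith
      finally show ?thesis by (simp add: cong_def)
    qed
    have uniq: "rotate k u = v \<longleftrightarrow> k = k0" if "k < m" for k
    proof
      assume "rotate k u = v"
      then have "[k + rot_offset u = rot_offset v] (mod m)" unfolding iff .
      then have "[k + rot_offset u = k0 + rot_offset u] (mod m)" by (rule cong_trans[OF _ cong_sym[OF c0]])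
      then have "[k = k0] (mod m)" by (simp add: cong_add_rcancel_nat)
      then show "k = k0" using that k0 by (rule cong_less_modulus_unique_nat)
    qed (use c0 iff in simp)
    have "(\<Sum>k<m. unit_root m ^ (k * (m - 1)) * (if rotate k u = v then 1 else 0)) = (\<Sum>k<m. if k = k0 then unit_root m ^ (k0 * (m - 1)) else 0)"
      using uniq by (intro sum.cong) auto
    also have "\<dots> = unit_root m ^ (k0 * (m - 1))" using k0 by simp
    also have "\<dots> = rot_weight v / rot_weight u"
    proof -
      have "unit_root m ^ (k0 * (m - 1)) * rot_weight u = unit_root m ^ ((k0 + rot_offset u) * (m - 1))"
        by (simp add: rot_weight_def u distrib_right power_add)
      also have "\<dots> = unit_root m ^ (((k0 + rot_offset u) mod m) * (m - 1))" by (rule unit_root_power_mod[OF m, symmetric])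
      also have "(k0 + rot_offset u) mod m = rot_offset v mod m" using c0 by (simp add: cong_def)
      also have "unit_root m ^ ((rot_offset v mod m) * (m - 1)) = rot_weight v" by (simp add: unit_root_power_mod[OF m] rot_weight_def v)
      finally show ?thesis using rot_weight_nz by (simp add: field_simps)
    qed
    finally show ?thesis using True \<open>prim u\<close> by simp
  next
    case False
    then have "rotate k u \<noteq> v" for k using necklace_rep_rotate by metis
    then show ?thesis using False by simp
  qed
next
  case False
  then obtain k0 where k0: "0 < k0" "k0 < m" "rotate k0 u = u" using u m by (auto simp: prim_def)
  let ?z = "unit_root m ^ (m - 1)"
  let ?S = "\<Sum>k<m. unit_root m ^ (k * (m - 1)) * (if rotate k u = v then 1 else 0)"
  have zm: "?z ^ m = 1" unfolding power_mult[symmetric] using unit_root_power_eq_1_iff[OF m] by simp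
  \<comment> \<open>\<open>m - 1\<close> is coprime to \<open>m\<close>, so \<open>?z\<close> has
    exact order \<open>m\<close>, and \<open>0 < k0 < m\<close>.\<close>
  have zk: "?z ^ k0 \<noteq> 1"
  proof
    assume "?z ^ k0 = 1"
    then have "m dvd (m - 1) * k0" unfolding power_mult[symmetric] using unit_root_power_eq_1_iff[OF m] by simp
    moreover have "coprime m (m - 1)" using m by (metis coprime_Suc_right_nat Suc_pred' coprime_commute coprime_diff_one_right_nat)
    ultimately have "m dvd k0" by (simp add: coprime_dvd_mult_right_iff)
    then show False using k0 by (auto dest: dvd_imp_le)
  qed
  have S: "?S = (\<Sum>k<m. ?z ^ k * (if rotate k u = v then 1 else 0))"
    by (intro sum.cong refl) (simp add: power_mult[symmetric] mult.commute)
  have bij: "bij_betw (\<lambda>k. (k + k0) mod m) {..<m} {..<m}"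
  proof -
    have "inj_on (\<lambda>k. (k + k0) mod m) {..<m}"
    proof (rule inj_onI)
      fix a b assume ab: "a \<in> {..<m}" "b \<in> {..<m}" "(a + k0) mod m = (b + k0) mod m"
      then have "[a = b] (mod m)" by (metis cong_add_rcancel_nat cong_def)
      then show "a = b" using ab by (intro cong_less_modulus_unique_nat) auto
    qed
    moreover have "(\<lambda>k. (k + k0) mod m) ` {..<m} \<subseteq> {..<m}" using m by auto
    ultimately show ?thesis by (simp add: bij_betw_def endo_inj_surj)
  qed
  have "?S = (\<Sum>k<m. ?z ^ ((k + k0) mod m) * (if rotate ((k + k0) mod m) u = v then 1 else 0))"
    unfolding S by (rule sum.reindex_bij_betw[OF bij, symmetric])
  also have "\<dots> = (\<Sum>k<m. ?z ^ k0 * (?z ^ k * (if rotate k u = v then 1 else 0)))"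
  proof (intro sum.cong refl)
    fix k
    have "rotate ((k + k0) mod m) u = rotate k u" using k0(3) u by (metis rotate_mod_len rotate_rotate)
    then show "?z ^ ((k + k0) mod m) * (if rotate ((k + k0) mod m) u = v then 1 else 0) = ?z ^ k0 * (?z ^ k * (if rotate k u = v then 1 else 0))"
      unfolding power_mod_root[OF zm] power_add by (simp only: mult.assoc mult.left_commute)
  qed
  also have "\<dots> = ?z ^ k0 * ?S" unfolding S by (rule sum_distrib_left[symmetric])
  finally have "(1 - ?z ^ k0) * ?S = 0" by (simp add: algebra_simps)
  then have "?S = 0" using zk by auto
  then show ?thesis using False by simp
qed

definition neck_msets :: "nat list \<Rightarrow> nat \<Rightarrow> nat list multiset set" where
  "neck_msets lam N = {M. image_mset length M = mset lam \<and> set_mset M \<subseteq> neck N}"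

lemma rotations_of_necklace:
  assumes "y \<in> neck N" "length y = m"
  shows "{v \<in> words N m. prim v \<and> necklace_rep v = y} = (\<lambda>k. rotate k y) ` {..<m}" "card {v \<in> words N m. prim v \<and> necklace_rep v = y} = m"
proof -
  have y: "prim y" "set y \<subseteq> {..<N}" "necklace_rep y = y" using assms(1) by (auto simp: neck_def)
  have m: "m > 0" using y(1) assms(2) by (auto simp: prim_def)
  show e: "{v \<in> words N m. prim v \<and> necklace_rep v = y} = (\<lambda>k. rotate k y) ` {..<m}"
  proof (intro equalityI subsetI)
    fix v assume "v \<in> {v \<in> words N m. prim v \<and> necklace_rep v = y}"
    then have "rotate (rot_offset v) y = v" using rotate_rot_offset[of v] by auto
    then have "rotate (rot_offset v mod m) y = v" using assms(2) rotate_mod_len by metis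
    then show "v \<in> (\<lambda>k. rotate k y) ` {..<m}" using m by (intro image_eqI[of _ _ "rot_offset v mod m"]) auto
  next
    fix v assume "v \<in> (\<lambda>k. rotate k y) ` {..<m}"
    then show "v \<in> {v \<in> words N m. prim v \<and> necklace_rep v = y}"
      using y assms(2) by (auto simp: words_def prim_rotate necklace_rep_rotate)
  qed
  have "inj_on (\<lambda>k. rotate k y) {..<m}"
    using prim_rotate_eq_iff[OF y(1)] assms(2) by (auto simp: inj_on_def intro: cong_less_modulus_unique_nat)
  then show "card {v \<in> words N m. prim v \<and> necklace_rep v = y} = m" unfolding e by (simp add: card_image)
qed

lemma finite_neck_length: "finite {u \<in> neck N. length u = m}"
  by (rule finite_subset[OF _ finite_words[of N m]]) (auto simp: neck_def words_def)

text \<open>Burnside's lemma for the block permutations acting on tuples of necklaces.\<close>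

lemma sum_fixed_tuples:
  fixes lam :: "nat list" and N :: nat
  defines "Y \<equiv> \<Pi>\<^sub>E j\<in>{..<length lam}. {u \<in> neck N. length u = lam ! j}"
  shows "(\<Sum>\<pi>\<in>block_perms lam. \<Sum>y | y \<in> Y \<and> y \<circ> \<pi> = y. \<Prod>j<length lam. letter_prod x (y j))
    = of_nat (card (block_perms lam)) * (\<Sum>M\<in>neck_msets lam N. prod_mset (image_mset (letter_prod x) M))"
proof -
  let ?J = "{..<length lam}" and ?r = "length lam"
  let ?x = "\<lambda>M. prod_mset (image_mset (letter_prod x) M)"
  define c where "c y = image_mset y (mset_set ?J)" for y :: "nat \<Rightarrow> nat list"
  have finY: "finite Y" unfolding Y_def by (intro finite_PiE) (auto simp: finite_neck_length)
  have lamJ: "image_mset (\<lambda>j. lam ! j) (mset_set ?J) = mset lam"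
    by (metis atLeast0LessThan map_nth mset_map mset_upt)
  have cY: "c y \<in> neck_msets lam N" if y: "y \<in> Y" for y
  proof -
    have "image_mset length (c y) = image_mset (\<lambda>j. lam ! j) (mset_set ?J)"
      unfolding c_def multiset.map_comp using y by (intro image_mset_cong) (auto simp: Y_def PiE_iff)
    moreover have "set_mset (c y) \<subseteq> neck N" using y by (auto simp: c_def Y_def PiE_iff)
    ultimately show ?thesis using lamJ by (simp add: neck_msets_def)
  qed
  have finM: "finite (neck_msets lam N)"
  proof (rule finite_subset)
    let ?U = "\<Union>m\<in>set lam. words N m"
    show "neck_msets lam N \<subseteq> {M. set_mset M \<subseteq> ?U \<and> size M = length lam}"
    proof
      fix M assume M: "M \<in> neck_msets lam N"
      then have l: "image_mset length M = mset lam" by (simp add: neck_msets_def)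
      have "u \<in> ?U" if u: "u \<in># M" for u
      proof -
        have "length u \<in># image_mset length M" using u by simp
        then have "length u \<in> set lam" unfolding l by simp
        moreover have "u \<in> words N (length u)" using M u by (auto simp: neck_msets_def neck_def words_def)
        ultimately show ?thesis by blast
      qed
      moreover have "size M = length lam" using arg_cong[OF l, of size] by simp
      ultimately show "M \<in> {M. set_mset M \<subseteq> ?U \<and> size M = length lam}" by blast
    qed
  qed (simp add: finite_msets_size finite_words)
  have cnt: "(\<Sum>\<pi> | \<pi> permutes ?J. card {y \<in> {y \<in> Y. c y = M}. y \<circ> \<pi> = y}) = card (block_perms lam)"
    if M: "M \<in> neck_msets lam N" for M
  proof -
    let ?Q = "{y \<in> Y. c y = M}"
    have l: "image_mset length M = mset lam" using M by (simp add: neck_msets_def)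
    have sM: "size M = card ?J" using arg_cong[OF l, of size] by simp
    obtain w1 where w1: "w1 \<in> content_words ?J M" using content_words_nonempty[OF _ sM] by blast
    have "image_mset (\<lambda>j. lam ! j) (mset_set ?J) = image_mset (\<lambda>j. length (w1 j)) (mset_set ?J)"
    proof -
      have "image_mset (\<lambda>j. length (w1 j)) (mset_set ?J) = image_mset length (image_mset w1 (mset_set ?J))"
        by (simp add: multiset.map_comp o_def)
      then show ?thesis using w1 l lamJ by (simp add: content_words_def)
    qed
    from image_mset_eq_implies_permutes[OF _ this] obtain p where p: "p permutes ?J" "\<forall>j\<in>?J. lam ! j = length (w1 (p j))" by blast
    \<comment> \<open>Rearranging the word gives it length \<open>lam ! j\<close> at place
      \<open>j\<close>, so that \<open>w0\<close> is itself one of the tuples to be counted.\<close>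
    define w0 where "w0 = w1 \<circ> p"
    have w0: "w0 \<in> content_words ?J M" unfolding w0_def by (rule content_words_comp[OF p(1) w1])
    have len0: "length (w0 j) = lam ! j" if "j < ?r" for j using p(2) that by (simp add: w0_def)
    have Qiff: "y \<in> ?Q \<longleftrightarrow> y \<in> content_words ?J M \<and> (\<forall>j<?r. length (y j) = lam ! j)" for y
    proof
      assume y: "y \<in> content_words ?J M \<and> (\<forall>j<?r. length (y j) = lam ! j)"
      then have cy: "c y = M" "y \<in> extensional ?J" by (auto simp: content_words_def c_def)
      have "y j \<in># M" if "j \<in> ?J" for j unfolding cy(1)[symmetric] c_def using that by simp
      then have "y j \<in> neck N" if "j \<in> ?J" for j using M that by (auto simp: neck_msets_def)
      then show "y \<in> ?Q" using y cy by (auto simp: Y_def PiE_iff)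
    qed (auto simp: Y_def PiE_iff content_words_def c_def)
    have "(\<Sum>\<pi> | \<pi> permutes ?J. card {y \<in> ?Q. y \<circ> \<pi> = y}) = card {\<rho>. \<rho> permutes ?J \<and> w0 \<circ> \<rho> \<in> ?Q}"
      using Qiff by (intro sum_fixn_weighted[OF _ w0]) auto
    also have "{\<rho>. \<rho> permutes ?J \<and> w0 \<circ> \<rho> \<in> ?Q} = block_perms lam"
    proof -
      have "w0 \<circ> \<rho> \<in> ?Q \<longleftrightarrow> (\<forall>j<?r. lam ! \<rho> j = lam ! j)" if \<rho>: "\<rho> permutes ?J" for \<rho>
      proof -
        have "\<rho> j < ?r" if "j < ?r" for j using permutes_in_image[OF \<rho>, of j] that by simp
        then show ?thesis unfolding Qiff using content_words_comp[OF \<rho> w0] len0 by auto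
      qed
      then show ?thesis by (auto simp: block_perms_def)
    qed
    finally show ?thesis .
  qed
  \<comment> \<open>Burnside's count runs over all permutations of the places; one outside
    \<open>block_perms lam\<close> matches places of different lengths and fixes no tuple.\<close>
  have notPP: "\<not> (y \<in> Y \<and> y \<circ> \<pi> = y)" if "\<pi> permutes ?J" "\<pi> \<notin> block_perms lam" for y \<pi>
  proof
    assume y: "y \<in> Y \<and> y \<circ> \<pi> = y"
    have "lam ! \<pi> j = lam ! j" if "j < ?r" for j
    proof -
      have "\<pi> j < ?r" using permutes_in_image[OF \<open>\<pi> permutes ?J\<close>, of j] that by simp
      moreover have "y (\<pi> j) = y j" using y by (metis comp_apply)
      moreover have "length (y i) = lam ! i" if "i < length lam" for i using y that by (auto simp: Y_def PiE_iff)
      ultimately show ?thesis using that by metis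
    qed
    then show False using that by (simp add: block_perms_def)
  qed
  have xc: "(\<Prod>j\<in>?J. letter_prod x (y j)) = ?x (c y)" for y
    by (simp add: c_def prod_unfold_prod_mset multiset.map_comp o_def)
  have "(\<Sum>\<pi>\<in>block_perms lam. \<Sum>y | y \<in> Y \<and> y \<circ> \<pi> = y. \<Prod>j\<in>?J. letter_prod x (y j))
    = (\<Sum>\<pi> | \<pi> permutes ?J. \<Sum>y | y \<in> Y \<and> y \<circ> \<pi> = y. ?x (c y))"
    unfolding xc
  proof (rule sum.mono_neutral_left)
    show "\<forall>\<pi>\<in>{\<pi>. \<pi> permutes ?J} - block_perms lam. (\<Sum>y | y \<in> Y \<and> y \<circ> \<pi> = y. ?x (c y)) = 0"
    proof
      fix \<pi> assume "\<pi> \<in> {\<pi>. \<pi> permutes ?J} - block_perms lam"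
      then have "{y. y \<in> Y \<and> y \<circ> \<pi> = y} = {}" using notPP by blast
      then show "(\<Sum>y | y \<in> Y \<and> y \<circ> \<pi> = y. ?x (c y)) = 0" by (simp only: sum.empty)
    qed
  qed (auto simp: block_perms_def intro: finite_permutations)
  also have "\<dots> = (\<Sum>\<pi> | \<pi> permutes ?J. \<Sum>M\<in>neck_msets lam N. of_nat (card {y \<in> {y \<in> Y. c y = M}. y \<circ> \<pi> = y}) * ?x M)"
  proof (intro sum.cong refl)
    fix \<pi>
    have "(\<Sum>y | y \<in> Y \<and> y \<circ> \<pi> = y. ?x (c y)) = (\<Sum>M\<in>neck_msets lam N. \<Sum>y | y \<in> {y. y \<in> Y \<and> y \<circ> \<pi> = y} \<and> c y = M. ?x (c y))"
      using finY finM cY by (intro sum.group[symmetric]) auto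
    also have "\<dots> = (\<Sum>M\<in>neck_msets lam N. of_nat (card {y \<in> {y \<in> Y. c y = M}. y \<circ> \<pi> = y}) * ?x M)"
    proof (intro sum.cong refl)
      fix M
      have "{y. y \<in> {y. y \<in> Y \<and> y \<circ> \<pi> = y} \<and> c y = M} = {y \<in> {y \<in> Y. c y = M}. y \<circ> \<pi> = y}" by auto
      then show "(\<Sum>y | y \<in> {y. y \<in> Y \<and> y \<circ> \<pi> = y} \<and> c y = M. ?x (c y)) = of_nat (card {y \<in> {y \<in> Y. c y = M}. y \<circ> \<pi> = y}) * ?x M"
        by simp
    qed
    finally show "(\<Sum>y | y \<in> Y \<and> y \<circ> \<pi> = y. ?x (c y)) = (\<Sum>M\<in>neck_msets lam N. of_nat (card {y \<in> {y \<in> Y. c y = M}. y \<circ> \<pi> = y}) * ?x M)" .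
  qed
  also have "\<dots> = (\<Sum>M\<in>neck_msets lam N. of_nat (\<Sum>\<pi> | \<pi> permutes ?J. card {y \<in> {y \<in> Y. c y = M}. y \<circ> \<pi> = y}) * ?x M)"
    unfolding of_nat_sum sum_distrib_right by (rule sum.swap)
  also have "\<dots> = of_nat (card (block_perms lam)) * (\<Sum>M\<in>neck_msets lam N. ?x M)"
    unfolding sum_distrib_left using cnt by (intro sum.cong refl) simp
  finally show ?thesis .
qed

text \<open>Summing over the shifts first leaves the tuples of primitive words that agree with their
  \<open>\<pi>\<close>-permuted tuple up to rotation. Replacing words by necklaces gives fixed
  tuples, each with as many lifts as there are shifts, and Burnside's lemma turns fixed tuples into
  multisets.\<close>

theorem wreath_average:
  assumes pos: "\<forall>j<length lam. 0 < lam ! j"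
  shows "(\<Sum>h\<in>wreath lam. rot_char lam h / of_nat (card (wreath lam)) * psum (cells lam) N x h)
    = (\<Sum>M\<in>neck_msets lam N. prod_mset (image_mset (letter_prod x) M))"
proof -
  let ?J = "{..<length lam}"
  let ?x = "\<lambda>p. \<Prod>j\<in>?J. letter_prod x (p j)"
  define Y where "Y = (\<Pi>\<^sub>E j\<in>?J. {u \<in> neck N. length u = lam ! j})"
  have finY: "finite Y" unfolding Y_def by (intro finite_PiE) (auto simp: finite_neck_length)
  define good where "good \<pi> p \<longleftrightarrow> (\<forall>j<length lam. prim (p (\<pi> j)) \<and> necklace_rep (p (\<pi> j)) = necklace_rep (p j))" for \<pi> p
  have inner: "(\<Sum>c\<in>block_shifts lam. rot_char lam (hperm lam \<pi> c) * psum (cells lam) N x (hperm lam \<pi> c))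
      = (\<Sum>p\<in>rows lam N. if good \<pi> p then ?x p else 0)" if \<pi>: "\<pi> \<in> block_perms lam" for \<pi>
  proof -
    have perm: "\<pi> permutes ?J" using \<pi> by (simp add: block_perms_def)
    have pj: "\<pi> j < length lam" "lam ! \<pi> j = lam ! j" if "j < length lam" for j
      using \<pi> that permutes_in_image[OF perm, of j] by (auto simp: block_perms_def)
    let ?t = "\<lambda>p j k. unit_root (lam ! j) ^ (k * (lam ! j - 1)) * (if rotate k (p (\<pi> j)) = p j then 1 else 0)"
    have "(\<Sum>c\<in>block_shifts lam. rot_char lam (hperm lam \<pi> c) * psum (cells lam) N x (hperm lam \<pi> c))
      = (\<Sum>c\<in>block_shifts lam. \<Sum>p\<in>rows lam N. (\<Prod>j\<in>?J. ?t p j (c j)) * ?x p)"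
    proof (intro sum.cong refl)
      fix c assume c: "c \<in> block_shifts lam"
      have ind: "(if \<forall>j<length lam. rotate (c j) (p (\<pi> j)) = p j then ?x p else 0)
          = (\<Prod>j\<in>?J. if rotate (c j) (p (\<pi> j)) = p j then 1 else 0) * ?x p" for p
      proof (cases "\<forall>j<length lam. rotate (c j) (p (\<pi> j)) = p j")
        case False
        then have "(\<Prod>j\<in>?J. if rotate (c j) (p (\<pi> j)) = p j then 1 else 0 :: complex) = 0" by (auto intro!: prod_zero)
        then show ?thesis using False by simp
      qed simp
      show "rot_char lam (hperm lam \<pi> c) * psum (cells lam) N x (hperm lam \<pi> c) = (\<Sum>p\<in>rows lam N. (\<Prod>j\<in>?J. ?t p j (c j)) * ?x p)"
        unfolding psum_hperm[OF \<pi>] rot_char_hperm[OF pos c] ind sum_distrib_left prod.distrib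
        by (simp only: mult.assoc)
    qed
    also have "\<dots> = (\<Sum>p\<in>rows lam N. \<Sum>c\<in>block_shifts lam. (\<Prod>j\<in>?J. ?t p j (c j)) * ?x p)" by (rule sum.swap)
    also have "\<dots> = (\<Sum>p\<in>rows lam N. (\<Prod>j\<in>?J. \<Sum>k<lam ! j. ?t p j k) * ?x p)"
    proof (intro sum.cong refl)
      fix p :: "nat \<Rightarrow> nat list"
      have "(\<Prod>j\<in>?J. \<Sum>k<lam ! j. ?t p j k) = (\<Sum>c\<in>block_shifts lam. \<Prod>j\<in>?J. ?t p j (c j))"
        unfolding block_shifts_def by (rule prod_sum_PiE) auto
      then show "(\<Sum>c\<in>block_shifts lam. (\<Prod>j\<in>?J. ?t p j (c j)) * ?x p) = (\<Prod>j\<in>?J. \<Sum>k<lam ! j. ?t p j k) * ?x p"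
        by (simp only: sum_distrib_right)
    qed
    also have "\<dots> = (\<Sum>p\<in>rows lam N. if good \<pi> p then ?x p else 0)"
    proof (intro sum.cong refl)
      fix p assume p: "p \<in> rows lam N"
      have lp: "length (p j) = lam ! j" if "j < length lam" for j
        using p that by (auto simp: rows_def words_def PiE_iff)
      have ts: "(\<Sum>k<lam ! j. ?t p j k) = (if prim (p (\<pi> j)) \<and> necklace_rep (p (\<pi> j)) = necklace_rep (p j) then rot_weight (p j) / rot_weight (p (\<pi> j)) else 0)"
        if "j < length lam" for j
        using that lp pj pos by (intro sum_rotate_indicator) auto
      show "(\<Prod>j\<in>?J. \<Sum>k<lam ! j. ?t p j k) * ?x p = (if good \<pi> p then ?x p else 0)"
      proof (cases "good \<pi> p")
        case True
        \<comment> \<open>The denominators are the numerators permuted by \<open>\<pi>\<close>, so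
          all weights cancel.\<close>
        have "(\<Prod>j\<in>?J. \<Sum>k<lam ! j. ?t p j k) = (\<Prod>j\<in>?J. rot_weight (p j) / rot_weight (p (\<pi> j)))"
          using ts True by (intro prod.cong refl) (auto simp: good_def)
        also have "\<dots> = (\<Prod>j\<in>?J. rot_weight (p j)) / (\<Prod>j\<in>?J. rot_weight (p (\<pi> j)))" by (rule prod_dividef)
        also have "(\<Prod>j\<in>?J. rot_weight (p (\<pi> j))) = (\<Prod>j\<in>?J. rot_weight (p j))"
          using prod.permute[OF perm, of "\<lambda>j. rot_weight (p j)"] by (simp add: o_def)
        finally have "(\<Prod>j\<in>?J. \<Sum>k<lam ! j. ?t p j k) = 1" using rot_weight_nz by simp
        then show ?thesis using True by simp
      next
        case False
        then obtain j where j: "j < length lam" "\<not> (prim (p (\<pi> j)) \<and> necklace_rep (p (\<pi> j)) = necklace_rep (p j))" by (auto simp: good_def)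
        then have "(\<Sum>k<lam ! j. ?t p j k) = 0" by (simp only: ts[OF j(1)] if_False)
        then have "(\<Prod>j\<in>?J. \<Sum>k<lam ! j. ?t p j k) = 0" using j(1) by (intro prod_zero) auto
        then show ?thesis using False by simp
      qed
    qed
    finally show ?thesis .
  qed
  have fib: "(\<Sum>p\<in>rows lam N. if good \<pi> p then ?x p else 0) = of_nat (card (block_shifts lam)) * (\<Sum>y | y \<in> Y \<and> y \<circ> \<pi> = y. ?x y)"
    if \<pi>: "\<pi> \<in> block_perms lam" for \<pi>
  proof -
    have perm: "\<pi> permutes ?J" using \<pi> by (simp add: block_perms_def)
    let ?R = "\<lambda>p. \<lambda>j\<in>?J. necklace_rep (p j)"
    let ?V = "{p. p \<in> rows lam N \<and> good \<pi> p}"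
    have surj: "\<exists>i<length lam. j = \<pi> i" if "j < length lam" for j
      using permutes_image[OF perm] that by (metis imageE lessThan_iff)
    have gprim: "prim (p j)" if "good \<pi> p" "j < length lam" for p j using surj[OF that(2)] that(1) by (auto simp: good_def)
    have RY: "?R p \<in> {y. y \<in> Y \<and> y \<circ> \<pi> = y}" if p: "p \<in> ?V" for p
    proof -
      have pw: "p j \<in> words N (lam ! j)" if "j < length lam" for j using p that by (auto simp: rows_def PiE_iff)
      have "necklace_rep (p j) \<in> neck N" "length (necklace_rep (p j)) = lam ! j" if "j < length lam" for j
        using pw[OF that] gprim[of p j] p that by (auto simp: neck_def words_def necklace_rep_facts necklace_rep_necklace_rep prim_necklace_rep)
      then have "?R p \<in> Y" by (auto simp: Y_def)
      moreover have "?R p \<circ> \<pi> = ?R p"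
      proof
        fix j show "(?R p \<circ> \<pi>) j = ?R p j"
        proof (cases "j < length lam")
          case True
          then have "\<pi> j < length lam" using permutes_in_image[OF perm, of j] by simp
          then show ?thesis using True p by (auto simp: good_def)
        next
          case False
          then show ?thesis using permutes_not_in[OF perm, of j] by simp
        qed
      qed
      ultimately show ?thesis by simp
    qed
    have cardfib: "card {p. p \<in> ?V \<and> ?R p = y} = card (block_shifts lam)" if y: "y \<in> {y. y \<in> Y \<and> y \<circ> \<pi> = y}" for y
    proof -
      have yn: "y j \<in> neck N" "length (y j) = lam ! j" if "j < length lam" for j using y that by (auto simp: Y_def PiE_iff)
      have "{p. p \<in> ?V \<and> ?R p = y} = (\<Pi>\<^sub>E j\<in>?J. {v \<in> words N (lam ! j). prim v \<and> necklace_rep v = y j})"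
      proof (intro equalityI subsetI)
        fix p assume p: "p \<in> {p. p \<in> ?V \<and> ?R p = y}"
        then have "necklace_rep (p j) = y j" if "j < length lam" for j using that by (auto simp: fun_eq_iff restrict_def split: if_splits) 
        then show "p \<in> (\<Pi>\<^sub>E j\<in>?J. {v \<in> words N (lam ! j). prim v \<and> necklace_rep v = y j})"
          using p gprim by (auto simp: rows_def PiE_iff)
      next
        fix p assume p: "p \<in> (\<Pi>\<^sub>E j\<in>?J. {v \<in> words N (lam ! j). prim v \<and> necklace_rep v = y j})"
        then have pj: "p j \<in> words N (lam ! j)" "prim (p j)" "necklace_rep (p j) = y j" if "j < length lam" for j
          using that by (auto simp: PiE_iff)
        have "good \<pi> p" unfolding good_def
        proof (intro allI impI)
          fix j assume j: "j < length lam"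
          then have "\<pi> j < length lam" using permutes_in_image[OF perm, of j] by simp
          moreover have "y (\<pi> j) = y j" using y by (auto simp: fun_eq_iff)
          ultimately show "prim (p (\<pi> j)) \<and> necklace_rep (p (\<pi> j)) = necklace_rep (p j)" using pj j by simp
        qed
        moreover have "p \<in> rows lam N" using p by (auto simp: rows_def PiE_iff)
        moreover have "?R p = y"
        proof
          fix j show "?R p j = y j" using pj y by (cases "j < length lam") (auto simp: Y_def PiE_iff extensional_def)
        qed
        ultimately show "p \<in> {p. p \<in> ?V \<and> ?R p = y}" by simp
      qed
      also have "card \<dots> = (\<Prod>j\<in>?J. card {v \<in> words N (lam ! j). prim v \<and> necklace_rep v = y j})" by (rule card_PiE) simp
      also have "\<dots> = (\<Prod>j\<in>?J. lam ! j)" using rotations_of_necklace(2)[OF yn] by (intro prod.cong) auto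
      finally show ?thesis by (simp add: card_block_shifts)
    qed
    have "(\<Sum>p\<in>rows lam N. if good \<pi> p then ?x p else 0) = (\<Sum>p\<in>?V. ?x (?R p))"
      using finite_rows by (simp add: sum.inter_filter[symmetric] necklace_rep_facts)
    also have "\<dots> = (\<Sum>y | y \<in> Y \<and> y \<circ> \<pi> = y. \<Sum>p | p \<in> ?V \<and> ?R p = y. ?x (?R p))"
      using RY finite_rows finY by (intro sum.group[symmetric]) auto
    also have "\<dots> = (\<Sum>y | y \<in> Y \<and> y \<circ> \<pi> = y. of_nat (card (block_shifts lam)) * ?x y)"
    proof (intro sum.cong refl)
      fix y assume y: "y \<in> {y. y \<in> Y \<and> y \<circ> \<pi> = y}"
      have "(\<Sum>p | p \<in> ?V \<and> ?R p = y. ?x (?R p)) = (\<Sum>p | p \<in> ?V \<and> ?R p = y. ?x y)" by (intro sum.cong) auto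
      then show "(\<Sum>p | p \<in> ?V \<and> ?R p = y. ?x (?R p)) = of_nat (card (block_shifts lam)) * ?x y" using cardfib[OF y] by simp
    qed
    finally show ?thesis by (simp only: sum_distrib_left)
  qed
  have c0: "card (block_shifts lam) \<noteq> 0" unfolding card_block_shifts using pos by simp
  have p0: "card (block_perms lam) \<noteq> 0" using finite_block_perms id_block_perms by auto
  have "(\<Sum>h\<in>wreath lam. rot_char lam h * psum (cells lam) N x h)
    = (\<Sum>\<pi>\<in>block_perms lam. \<Sum>c\<in>block_shifts lam. rot_char lam (hperm lam \<pi> c) * psum (cells lam) N x (hperm lam \<pi> c))"
    unfolding wreath_def sum.reindex[OF hperm_inj[OF pos]] by (simp add: sum.cartesian_product split_def)
  also have "\<dots> = (\<Sum>\<pi>\<in>block_perms lam. of_nat (card (block_shifts lam)) * (\<Sum>y | y \<in> Y \<and> y \<circ> \<pi> = y. ?x y))"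
    using inner fib by (intro sum.cong refl) simp
  also have "\<dots> = of_nat (card (block_shifts lam)) * (of_nat (card (block_perms lam)) * (\<Sum>M\<in>neck_msets lam N. prod_mset (image_mset (letter_prod x) M)))"
    unfolding sum_distrib_left[symmetric] Y_def sum_fixed_tuples ..
  finally have e: "(\<Sum>h\<in>wreath lam. rot_char lam h * psum (cells lam) N x h) = \<dots>" .
  have "(\<Sum>h\<in>wreath lam. rot_char lam h / of_nat (card (wreath lam)) * psum (cells lam) N x h)
    = (\<Sum>h\<in>wreath lam. rot_char lam h * psum (cells lam) N x h) / of_nat (card (block_perms lam) * card (block_shifts lam))"
    by (simp add: card_wreath(1)[OF pos] sum_divide_distrib)
  then show ?thesis unfolding e using c0 p0 by simp
qed

section \<open>A basis of the free Lie algebra\<close>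

subsection \<open>Linear extension\<close>

lemma lin_ext_superset:
  assumes "finite A" "Poly_Mapping.keys p \<subseteq> A"
  shows "lin_ext f p = (\<Sum>b\<in>A. pm_scale (Poly_Mapping.lookup p b) (f b))"
  unfolding lin_ext_def
  by (rule sum.mono_neutral_left) (use assms in \<open>auto simp: in_keys_iff\<close>)

lemma lin_ext_add: "lin_ext f (p + q) = lin_ext f p + lin_ext f q"
proof -
  let ?A = "Poly_Mapping.keys p \<union> Poly_Mapping.keys q"
  have "lin_ext f r = (\<Sum>b\<in>?A. pm_scale (Poly_Mapping.lookup r b) (f b))" if "Poly_Mapping.keys r \<subseteq> ?A" for r
    using that by (intro lin_ext_superset) auto
  then show ?thesis
    using keys_add[of p q] by (simp add: lookup_add pm.scale_left_distrib sum.distrib)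
qed

lemma lin_ext_scale: "lin_ext f (pm_scale a p) = pm_scale a (lin_ext f p)"
proof -
  have "lin_ext f (pm_scale a p) = (\<Sum>b\<in>Poly_Mapping.keys p. pm_scale (Poly_Mapping.lookup (pm_scale a p) b) (f b))"
    by (rule lin_ext_superset) (auto simp: in_keys_iff)
  then show ?thesis by (simp add: lin_ext_def pm.scale_sum_right)
qed

lemma lin_ext_0 [simp]: "lin_ext f 0 = 0" by (simp add: lin_ext_def)

lemma lin_ext_single: "lin_ext f (Poly_Mapping.single b c) = pm_scale c (f b)"
  by (cases "c = 0") (simp_all add: lin_ext_def)

lemma lin_ext_bvec [simp]: "lin_ext f (Poly_Mapping.single b 1) = f b"
  by (simp add: lin_ext_single)

lemma lin_ext_sum: "lin_ext f (sum g A) = (\<Sum>a\<in>A. lin_ext f (g a))"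
  by (induction A rule: infinite_finite_induct) (simp_all add: lin_ext_add)

lemma lin_ext_minus: "lin_ext f (p - q) = lin_ext f p - lin_ext f q"
proof -
  have "lin_ext f (p - q) + lin_ext f q = lin_ext f p" by (simp flip: lin_ext_add)
  then show ?thesis by (simp add: algebra_simps)
qed

lemma pm_expand: "p = (\<Sum>b\<in>Poly_Mapping.keys p. pm_scale (Poly_Mapping.lookup p b) (Poly_Mapping.single b 1))"
proof (rule poly_mapping_eqI)
  fix k
  have "Poly_Mapping.lookup (\<Sum>b\<in>Poly_Mapping.keys p. pm_scale (Poly_Mapping.lookup p b) (Poly_Mapping.single b 1)) k
    = (\<Sum>b\<in>Poly_Mapping.keys p. if b = k then Poly_Mapping.lookup p k else 0)"
    unfolding lookup_sum by (intro sum.cong) (auto simp: lookup_single when_def)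
  also have "\<dots> = Poly_Mapping.lookup p k" by (simp add: in_keys_iff)
  finally show "Poly_Mapping.lookup p k = Poly_Mapping.lookup (\<Sum>b\<in>Poly_Mapping.keys p. pm_scale (Poly_Mapping.lookup p b) (Poly_Mapping.single b 1)) k" ..
qed

lemma pm_induct [case_names zero add scale single]:
  assumes "P 0" "\<And>p q. P p \<Longrightarrow> P q \<Longrightarrow> P (p + q)" "\<And>a p. P p \<Longrightarrow> P (pm_scale a p)"
    and "\<And>b. b \<in> Poly_Mapping.keys p \<Longrightarrow> P (Poly_Mapping.single b 1)"
  shows "P (p :: 'b \<Rightarrow>\<^sub>0 complex)"
proof -
  have "P (\<Sum>b\<in>B. pm_scale (Poly_Mapping.lookup p b) (Poly_Mapping.single b 1))"
    if "finite B" "B \<subseteq> Poly_Mapping.keys p" for B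
    using that by (induction B rule: finite_induct) (auto intro: assms)
  from this[of "Poly_Mapping.keys p"] show ?thesis by (simp add: pm_expand[symmetric])
qed

lemma pm_scale_eq_mult: "pm_scale a p = Poly_Mapping.single 0 a * (p :: 'm :: monoid_add \<Rightarrow>\<^sub>0 complex)"
  unfolding pm_scale_def by (rule mult_map_scale_conv_mult)

lemma pm_scale_mult_left: "pm_scale a p * q = pm_scale a (p * (q :: 'm :: monoid_add \<Rightarrow>\<^sub>0 complex))"
  by (simp only: pm_scale_eq_mult mult.assoc)

lemma pm_scale_mult_right: "p * pm_scale a q = pm_scale a (p * (q :: 'm :: monoid_add \<Rightarrow>\<^sub>0 complex))"
proof -
  have "p * Poly_Mapping.single 0 a = Poly_Mapping.single 0 a * p"
  proof (induction p rule: pm_induct)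
    case (scale c p)
    have "pm_scale c p * Poly_Mapping.single 0 a = Poly_Mapping.single 0 c * (Poly_Mapping.single 0 a * p)"
      by (simp only: pm_scale_eq_mult mult.assoc scale)
    also have "\<dots> = Poly_Mapping.single 0 a * (Poly_Mapping.single 0 c * p)"
      by (simp only: mult.assoc[symmetric] mult_single mult.commute[of c] add_0)
    finally show ?case by (simp only: pm_scale_eq_mult)
  qed (simp_all add: distrib_left distrib_right mult_single)
  then show ?thesis by (simp only: pm_scale_eq_mult mult.assoc[symmetric])
qed

lemma pm_scale_uminus: "pm_scale a (- p) = - pm_scale a p" "pm_scale (-1) p = - p" "pm_scale a (p - q) = pm_scale a p - pm_scale a q"
  by (simp_all add: pm.scale_minus_right pm.scale_minus_left pm.scale_right_diff_distrib)

abbreviation bvec :: "'b \<Rightarrow> ('b \<Rightarrow>\<^sub>0 complex)" where "bvec w \<equiv> Poly_Mapping.single w 1"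

lemma bvec_mult: "bvec (u :: 'a list) * bvec v = bvec (u @ v)" by (simp add: mult_single plus_list_def)

lemma bvec_Nil: "bvec ([] :: 'a list) = 1" unfolding single_one[symmetric] zero_list_def ..

subsection \<open>Iterated brackets\<close>

fun ad :: "nat list \<Rightarrow> (nat list \<Rightarrow>\<^sub>0 complex) \<Rightarrow> (nat list \<Rightarrow>\<^sub>0 complex)" where
  "ad [] X = X"
| "ad (a # w) X = bvec [a] * ad w X - ad w X * bvec [a]"

text \<open>The adjoint action extended from letters to the whole tensor algebra: a word acts by the
  composite of the brackets with its letters.\<close>

definition adl :: "(nat list \<Rightarrow>\<^sub>0 complex) \<Rightarrow> (nat list \<Rightarrow>\<^sub>0 complex) \<Rightarrow> (nat list \<Rightarrow>\<^sub>0 complex)" where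
  "adl p X = lin_ext (\<lambda>w. ad w X) p"

definition brk :: "nat list \<Rightarrow> (nat list \<Rightarrow>\<^sub>0 complex)" where
  "brk w = ad (butlast w) (bvec [last w])"

lemma ad_append: "ad (u @ v) X = ad u (ad v X)"
  by (induction u) simp_all

lemma ad_add: "ad w (X + Y) = ad w X + ad w Y"
  by (induction w) (simp_all add: algebra_simps)

lemma ad_scale: "ad w (pm_scale a X) = pm_scale a (ad w X)"
  by (induction w) (simp_all add: pm_scale_mult_left pm_scale_mult_right pm_scale_uminus)

lemma ad_0: "ad w 0 = 0" by (induction w) simp_all

lemma ad_minus: "ad w (X - Y) = ad w X - ad w Y"
  using ad_add[of w "X - Y" Y] by simp

lemma adl_mult: "adl (p * q) X = adl p (adl q X)"
proof (induction p rule: pm_induct)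
  case (single u)
  show ?case
  proof (induction q rule: pm_induct)
    case (single v)
    then show ?case by (simp add: bvec_mult adl_def ad_append)
  qed (simp_all add: distrib_left pm_scale_mult_right adl_def lin_ext_add lin_ext_scale ad_0 ad_add ad_scale)
qed (simp_all add: distrib_right pm_scale_mult_left adl_def lin_ext_add lin_ext_scale)

lemma adl_diff_left: "adl (p - q) X = adl p X - adl q X" by (simp add: adl_def lin_ext_minus)

text \<open>\<open>adl\<close> is multiplicative, so by Jacobi's identity the elements that act as
  commutators are closed under brackets; letters are among them.\<close>

lemma adl_lie: "p \<in> free_lie N \<Longrightarrow> adl p X = p * X - X * p"
proof (induction arbitrary: X rule: free_lie.induct)
  case (bracket p q)
  have "adl (p * q - q * p) X = adl p (adl q X) - adl q (adl p X)" by (simp add: adl_diff_left adl_mult)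
  also have "\<dots> = p * (q * X - X * q) - (q * X - X * q) * p - (q * (p * X - X * p) - (p * X - X * p) * q)"
    by (simp only: bracket.IH)
  also have "\<dots> = (p * q - q * p) * X - X * (p * q - q * p)" by (simp add: algebra_simps)
  finally show ?case .
next
  case (gen i) then show ?case by (simp add: adl_def)
next
  case zero then show ?case by (simp add: adl_def)
next
  case (add p q) then show ?case by (simp add: adl_def lin_ext_add algebra_simps)
next
  case (scale p a)
  then show ?case by (simp add: adl_def lin_ext_scale pm_scale_mult_left pm_scale_mult_right pm_scale_uminus)
qed

lemma free_lie_subspace: "pm.subspace (free_lie N)"
  by (auto simp: pm.subspace_def intro: free_lie.intros)

lemma ad_free_lie: "set w \<subseteq> {..<N} \<Longrightarrow> X \<in> free_lie N \<Longrightarrow> ad w X \<in> free_lie N"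
  by (induction w) (auto intro: free_lie.intros)

lemma brk_free_lie: "w \<noteq> [] \<Longrightarrow> set w \<subseteq> {..<N} \<Longrightarrow> brk w \<in> free_lie N"
  unfolding brk_def by (intro ad_free_lie free_lie.gen) (auto dest: in_set_butlastD last_in_set)

lemma keys_mult_mset:
  assumes "\<And>u. u \<in> Poly_Mapping.keys p \<Longrightarrow> mset u = A" "\<And>v. v \<in> Poly_Mapping.keys q \<Longrightarrow> mset v = B"
    and "w \<in> Poly_Mapping.keys (p * q :: 'a list \<Rightarrow>\<^sub>0 complex)"
  shows "mset w = A + B"
  using keys_mult[of p q] assms by (force simp: plus_list_def)

lemma keys_ad: "(\<And>u. u \<in> Poly_Mapping.keys X \<Longrightarrow> mset u = B) \<Longrightarrow> v \<in> Poly_Mapping.keys (ad w X) \<Longrightarrow> mset v = mset w + B"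
proof (induction w arbitrary: v)
  case (Cons a w)
  have IH: "mset u = mset w + B" if "u \<in> Poly_Mapping.keys (ad w X)" for u using Cons that by blast
  have 1: "mset u = {#a#}" if "u \<in> Poly_Mapping.keys (bvec [a])" for u using that by (simp split: if_splits)
  have "v \<in> Poly_Mapping.keys (bvec [a] * ad w X) \<or> v \<in> Poly_Mapping.keys (ad w X * bvec [a])"
    using Cons.prems(2) keys_diff[of "bvec [a] * ad w X" "ad w X * bvec [a]"] by auto
  then show ?case
  proof
    assume "v \<in> Poly_Mapping.keys (bvec [a] * ad w X)"
    from keys_mult_mset[OF 1 IH this] show ?thesis by (simp add: add_ac)
  next
    assume "v \<in> Poly_Mapping.keys (ad w X * bvec [a])"
    from keys_mult_mset[OF IH 1 this] show ?thesis by (simp add: add_ac)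
  qed
qed simp

lemma keys_brk: "w \<noteq> [] \<Longrightarrow> v \<in> Poly_Mapping.keys (brk w) \<Longrightarrow> mset v = mset w"
proof -
  assume w: "w \<noteq> []" and v: "v \<in> Poly_Mapping.keys (brk w)"
  have "mset v = mset (butlast w) + {#last w#}"
    using v unfolding brk_def by (rule keys_ad[rotated]) (simp split: if_splits)
  also have "\<dots> = mset (butlast w @ [last w])" by simp
  finally show "mset v = mset w" using w by simp
qed

lemma keys_free_lie: "p \<in> free_lie N \<Longrightarrow> w \<in> Poly_Mapping.keys p \<Longrightarrow> set w \<subseteq> {..<N} \<and> w \<noteq> []"
proof (induction arbitrary: w rule: free_lie.induct)
  case (add p q) then show ?case using keys_add[of p q] by blast
next
  case (scale p a)
  then have "w \<in> Poly_Mapping.keys p" by (auto simp: in_keys_iff)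
  then show ?case using scale.IH by blast
next
  case (bracket p q)
  then have "w \<in> Poly_Mapping.keys (p * q) \<or> w \<in> Poly_Mapping.keys (q * p)" using keys_diff[of "p * q" "q * p"] by blast
  then obtain u v where "w = u @ v" "u \<in> Poly_Mapping.keys p \<and> v \<in> Poly_Mapping.keys q \<or> u \<in> Poly_Mapping.keys q \<and> v \<in> Poly_Mapping.keys p"
    using keys_mult[of p q] keys_mult[of q p] by (auto simp: plus_list_def)
  then show ?case using bracket.IH by auto
qed (auto split: if_splits)

subsection \<open>Marking a letter\<close>

text \<open>
  The letter \<open>a + N\<close> is a marked copy of \<open>a\<close>. \<open>mark\<close> is the derivation that marks one letter in all
  possible ways; on Lie elements it agrees with the iterated brackets whose innermost letter is marked.
\<close>

primrec markw :: "nat \<Rightarrow> nat list \<Rightarrow> (nat list \<Rightarrow>\<^sub>0 complex)" where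
  "markw N [] = 0"
| "markw N (a # w) = bvec [a + N] * bvec w + bvec [a] * markw N w"

definition mark :: "nat \<Rightarrow> (nat list \<Rightarrow>\<^sub>0 complex) \<Rightarrow> (nat list \<Rightarrow>\<^sub>0 complex)" where
  "mark N = lin_ext (markw N)"

definition lmarkw :: "nat \<Rightarrow> nat list \<Rightarrow> (nat list \<Rightarrow>\<^sub>0 complex)" where
  "lmarkw N w = (if w = [] then 0 else ad (butlast w) (bvec [last w + N]))"

definition lmark :: "nat \<Rightarrow> (nat list \<Rightarrow>\<^sub>0 complex) \<Rightarrow> (nat list \<Rightarrow>\<^sub>0 complex)" where
  "lmark N = lin_ext (lmarkw N)"

lemma markw_append: "markw N (u @ v) = markw N u * bvec v + bvec u * markw N v"
proof (induction u)
  case (Cons a u)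
  have "bvec (a # u) = bvec [a] * bvec u" by (simp add: bvec_mult)
  then show ?case using Cons by (simp add: bvec_mult[symmetric] algebra_simps)
qed (simp add: bvec_Nil)

lemma mark_mult: "mark N (p * q) = mark N p * q + p * mark N q"
proof (induction p rule: pm_induct)
  case (single u)
  show ?case
  proof (induction q rule: pm_induct)
    case (single v)
    then show ?case by (simp add: bvec_mult mark_def markw_append)
  qed (simp_all add: mark_def lin_ext_add lin_ext_scale algebra_simps pm_scale_mult_right pm.scale_right_distrib)
qed (simp_all add: mark_def lin_ext_add lin_ext_scale algebra_simps pm_scale_mult_left pm.scale_right_distrib)

text \<open>\<open>lmark\<close> marks the last letter, which has to come from \<open>q\<close>; an
  empty word in \<open>q\<close> would let it come from \<open>p\<close>.\<close>

lemma lmark_mult: assumes "[] \<notin> Poly_Mapping.keys q" shows "lmark N (p * q) = adl p (lmark N q)"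
proof (induction p rule: pm_induct)
  case (single u)
  have "lmark N (bvec u * q) = ad u (lmark N q)"
    using assms
  proof -
    have "\<forall>v\<in>B. v \<noteq> [] \<Longrightarrow> finite B \<Longrightarrow> lmark N (bvec u * (\<Sum>v\<in>B. pm_scale (c v) (bvec v))) = ad u (lmark N (\<Sum>v\<in>B. pm_scale (c v) (bvec v)))" for B c
    proof (induction B rule: infinite_finite_induct)
      case (insert v B)
      have "lmarkw N (u @ v) = ad u (lmarkw N v)" using insert by (simp add: lmarkw_def butlast_append ad_append)
      then have "lmark N (bvec u * bvec v) = ad u (lmark N (bvec v))" by (simp add: bvec_mult lmark_def)
      then show ?case using insert
        by (simp add: lmark_def distrib_left lin_ext_add lin_ext_scale ad_add ad_scale pm_scale_mult_right)
    qed (simp_all add: lmark_def ad_0)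
    from this[of "Poly_Mapping.keys q" "Poly_Mapping.lookup q"] assms show ?thesis by (auto simp: pm_expand[symmetric])
  qed
  then show ?case by (simp add: adl_def)
qed (simp_all add: lmark_def adl_def lin_ext_add lin_ext_scale distrib_right pm_scale_mult_left)

lemma lmark_diff: "lmark N (p - q) = lmark N p - lmark N q" by (simp add: lmark_def lin_ext_minus)
lemma mark_diff: "mark N (p - q) = mark N p - mark N q" by (simp add: mark_def lin_ext_minus)

text \<open>Both operators send the bracket of \<open>p\<close> and \<open>q\<close> to the bracket
  of \<open>p\<close> with the image of \<open>q\<close> minus the bracket of \<open>q\<close> with
  the image of \<open>p\<close>: \<open>mark\<close> because it is a derivation,
  \<open>lmark\<close> through \<open>adl\<close>.\<close>

lemma mark_lie: "p \<in> free_lie N \<Longrightarrow> mark M p = lmark M p"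
proof (induction rule: free_lie.induct)
  case (gen i)
  have "lmarkw M [i] = bvec [i + M]" by (simp add: lmarkw_def)
  then show ?case by (simp add: mark_def lmark_def bvec_Nil)
next
  case (bracket p q)
  have nk: "[] \<notin> Poly_Mapping.keys p" "[] \<notin> Poly_Mapping.keys q" using keys_free_lie bracket.hyps by blast+
  have "mark M (p * q - q * p) = (p * mark M q - mark M q * p) - (q * mark M p - mark M p * q)"
    by (simp add: mark_diff mark_mult algebra_simps)
  also have "\<dots> = adl p (mark M q) - adl q (mark M p)" using bracket.hyps by (simp add: adl_lie)
  also have "\<dots> = lmark M (p * q - q * p)" using bracket.IH nk by (simp add: lmark_diff lmark_mult)
  finally show ?case .
qed (simp_all add: mark_def lmark_def lin_ext_add lin_ext_scale)

subsection \<open>Cyclic rotation of Lie elements\<close>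

text \<open>
  \<open>unmarkw\<close> rotates the marked letter to the end of the word, with weight \<open>\<zeta>\<close> per letter that follows it.
  Applied to the two descriptions of \<open>mark\<close>, it shows that on Lie elements the twisted rotation
  operator \<open>rotw\<close> is the operator \<open>qlastw\<close>, which is invertible.
\<close>

definition unmarkw :: "nat \<Rightarrow> complex \<Rightarrow> nat list \<Rightarrow> (nat list \<Rightarrow>\<^sub>0 complex)" where
  "unmarkw N z w = (let s = takeWhile (\<lambda>a. a < N) w; t = tl (dropWhile (\<lambda>a. a < N) w) in
     pm_scale (z ^ length t) (bvec (t @ s @ [hd (dropWhile (\<lambda>a. a < N) w) - N])))"

text \<open>Iterated z-commutators X a - z a X, starting from 1 and running through the reversed
  word. They are what iterated brackets become once the marked letter has been turned to the
  end.\<close>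

primrec qrev :: "complex \<Rightarrow> nat list \<Rightarrow> (nat list \<Rightarrow>\<^sub>0 complex)" where
  "qrev z [] = 1"
| "qrev z (a # w) = qrev z w * bvec [a] - pm_scale z (bvec [a] * qrev z w)"

definition qlastw :: "complex \<Rightarrow> nat list \<Rightarrow> (nat list \<Rightarrow>\<^sub>0 complex)" where
  "qlastw z w = qrev z (rev (butlast w)) * bvec [last w]"

definition rotw :: "complex \<Rightarrow> nat list \<Rightarrow> (nat list \<Rightarrow>\<^sub>0 complex)" where
  "rotw z w = (\<Sum>i<length w. pm_scale (z ^ (length w - Suc i)) (bvec (rotate (Suc i) w)))"

lemma unmarkw: "set s \<subseteq> {..<N} \<Longrightarrow> unmarkw N z (s @ (a + N) # t) = pm_scale (z ^ length t) (bvec (t @ s @ [a]))"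
proof -
  assume s: "set s \<subseteq> {..<N}"
  have "takeWhile (\<lambda>a. a < N) (s @ (a + N) # t) = s" "dropWhile (\<lambda>a. a < N) (s @ (a + N) # t) = (a + N) # t"
    using s by (auto simp: takeWhile_append dropWhile_append)
  then show ?thesis by (simp add: unmarkw_def)
qed

text \<open>Each bracket puts its letter in front of or behind the distinguished letter
  \<open>b\<close>. By \<open>base\<close>, \<open>L\<close> brings the part behind \<open>b\<close>
  to the front at cost \<open>z\<close> per letter, so the two choices form one step of
  \<open>qrev\<close>. \<open>L\<close> and \<open>K\<close> are abstract because the computation
  serves both for unmarking and for the rotation operator.\<close>

lemma bracket_collapse:
  fixes L :: "(nat list \<Rightarrow>\<^sub>0 complex) \<Rightarrow> (nat list \<Rightarrow>\<^sub>0 complex)" and K :: "(nat list \<Rightarrow>\<^sub>0 complex) \<Rightarrow> (nat list \<Rightarrow>\<^sub>0 complex)"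
  assumes L: "\<And>p q. L (p - q) = L p - L q" and K: "\<And>p q. K (p - q) = K p - K q" "\<And>a p. K (pm_scale a p) = pm_scale a (K p)"
    and base: "\<And>s t. set s \<subseteq> U \<Longrightarrow> set t \<subseteq> U \<Longrightarrow> length s + length t = n \<Longrightarrow> L (bvec (s @ b # t)) = pm_scale (z ^ length t) (K (bvec (t @ s @ [a])))"
    and "set w \<subseteq> U" "set s \<subseteq> U" "set t \<subseteq> U" "length w + length s + length t = n"
  shows "L (ad w (bvec (s @ b # t))) = pm_scale (z ^ length t) (K (bvec t * (qrev z (rev w) * bvec (s @ [a]))))"
  using assms(5-8)
proof (induction w arbitrary: s t rule: rev_induct)
  case Nil
  then show ?case using base[of s t] by (simp add: bvec_mult bvec_Nil[symmetric])
next
  case (snoc c w)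
  have "ad (w @ [c]) (bvec (s @ b # t)) = ad w (bvec ((c # s) @ b # t)) - ad w (bvec (s @ b # (t @ [c])))"
    by (simp add: ad_append ad_minus bvec_mult)
  then have "L (ad (w @ [c]) (bvec (s @ b # t)))
    = pm_scale (z ^ length t) (K (bvec t * (qrev z (rev w) * bvec ((c # s) @ [a]))))
      - pm_scale (z ^ length (t @ [c])) (K (bvec (t @ [c]) * (qrev z (rev w) * bvec (s @ [a]))))"
    using snoc.IH[of "c # s" t] snoc.IH[of s "t @ [c]"] snoc.prems by (simp add: L)
  also have "bvec ((c # s) @ [a]) = bvec [c] * bvec (s @ [a])" by (simp add: bvec_mult)
  also have "bvec (t @ [c]) = bvec t * bvec [c]" by (simp add: bvec_mult)
  also have "pm_scale (z ^ length (t @ [c])) (K (bvec t * bvec [c] * (qrev z (rev w) * bvec (s @ [a]))))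
    = pm_scale (z ^ length t) (K (bvec t * (pm_scale z (bvec [c] * qrev z (rev w)) * bvec (s @ [a]))))"
    by (simp add: pm_scale_mult_left pm_scale_mult_right K mult.assoc)
  finally show ?case
    by (simp add: K(1)[symmetric] pm.scale_right_diff_distrib[symmetric] left_diff_distrib right_diff_distrib mult.assoc)
qed

lemma markw_eq: "markw N w = (\<Sum>i<length w. bvec (take i w @ (w ! i + N) # drop (Suc i) w))"
proof (induction w)
  case (Cons a w)
  have "bvec [a] * markw N w = (\<Sum>i<length w. bvec (a # take i w @ (w ! i + N) # drop (Suc i) w))"
    unfolding Cons.IH sum_distrib_left by (simp add: bvec_mult)
  then show ?case by (simp add: sum.lessThan_Suc_shift bvec_mult del: sum.lessThan_Suc)
qed simp

lemma unmark_markw: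
  assumes "set w \<subseteq> {..<N}"
  shows "lin_ext (unmarkw N z) (markw N w) = rotw z w"
  unfolding markw_eq lin_ext_sum rotw_def
proof (rule sum.cong[OF refl])
  fix i assume "i \<in> {..<length w}"
  then have i: "i < length w" by simp
  have "set (take i w) \<subseteq> {..<N}" using assms by (meson order_trans set_take_subset)
  then have "lin_ext (unmarkw N z) (bvec (take i w @ (w ! i + N) # drop (Suc i) w))
    = pm_scale (z ^ (length w - Suc i)) (bvec (drop (Suc i) w @ take i w @ [w ! i]))"
    by (simp add: unmarkw)
  also have "take i w @ [w ! i] = take (Suc i) w" using i by (simp add: take_Suc_conv_app_nth)
  also have "drop (Suc i) w @ take (Suc i) w = rotate (Suc i) w"
  proof (cases "Suc i = length w")
    case True
    have "rotate (length w) w = w" using rotate_conv_mod[of "length w" w] by simp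
    then show ?thesis unfolding True by simp
  next
    case False
    then show ?thesis using i by (simp add: rotate_drop_take del: rotate_Suc)
  qed
  finally show "lin_ext (unmarkw N z) (bvec (take i w @ (w ! i + N) # drop (Suc i) w)) = pm_scale (z ^ (length w - Suc i)) (bvec (rotate (Suc i) w))" .
qed

lemma unmark_lmarkw:
  assumes "set w \<subseteq> {..<N}" "w \<noteq> []"
  shows "lin_ext (unmarkw N z) (lmarkw N w) = qlastw z w"
proof -
  have "lin_ext (unmarkw N z) (ad (butlast w) (bvec ([] @ (last w + N) # [])))
    = pm_scale (z ^ length ([] :: nat list)) (bvec [] * (qrev z (rev (butlast w)) * bvec ([] @ [last w])))"
    by (rule bracket_collapse[where U = "{..<N}" and n = "length (butlast w)" and K = "\<lambda>p. p"])
       (use assms in \<open>auto simp: lin_ext_minus unmarkw dest: in_set_butlastD\<close>)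
  then show ?thesis using assms by (simp add: lmarkw_def qlastw_def bvec_Nil)
qed

lemma rot_eq_qlast_lie:
  assumes p: "p \<in> free_lie N"
  shows "lin_ext (rotw z) p = lin_ext (qlastw z) p"
proof -
  have k: "set w \<subseteq> {..<N}" "w \<noteq> []" if "w \<in> Poly_Mapping.keys p" for w using keys_free_lie[OF p that] by auto
  have comp: "lin_ext (unmarkw N z) (lin_ext F p) = lin_ext (\<lambda>w. lin_ext (unmarkw N z) (F w)) p" for F
    by (simp add: lin_ext_def[of F] lin_ext_sum lin_ext_scale lin_ext_def[of "\<lambda>w. lin_ext (unmarkw N z) (F w)"])
  have "lin_ext (rotw z) p = lin_ext (unmarkw N z) (mark N p)"
    unfolding mark_def comp unfolding lin_ext_def[of _ p] using k by (intro sum.cong) (auto simp: unmark_markw)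
  also have "\<dots> = lin_ext (unmarkw N z) (lmark N p)" by (simp only: mark_lie[OF p])
  also have "\<dots> = lin_ext (qlastw z) p"
    unfolding lmark_def comp unfolding lin_ext_def[of _ p] using k by (intro sum.cong) (auto simp: unmark_lmarkw)
  finally show ?thesis .
qed

text \<open>Rotating the word shifts the summation index; the boundary terms agree because
  \<open>z ^ length w = 1\<close>.\<close>

lemma rotw_rotate1:
  assumes "z ^ length w = 1" "w \<noteq> []"
  shows "rotw z (rotate1 w) = pm_scale z (rotw z w)"
proof -
  let ?m = "length w"
  let ?g = "\<lambda>i. pm_scale (z ^ (?m - i)) (bvec (rotate (Suc i) w))"
  have "rotw z (rotate1 w) = (\<Sum>i<?m. ?g (Suc i))"
    unfolding rotw_def by (simp add: rotate1_rotate_swap)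
  moreover have "pm_scale z (rotw z w) = (\<Sum>i<?m. ?g i)"
    unfolding rotw_def pm.scale_sum_right
  proof (rule sum.cong[OF refl])
    fix i assume "i \<in> {..<?m}"
    then have "?m - i = Suc (?m - Suc i)" by simp
    then show "pm_scale z (pm_scale (z ^ (?m - Suc i)) (bvec (rotate (Suc i) w))) = ?g i" by simp
  qed
  moreover have "(\<Sum>i<?m. ?g (Suc i)) - (\<Sum>i<?m. ?g i) = ?g ?m - ?g 0"
    unfolding sum_subtractf[symmetric] by (rule sum_lessThan_telescope)
  moreover have "rotate ?m w = w" using rotate_conv_mod[of ?m w] by simp
  then have "?g ?m = ?g 0" using assms by simp
  ultimately show ?thesis by simp
qed

lemma rotw_rotate:
  assumes "z ^ length w = 1" "w \<noteq> []"
  shows "rotw z (rotate k w) = pm_scale (z ^ k) (rotw z w)"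
proof (induction k)
  case (Suc k)
  have "rotw z (rotate1 (rotate k w)) = pm_scale z (rotw z (rotate k w))"
    using assms by (intro rotw_rotate1) auto
  then show ?case using Suc by simp
qed simp

text \<open>The rotation operator turns a rotation of its argument into a scalar, so
  \<open>bracket_collapse\<close> applies to it with \<open>L = K\<close>. Together with
  \<open>qlast_surj\<close> this yields Lie elements with prescribed twisted rotation sums.\<close>

lemma rot_brk:
  assumes z: "z ^ m = 1" and w: "length w = m" "w \<noteq> []"
  shows "lin_ext (rotw z) (brk w) = lin_ext (rotw z) (qlastw z w)"
proof -
  have base: "lin_ext (rotw z) (bvec (s @ a # t)) = pm_scale (z ^ length t) (lin_ext (rotw z) (bvec (t @ s @ [a])))"
    if "length s + length t = m - 1" for s t :: "nat list" and a
  proof -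
    have l: "length (t @ s @ [a]) = m" using that w by (cases m) auto
    have "rotate (length t) (t @ (s @ [a])) = (s @ [a]) @ t" by (rule rotate_append)
    then have "rotw z (s @ a # t) = pm_scale (z ^ length t) (rotw z (t @ s @ [a]))"
      using rotw_rotate[of z "t @ s @ [a]" "length t"] by (simp only: z l append.assoc append_Cons append_Nil list.simps append_is_Nil_conv simp_thms)
    then show ?thesis by simp
  qed
  have "lin_ext (rotw z) (ad (butlast w) (bvec ([] @ last w # [])))
    = pm_scale (z ^ length ([] :: nat list)) (lin_ext (rotw z) (bvec [] * (qrev z (rev (butlast w)) * bvec ([] @ [last w]))))"
    by (rule bracket_collapse[where U = UNIV and n = "m - 1" and K = "lin_ext (rotw z)"])
       (use base w in \<open>auto simp: lin_ext_minus lin_ext_scale\<close>)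
  then show ?thesis by (simp add: brk_def qlastw_def bvec_Nil)
qed

lemma mset_rotate: "mset (rotate k w) = mset w"
proof -
  have "mset (rotate1 v) = mset v" for v :: "'a list" by (cases v) simp_all
  then show ?thesis by (induction k) simp_all
qed

lemma keys_qrev: "v \<in> Poly_Mapping.keys (qrev z w) \<Longrightarrow> mset v = mset w"
proof (induction w arbitrary: v)
  case Nil
  then show ?case by (simp add: bvec_Nil[symmetric])
next
  case (Cons a w)
  have 1: "mset u = {#a#}" if "u \<in> Poly_Mapping.keys (bvec [a])" for u using that by (simp split: if_splits)
  have "v \<in> Poly_Mapping.keys (qrev z w * bvec [a]) \<or> v \<in> Poly_Mapping.keys (pm_scale z (bvec [a] * qrev z w))"
    using Cons.prems keys_diff[of "qrev z w * bvec [a]" "pm_scale z (bvec [a] * qrev z w)"] by auto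
  then have "v \<in> Poly_Mapping.keys (qrev z w * bvec [a]) \<or> v \<in> Poly_Mapping.keys (bvec [a] * qrev z w)"
    by (auto simp: in_keys_iff)
  then show ?case
  proof
    assume "v \<in> Poly_Mapping.keys (qrev z w * bvec [a])"
    from keys_mult_mset[OF Cons.IH 1 this] show ?thesis by simp
  next
    assume "v \<in> Poly_Mapping.keys (bvec [a] * qrev z w)"
    from keys_mult_mset[OF 1 Cons.IH this] show ?thesis by simp
  qed
qed

lemma keys_qlastw: "w \<noteq> [] \<Longrightarrow> v \<in> Poly_Mapping.keys (qlastw z w) \<Longrightarrow> mset v = mset w"
proof -
  assume w: "w \<noteq> []" and v: "v \<in> Poly_Mapping.keys (qlastw z w)"
  have 1: "mset u = {#last w#}" if "u \<in> Poly_Mapping.keys (bvec [last w])" for u using that by (simp split: if_splits)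
  have 2: "mset u = mset (butlast w)" if "u \<in> Poly_Mapping.keys (qrev z (rev (butlast w)))" for u
    using keys_qrev[OF that] by simp
  have "mset v = mset (butlast w) + {#last w#}"
    by (rule keys_mult_mset[OF 2 1 v[unfolded qlastw_def]])
  also have "\<dots> = mset (butlast w @ [last w])" by simp
  finally show "mset v = mset w" using w by simp
qed

lemma keys_lin_ext: "v \<in> Poly_Mapping.keys (lin_ext F p) \<Longrightarrow> \<exists>w\<in>Poly_Mapping.keys p. v \<in> Poly_Mapping.keys (F w)"
proof -
  assume "v \<in> Poly_Mapping.keys (lin_ext F p)"
  then have "Poly_Mapping.lookup (lin_ext F p) v \<noteq> 0" by (simp add: in_keys_iff)
  then obtain w where "w \<in> Poly_Mapping.keys p" "Poly_Mapping.lookup (pm_scale (Poly_Mapping.lookup p w) (F w)) v \<noteq> 0"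
    unfolding lin_ext_def lookup_sum by (meson sum.not_neutral_contains_not_neutral)
  then show ?thesis by (auto simp: in_keys_iff)
qed

lemma qrev_mult: "lin_ext (\<lambda>w. qrev z (rev w)) (p * bvec [a])
  = lin_ext (\<lambda>w. qrev z (rev w)) p * bvec [a] - pm_scale z (bvec [a] * lin_ext (\<lambda>w. qrev z (rev w)) p)"
proof (induction p rule: pm_induct)
  case (single b)
  then show ?case by (simp add: bvec_mult)
qed (simp_all add: distrib_left distrib_right lin_ext_add lin_ext_scale pm_scale_mult_left pm_scale_mult_right pm.scale_right_distrib pm_scale_uminus mult.commute)

lemma keys_scale_sum:
  assumes "v \<in> Poly_Mapping.keys (pm_scale a (\<Sum>i\<in>I. pm_scale (c i) (F i)))"
  shows "\<exists>i\<in>I. v \<in> Poly_Mapping.keys (F i)"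
proof -
  have "(\<Sum>i\<in>I. c i * Poly_Mapping.lookup (F i) v) \<noteq> 0" using assms by (auto simp: in_keys_iff lookup_sum)
  then obtain i where "i \<in> I" "c i * Poly_Mapping.lookup (F i) v \<noteq> 0" by (meson sum.not_neutral_contains_not_neutral)
  then show ?thesis by (auto simp: in_keys_iff)
qed

text \<open>The operator \<open>1 - \<zeta> c\<close>, with \<open>c\<close> the rotation of words of length \<open>k\<close>, has the inverse
  \<open>(1 - \<zeta>\<^sup>k)\<^sup>-\<^sup>1 \<Sum>\<^bsub>i<k\<^esub> \<zeta>\<^sup>i c\<^sup>i\<close>.\<close>

lemma qrev_surj:
  assumes prim: "\<And>i. 0 < i \<Longrightarrow> i < m \<Longrightarrow> z ^ i \<noteq> 1" and "length u < m"
  shows "\<exists>p. (\<forall>w\<in>Poly_Mapping.keys p. mset w = mset u) \<and> lin_ext (\<lambda>w. qrev z (rev w)) p = bvec u"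
  using assms(2)
proof (induction "length u" arbitrary: u)
  case 0
  then show ?case by (intro exI[of _ "bvec []"]) (auto simp: bvec_Nil[symmetric] split: if_splits)
next
  case (Suc k)
  let ?k = "Suc k"
  let ?Q = "lin_ext (\<lambda>w. qrev z (rev w))"
  \<comment> \<open>\<open>r i\<close> is \<open>u\<close> turned \<open>i\<close> steps to the
    right: its last letter becomes the first letter of \<open>r (Suc i)\<close>, which makes the sum
    below telescope.\<close>
  define r where "r i = rotate (?k - i) u" for i
  have lr: "length (r i) = ?k" for i using Suc.hyps(2) by (simp add: r_def)
  have "\<exists>p. (\<forall>w\<in>Poly_Mapping.keys p. mset w = mset (butlast (r i))) \<and> ?Q p = bvec (butlast (r i))" for i
    using Suc lr[of i] by (intro Suc.hyps(1)) auto
  then obtain p where p: "\<And>i w. w \<in> Poly_Mapping.keys (p i) \<Longrightarrow> mset w = mset (butlast (r i))" "\<And>i. ?Q (p i) = bvec (butlast (r i))"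
    by metis
  define q where "q = pm_scale (1 / (1 - z ^ ?k)) (\<Sum>i<?k. pm_scale (z ^ i) (p i * bvec [last (r i)]))"
  have step: "last (r i) # butlast (r i) = r (Suc i)" if "i < ?k" for i
  proof -
    have "?k - i = Suc (?k - Suc i)" using that by simp
    then have "r i = rotate1 (r (Suc i))" unfolding r_def by simp
    moreover obtain b v where "r (Suc i) = b # v" using lr[of "Suc i"] by (cases "r (Suc i)") auto
    ultimately show ?thesis by simp
  qed
  have ne: "r i \<noteq> []" for i using lr[of i] by auto
  have "?Q q = pm_scale (1 / (1 - z ^ ?k)) (\<Sum>i<?k. pm_scale (z ^ i) (bvec (r i)) - pm_scale (z ^ Suc i) (bvec (r (Suc i))))"
    unfolding q_def lin_ext_scale lin_ext_sum
  proof (intro arg_cong[where f = "pm_scale (1 / (1 - z ^ ?k))"] sum.cong refl)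
    fix i assume "i \<in> {..<?k}"
    then have "bvec [last (r i)] * bvec (butlast (r i)) = bvec (r (Suc i))" using step[of i] by (simp add: bvec_mult)
    moreover have "bvec (butlast (r i)) * bvec [last (r i)] = bvec (r i)" using ne by (simp add: bvec_mult)
    ultimately show "pm_scale (z ^ i) (?Q (p i * bvec [last (r i)])) = pm_scale (z ^ i) (bvec (r i)) - pm_scale (z ^ Suc i) (bvec (r (Suc i)))"
      by (simp add: qrev_mult p(2) pm_scale_uminus mult.commute)
  qed
  also have "(\<Sum>i<?k. pm_scale (z ^ i) (bvec (r i)) - pm_scale (z ^ Suc i) (bvec (r (Suc i)))) = pm_scale (z ^ 0) (bvec (r 0)) - pm_scale (z ^ ?k) (bvec (r ?k))"
    by (rule sum_lessThan_telescope')
  also have "r 0 = u" using Suc.hyps(2) rotate_conv_mod[of "length u" u] by (simp add: r_def)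
  also have "r ?k = u" by (simp add: r_def)
  also have "pm_scale (z ^ 0) (bvec u) - pm_scale (z ^ ?k) (bvec u) = pm_scale (1 - z ^ ?k) (bvec u)"
    by (simp only: pm.scale_left_diff_distrib power_0)
  also have "pm_scale (1 / (1 - z ^ ?k)) (pm_scale (1 - z ^ ?k) (bvec u)) = bvec u"
  proof -
    have "z ^ ?k \<noteq> 1" using Suc.hyps(2) Suc.prems by (intro prim) linarith+
    then have "1 / (1 - z ^ ?k) * (1 - z ^ ?k) = 1" by (simp del: power_Suc)
    then show ?thesis by (simp only: pm.scale_scale pm.scale_one)
  qed
  finally have Qq: "?Q q = bvec u" .
  have "mset w = mset u" if w: "w \<in> Poly_Mapping.keys q" for w
  proof -
    obtain i where "w \<in> Poly_Mapping.keys (p i * bvec [last (r i)])" using keys_scale_sum[OF w[unfolded q_def]] by blast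
    then have "mset w = mset (butlast (r i)) + {#last (r i)#}"
      by (rule keys_mult_mset[OF p(1), rotated -1]) (auto split: if_splits)
    also have "\<dots> = mset (butlast (r i) @ [last (r i)])" by simp
    also have "\<dots> = mset (r i)" by (simp only: append_butlast_last_id[OF ne])
    also have "\<dots> = mset u" unfolding r_def by (rule mset_rotate)
    finally show ?thesis .
  qed
  then show ?case using Qq by blast
qed

lemma qlast_surj:
  assumes prim: "\<And>i. 0 < i \<Longrightarrow> i < m \<Longrightarrow> z ^ i \<noteq> 1" and u: "length u = m" "u \<noteq> []"
  shows "\<exists>p. (\<forall>w\<in>Poly_Mapping.keys p. mset w = mset u) \<and> lin_ext (qlastw z) p = bvec u"
proof -
  have "length (butlast u) < m" using u by (cases u) auto
  then obtain p where p: "\<forall>w\<in>Poly_Mapping.keys p. mset w = mset (butlast u)" "lin_ext (\<lambda>w. qrev z (rev w)) p = bvec (butlast u)"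
    using qrev_surj[OF prim] by blast
  have "lin_ext (qlastw z) (p * bvec [a]) = lin_ext (\<lambda>w. qrev z (rev w)) p * bvec [a]" for p a
  proof (induction p rule: pm_induct)
    case (single b)
    then show ?case by (simp add: bvec_mult qlastw_def)
  qed (simp_all add: distrib_right lin_ext_add lin_ext_scale pm_scale_mult_left)
  then have "lin_ext (qlastw z) (p * bvec [last u]) = bvec u" using p(2) u by (simp add: bvec_mult)
  moreover have "mset w = mset u" if "w \<in> Poly_Mapping.keys (p * bvec [last u])" for w
  proof -
    have "mset w = mset (butlast u) + {#last u#}"
      using that by (rule keys_mult_mset[rotated -1]) (use p(1) in \<open>auto split: if_splits\<close>)
    also have "\<dots> = mset (butlast u @ [last u])" by simp
    finally show ?thesis using u by simp
  qed
  ultimately show ?thesis by blast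
qed

text \<open>A surjective endomorphism of a finite-dimensional space is injective: if \<open>A B = 1\<close> then
  \<open>1 - B A\<close> is an idempotent of trace zero.\<close>

lemma lin_ext_inj_if_surj:
  fixes F :: "'b \<Rightarrow> ('b \<Rightarrow>\<^sub>0 complex)"
  assumes W: "finite W" and F: "\<And>w. w \<in> W \<Longrightarrow> Poly_Mapping.keys (F w) \<subseteq> W"
    and surj: "\<And>u. u \<in> W \<Longrightarrow> \<exists>p. Poly_Mapping.keys p \<subseteq> W \<and> lin_ext F p = bvec u"
    and p: "Poly_Mapping.keys p \<subseteq> W" "lin_ext F p = 0"
  shows "p = 0"
proof -
  obtain b where b: "\<And>u. u \<in> W \<Longrightarrow> Poly_Mapping.keys (b u) \<subseteq> W" "\<And>u. u \<in> W \<Longrightarrow> lin_ext F (b u) = bvec u"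
    using surj by metis
  define A where "A u w = (if u \<in> W \<and> w \<in> W then Poly_Mapping.lookup (F w) u else 0)" for u w
  define B where "B w u = (if u \<in> W \<and> w \<in> W then Poly_Mapping.lookup (b u) w else 0)" for u w
  define I where "I u v = (if u \<in> W \<and> u = v then 1 else 0 :: complex)" for u v
  have ap: "Poly_Mapping.lookup (lin_ext F q) u = (\<Sum>w\<in>W. A u w * Poly_Mapping.lookup q w)" if "Poly_Mapping.keys q \<subseteq> W" "u \<in> W" for q u
    using that by (simp add: lin_ext_superset[OF W] lookup_sum A_def mult.commute)
  have AB: "mmul W A B = I"
  proof (intro ext)
    fix u v show "mmul W A B u v = I u v"
    proof (cases "u \<in> W \<and> v \<in> W")
      case True
      then have "mmul W A B u v = Poly_Mapping.lookup (lin_ext F (b v)) u"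
        using ap[OF b(1), of v u] by (simp add: mmul_def B_def)
      then show ?thesis using b(2)[of v] True by (auto simp: I_def lookup_single when_def)
    qed (auto simp: mmul_def A_def B_def I_def)
  qed
  have sup: "msupp W A" "msupp W B" "msupp W I" by (auto simp: msupp_def A_def B_def I_def)
  have Ir: "mmul W X I = X" if "msupp W X" for X
  proof (intro ext)
    fix u v
    have "mmul W X I u v = (\<Sum>k\<in>W. if k = v then X u v else 0)" unfolding mmul_def I_def by (intro sum.cong) auto
    then show "mmul W X I u v = X u v" using W that by (auto simp: msupp_def)
  qed
  have Il: "mmul W I X = X" if "msupp W X" for X
  proof (intro ext)
    fix u v
    have "mmul W I X u v = (\<Sum>k\<in>W. if k = u then X u v else 0)" unfolding mmul_def I_def by (intro sum.cong) auto
    then show "mmul W I X u v = X u v" using W that by (auto simp: msupp_def)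
  qed
  let ?E = "\<lambda>u v. I u v - mmul W B A u v"
  have BA: "mmul W (mmul W B A) (mmul W B A) = mmul W B A" using AB Il[OF sup(1)] by (metis mmul_assoc)
  have sBA: "msupp W (mmul W B A)" by (rule msupp_mmul[OF sup(2,1)])
  have "mmul W ?E ?E = ?E"
    by (simp add: mmul_diff_left mmul_diff_right BA Ir[OF sBA] Il[OF sBA] Ir[OF sup(3)])
  moreover have "msupp W ?E" using sup(3) sBA by (auto simp: msupp_def)
  ultimately obtain k :: nat where k: "mtrace W ?E = of_nat k" "k = 0 \<longrightarrow> ?E = (\<lambda>_ _. 0)"
    using idempotent_trace[OF W] by blast
  have "mtrace W ?E = 0" unfolding mtrace_diff mtrace_mmul[of W B A] AB by simp
  then have "?E = (\<lambda>_ _. 0)" using k by simp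
  then have BAI: "mmul W B A w v = I w v" for w v by (metis (no_types, lifting) eq_iff_diff_eq_0)
  have "Poly_Mapping.lookup p w = 0" if w: "w \<in> W" for w
  proof -
    have "Poly_Mapping.lookup p w = (\<Sum>v\<in>W. I w v * Poly_Mapping.lookup p v)"
    proof -
      have "(\<Sum>v\<in>W. I w v * Poly_Mapping.lookup p v) = (\<Sum>v\<in>W. if v = w then Poly_Mapping.lookup p w else 0)"
        using w by (intro sum.cong) (auto simp: I_def)
      then show ?thesis using W w by simp
    qed
    also have "\<dots> = (\<Sum>v\<in>W. \<Sum>u\<in>W. B w u * (A u v * Poly_Mapping.lookup p v))"
      unfolding BAI[symmetric] mmul_def sum_distrib_right by (simp add: mult.assoc)
    also have "\<dots> = (\<Sum>u\<in>W. B w u * (\<Sum>v\<in>W. A u v * Poly_Mapping.lookup p v))"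
      unfolding sum_distrib_left by (rule sum.swap)
    also have "\<dots> = (\<Sum>u\<in>W. B w u * Poly_Mapping.lookup (lin_ext F p) u)"
      using ap[OF p(1)] by (intro sum.cong) auto
    finally show ?thesis by (simp add: p(2))
  qed
  then have "Poly_Mapping.lookup p w = 0" for w using p(1) by (cases "w \<in> W") (auto simp: in_keys_iff)
  then show "p = 0" by (intro poly_mapping_eqI) simp
qed

text \<open>For each necklace \<open>u\<close> a preimage \<open>P u\<close> of \<open>u\<close>
  under \<open>qlastw\<close> is bracketed; by \<open>rot_brk\<close> the result has twisted
  rotation sum \<open>rotw z u\<close>. Coefficients at the representatives separate these sums,
  whence independence. They span because the rotation operator agrees on Lie elements with the
  injective operator of \<open>qlastw\<close>.\<close>

theorem lie_part_basis:
  fixes N m :: nat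
  assumes m: "m > 0"
  defines "X \<equiv> {u \<in> neck N. length u = m}"
  shows "\<exists>\<Lambda>. inj_on \<Lambda> X \<and> pm.independent (\<Lambda> ` X) \<and> pm.span (\<Lambda> ` X) = lie_part N m \<and>
    (\<forall>u\<in>X. \<forall>w\<in>Poly_Mapping.keys (\<Lambda> u). mset w = mset u)"
proof -
  define z where "z = unit_root m"
  have zm: "z ^ m = 1" using unit_root_power_eq_1_iff[OF m] by (simp add: z_def)
  have prm: "z ^ i \<noteq> 1" if "0 < i" "i < m" for i
    using unit_root_power_eq_1_iff[OF m] that by (auto simp: z_def dest: dvd_imp_le)
  let ?\<Theta> = "lin_ext (rotw z)" and ?Q = "lin_ext (qlastw z)"
  have finX: "finite X" unfolding X_def by (rule finite_neck_length)
  have Xw: "u \<in> words N m" "u \<noteq> []" "prim u" "necklace_rep u = u" if "u \<in> X" for u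
    using that by (auto simp: X_def neck_def words_def prim_def)
  obtain P where P: "\<And>u w. u \<in> words N m \<Longrightarrow> w \<in> Poly_Mapping.keys (P u) \<Longrightarrow> mset w = mset u"
    "\<And>u. u \<in> words N m \<Longrightarrow> ?Q (P u) = bvec u"
  proof -
    have "\<exists>p. (\<forall>w\<in>Poly_Mapping.keys p. mset w = mset u) \<and> ?Q p = bvec u" if "u \<in> words N m" for u
      using that m by (intro qlast_surj[OF prm]) (auto simp: words_def)
    then show ?thesis using that by metis
  qed
  have mw: "w \<in> words N m" if "mset w = mset u" "u \<in> words N m" for u w
    using that by (metis (mono_tags, lifting) mem_Collect_eq mset_eq_length mset_eq_setD words_def)
  define \<Lambda> where "\<Lambda> u = lin_ext brk (P u)" for u
  have \<Lambda>k: "mset w = mset u" if uN: "u \<in> words N m" and w: "w \<in> Poly_Mapping.keys (\<Lambda> u)" for u w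
  proof -
    obtain v where v: "v \<in> Poly_Mapping.keys (P u)" "w \<in> Poly_Mapping.keys (brk v)"
      using keys_lin_ext[OF w[unfolded \<Lambda>_def]] by blast
    have mv: "mset v = mset u" by (rule P(1)[OF uN v(1)])
    moreover have "u \<noteq> []" using uN m by (auto simp: words_def)
    ultimately have "v \<noteq> []" by auto
    then show ?thesis using keys_brk[OF _ v(2)] mv by simp
  qed
  have \<Lambda>lie: "\<Lambda> u \<in> lie_part N m" if u: "u \<in> words N m" for u
  proof -
    have "\<Lambda> u \<in> free_lie N" unfolding \<Lambda>_def lin_ext_def
    proof (intro pm.subspace_sum[OF free_lie_subspace] free_lie.scale)
      fix v assume "v \<in> Poly_Mapping.keys (P u)"
      then have "v \<in> words N m" using P(1)[OF u] mw u by blast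
      then show "brk v \<in> free_lie N" using m by (intro brk_free_lie) (auto simp: words_def)
    qed
    moreover have "length w = m" if "w \<in> Poly_Mapping.keys (\<Lambda> u)" for w
      using mw[OF \<Lambda>k[OF u that] u] by (simp add: words_def)
    ultimately show ?thesis by (simp add: lie_part_def)
  qed
  have \<Theta>\<Lambda>: "?\<Theta> (\<Lambda> u) = rotw z u" if u: "u \<in> words N m" for u
  proof -
    have "?\<Theta> (\<Lambda> u) = (\<Sum>v\<in>Poly_Mapping.keys (P u). pm_scale (Poly_Mapping.lookup (P u) v) (?\<Theta> (brk v)))"
      by (simp add: \<Lambda>_def lin_ext_def[of brk] lin_ext_sum lin_ext_scale)
    also have "\<dots> = (\<Sum>v\<in>Poly_Mapping.keys (P u). pm_scale (Poly_Mapping.lookup (P u) v) (?\<Theta> (qlastw z v)))"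
    proof (intro sum.cong refl)
      fix v assume "v \<in> Poly_Mapping.keys (P u)"
      then have "v \<in> words N m" using P(1)[OF u] mw u by blast
      then have "?\<Theta> (brk v) = ?\<Theta> (qlastw z v)" using m by (intro rot_brk[OF zm]) (auto simp: words_def)
      then show "pm_scale (Poly_Mapping.lookup (P u) v) (?\<Theta> (brk v)) = pm_scale (Poly_Mapping.lookup (P u) v) (?\<Theta> (qlastw z v))" by simp
    qed
    also have "\<dots> = ?\<Theta> (?Q (P u))" by (simp add: lin_ext_def[of "qlastw z"] lin_ext_sum lin_ext_scale)
    finally show ?thesis using P(2)[OF u] by simp
  qed
  \<comment> \<open>Distinct representatives are not rotations of each other, and a primitive word
    returns only after a full turn, whose weight is \<open>z ^ 0\<close>.\<close>
  have look: "Poly_Mapping.lookup (rotw z v) u = (if u = v then 1 else 0)" if "u \<in> X" "v \<in> X" for u v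
  proof -
    have lv: "length v = m" using that by (simp add: X_def)
    have "rotate (Suc i) v = u \<longleftrightarrow> u = v \<and> Suc i = m" if "i < m" for i
    proof
      assume r: "rotate (Suc i) v = u"
      then have "u = v" using necklace_rep_rotate[of "Suc i" v] Xw(4) \<open>u \<in> X\<close> \<open>v \<in> X\<close> by simp
      moreover have "Suc i = m"
      proof (rule ccontr)
        assume "Suc i \<noteq> m"
        then have "Suc i < m" using that by simp
        then show False using Xw(3)[OF \<open>v \<in> X\<close>] r \<open>u = v\<close> lv by (auto simp: prim_def)
      qed
      ultimately show "u = v \<and> Suc i = m" ..
    next
      assume "u = v \<and> Suc i = m"
      then show "rotate (Suc i) v = u" using rotate_conv_mod[of m v] lv by simp
    qed
    then have "Poly_Mapping.lookup (rotw z v) u = (\<Sum>i<m. if i = m - 1 then (if u = v then 1 else 0) else 0)"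
      unfolding rotw_def lookup_sum lv
      by (intro sum.cong refl) (auto simp: lookup_single when_def)
    then show ?thesis using m by simp
  qed
  have look\<Lambda>: "Poly_Mapping.lookup (?\<Theta> (\<Lambda> v)) u = (if u = v then 1 else 0)" if "u \<in> X" "v \<in> X" for u v
    using \<Theta>\<Lambda>[OF Xw(1)] look that by simp
  have inj: "inj_on \<Lambda> X"
  proof (rule inj_onI)
    fix u v assume uv: "u \<in> X" "v \<in> X" "\<Lambda> u = \<Lambda> v"
    then show "u = v" using look\<Lambda>[of u u] look\<Lambda>[of u v] by (auto split: if_splits)
  qed
  have ind: "pm.independent (\<Lambda> ` X)"
  proof (rule pm.independent_if_scalars_zero)
    show "finite (\<Lambda> ` X)" using finX by simp
    fix f x assume s: "(\<Sum>x\<in>\<Lambda> ` X. pm_scale (f x) x) = 0" and x: "x \<in> \<Lambda> ` X"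
    obtain u where u: "u \<in> X" "x = \<Lambda> u" using x by auto
    have "0 = Poly_Mapping.lookup (?\<Theta> (\<Sum>v\<in>X. pm_scale (f (\<Lambda> v)) (\<Lambda> v))) u"
      using s by (simp add: sum.reindex[OF inj])
    also have "\<dots> = (\<Sum>v\<in>X. if v = u then f x else 0)"
      unfolding lin_ext_sum lookup_sum lin_ext_scale using look\<Lambda>[OF u(1)] u(2) by (intro sum.cong) auto
    also have "\<dots> = f x" using finX u by simp
    finally show "f x = 0" ..
  qed
  have spanrot: "?\<Theta> (bvec w) = (\<Sum>u\<in>X. pm_scale (Poly_Mapping.lookup (?\<Theta> (bvec w)) u) (rotw z u))" if w: "w \<in> words N m" for w
  proof (cases "prim w")
    case True
    have wm: "length w = m" "w \<noteq> []" using w m by (auto simp: words_def)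
    have nX: "necklace_rep w \<in> X" using w True by (auto simp: X_def neck_def words_def necklace_rep_facts prim_necklace_rep necklace_rep_necklace_rep)
    have e: "rotw z w = pm_scale (z ^ rot_offset w) (rotw z (necklace_rep w))"
      using rotw_rotate[of z "necklace_rep w" "rot_offset w"] rotate_rot_offset[of w] zm wm necklace_rep_facts(1)[of w] by (metis length_0_conv)
    have "(\<Sum>u\<in>X. pm_scale (Poly_Mapping.lookup (?\<Theta> (bvec w)) u) (rotw z u)) = (\<Sum>u\<in>X. if u = necklace_rep w then rotw z w else 0)"
      using look[OF _ nX] by (intro sum.cong) (auto simp: e)
    then show ?thesis using finX nX by simp
  next
    case False
    then obtain k where k: "0 < k" "k < m" "rotate k w = w" using w m by (auto simp: prim_def words_def)
    \<comment> \<open>A nontrivial period forces \<open>rotw z w = 0\<close>, as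
      \<open>z ^ k\<close> differs from one.\<close>
    have "rotw z w = pm_scale (z ^ k) (rotw z w)"
      using rotw_rotate[of z w k] k(3) zm w m by (auto simp: words_def)
    then have "pm_scale (1 - z ^ k) (rotw z w) = 0" by (simp add: pm.scale_left_diff_distrib)
    then have "rotw z w = 0" using prm[OF k(1,2)] by simp
    then show ?thesis by simp
  qed
  have lpsub: "pm.subspace (lie_part N m)"
    unfolding lie_part_def pm.subspace_def
    using keys_add by (auto intro: free_lie.intros simp: in_keys_iff lookup_add)
  have span: "pm.span (\<Lambda> ` X) = lie_part N m"
  proof (intro equalityI subsetI)
    fix x assume "x \<in> pm.span (\<Lambda> ` X)"
    then show "x \<in> lie_part N m" using pm.span_minimal[OF _ lpsub, of "\<Lambda> ` X"] \<Lambda>lie Xw(1) by blast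
  next
    fix p assume p: "p \<in> lie_part N m"
    then have letter_prod: "p \<in> free_lie N" and pk: "Poly_Mapping.keys p \<subseteq> words N m"
      using keys_free_lie by (auto simp: lie_part_def words_def)
    define c where "c u = Poly_Mapping.lookup (?\<Theta> p) u" for u
    define q where "q = p - (\<Sum>u\<in>X. pm_scale (c u) (\<Lambda> u))"
    have \<Theta>p: "?\<Theta> p = (\<Sum>u\<in>X. pm_scale (c u) (rotw z u))"
    proof -
      have "?\<Theta> p = (\<Sum>w\<in>Poly_Mapping.keys p. pm_scale (Poly_Mapping.lookup p w) (?\<Theta> (bvec w)))"
        by (simp add: lin_ext_def[of _ p])
      also have "\<dots> = (\<Sum>w\<in>Poly_Mapping.keys p. \<Sum>u\<in>X. pm_scale (Poly_Mapping.lookup p w * Poly_Mapping.lookup (?\<Theta> (bvec w)) u) (rotw z u))"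
      proof (intro sum.cong refl)
        fix w assume "w \<in> Poly_Mapping.keys p"
        then have "w \<in> words N m" using pk by blast
        from arg_cong[OF spanrot[OF this], of "pm_scale (Poly_Mapping.lookup p w)"]
        show "pm_scale (Poly_Mapping.lookup p w) (?\<Theta> (bvec w)) = (\<Sum>u\<in>X. pm_scale (Poly_Mapping.lookup p w * Poly_Mapping.lookup (?\<Theta> (bvec w)) u) (rotw z u))"
          by (simp only: pm.scale_sum_right pm.scale_scale)
      qed
      also have "\<dots> = (\<Sum>u\<in>X. \<Sum>w\<in>Poly_Mapping.keys p. pm_scale (Poly_Mapping.lookup p w * Poly_Mapping.lookup (?\<Theta> (bvec w)) u) (rotw z u))"
        by (rule sum.swap)
      also have "\<dots> = (\<Sum>u\<in>X. pm_scale (c u) (rotw z u))"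
        unfolding pm.scale_sum_left[symmetric] c_def
        by (intro sum.cong refl arg_cong2[where f = pm_scale]) (simp add: lin_ext_def[of _ p] lookup_sum)
      finally show ?thesis .
    qed
    have sumlie: "(\<Sum>u\<in>X. pm_scale (c u) (\<Lambda> u)) \<in> lie_part N m"
      using \<Lambda>lie Xw(1) by (intro pm.subspace_sum[OF lpsub] pm.subspace_scale[OF lpsub]) auto
    have ql: "q \<in> lie_part N m" unfolding q_def by (rule pm.subspace_diff[OF lpsub p sumlie])
    \<comment> \<open>The coefficients \<open>c u\<close> were chosen to kill the twisted rotation
      sum of the remainder; injectivity of \<open>?Q\<close> then gives
      \<open>q = 0\<close>.\<close>
    have "?\<Theta> q = 0"
      unfolding q_def lin_ext_minus \<Theta>p lin_ext_sum lin_ext_scale using \<Theta>\<Lambda> Xw(1) by (simp cong: sum.cong)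
    then have Q0: "?Q q = 0" using rot_eq_qlast_lie[of q N z] ql by (simp add: lie_part_def)
    have "q = 0"
    proof (rule lin_ext_inj_if_surj[OF finite_words _ _ _ Q0])
      show "Poly_Mapping.keys (qlastw z w) \<subseteq> words N m" if "w \<in> words N m" for w
      proof
        fix v assume v: "v \<in> Poly_Mapping.keys (qlastw z w)"
        have "w \<noteq> []" using that m by (auto simp: words_def)
        from keys_qlastw[OF this v] show "v \<in> words N m" using that by (rule mw)
      qed
      show "\<exists>p. Poly_Mapping.keys p \<subseteq> words N m \<and> ?Q p = bvec u" if "u \<in> words N m" for u
      proof (intro exI conjI subsetI)
        show "?Q (P u) = bvec u" by (rule P(2)[OF that])
        fix w assume "w \<in> Poly_Mapping.keys (P u)"
        from P(1)[OF that this] show "w \<in> words N m" using that by (rule mw)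
      qed
      show "Poly_Mapping.keys q \<subseteq> words N m" using ql keys_free_lie by (auto simp: lie_part_def words_def)
    qed
    then have "p = (\<Sum>u\<in>X. pm_scale (c u) (\<Lambda> u))" by (simp add: q_def)
    moreover have "(\<Sum>u\<in>X. pm_scale (c u) (\<Lambda> u)) \<in> pm.span (\<Lambda> ` X)"
      by (intro pm.span_sum pm.span_scale pm.span_base imageI)
    ultimately show "p \<in> pm.span (\<Lambda> ` X)" by (simp only:)
  qed
  show ?thesis using inj ind span \<Lambda>k Xw(1) by blast
qed

section \<open>The character of a higher Lie module\<close>

subsection \<open>Traces and algebra maps\<close>

text \<open>The trace refers to an unspecified basis \<open>B\<close>. The functionals dual to the
  eigenvectors, packed into one linear map, carry the computation over: expanding \<open>E i\<close>
  along \<open>B\<close> and applying its own functional gives 1, so each eigenvalue is counted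
  once.\<close>

lemma trace_eigenbasis:
  fixes E :: "'i \<Rightarrow> ('b \<Rightarrow>\<^sub>0 complex)"
  assumes fin: "finite I" and span: "pm.span (E ` I) = W"
    and dual: "\<And>i. i \<in> I \<Longrightarrow> lin_ext F (E i) = Poly_Mapping.single i 1"
    and A: "A = lin_ext G" and ev: "\<And>i. i \<in> I \<Longrightarrow> A (E i) = pm_scale (ev i) (E i)"
  shows "trace_on W A = (\<Sum>i\<in>I. ev i)"
proof -
  let ?\<phi> = "\<lambda>i p. Poly_Mapping.lookup (lin_ext F p) i"
  have \<phi>E: "?\<phi> i (E j) = (if i = j then 1 else 0)" if "j \<in> I" for i j
    using that by (auto simp: dual lookup_single when_def)
  have inj: "inj_on E I"
  proof (rule inj_onI)
    fix i j assume "i \<in> I" "j \<in> I" "E i = E j"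
    then show "i = j" using \<phi>E[of i i] \<phi>E[of j i] by (auto split: if_splits)
  qed
  have expand: "w = (\<Sum>i\<in>I. pm_scale (?\<phi> i w) (E i))" if "w \<in> W" for w
    using that unfolding span[symmetric]
  proof (induction rule: pm.span_induct_alt)
    case (step c b y)
    then obtain j where j: "j \<in> I" "b = E j" by auto
    have "(\<Sum>i\<in>I. pm_scale (?\<phi> i (pm_scale c b + y)) (E i)) = (\<Sum>i\<in>I. if i = j then pm_scale c b else 0) + (\<Sum>i\<in>I. pm_scale (?\<phi> i y) (E i))"
      unfolding sum.distrib[symmetric] using j \<phi>E[OF j(1)]
      by (intro sum.cong refl) (auto simp: lin_ext_add lin_ext_scale lookup_add pm.scale_left_distrib)
    also have "(\<Sum>i\<in>I. if i = j then pm_scale c b else 0) = pm_scale c b" using fin j by simp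
    also have "(\<Sum>i\<in>I. pm_scale (?\<phi> i y) (E i)) = y" by (rule step(2)[symmetric])
    finally show ?case ..
  qed simp
  have ind: "pm.independent (E ` I)"
  proof (rule pm.independent_if_scalars_zero)
    fix f x assume s: "(\<Sum>x\<in>E ` I. pm_scale (f x) x) = 0" and "x \<in> E ` I"
    then obtain j where j: "j \<in> I" "x = E j" by auto
    have "0 = ?\<phi> j (\<Sum>i\<in>I. pm_scale (f (E i)) (E i))" using s by (simp add: sum.reindex[OF inj])
    also have "\<dots> = (\<Sum>i\<in>I. if i = j then f x else 0)"
      unfolding lin_ext_sum lookup_sum lin_ext_scale using \<phi>E j by (intro sum.cong) auto
    also have "\<dots> = f x" using fin j by simp
    finally show "f x = 0" ..
  qed (simp add: fin)
  define B where "B = (SOME B. B \<subseteq> W \<and> pm.independent B \<and> pm.span B = W)"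
  have "E ` I \<subseteq> W" unfolding span[symmetric] by (rule pm.span_superset)
  then have "\<exists>B. B \<subseteq> W \<and> pm.independent B \<and> pm.span B = W" using ind span by blast
  then have B: "B \<subseteq> W" "pm.independent B" "pm.span B = W"
    unfolding B_def by (rule someI_ex[THEN conjunct1], rule someI_ex[THEN conjunct2, THEN conjunct1], rule someI_ex[THEN conjunct2, THEN conjunct2])
  have finB: "finite B"
    using pm.independent_span_bound[of "E ` I" B] fin B unfolding span by simp
  have EW: "E i \<in> W" if "i \<in> I" for i using that \<open>E ` I \<subseteq> W\<close> by blast
  let ?r = "pm.representation B"
  have Ab: "?r (A b) b = (\<Sum>i\<in>I. ev i * (?\<phi> i b * ?r (E i) b))" if b: "b \<in> B" for b
  proof -
    have "A b = A (\<Sum>i\<in>I. pm_scale (?\<phi> i b) (E i))" using expand[of b] b B(1) by auto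
    also have "\<dots> = (\<Sum>i\<in>I. pm_scale (?\<phi> i b) (A (E i)))" unfolding A lin_ext_sum lin_ext_scale ..
    also have "\<dots> = (\<Sum>i\<in>I. pm_scale (?\<phi> i b * ev i) (E i))" by (intro sum.cong refl) (simp add: ev)
    finally have "?r (A b) = ?r (\<Sum>i\<in>I. pm_scale (?\<phi> i b * ev i) (E i))" by (simp only:)
    also have "\<dots> = (\<lambda>c. \<Sum>i\<in>I. ?r (pm_scale (?\<phi> i b * ev i) (E i)) c)"
      by (rule pm.representation_sum[OF B(2)]) (auto simp: B(3) EW intro: pm.subspace_scale[OF pm.subspace_span[of B, unfolded B(3)]])
    finally have "?r (A b) b = (\<Sum>i\<in>I. ?r (pm_scale (?\<phi> i b * ev i) (E i)) b)" by (simp only:)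
    also have "\<dots> = (\<Sum>i\<in>I. ev i * (?\<phi> i b * ?r (E i) b))"
    proof (intro sum.cong refl)
      fix i assume "i \<in> I"
      then have "E i \<in> pm.span B" using EW B(3) by simp
      from pm.representation_scale[OF B(2) this]
      show "?r (pm_scale (?\<phi> i b * ev i) (E i)) b = ev i * (?\<phi> i b * ?r (E i) b)" by simp
    qed
    finally show ?thesis .
  qed
  have "trace_on W A = (\<Sum>b\<in>B. ?r (A b) b)" by (simp add: trace_on_def B_def Let_def)
  also have "\<dots> = (\<Sum>b\<in>B. \<Sum>i\<in>I. ev i * (?\<phi> i b * ?r (E i) b))" by (intro sum.cong refl Ab)
  also have "\<dots> = (\<Sum>i\<in>I. ev i * (\<Sum>b\<in>B. ?\<phi> i b * ?r (E i) b))"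
    unfolding sum_distrib_left by (rule sum.swap)
  also have "\<dots> = (\<Sum>i\<in>I. ev i)"
  proof (intro sum.cong refl)
    fix i assume i: "i \<in> I"
    have "(\<Sum>b\<in>B. ?\<phi> i b * ?r (E i) b) = ?\<phi> i (\<Sum>b\<in>B. pm_scale (?r (E i) b) b)"
      unfolding lin_ext_sum lin_ext_scale lookup_sum by (intro sum.cong refl) simp
    also have "(\<Sum>b\<in>B. pm_scale (?r (E i) b) b) = E i"
      using EW[OF i] B finB by (intro pm.sum_representation_eq) auto
    finally show "ev i * (\<Sum>b\<in>B. ?\<phi> i b * ?r (E i) b) = ev i" using \<phi>E[OF i, of i] by simp
  qed
  finally show ?thesis .
qed

lemma tens_map_mult: "tens_map A (p * q) = tens_map A p * tens_map A q"
proof (induction p rule: pm_induct)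
  case (single u)
  show ?case
  proof (induction q rule: pm_induct)
    case (single v)
    show ?case by (simp add: bvec_mult tens_map_def)
  qed (simp_all add: tens_map_def distrib_left lin_ext_add lin_ext_scale pm_scale_mult_right)
qed (simp_all add: tens_map_def distrib_right lin_ext_add lin_ext_scale pm_scale_mult_left)

lemma tens_map_1: "tens_map A 1 = 1" unfolding bvec_Nil[symmetric] tens_map_def lin_ext_bvec by (simp add: bvec_Nil)

lemma tens_map_tens_vec: assumes "A = lin_ext F" shows "tens_map A (tens_vec w) = tens_vec (A w)"
  unfolding assms by (induction w rule: pm_induct) (simp_all add: tens_map_def tens_vec_def lin_ext_add lin_ext_scale)

lemma tens_map_prod: assumes "A = lin_ext F" shows "tens_map A (\<Prod>w\<leftarrow>ws. tens_vec w) = (\<Prod>w\<leftarrow>ws. tens_vec (A w))"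
  by (induction ws) (simp_all add: tens_map_1 tens_map_mult tens_map_tens_vec[OF assms])

lemma bvec_mset_mult: "Poly_Mapping.single (M :: 'a multiset) (1 :: complex) * Poly_Mapping.single M' 1 = Poly_Mapping.single (M + M') 1"
  by (simp add: mult_single)

lemma bvec_mset_empty: "Poly_Mapping.single ({#} :: 'a multiset) (1 :: complex) = 1"
  unfolding single_one[symmetric] zero_multiset_def[symmetric] ..

lemma sym_map_mult: "sym_map A (p * q) = sym_map A p * sym_map A q"
proof (induction p rule: pm_induct)
  case (single u)
  show ?case
  proof (induction q rule: pm_induct)
    case (single v)
    show ?case by (simp add: bvec_mset_mult sym_map_def)
  qed (simp_all add: sym_map_def distrib_left lin_ext_add lin_ext_scale pm_scale_mult_right)
qed (simp_all add: sym_map_def distrib_right lin_ext_add lin_ext_scale pm_scale_mult_left)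

lemma sym_map_1: "sym_map A 1 = 1" unfolding bvec_mset_empty[symmetric] sym_map_def lin_ext_bvec by (simp add: bvec_mset_empty)

lemma sym_map_sym_vec: assumes "A = lin_ext F" shows "sym_map A (sym_vec w) = sym_vec (A w)"
  unfolding assms by (induction w rule: pm_induct) (simp_all add: sym_map_def sym_vec_def lin_ext_add lin_ext_scale)

lemma sym_map_prod: assumes "A = lin_ext F" shows "sym_map A (\<Prod>u\<in>#M. sym_vec (f u)) = (\<Prod>u\<in>#M. sym_vec (A (f u)))"
  by (induction M) (simp_all add: sym_map_1 sym_map_mult sym_map_sym_vec[OF assms])

lemma prod_sym_scale: "(\<Prod>u\<in>#M. sym_vec (pm_scale (c u) (f u))) = pm_scale (\<Prod>u\<in>#M. c u) (\<Prod>u\<in>#M. sym_vec (f u))"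
  by (induction M) (simp_all add: sym_vec_def lin_ext_scale pm_scale_mult_left pm_scale_mult_right mult.commute)

lemma prod_tens_scale: "(\<Prod>u\<leftarrow>us. tens_vec (pm_scale (c u) (f u))) = pm_scale (\<Prod>u\<leftarrow>us. c u) (\<Prod>u\<leftarrow>us. tens_vec (f u))"
  by (induction us) (simp_all add: tens_vec_def lin_ext_scale pm_scale_mult_left pm_scale_mult_right mult.commute)

lemma prod_sym_bvec: "(\<Prod>u\<in>#M. sym_vec (Poly_Mapping.single u 1)) = Poly_Mapping.single M 1"
  by (induction M) (simp_all add: bvec_mset_empty sym_vec_def bvec_mset_mult)

lemma prod_tens_bvec: "(\<Prod>u\<leftarrow>us. tens_vec (Poly_Mapping.single u 1)) = Poly_Mapping.single us 1"
  by (induction us) (simp_all add: bvec_Nil tens_vec_def bvec_mult)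

lemma span_mult:
  fixes p :: "'m :: monoid_add \<Rightarrow>\<^sub>0 complex"
  assumes w: "w \<in> pm.span A" and p: "p \<in> pm.span B" and T: "pm.subspace T"
    and AB: "\<And>a b. a \<in> A \<Longrightarrow> b \<in> B \<Longrightarrow> lin_ext f a * b \<in> T"
  shows "lin_ext f w * p \<in> T"
  using w
proof (induction rule: pm.span_induct_alt)
  case base then show ?case using T by (simp add: pm.subspace_0)
next
  case (step c a y)
  have "lin_ext f a * p \<in> T" using p
  proof (induction rule: pm.span_induct_alt)
    case base then show ?case using T by (simp add: pm.subspace_0)
  next
    case (step c b z)
    then show ?case using AB[OF \<open>a \<in> A\<close>] T
      by (simp add: distrib_left pm_scale_mult_right pm.subspace_add pm.subspace_scale)
  qed
  then show ?case using step T
    by (simp add: lin_ext_add lin_ext_scale distrib_right pm_scale_mult_left pm.subspace_add pm.subspace_scale)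
qed

subsection \<open>Bases of symmetric powers and tensor products\<close>

text \<open>Spanning is all that is shown here; independence of the monomials comes from the dual
  map in \<open>trace_eigenbasis\<close>.\<close>

lemma sym_power_span:
  assumes W: "pm.span (f ` X) = W"
  shows "sym_power k W = pm.span ((\<lambda>M. \<Prod>u\<in>#M. sym_vec (f u)) ` {M. set_mset M \<subseteq> X \<and> size M = k})"
    (is "_ = pm.span (?E ` ?I k)")
  unfolding sym_power_def
proof (rule antisym; rule pm.span_minimal[OF _ pm.subspace_span])
  have "(\<Prod>w\<leftarrow>ws. sym_vec w) \<in> pm.span (?E ` ?I (length ws))" if "set ws \<subseteq> W" for ws
    using that
  proof (induction ws)
    case Nil
    have "?E {#} \<in> ?E ` ?I 0" by (intro imageI) simp
    then have "?E {#} \<in> pm.span (?E ` ?I 0)" by (rule pm.span_base)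
    then show ?case by simp
  next
    case (Cons w ws)
    have "lin_ext (\<lambda>b. Poly_Mapping.single {#b#} 1) w * (\<Prod>w\<leftarrow>ws. sym_vec w) \<in> pm.span (?E ` ?I (Suc (length ws)))"
    proof (rule span_mult[OF _ _ pm.subspace_span])
      show "w \<in> pm.span (f ` X)" using Cons.prems W by simp
      show "(\<Prod>w\<leftarrow>ws. sym_vec w) \<in> pm.span (?E ` ?I (length ws))" using Cons by simp
      fix a b assume "a \<in> f ` X" "b \<in> ?E ` ?I (length ws)"
      then obtain u M where uM: "u \<in> X" "a = f u" "M \<in> ?I (length ws)" "b = ?E M" by auto
      have "lin_ext (\<lambda>b. Poly_Mapping.single {#b#} 1) a * b = ?E (add_mset u M)"
        unfolding uM(2,4) sym_vec_def[symmetric] by simp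
      moreover have "add_mset u M \<in> ?I (Suc (length ws))" using uM by auto
      ultimately show "lin_ext (\<lambda>b. Poly_Mapping.single {#b#} 1) a * b \<in> pm.span (?E ` ?I (Suc (length ws)))"
        by (simp only:) (intro pm.span_base imageI)
    qed
    then show ?case by (simp add: sym_vec_def)
  qed
  then show "{\<Prod>w\<leftarrow>ws. sym_vec w |ws. length ws = k \<and> set ws \<subseteq> W} \<subseteq> pm.span (?E ` ?I k)" by blast
  show "?E ` ?I k \<subseteq> pm.span {\<Prod>w\<leftarrow>ws. sym_vec w |ws. length ws = k \<and> set ws \<subseteq> W}"
  proof (rule image_subsetI)
    fix M assume M: "M \<in> ?I k"
    obtain us where us: "mset us = M" using ex_mset by blast
    have "?E M = (\<Prod>w\<leftarrow>map f us. sym_vec w)"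
      unfolding us[symmetric] mset_map[symmetric] prod_mset_prod_list by (simp add: o_def)
    moreover have "length (map f us) = k" "set (map f us) \<subseteq> W"
      using M us image_subset_iff[of f X W] pm.span_superset[of "f ` X"] unfolding W by auto
    ultimately show "?E M \<in> pm.span {\<Prod>w\<leftarrow>ws. sym_vec w |ws. length ws = k \<and> set ws \<subseteq> W}"
      by (intro pm.span_base) blast
  qed
qed

lemma tensor_prod_span:
  assumes W: "\<And>i. i \<in> set is \<Longrightarrow> pm.span (f ` X i) = W i"
  shows "tensor_prod (map W is) = pm.span ((\<lambda>us. \<Prod>u\<leftarrow>us. tens_vec (f u)) ` {us. list_all2 (\<lambda>u i. u \<in> X i) us is})"
    (is "_ = pm.span (?E ` ?I is)")
  unfolding tensor_prod_def
proof (rule antisym; rule pm.span_minimal[OF _ pm.subspace_span])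
  have "(\<Prod>w\<leftarrow>ws. tens_vec w) \<in> pm.span (?E ` ?I js)" if "list_all2 (\<in>) ws (map W js)" "set js \<subseteq> set is" for ws js
    using that
  proof (induction js arbitrary: ws)
    case Nil
    have "?E [] \<in> ?E ` ?I []" by (intro imageI) simp
    then have "?E [] \<in> pm.span (?E ` ?I [])" by (rule pm.span_base)
    then show ?case using Nil by simp
  next
    case (Cons j js ws')
    obtain w ws where ws: "ws' = w # ws" "w \<in> W j" "list_all2 (\<in>) ws (map W js)"
      using Cons.prems(1) by (auto simp: list_all2_Cons2)
    have "lin_ext (\<lambda>b. Poly_Mapping.single [b] 1) w * (\<Prod>w\<leftarrow>ws. tens_vec w) \<in> pm.span (?E ` ?I (j # js))"
    proof (rule span_mult[OF _ _ pm.subspace_span])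
      show "w \<in> pm.span (f ` X j)" using Cons.prems W ws by simp
      show "(\<Prod>w\<leftarrow>ws. tens_vec w) \<in> pm.span (?E ` ?I js)" using Cons ws by simp
      fix a b assume "a \<in> f ` X j" "b \<in> ?E ` ?I js"
      then obtain u us where uM: "u \<in> X j" "a = f u" "us \<in> ?I js" "b = ?E us" by auto
      have "lin_ext (\<lambda>b. Poly_Mapping.single [b] 1) a * b = ?E (u # us)"
        unfolding uM(2,4) tens_vec_def[symmetric] by simp
      moreover have "u # us \<in> ?I (j # js)" using uM by auto
      ultimately show "lin_ext (\<lambda>b. Poly_Mapping.single [b] 1) a * b \<in> pm.span (?E ` ?I (j # js))"
        by (simp only:) (intro pm.span_base imageI)
    qed
    then show ?case by (simp add: tens_vec_def ws)
  qed
  from this[OF _ order_refl]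
  show "{\<Prod>w\<leftarrow>ws. tens_vec w |ws. list_all2 (\<in>) ws (map W is)} \<subseteq> pm.span (?E ` ?I is)" by blast
  show "?E ` ?I is \<subseteq> pm.span {\<Prod>w\<leftarrow>ws. tens_vec w |ws. list_all2 (\<in>) ws (map W is)}"
  proof (rule image_subsetI)
    fix us assume us: "us \<in> ?I is"
    have "?E us = (\<Prod>w\<leftarrow>map f us. tens_vec w)" by (simp add: o_def)
    moreover have "list_all2 (\<in>) (map f us) (map W is)"
    proof -
      have "f u \<in> W i" if "i \<in> set is" "u \<in> X i" for u i
        using pm.span_superset[of "f ` X i"] W[OF that(1)] that(2) by blast
      then show ?thesis using us by (auto simp: list_all2_conv_all_nth)
    qed
    ultimately show "?E us \<in> pm.span {\<Prod>w\<leftarrow>ws. tens_vec w |ws. list_all2 (\<in>) ws (map W is)}"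
      by (intro pm.span_base) blast
  qed
qed

lemma finite_list_all2: "(\<And>i. i \<in> set is \<Longrightarrow> finite (X i)) \<Longrightarrow> finite {us. list_all2 (\<lambda>u i. u \<in> X i) us is}"
proof (induction "is")
  case (Cons i "is")
  have "{us. list_all2 (\<lambda>u i. u \<in> X i) us (i # is)} = (\<lambda>(u, us). u # us) ` (X i \<times> {us. list_all2 (\<lambda>u i. u \<in> X i) us is})"
    by (auto simp: list_all2_Cons2)
  then show ?case using Cons by simp
qed simp

subsection \<open>The character\<close>

text \<open>One map \<open>G\<close> serves all degrees because words of different lengths do not
  interact. The algebra maps it induces send monomials in the basis elements to basis vectors, which
  is the dual map that \<open>trace_eigenbasis\<close> asks for.\<close>

lemma lie_dual:
  "\<exists>\<Lambda> G. (\<forall>u\<in>neck N. (\<forall>w\<in>Poly_Mapping.keys (\<Lambda> u). mset w = mset u) \<and> lin_ext G (\<Lambda> u) = bvec u) \<and>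
    (\<forall>m>0. pm.span (\<Lambda> ` {u \<in> neck N. length u = m}) = lie_part N m)"
proof -
  let ?X = "\<lambda>m. {u \<in> neck N. length u = m}"
  define Q where "Q m p \<longleftrightarrow> pm.span (fst p ` ?X m) = lie_part N m \<and>
    (\<forall>u\<in>?X m. (\<forall>w\<in>Poly_Mapping.keys (fst p u). mset w = mset u) \<and> lin_ext (snd p) (fst p u) = bvec u)"
    for m and p :: "(nat list \<Rightarrow> (nat list \<Rightarrow>\<^sub>0 complex)) \<times> (nat list \<Rightarrow> (nat list \<Rightarrow>\<^sub>0 complex))"
  have vsp: "vector_space_pair (pm_scale :: complex \<Rightarrow> (nat list \<Rightarrow>\<^sub>0 complex) \<Rightarrow> _) (pm_scale :: complex \<Rightarrow> (nat list \<Rightarrow>\<^sub>0 complex) \<Rightarrow> _)"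
    by unfold_locales
  have ex: "\<exists>p. Q m p" if m0: "m > 0" for m
  proof -
    obtain L where L: "inj_on L (?X m)" "pm.independent (L ` ?X m)" "pm.span (L ` ?X m) = lie_part N m"
      "\<forall>u\<in>?X m. \<forall>w\<in>Poly_Mapping.keys (L u). mset w = mset u"
      using lie_part_basis[OF m0, of N] by blast
    obtain g where g: "Vector_Spaces.linear pm_scale pm_scale g" "\<forall>x\<in>L ` ?X m. g x = bvec (inv_into (?X m) L x)"
      using vector_space_pair.linear_independent_extend[OF vsp L(2), of "\<lambda>x. bvec (inv_into (?X m) L x)"] by blast
    interpret g: Vector_Spaces.linear "pm_scale :: complex \<Rightarrow> (nat list \<Rightarrow>\<^sub>0 complex) \<Rightarrow> _" "pm_scale :: complex \<Rightarrow> (nat list \<Rightarrow>\<^sub>0 complex) \<Rightarrow> _" g by (rule g(1))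
    have ge: "lin_ext (\<lambda>w. g (bvec w)) p = g p" for p
    proof -
      have "g p = g (\<Sum>b\<in>Poly_Mapping.keys p. pm_scale (Poly_Mapping.lookup p b) (bvec b))" by (simp only: pm_expand[symmetric])
      also have "\<dots> = lin_ext (\<lambda>w. g (bvec w)) p" by (simp add: g.sum g.scale lin_ext_def)
      finally show ?thesis ..
    qed
    have "g (L u) = bvec u" if "u \<in> ?X m" for u using g(2) that inv_into_f_f[OF L(1) that] by simp
    then have "Q m (L, \<lambda>w. g (bvec w))" unfolding Q_def fst_conv snd_conv ge using L(3,4) by blast
    then show ?thesis by blast
  qed
  define h where "h m = (SOME p. Q m p)" for m
  have h: "Q m (h m)" if "m > 0" for m unfolding h_def by (rule someI_ex[OF ex[OF that]])
  define \<Lambda> where "\<Lambda> u = fst (h (length u)) u" for u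
  define G where "G w = snd (h (length w)) w" for w
  have pos: "length u > 0" if "u \<in> neck N" for u using that by (auto simp: neck_def prim_def)
  have k: "mset w = mset u" if "u \<in> neck N" "w \<in> Poly_Mapping.keys (\<Lambda> u)" for u w
    using h[OF pos[OF that(1)]] that unfolding Q_def \<Lambda>_def by blast
  have d: "lin_ext G (\<Lambda> u) = bvec u" if u: "u \<in> neck N" for u
  proof -
    have "lin_ext G (\<Lambda> u) = lin_ext (snd (h (length u))) (\<Lambda> u)"
      unfolding lin_ext_def
    proof (intro sum.cong refl)
      fix w assume "w \<in> Poly_Mapping.keys (\<Lambda> u)"
      then have "length w = length u" using k[OF u] mset_eq_length by blast
      then show "pm_scale (Poly_Mapping.lookup (\<Lambda> u) w) (G w) = pm_scale (Poly_Mapping.lookup (\<Lambda> u) w) (snd (h (length u)) w)"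
        by (simp add: G_def)
    qed
    also have "\<dots> = bvec u" using h[OF pos[OF u]] u unfolding Q_def \<Lambda>_def by blast
    finally show ?thesis .
  qed
  have s: "pm.span (\<Lambda> ` ?X m) = lie_part N m" if "m > 0" for m
  proof -
    have "\<Lambda> ` ?X m = fst (h m) ` ?X m" by (intro image_cong) (auto simp: \<Lambda>_def)
    then show ?thesis using h[OF that] by (simp add: Q_def)
  qed
  show ?thesis using k d s by blast
qed

lemma gl_diag: assumes "a < N" shows "gl_std (mat_diag N x) (Poly_Mapping.single a 1) = pm_scale (x a) (Poly_Mapping.single a 1)"
proof -
  have "(\<Sum>i<N. Poly_Mapping.single i (mat_diag N x $$ (i, a))) = (\<Sum>i<N. if i = a then Poly_Mapping.single a (x a) else 0)"
    using assms by (intro sum.cong) (auto simp: mat_diag_def)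
  also have "\<dots> = pm_scale (x a) (Poly_Mapping.single a 1)"
    using assms by (intro poly_mapping_eqI) (simp add: lookup_single when_def)
  finally show ?thesis by (simp add: gl_std_def mat_diag_def)
qed

lemma tens_gl_diag:
  assumes "set w \<subseteq> {..<N}"
  shows "tens_map (gl_std (mat_diag N x)) (bvec w) = pm_scale (letter_prod x w) (bvec w)"
proof -
  have "tens_map (gl_std (mat_diag N x)) (bvec w) = (\<Prod>b\<leftarrow>w. tens_vec (pm_scale (x b) (Poly_Mapping.single b 1)))"
    unfolding tens_map_def lin_ext_bvec using assms by (intro arg_cong[where f = prod_list] map_cong refl arg_cong[where f = tens_vec] gl_diag) auto
  also have "\<dots> = pm_scale (letter_prod x w) (bvec w)" unfolding prod_tens_scale prod_tens_bvec letter_prod_def ..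
  finally show ?thesis .
qed

lemma size_filter_image: "count (image_mset f M) i = size {#u \<in># M. f u = i#}"
  by (induction M) auto

lemma regroup_filter:
  "distinct is \<Longrightarrow> sum_list (map (\<lambda>i. {#u \<in># M. f u = i#}) is) = {#u \<in># M. f u \<in> set is#}"
proof (induction "is")
  case (Cons i "is")
  have "{#u \<in># M. f u \<in> set (i # is)#} = {#u \<in># M. f u = i#} + {#u \<in># M. f u \<in> set is#}"
    using Cons.prems by (intro multiset_eqI) auto
  then show ?case using Cons by simp
qed simp

lemma filter_regroup:
  "list_all2 (\<lambda>M i. \<forall>u\<in>#M. f u = i) Ms is \<Longrightarrow> distinct is \<Longrightarrow> map (\<lambda>i. {#u \<in># sum_list Ms. f u = i#}) is = Ms"
proof (induction Ms "is" rule: list_all2_induct)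
  case (Cons M Ms i "is")
  have Ms: "f u \<in> set is" if "u \<in># sum_list Ms" for u
    using Cons.hyps(2) that by (induction Ms "is" rule: list_all2_induct) auto
  have M: "{#u \<in># M. f u = j#} = (if j = i then M else {#})" for j
    using Cons.hyps(1) by (auto simp: filter_mset_eq_conv)
  have "{#u \<in># sum_list Ms. f u = i#} = {#}" using Ms Cons.prems by auto
  then have "{#u \<in># sum_list (M # Ms). f u = i#} = M" by (simp only: sum_list.Cons filter_union_mset M if_True add_0_right refl)
  moreover have "map (\<lambda>j. {#u \<in># sum_list (M # Ms). f u = j#}) is = map (\<lambda>j. {#u \<in># sum_list Ms. f u = j#}) is"
    using Cons.prems by (intro map_cong refl) (auto simp: M)
  moreover have "map (\<lambda>j. {#u \<in># sum_list Ms. f u = j#}) is = Ms" using Cons by simp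
  ultimately show ?case by (simp only: list.map)
qed simp

text \<open>Each basis element is homogeneous with the content of its necklace, so a diagonal matrix
  scales it by the corresponding monomial, and products of basis elements are eigenvectors. It
  remains to merge the factors of the tensor product into one multiset.\<close>

theorem higher_lie_char_eq:
  assumes lam: "lam \<in> partitions n"
  shows "higher_lie_char N lam x = (\<Sum>M\<in>neck_msets lam N. prod_mset (image_mset (letter_prod x) M))"
proof -
  obtain \<Lambda> G where \<Lambda>: "\<And>u w. u \<in> neck N \<Longrightarrow> w \<in> Poly_Mapping.keys (\<Lambda> u) \<Longrightarrow> mset w = mset u"
      "\<And>u. u \<in> neck N \<Longrightarrow> lin_ext G (\<Lambda> u) = bvec u"
      "\<And>m. m > 0 \<Longrightarrow> pm.span (\<Lambda> ` {u \<in> neck N. length u = m}) = lie_part N m"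
    using lie_dual[of N] by blast
  define js where "js = [1..<Suc (sum_list lam)]"
  define X where "X i = {M. set_mset M \<subseteq> {u \<in> neck N. length u = i} \<and> size M = count_list lam i}" for i
  define I where "I = {Ms. list_all2 (\<lambda>M i. M \<in> X i) Ms js}"
  let ?E1 = "\<lambda>M. \<Prod>u\<in>#M. sym_vec (\<Lambda> u)"
  let ?E = "\<lambda>Ms. \<Prod>M\<leftarrow>Ms. tens_vec (?E1 M)"
  let ?ev = "\<lambda>M. prod_mset (image_mset (letter_prod x) M)"
  let ?B = "tens_map (gl_std (mat_diag N x))"
  have finX: "finite (X i)" for i unfolding X_def by (rule finite_msets_size) (rule finite_neck_length)
  have Ine: "u \<in> neck N" if "Ms \<in> I" "M \<in> set Ms" "u \<in># M" for Ms M u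
    using that unfolding I_def X_def by (auto simp: list_all2_conv_all_nth in_set_conv_nth)
  have BL: "?B (\<Lambda> u) = pm_scale (letter_prod x u) (\<Lambda> u)" if u: "u \<in> neck N" for u
  proof -
    have "?B (\<Lambda> u) = (\<Sum>w\<in>Poly_Mapping.keys (\<Lambda> u). pm_scale (Poly_Mapping.lookup (\<Lambda> u) w) (?B (bvec w)))"
      unfolding tens_map_def by (simp add: lin_ext_def[of _ "\<Lambda> u"])
    also have "\<dots> = (\<Sum>w\<in>Poly_Mapping.keys (\<Lambda> u). pm_scale (letter_prod x u) (pm_scale (Poly_Mapping.lookup (\<Lambda> u) w) (bvec w)))"
    proof (intro sum.cong refl)
      fix w assume w: "w \<in> Poly_Mapping.keys (\<Lambda> u)"
      have m: "mset w = mset u" by (rule \<Lambda>(1)[OF u w])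
      have "set w = set u" using m by (rule mset_eq_setD)
      then have "set w \<subseteq> {..<N}" using u by (simp add: neck_def)
      moreover have "letter_prod x w = letter_prod x u" by (simp only: letter_prod_mset m)
      ultimately show "pm_scale (Poly_Mapping.lookup (\<Lambda> u) w) (?B (bvec w)) = pm_scale (letter_prod x u) (pm_scale (Poly_Mapping.lookup (\<Lambda> u) w) (bvec w))"
        by (simp add: tens_gl_diag mult.commute)
    qed
    also have "\<dots> = pm_scale (letter_prod x u) (\<Lambda> u)" unfolding pm.scale_sum_right[symmetric] pm_expand[symmetric] ..
    finally show ?thesis .
  qed
  have act: "gl_action (mat_diag N x) (?E Ms) = pm_scale (\<Prod>M\<leftarrow>Ms. ?ev M) (?E Ms)" if "Ms \<in> I" for Ms
  proof -
    have "gl_action (mat_diag N x) (?E Ms) = (\<Prod>M\<leftarrow>Ms. tens_vec (sym_map ?B (?E1 M)))"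
      using tens_map_prod[OF sym_map_def, of _ "map ?E1 Ms"] unfolding gl_action_def by (simp add: o_def)
    also have "\<dots> = (\<Prod>M\<leftarrow>Ms. tens_vec (pm_scale (?ev M) (?E1 M)))"
    proof (intro arg_cong[where f = prod_list] map_cong refl arg_cong[where f = tens_vec])
      fix M assume "M \<in> set Ms"
      then have "(\<Prod>u\<in>#M. sym_vec (?B (\<Lambda> u))) = (\<Prod>u\<in>#M. sym_vec (pm_scale (letter_prod x u) (\<Lambda> u)))"
        using BL Ine[OF that] by (intro arg_cong[where f = prod_mset] image_mset_cong) simp
      then show "sym_map ?B (?E1 M) = pm_scale (?ev M) (?E1 M)"
        unfolding sym_map_prod[OF tens_map_def] prod_sym_scale .
    qed
    finally show ?thesis unfolding prod_tens_scale .
  qed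
  have dual: "tens_map (sym_map (lin_ext G)) (?E Ms) = Poly_Mapping.single Ms 1" if "Ms \<in> I" for Ms
  proof -
    have "tens_map (sym_map (lin_ext G)) (?E Ms) = (\<Prod>M\<leftarrow>Ms. tens_vec (sym_map (lin_ext G) (?E1 M)))"
      using tens_map_prod[OF sym_map_def, of _ "map ?E1 Ms"] by (simp add: o_def)
    also have "\<dots> = (\<Prod>M\<leftarrow>Ms. tens_vec (Poly_Mapping.single M 1))"
    proof (intro arg_cong[where f = prod_list] map_cong refl arg_cong[where f = tens_vec])
      fix M assume "M \<in> set Ms"
      then have "(\<Prod>u\<in>#M. sym_vec (lin_ext G (\<Lambda> u))) = (\<Prod>u\<in>#M. sym_vec (bvec u))"
        using \<Lambda>(2) Ine[OF that] by (intro arg_cong[where f = prod_mset] image_mset_cong) simp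
      then show "sym_map (lin_ext G) (?E1 M) = Poly_Mapping.single M 1"
        unfolding sym_map_prod[OF refl] prod_sym_bvec .
    qed
    finally show ?thesis unfolding prod_tens_bvec .
  qed
  have span: "pm.span (?E ` I) = higher_lie N lam"
  proof -
    have "pm.span (?E1 ` X i) = sym_power (count_list lam i) (lie_part N i)" if "i \<in> set js" for i
    proof -
      have "i > 0" using that unfolding js_def set_upt by simp
      from sym_power_span[OF \<Lambda>(3)[OF this]] show ?thesis unfolding X_def by (simp only:)
    qed
    from tensor_prod_span[of js ?E1 X "\<lambda>i. sym_power (count_list lam i) (lie_part N i)", OF this]
    show ?thesis unfolding higher_lie_def I_def js_def[symmetric] by (simp only:)
  qed
  have "finite I" unfolding I_def using finX by (intro finite_list_all2)
  from trace_eigenbasis[OF this span dual[unfolded tens_map_def] gl_action_def[unfolded tens_map_def[of "sym_map _"]] act]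
  have "higher_lie_char N lam x = (\<Sum>Ms\<in>I. \<Prod>M\<leftarrow>Ms. ?ev M)" unfolding higher_lie_char_def .
  also have "\<dots> = (\<Sum>M\<in>neck_msets lam N. ?ev M)"
  proof (rule sum.reindex_bij_witness[of _ "\<lambda>M. map (\<lambda>i. {#u \<in># M. length u = i#}) js" sum_list])
    have dis: "distinct js" by (simp add: js_def)
    have set_js: "a \<in> set js" if "a \<in> set lam" for a
    proof -
      have "0 \<notin> set lam" using lam by (simp add: partitions_def)
      then have "a \<noteq> 0" using that by metis
      then show ?thesis using member_le_sum_list[OF that] unfolding js_def set_upt by simp
    qed
    {
      fix Ms assume Ms: "Ms \<in> I"
      have la: "list_all2 (\<lambda>M i. \<forall>u\<in>#M. length u = i) Ms js"
        using Ms unfolding I_def mem_Collect_eq by (rule list_all2_mono) (auto simp: X_def)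
      from la dis show e: "map (\<lambda>i. {#u \<in># sum_list Ms. length u = i#}) js = Ms" by (rule filter_regroup)
      have "(\<Prod>M\<leftarrow>Ms. ?ev M) = ?ev (sum_list Ms)" for Ms by (induction Ms) simp_all
      then show "?ev (sum_list Ms) = (\<Prod>M\<leftarrow>Ms. ?ev M)" by (rule sym)
      have inMs: "\<exists>M\<in>set Ms. u \<in># M" if "u \<in># sum_list Ms" for u and Ms :: "nat list multiset list"
        using that by (induction Ms) auto
      have "image_mset length (sum_list Ms) = mset lam"
      proof (rule multiset_eqI)
        fix i
        show "count (image_mset length (sum_list Ms)) i = count (mset lam) i"
        proof (cases "i \<in> set js")
          case True
          then obtain k where k: "k < length js" "js ! k = i" by (auto simp: in_set_conv_nth)
          have "Ms ! k = map (\<lambda>i. {#u \<in># sum_list Ms. length u = i#}) js ! k" by (simp only: e)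
          then have "{#u \<in># sum_list Ms. length u = i#} = Ms ! k" using k by simp
          moreover have "Ms ! k \<in> X i" using Ms k unfolding I_def by (auto simp: list_all2_conv_all_nth)
          ultimately show ?thesis unfolding size_filter_image X_def by (simp add: count_mset)
        next
          case False
          have "length u \<in> set js" if u: "u \<in># sum_list Ms" for u
          proof -
            obtain M where "M \<in> set Ms" "u \<in># M" using inMs[OF u] by blast
            moreover from this obtain i where "i < length Ms" "Ms ! i = M" by (auto simp: in_set_conv_nth)
            ultimately have "i < length js" "length u = js ! i" using la by (auto simp: list_all2_conv_all_nth)
            then show ?thesis by simp
          qed
          then have "{#u \<in># sum_list Ms. length u = i#} = {#}" using False by auto
          moreover have "i \<notin> set lam" using set_js False by blast
          ultimately show ?thesis unfolding size_filter_image by (simp add: count_mset)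
        qed
      qed
      moreover have "set_mset (sum_list Ms) \<subseteq> neck N" using inMs Ine[OF Ms] by blast
      ultimately show "sum_list Ms \<in> neck_msets lam N" by (simp add: neck_msets_def)
    }
    fix M assume M: "M \<in> neck_msets lam N"
    have "length u \<in> set js" if "u \<in># M" for u
    proof -
      have "length u \<in># image_mset length M" using that by simp
      also have "image_mset length M = mset lam" using M by (simp add: neck_msets_def)
      finally show ?thesis using set_js by simp
    qed
    then have "{#u \<in># M. length u \<in> set js#} = M" by (simp add: filter_mset_eq_conv)
    then show "sum_list (map (\<lambda>i. {#u \<in># M. length u = i#}) js) = M" unfolding regroup_filter[OF dis] .
    have "{#u \<in># M. length u = i#} \<in> X i" for i
      using M size_filter_image[of length M i] by (auto simp: X_def neck_msets_def count_mset)
    then show "map (\<lambda>i. {#u \<in># M. length u = i#}) js \<in> I" by (simp add: I_def list_all2_conv_all_nth)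
  qed
  finally show ?thesis .
qed

section \<open>Uniqueness of the Schur expansion\<close>

lemma digits_unique:
  fixes b :: nat
  assumes "\<And>i. i < N \<Longrightarrow> a i < b" "\<And>i. i < N \<Longrightarrow> a' i < b" "(\<Sum>i<N. a i * b ^ i) = (\<Sum>i<N. a' i * b ^ i)" "i < N"
  shows "a i = a' i"
  using assms
proof (induction N arbitrary: a a' i)
  case (Suc N)
  have split: "(\<Sum>i<Suc N. d i * b ^ i) = d 0 + b * (\<Sum>i<N. d (Suc i) * b ^ i)" for d :: "nat \<Rightarrow> nat"
    unfolding sum.lessThan_Suc_shift sum_distrib_left by (simp add: mult.left_commute)
  have lt: "a 0 < b" "a' 0 < b" using Suc.prems(1,2) by auto
  have e: "a 0 + b * (\<Sum>i<N. a (Suc i) * b ^ i) = a' 0 + b * (\<Sum>i<N. a' (Suc i) * b ^ i)"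
    using Suc.prems(3) unfolding split .
  have 0: "a 0 = a' 0" using arg_cong[OF e, of "\<lambda>k. k mod b"] lt by simp
  show ?case
  proof (cases i)
    case 0
    then show ?thesis using \<open>a 0 = a' 0\<close> by simp
  next
    case (Suc j)
    have "(\<Sum>i<N. a (Suc i) * b ^ i) = (\<Sum>i<N. a' (Suc i) * b ^ i)" using e \<open>a 0 = a' 0\<close> lt by simp
    from Suc.IH[OF _ _ this, of j] show ?thesis using Suc.prems(1,2,4) \<open>i = Suc j\<close> by simp
  qed
qed simp

text \<open>The substitution \<open>x\<^sub>i = z^((n + 1)^i)\<close> separates the monomials of degree \<open>n\<close>.\<close>

lemma monomials_independent:
  fixes d :: "nat multiset \<Rightarrow> complex"
  assumes zero: "\<And>x. (\<forall>i<N. x i \<noteq> 0) \<Longrightarrow> (\<Sum>B\<in>letter_msets N n. d B * prod_mset (image_mset x B)) = 0"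
    and B: "B \<in> letter_msets N n"
  shows "d B = 0"
proof -
  define e where "e B = (\<Sum>i\<in>#B. Suc n ^ i)" for B
  have "e B = (\<Sum>i<N. count B i * Suc n ^ i)" if "set_mset B \<subseteq> {..<N}" for B
    using that
  proof (induction B)
    case (add j B)
    have "(\<Sum>i<N. count (add_mset j B) i * Suc n ^ i) = (\<Sum>i<N. (if i = j then Suc n ^ j else 0) + count B i * Suc n ^ i)"
      by (intro sum.cong) auto
    also have "\<dots> = Suc n ^ j + (\<Sum>i<N. count B i * Suc n ^ i)" using add.prems by (simp add: sum.distrib)
    also have "\<dots> = Suc n ^ j + e B" using add by simp
    finally show ?case by (simp add: e_def)
  qed (simp add: e_def)
  then have e: "e B = (\<Sum>i<N. count B i * Suc n ^ i)" if "B \<in> letter_msets N n" for B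
    using that by (simp add: letter_msets_def)
  have inj: "inj_on e (letter_msets N n)"
  proof (rule inj_onI)
    fix A B assume A: "A \<in> letter_msets N n" and B: "B \<in> letter_msets N n" and eq: "e A = e B"
    have le: "count M i < Suc n" if "M \<in> letter_msets N n" for M i
      using that count_le_size[of M i] by (simp add: letter_msets_def)
    show "A = B"
    proof (rule multiset_eqI)
      fix i
      show "count A i = count B i"
      proof (cases "i < N")
        case True
        then show ?thesis
          by (rule digits_unique[OF le[OF A] le[OF B] eq[unfolded e[OF A] e[OF B]]])
      next
        case False
        then have "i \<notin># A" "i \<notin># B" using A B by (auto simp: letter_msets_def)
        then show ?thesis by (simp add: not_in_iff)
      qed
    qed
  qed
  define p where "p = (\<Sum>B\<in>letter_msets N n. monom (d B) (e B))"
  have "poly p z = 0" if "z \<noteq> 0" for z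
  proof -
    have "poly p z = (\<Sum>B\<in>letter_msets N n. d B * prod_mset (image_mset (\<lambda>i. z ^ (Suc n ^ i)) B))"
    proof -
      have "z ^ e B = prod_mset (image_mset (\<lambda>i. z ^ (Suc n ^ i)) B)" for B
        unfolding e_def by (induction B) (simp_all add: power_add)
      then show ?thesis unfolding p_def poly_sum poly_monom by (simp only:)
    qed
    also have "\<dots> = 0" using that by (intro zero) simp
    finally show ?thesis .
  qed
  then have "UNIV - {0} \<subseteq> {z. poly p z = 0}" by blast
  moreover have "infinite (UNIV - {0 :: complex})" by (simp add: infinite_UNIV_char_0)
  ultimately have "p = 0" using poly_roots_finite finite_subset by blast
  have "coeff p (e B) = (\<Sum>A\<in>letter_msets N n. if A = B then d B else 0)"
    unfolding p_def coeff_sum coeff_monom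
    using inj B by (intro sum.cong refl) (auto simp: inj_on_eq_iff)
  also have "\<dots> = d B" using B finite_letter_msets by simp
  finally show ?thesis using \<open>p = 0\<close> by simp
qed

text \<open>Comparing monomials, with enough variables for the letters of the content, gives a
  linear relation between Kostka numbers for every content; a row of the inverse Kostka matrix
  isolates \<open>mu0\<close>.\<close>

lemma schur_coefficients_unique:
  fixes a b :: "nat list \<Rightarrow> complex"
  assumes eq: "\<And>N x. (\<forall>i<N. x i \<noteq> 0) \<Longrightarrow>
      (\<Sum>mu\<in>partitions n. a mu * schur_poly N mu x) = (\<Sum>mu\<in>partitions n. b mu * schur_poly N mu x)"
    and mu0: "mu0 \<in> partitions n"
  shows "a mu0 = b mu0"
proof -
  define d where "d B = (\<Sum>mu\<in>partitions n. (a mu - b mu) * of_nat (kostka (row_of mu) B))" for B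
  have d: "d B = 0" if "size B = n" for B
  proof -
    let ?N = "Suc (Max_mset B)"
    have "B \<in> letter_msets ?N n" using that by (auto simp: letter_msets_def less_Suc_eq_le)
    then show ?thesis
    proof (rule monomials_independent[rotated])
      fix x :: "nat \<Rightarrow> complex" assume x: "\<forall>i<?N. x i \<noteq> 0"
      have "0 = (\<Sum>mu\<in>partitions n. (a mu - b mu) * schur_poly ?N mu x)"
        using eq[OF x] by (simp add: left_diff_distrib sum_subtractf)
      also have "\<dots> = (\<Sum>mu\<in>partitions n. \<Sum>B\<in>letter_msets ?N n. (a mu - b mu) * of_nat (kostka (row_of mu) B) * prod_mset (image_mset x B))"
        by (intro sum.cong refl) (simp add: schur_poly_content sum_distrib_left mult.assoc)
      also have "\<dots> = (\<Sum>B\<in>letter_msets ?N n. d B * prod_mset (image_mset x B))"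
        unfolding d_def sum_distrib_right by (rule sum.swap)
      finally show "(\<Sum>B\<in>letter_msets ?N n. d B * prod_mset (image_mset x B)) = 0" ..
    qed
  qed
  let ?f = "row_of mu0"
  let ?S = "{h. shape h \<and> sz h = n}"
  have f: "shape ?f" "sz ?f = n" using shape_row_of[OF mu0] sz_row_of[OF mu0] .
  have "0 = (\<Sum>h\<in>?S. of_int (inv_kostka ?f h) * d (row_content h))"
    using d by (intro sum.neutral[symmetric]) (simp add: size_row_content)
  also have "\<dots> = (\<Sum>h\<in>?S. \<Sum>mu\<in>partitions n. (a mu - b mu) * of_int (inv_kostka ?f h * int (kostka (row_of mu) (row_content h))))"
    unfolding d_def sum_distrib_left by (intro sum.cong refl) (simp add: algebra_simps)
  also have "\<dots> = (\<Sum>mu\<in>partitions n. (a mu - b mu) * of_int (\<Sum>h\<in>?S. inv_kostka ?f h * int (kostka (row_of mu) (row_content h))))"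
    unfolding of_int_sum sum_distrib_left by (rule sum.swap)
  also have "\<dots> = (\<Sum>mu\<in>partitions n. if mu = mu0 then a mu0 - b mu0 else 0)"
  proof (intro sum.cong refl)
    fix mu assume mu: "mu \<in> partitions n"
    have "row_of mu = ?f \<longleftrightarrow> mu = mu0"
      using bij_row_of[of n] mu mu0 by (auto simp: bij_betw_def inj_on_eq_iff)
    then have "(\<Sum>h\<in>?S. inv_kostka ?f h * int (kostka (row_of mu) (row_content h))) = (if mu = mu0 then 1 else 0)"
      using inv_kostka[OF f(1) shape_row_of[OF mu]] sz_row_of[OF mu] f(2) by simp
    then show "(a mu - b mu) * of_int (\<Sum>h\<in>?S. inv_kostka ?f h * int (kostka (row_of mu) (row_content h)))
      = (if mu = mu0 then a mu0 - b mu0 else 0)" by simp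
  qed
  also have "\<dots> = a mu0 - b mu0" using mu0 finite_partitions by simp
  finally show ?thesis by simp
qed

section \<open>The refined Thrall inequality\<close>

text \<open>The multiplicity of \<open>rot_char lam\<close>, restricted to \<open>H\<close>, in the
  irreducible character of shape \<open>mu\<close>; as \<open>irr\<close> has integer values no
  conjugate appears. The value stays complex until \<open>irr_isotypic\<close> shows it to be a
  natural number.\<close>

definition avg_coeff :: "nat list \<Rightarrow> (nat \<times> nat \<Rightarrow> nat \<times> nat) set \<Rightarrow> nat list \<Rightarrow> complex" where
  "avg_coeff lam H mu = (\<Sum>h\<in>H. rot_char lam h / of_nat (card H) * of_int (irr (cells lam) (row_of mu) h))"

lemma psum_average:
  assumes H: "H \<subseteq> {\<sigma>. \<sigma> permutes cells lam}" and n: "sum_list lam = n"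
  shows "(\<Sum>h\<in>H. rot_char lam h / of_nat (card H) * psum (cells lam) N x h)
    = (\<Sum>mu\<in>partitions n. avg_coeff lam H mu * schur_poly N mu x)"
proof -
  have "(\<Sum>h\<in>H. rot_char lam h / of_nat (card H) * psum (cells lam) N x h)
    = (\<Sum>h\<in>H. \<Sum>mu\<in>partitions n. rot_char lam h / of_nat (card H) * of_int (irr (cells lam) (row_of mu) h) * schur_poly N mu x)"
  proof (intro sum.cong refl)
    fix h assume "h \<in> H"
    then have "h permutes cells lam" using H by blast
    from psum_eq_schur[OF finite_cells this] show "rot_char lam h / of_nat (card H) * psum (cells lam) N x h
      = (\<Sum>mu\<in>partitions n. rot_char lam h / of_nat (card H) * of_int (irr (cells lam) (row_of mu) h) * schur_poly N mu x)"
      by (simp only: card_cells n sum_distrib_left mult.assoc)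
  qed
  also have "\<dots> = (\<Sum>mu\<in>partitions n. avg_coeff lam H mu * schur_poly N mu x)"
    unfolding avg_coeff_def sum_distrib_right by (rule sum.swap)
  finally show ?thesis .
qed

lemma rot_char_id: "rot_char lam id = 1" by (simp add: rot_char_def)

text \<open>Pairing with the regular character recovers the order of the group from the coefficients.\<close>

lemma avg_coeff_regular:
  assumes H: "H \<subseteq> {\<sigma>. \<sigma> permutes cells lam}" "id \<in> H" and n: "sum_list lam = n"
  shows "(\<Sum>mu\<in>partitions n. of_nat (kostka (row_of mu) (mset_set {..<n})) * avg_coeff lam H mu) = fact n / of_nat (card H)"
proof -
  let ?D = "cells lam" and ?B = "mset_set {..<n}"
  have c: "card ?D = n" by (simp add: card_cells n)
  have finH: "finite H" by (rule finite_subset[OF H(1) finite_permutations[OF finite_cells]])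
  have K: "(of_nat (fixn ?D ?B h) :: complex) = (\<Sum>mu\<in>partitions n. of_nat (kostka (row_of mu) ?B) * of_int (irr ?D (row_of mu) h))"
    if "h \<in> H" for h
  proof -
    have "h permutes ?D" using H that by blast
    then have "int (fixn ?D ?B h) = (\<Sum>f | shape f \<and> sz f = n. int (kostka f ?B) * irr ?D f h)"
      using fixn_eq_sum_irr[OF finite_cells, of ?B lam h] by (simp add: c)
    also have "\<dots> = (\<Sum>mu\<in>partitions n. int (kostka (row_of mu) ?B) * irr ?D (row_of mu) h)"
      by (rule sum.reindex_bij_betw[OF bij_row_of, symmetric])
    finally have "(of_int (int (fixn ?D ?B h)) :: complex) = of_int (\<Sum>mu\<in>partitions n. int (kostka (row_of mu) ?B) * irr ?D (row_of mu) h)"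
      by (simp only:)
    then show ?thesis by simp
  qed
  have "(\<Sum>mu\<in>partitions n. of_nat (kostka (row_of mu) ?B) * avg_coeff lam H mu)
    = (\<Sum>h\<in>H. rot_char lam h / of_nat (card H) * (\<Sum>mu\<in>partitions n. of_nat (kostka (row_of mu) ?B) * of_int (irr ?D (row_of mu) h)))"
    unfolding avg_coeff_def sum_distrib_left by (subst sum.swap) (simp add: mult.left_commute)
  also have "\<dots> = (\<Sum>h\<in>H. rot_char lam h / of_nat (card H) * of_nat (fixn ?D ?B h))"
    by (intro sum.cong refl) (simp only: K)
  also have "\<dots> = (\<Sum>h\<in>H. if h = id then fact n / of_nat (card H) else 0)"
  proof (intro sum.cong refl)
    fix h assume "h \<in> H"
    then have "h permutes ?D" using H by blast
    from fixn_distinct[OF finite_cells this] have "fixn ?D ?B h = (if h = id then fact n else 0)" by (simp only: c)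
    then show "rot_char lam h / of_nat (card H) * of_nat (fixn ?D ?B h) = (if h = id then fact n / of_nat (card H) else 0)"
      by (simp add: rot_char_id)
  qed
  also have "\<dots> = fact n / of_nat (card H)" using finH H(2) by simp
  finally show ?thesis .
qed

lemma card_block_perms_eq_1_iff: "card (block_perms lam) = 1 \<longleftrightarrow> distinct lam"
proof
  assume "distinct lam"
  have "\<pi> = id" if \<pi>: "\<pi> \<in> block_perms lam" for \<pi>
  proof
    fix j
    have perm: "\<pi> permutes {..<length lam}" using \<pi> by (simp add: block_perms_def)
    show "\<pi> j = id j"
    proof (cases "j < length lam")
      case True
      then have "\<pi> j < length lam" using permutes_in_image[OF perm, of j] by simp
      moreover have "lam ! \<pi> j = lam ! j" using \<pi> True by (simp add: block_perms_def)
      ultimately show ?thesis using \<open>distinct lam\<close> True by (simp add: nth_eq_iff_index_eq)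
    next
      case False
      then show ?thesis using permutes_not_in[OF perm, of j] by simp
    qed
  qed
  then have "block_perms lam = {id}" using id_block_perms by blast
  then show "card (block_perms lam) = 1" by simp
next
  assume c: "card (block_perms lam) = 1"
  show "distinct lam"
  proof (rule ccontr)
    assume "\<not> distinct lam"
    then obtain i j where ij: "i < length lam" "j < length lam" "i \<noteq> j" "lam ! i = lam ! j" by (auto simp: distinct_conv_nth)
    let ?t = "Transposition.transpose i j"
    have "?t permutes {..<length lam}" using ij by (intro permutes_swap_id) auto
    moreover have "lam ! ?t k = lam ! k" for k using ij by (auto simp: Transposition.transpose_def)
    ultimately have "?t \<in> block_perms lam" by (simp add: block_perms_def)
    moreover have "?t \<noteq> id" using ij by (metis id_apply transpose_apply_first)
    ultimately show False using c id_block_perms by (metis card_1_singletonE singletonD)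
  qed
qed

theorem proposition3p8:
  fixes n :: nat and lam :: "nat list"
  assumes "lam \<in> partitions n"
  shows "(\<forall>mu\<in>partitions n. schur_coeff lam mu \<le> int (card (SYT_blocks lam mu)))
       \<and> (\<forall>mu\<in>partitions n. \<exists>S. refined_Thrall_subset lam mu S)
       \<and> ((\<forall>mu\<in>partitions n. schur_coeff lam mu = int (card (SYT_blocks lam mu))) \<longleftrightarrow> distinct lam)"
proof -
  let ?W = "wreath lam" and ?R = "rotations lam"
  have n: "sum_list lam = n" using assms by (simp add: partitions_def)
  have pos: "\<forall>j<length lam. 0 < lam ! j"
  proof (intro allI impI)
    fix j assume "j < length lam"
    then have "lam ! j \<in> set lam" by simp
    moreover have "0 \<notin> set lam" using assms by (simp add: partitions_def)
    ultimately show "0 < lam ! j" by (metis gr0I)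
  qed
  note G = wreath_group[OF pos]
  have R: "?R \<subseteq> {\<sigma>. \<sigma> permutes cells lam}" and idW: "id \<in> ?W" using G(1-3) by auto
  define k where "k mu = (SOME k. avg_coeff lam ?W mu = of_nat k)" for mu
  have k: "avg_coeff lam ?W mu = of_nat (k mu)"
    and mono: "\<exists>j. avg_coeff lam ?R mu = avg_coeff lam ?W mu + of_nat j" if mu: "mu \<in> partitions n" for mu
  proof -
    have f: "shape (row_of mu)" "sz (row_of mu) = card (cells lam)"
      using shape_row_of[OF mu] sz_row_of[OF mu] by (simp_all add: card_cells n)
    note iso = irr_isotypic[OF finite_cells f G(1) idW G(4) G(6) G(3) G(2) G(5)]
    show "\<exists>j. avg_coeff lam ?R mu = avg_coeff lam ?W mu + of_nat j" unfolding avg_coeff_def by (rule iso(2))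
    have "\<exists>k. avg_coeff lam ?W mu = of_nat k" unfolding avg_coeff_def by (rule iso(1))
    then show "avg_coeff lam ?W mu = of_nat (k mu)" unfolding k_def by (rule someI_ex)
  qed
  have char: "higher_lie_char N lam x = (\<Sum>mu\<in>partitions n. of_nat (k mu) * schur_poly N mu x)" for N x
  proof -
    have "higher_lie_char N lam x = (\<Sum>mu\<in>partitions n. avg_coeff lam ?W mu * schur_poly N mu x)"
      unfolding higher_lie_char_eq[OF assms] wreath_average[OF pos, symmetric] by (rule psum_average[OF G(1) n])
    then show ?thesis using k by (simp cong: sum.cong)
  qed
  have syt: "avg_coeff lam ?R mu = of_nat (card (SYT_blocks lam mu))" if "mu \<in> partitions n" for mu
    using that
  proof (rule schur_coefficients_unique[rotated])
    fix N and x :: "nat \<Rightarrow> complex"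
    show "(\<Sum>mu\<in>partitions n. avg_coeff lam ?R mu * schur_poly N mu x)
      = (\<Sum>mu\<in>partitions n. of_nat (card (SYT_blocks lam mu)) * schur_poly N mu x)"
      unfolding psum_average[OF R n, symmetric] rotations_average[OF pos] by (rule maj_rows_schur[OF n])
  qed
  \<comment> \<open>The definite description asks for uniqueness as well as existence; off the
    partitions of \<open>n\<close> the value 0 is part of the definition of an expansion.\<close>
  have coeff: "schur_coeff lam = (\<lambda>mu. if mu \<in> partitions n then int (k mu) else 0)" (is "_ = ?c")
    unfolding schur_coeff_def
  proof (rule the_equality)
    show "is_schur_expansion lam ?c"
      unfolding is_schur_expansion_def n char by (auto intro!: sum.cong)
    fix c assume c: "is_schur_expansion lam c"
    show "c = ?c"
    proof
      fix mu
      show "c mu = ?c mu"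
      proof (cases "mu \<in> partitions n")
        case True
        then have "(of_int (c mu) :: complex) = of_nat (k mu)"
        proof (rule schur_coefficients_unique[rotated])
          fix N and x :: "nat \<Rightarrow> complex" assume "\<forall>i<N. x i \<noteq> 0"
          then show "(\<Sum>mu\<in>partitions n. of_int (c mu) * schur_poly N mu x) = (\<Sum>mu\<in>partitions n. of_nat (k mu) * schur_poly N mu x)"
            using c unfolding is_schur_expansion_def n char by metis
        qed
        then have "(of_int (c mu) :: complex) = of_int (int (k mu))" by simp
        then show ?thesis using True by (simp only: of_int_eq_iff if_True)
      next
        case False
        then show ?thesis using c by (simp add: is_schur_expansion_def n)
      qed
    qed
  qed
  have le: "k mu \<le> card (SYT_blocks lam mu)" if mu: "mu \<in> partitions n" for mu
  proof -
    obtain j where "(of_nat (card (SYT_blocks lam mu)) :: complex) = of_nat (k mu) + of_nat j"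
      using mono[OF mu] unfolding k[OF mu] syt[OF mu] by blast
    then have "(of_nat (card (SYT_blocks lam mu)) :: complex) = of_nat (k mu + j)" by simp
    then have "card (SYT_blocks lam mu) = k mu + j" by (simp only: of_nat_eq_iff)
    then show ?thesis by simp
  qed
  have "\<exists>S. refined_Thrall_subset lam mu S" if mu: "mu \<in> partitions n" for mu
  proof -
    obtain S where "S \<subseteq> SYT_blocks lam mu" "card S = k mu" using obtain_subset_with_card_n[OF le[OF mu]] by blast
    then show ?thesis using mu by (auto simp: refined_Thrall_subset_def coeff)
  qed
  moreover have "(\<forall>mu\<in>partitions n. k mu = card (SYT_blocks lam mu)) \<longleftrightarrow> distinct lam"
  proof
    assume e: "\<forall>mu\<in>partitions n. k mu = card (SYT_blocks lam mu)"
    have "(\<Sum>mu\<in>partitions n. of_nat (kostka (row_of mu) (mset_set {..<n})) * avg_coeff lam ?W mu)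
      = (\<Sum>mu\<in>partitions n. of_nat (kostka (row_of mu) (mset_set {..<n})) * avg_coeff lam ?R mu)"
      using e k syt by (intro sum.cong refl) simp
    then have "(fact n / of_nat (card ?W) :: complex) = fact n / of_nat (card ?R)"
      unfolding avg_coeff_regular[OF G(1) idW n] avg_coeff_regular[OF R G(2) n] .
    then have "(of_nat (card ?W) :: complex) = of_nat (card ?R)"
      by (metis div_by_0 divide_cancel_left fact_nonzero)
    then have "card (block_perms lam) * card (block_shifts lam) = card (block_shifts lam)" unfolding card_wreath[OF pos] of_nat_eq_iff .
    moreover have "card (block_shifts lam) \<noteq> 0" unfolding card_block_shifts using pos by simp
    ultimately have "card (block_perms lam) = 1" by simp
    then show "distinct lam" by (simp only: card_block_perms_eq_1_iff)
  next
    assume "distinct lam"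
    \<comment> \<open>Distinct parts admit no permutation of rows, so the two groups themselves
      coincide, and with them all coefficients.\<close>
    then have "card ?W = card ?R" using card_block_perms_eq_1_iff[of lam] by (simp add: card_wreath[OF pos])
    moreover have "finite ?W" by (rule finite_subset[OF G(1) finite_permutations[OF finite_cells]])
    ultimately have "?R = ?W" using G(3) card_subset_eq by metis
    then show "\<forall>mu\<in>partitions n. k mu = card (SYT_blocks lam mu)" using k syt by (metis of_nat_eq_iff)
  qed
  ultimately show ?thesis using le by (simp add: coeff)
qed

end
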